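(* Let $r\in\mathbb{N}$. Suppose that conditions (A1)–(A4) hold with $s=r+2$, and choose $q\in\mathbb{N}$ with $q>\frac{r}{2r_1}$. Then $S_N$ admits the averaged Edgeworth expansion of order $r$ for $f\in F^q_0$: there are polynomials $P_{1,a},\dots,P_{r,a}$, independent of $f$, such that for $f\in F^q_0$ and $z\in\mathbb{R}$, $$\int\left[\mathbb{P}\left(\frac{S_N-NA}{\sqrt{N}}\leq z+\frac{y}{\sqrt{N}}\right)-\mathfrak{N}\left(z+\frac{y}{\sqrt{N}}\right)\right]f(y)\,dy=\sum_{p=1}^r\frac{1}{N^{p/2}}\int P_{p,a}\left(z+\frac{y}{\sqrt{N}}\right)\mathfrak{n}\left(z+\frac{y}{\sqrt{N}}\right)f(y)\,dy+\|f\|\,o\left(N^{-r/2}\right),$$ where $\|f\|=C^q_0(f)$.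
   Context: Let $X_1,X_2,\dots$ be real random variables and $S_N=\sum_{n=1}^N X_n$. Assume there are a complex Banach space $\mathcal{B}$ with dual $\mathcal{B}'$, a family of bounded linear operators $\mathcal{L}_t:\mathcal{B}\to\mathcal{B}$ ($t\in\mathbb{R}$), and vectors $v\in\mathcal{B}$, $\ell\in\mathcal{B}'$ such that $\mathbb{E}(e^{itS_N})=\ell(\mathcal{L}_t^N v)$ for all $t\in\mathbb{R}$ and $N\geq1$. The conditions are: (A1) $t\mapsto\mathcal{L}_t$ is continuous and there exist $s\in\mathbb{N}$ and $\delta>0$ such that $t\mapsto\mathcal{L}_t$ is $s$ times continuously differentiable for $|t|\leq\delta$. (A2) $1$ is an isolated and simple eigenvalue of $\mathcal{L}_0$, all other eigenvalues of $\mathcal{L}_0$ have absolute value less than $1$, and the essential spectrum of $\mathcal{L}_0$ is contained in a disk of radius strictly less than $1$. (A3) For all $t\neq 0$, the spectrum of $\mathcal{L}_t$ is contained in $\{|z|<1\}$. (A4) There are positive real numbers $K,r_1,r_2,N_0$ such that $\|\mathcal{L}_t^N\|\leq N^{-r_2}$ for all $t$ with $K\leq|t|\leq N^{r_1}$ and all $N>N_0$. Under (A1)–(A3) with $s\geq3$ there are $A\in\mathbb{R}$ and $\sigma^2\geq0$ such that $(S_N-NA)/\sqrt{N}$ converges in distribution to $\mathcal{N}(0,\sigma^2)$; it is assumed that $\sigma^2>0$. $\mathfrak{n}(y)=\frac{1}{\sqrt{2\pi\sigma^2}}e^{-y^2/(2\sigma^2)}$, $\mathfrak{N}(z)=\int_{-\infty}^z\mathfrak{n}$.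 Function spaces: $C^m(f)=\max_{0\leq j\leq m}\|f^{(j)}\|_{L^1}$, $C_k(f)=\max_{0\leq j\leq k}\|x^jf\|_{L^1}$, $C^m_k(f)=C^m(f)+C_k(f)$; $f\in F^m_k$ means $f$ is $m$ times continuously differentiable and $C^m_k(f)<\infty$. *)

theory Defs
  imports "HOL-Analysis.Analysis" "HOL-Probability.Probability"
    "HOL-Computational_Algebra.Polynomial"
begin

text \<open>A complex Banach space is modelled as a real Banach space (type class banach)
together with a complex scalar multiplication cs extending the real one and
making the norm complex-homogeneous.\<close>

definition complex_banach_structure :: "(complex \<Rightarrow> 'b::banach \<Rightarrow> 'b) \<Rightarrow> bool" where
  "complex_banach_structure cs \<longleftrightarrow>
     (\<forall>a x y. cs a (x + y) = cs a x + cs a y) \<and>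
     (\<forall>a b x. cs (a + b) x = cs a x + cs b x) \<and>
     (\<forall>a b x. cs (a * b) x = cs a (cs b x)) \<and>
     (\<forall>r x. cs (complex_of_real r) x = r *\<^sub>R x) \<and>
     (\<forall>a x. norm (cs a x) = cmod a * norm x)"

definition clinear_op :: "(complex \<Rightarrow> 'b::banach \<Rightarrow> 'b) \<Rightarrow> ('b \<Rightarrow>\<^sub>L 'b) \<Rightarrow> bool" where
  "clinear_op cs T \<longleftrightarrow> (\<forall>a x. blinfun_apply T (cs a x) = cs a (blinfun_apply T x))"

definition clinear_functional :: "(complex \<Rightarrow> 'b::banach \<Rightarrow> 'b) \<Rightarrow> ('b \<Rightarrow>\<^sub>L complex) \<Rightarrow> bool" where
  "clinear_functional cs l \<longleftrightarrow> (\<forall>a x. blinfun_apply l (cs a x) = a * blinfun_apply l x)"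

definition op_pow :: "('b::real_normed_vector \<Rightarrow>\<^sub>L 'b) \<Rightarrow> nat \<Rightarrow> ('b \<Rightarrow>\<^sub>L 'b)" where
  "op_pow T N = ((\<lambda>U. T o\<^sub>L U) ^^ N) id_blinfun"

definition shifted_op :: "(complex \<Rightarrow> 'b::banach \<Rightarrow> 'b) \<Rightarrow> ('b \<Rightarrow>\<^sub>L 'b) \<Rightarrow> complex \<Rightarrow> 'b \<Rightarrow> 'b" where
  "shifted_op cs T mu = (\<lambda>x. cs mu x - blinfun_apply T x)"

definition op_spectrum :: "(complex \<Rightarrow> 'b::banach \<Rightarrow> 'b) \<Rightarrow> ('b \<Rightarrow>\<^sub>L 'b) \<Rightarrow> complex set" where
  "op_spectrum cs T = {mu. \<not> bij (shifted_op cs T mu)}"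

definition is_eigenvalue :: "(complex \<Rightarrow> 'b::banach \<Rightarrow> 'b) \<Rightarrow> ('b \<Rightarrow>\<^sub>L 'b) \<Rightarrow> complex \<Rightarrow> bool" where
  "is_eigenvalue cs T mu \<longleftrightarrow> (\<exists>x. x \<noteq> 0 \<and> blinfun_apply T x = cs mu x)"

definition gen_eigenspace :: "(complex \<Rightarrow> 'b::banach \<Rightarrow> 'b) \<Rightarrow> ('b \<Rightarrow>\<^sub>L 'b) \<Rightarrow> complex \<Rightarrow> 'b set" where
  "gen_eigenspace cs T mu = {x. \<exists>k. (shifted_op cs T mu ^^ k) x = 0}"

definition simple_eigenvalue :: "(complex \<Rightarrow> 'b::banach \<Rightarrow> 'b) \<Rightarrow> ('b \<Rightarrow>\<^sub>L 'b) \<Rightarrow> complex \<Rightarrow> bool" where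
  "simple_eigenvalue cs T mu \<longleftrightarrow>
     is_eigenvalue cs T mu \<and> (\<exists>e. e \<noteq> 0 \<and> gen_eigenspace cs T mu = range (\<lambda>c. cs c e))"

definition isolated_in_spectrum :: "(complex \<Rightarrow> 'b::banach \<Rightarrow> 'b) \<Rightarrow> ('b \<Rightarrow>\<^sub>L 'b) \<Rightarrow> complex \<Rightarrow> bool" where
  "isolated_in_spectrum cs T mu \<longleftrightarrow>
     mu \<in> op_spectrum cs T \<and> (\<exists>e>0. op_spectrum cs T \<inter> ball mu e = {mu})"

text \<open>Fredholm operators: finite-dimensional kernel, closed range of finite
codimension (finite dimension over C is equivalent to finite dimension over R).\<close>

definition fredholm_map :: "('b::banach \<Rightarrow> 'b) \<Rightarrow> bool" where
  "fredholm_map F \<longleftrightarrow>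
     (\<exists>K. finite K \<and> {x. F x = 0} \<subseteq> span K) \<and>
     closed (range F) \<and>
     (\<exists>C. finite C \<and> {y + c | y c. y \<in> range F \<and> c \<in> span C} = UNIV)"

definition essential_spectrum :: "(complex \<Rightarrow> 'b::banach \<Rightarrow> 'b) \<Rightarrow> ('b \<Rightarrow>\<^sub>L 'b) \<Rightarrow> complex set" where
  "essential_spectrum cs T = {mu. \<not> fredholm_map (shifted_op cs T mu)}"

definition Cs_on_interval :: "nat \<Rightarrow> real \<Rightarrow> (real \<Rightarrow> 'v::real_normed_vector) \<Rightarrow> bool" where
  "Cs_on_interval s \<delta> L \<longleftrightarrow>
     (\<exists>D :: nat \<Rightarrow> real \<Rightarrow> 'v.
        (\<forall>t\<in>{-\<delta>..\<delta>}. D 0 t = L t) \<and>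
        (\<forall>k<s. \<forall>t\<in>{-\<delta>..\<delta>}. (D k has_vector_derivative D (Suc k) t) (at t within {-\<delta>..\<delta>})) \<and>
        continuous_on {-\<delta>..\<delta>} (D s))"

definition nfrak :: "real \<Rightarrow> real \<Rightarrow> real" where
  "nfrak \<sigma>2 y = exp (- y\<^sup>2 / (2 * \<sigma>2)) / sqrt (2 * pi * \<sigma>2)"

definition Nfrak :: "real \<Rightarrow> real \<Rightarrow> real" where
  "Nfrak \<sigma>2 z = (LINT y:{..z}|lborel. nfrak \<sigma>2 y)"

definition C_upper :: "nat \<Rightarrow> (real \<Rightarrow> real) \<Rightarrow> real" where
  "C_upper m f = Max ((\<lambda>j. LINT x|lborel. \<bar>(deriv ^^ j) f x\<bar>) ` {0..m})"

definition C_lower :: "nat \<Rightarrow> (real \<Rightarrow> real) \<Rightarrow> real" where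
  "C_lower k f = Max ((\<lambda>j. LINT x|lborel. \<bar>x ^ j * f x\<bar>) ` {0..k})"

definition C_norm :: "nat \<Rightarrow> nat \<Rightarrow> (real \<Rightarrow> real) \<Rightarrow> real" where
  "C_norm m k f = C_upper m f + C_lower k f"

definition C_m :: "nat \<Rightarrow> (real \<Rightarrow> real) \<Rightarrow> bool" where
  "C_m m f \<longleftrightarrow> (\<forall>j<m. \<forall>x. (deriv ^^ j) f differentiable (at x)) \<and>
               continuous_on UNIV ((deriv ^^ m) f)"

text \<open>F^m_k: C^m functions with C^m_k(f) finite, i.e. all the relevant L^1 norms finite.\<close>

definition F_space :: "nat \<Rightarrow> nat \<Rightarrow> (real \<Rightarrow> real) set" where
  "F_space m k = {f. C_m m f \<and>
      (\<forall>j\<le>m. integrable lborel ((deriv ^^ j) f)) \<and>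
      (\<forall>j\<le>k. integrable lborel (\<lambda>x. x ^ j * f x))}"

end

theory Submission
  imports Defs "HOL-Complex_Analysis.Complex_Analysis" "HOL-Real_Asymp.Real_Asymp"
begin

text \<open>
The quotient of the characteristic function difference by \<open>-it\<close> is the Fourier transform of the difference
of distribution functions, and for \<open>f \<in> F\<^sup>q\<^sub>0\<close> the transform of \<open>f\<close> is at most
\<open>\<parallel>f\<parallel> min(1, |t|\<^sup>-\<^sup>q)\<close>. A Gaussian smoothing that is then removed makes Parseval's identity available,
and the averaged error is thereby bounded by
\<open>\<parallel>f\<parallel> \<integral> |\<phi>\<^sub>N(t) - E\<^sub>N(t)| / |t| min(1, |t|\<^sup>-\<^sup>q) dt\<close>, where \<open>\<phi>\<^sub>N\<close> is the characteristic function of \<open>S\<^sub>N - NA\<close>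
and \<open>E\<^sub>N\<close> the transform of the Edgeworth approximation. Four ranges of \<open>t\<close> contribute.

Near 0, \<open>\<phi>\<^sub>N(t) = e\<^sup>-\<^sup>i\<^sup>N\<^sup>A\<^sup>t (\<lambda>(t)\<^sup>N Z(t) + O(|t| N \<theta>\<^sup>N))\<close> with a perturbed eigenvalue \<open>\<lambda>\<close>. Only Taylor expansions
of \<open>\<lambda>\<close> and \<open>Z\<close> at the single point 0 are needed, so no holomorphic functional calculus enters: the
eigenvectors come from a fixed point equation, and the spectral gap from an elementary spectral radius argument.
The central limit theorem identifies the first two cumulants. On compact sets of frequencies avoiding 0, (A3)
and compactness give exponential decay. For \<open>K \<le> |t| \<le> c N\<^sup>r\<^sup>1\<close>, (A4) applied to many blocks of length
of order \<open>N\<close> gives decay of any polynomial order. Beyond that, \<open>|t|\<^sup>-\<^sup>q\<close> suffices since \<open>q r\<^sub>1 > r/2\<close>.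

The construction yields complex polynomials; since the left-hand side is real, their real parts may be taken.
\<close>

section \<open>The spectral gap\<close>

text \<open>The division by \<open>|t|\<close> in the error integral shapes the local analysis:
  every error near 0 has to carry a factor \<open>|t|\<close>. For this reason the exponentially
  small remainder is compared with its value at \<open>t = 0\<close>, which costs the factor
  \<open>N\<close> in \<open>|t| N \<theta>^N\<close>, and the corrections are brought to the form
  \<open>x * a p x\<close>, so that dividing by \<open>-it\<close> leaves a polynomial times a
  Gaussian. Smoothness \<open>r + 2\<close> is what the scaling \<open>x = t * sqrt N\<close> asks
  for: an \<open>N\<close>-fold remainder \<open>N * o(t^(r+2))\<close> equals
  \<open>N^(-r/2) * x^(r+2) * o(1)\<close>, and the power of \<open>x\<close> is absorbed by the
  Gaussian. The smoothing is there because the quotient is only known to be of order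
  \<open>1/|t|\<close> at infinity; it becomes integrable after multiplication by the transform of
  \<open>f\<close>, of order \<open>|t|^(-q)\<close> with \<open>q \<ge> 1\<close>. The point
  \<open>z\<close> enters only through a factor of modulus 1 and \<open>f\<close> only through its
  norm, whence the uniformity in both.\<close>

lemma open_mapping_closed_range:
  fixes T :: "'a::banach \<Rightarrow> 'b::banach"
  assumes T: "bounded_linear T" and cl: "closed (range T)"
  shows "\<exists>C>0. \<forall>y\<in>range T. \<exists>x. T x = y \<and> norm x \<le> C * norm y"
proof -
  interpret T: bounded_linear T by fact
  let ?Y = "range T"
  have sub: "subspace ?Y" using T.linear_axioms linear_subspace_image subspace_UNIV by blast
  let ?X = "top_of_set ?Y"
  define G where "G n = closure (T ` ball 0 (real n))" for n
  have GY: "G n \<subseteq> ?Y" for n unfolding G_def by (rule closure_minimal) (use cl in auto)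
  have UG: "(\<Union>n. G n) = ?Y"
  proof
    show "?Y \<subseteq> (\<Union>n. G n)"
    proof
      fix y assume "y \<in> ?Y" then obtain x where x: "y = T x" by auto
      obtain n where "norm x < real n" using reals_Archimedean2 by blast
      then have "y \<in> G n" unfolding G_def x by (intro subsetD[OF closure_subset]) auto
      then show "y \<in> (\<Union>n. G n)" by auto
    qed
  qed (use GY in auto)
  have cm: "completely_metrizable_space ?X"
    by (metis cl closed_closedin completely_metrizable_space_closedin completely_metrizable_space_euclidean)
  \<comment> \<open>Baire's theorem in the range, which is completely metrizable because it is
    closed: it is the countable union of the closed sets \<open>G n\<close>, so one of them has
    interior points relative to the range.\<close>
  have "\<exists>n. ?X interior_of (G n) \<noteq> {}"
  proof (rule ccontr)
    assume "\<not> ?thesis" then have e: "?X interior_of (G n) = {}" for n by auto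
    have "?X interior_of \<Union>(range G) = {}"
    proof (rule Baire_category_alt)
      show "completely_metrizable_space ?X \<or> locally_compact_space ?X \<and> regular_space ?X"
        using cm by simp
      fix S assume "S \<in> range G"
      then obtain n where S: "S = G n" by auto
      have "closedin ?X S" unfolding S using GY[of n]
        by (intro closed_subset) (auto simp: G_def)
      then show "closedin ?X S \<and> ?X interior_of S = {}" using e S by auto
    qed auto
    then have "?X interior_of ?Y = {}" using UG by simp
    moreover have "?X interior_of ?Y = ?Y" by (metis interior_of_topspace topspace_euclidean_subtopology)
    ultimately show False by auto
  qed
  then obtain n y0 where "y0 \<in> ?X interior_of (G n)" by auto
  then obtain W where W: "openin ?X W" "y0 \<in> W" "W \<subseteq> G n" unfolding interior_of_def by auto
  then obtain e where e: "e > 0" "y0 \<in> ?Y" "ball y0 e \<inter> ?Y \<subseteq> W"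
    unfolding openin_contains_ball by blast
  \<comment> \<open>Both \<open>y0\<close> and \<open>y0 + y\<close> lie in the closure
    \<open>G n\<close>; subtracting approximate preimages of the two removes the centre
    \<open>y0\<close> and doubles the bound \<open>n\<close>.\<close>
  have half: "\<exists>x. norm x < real (2*n) \<and> norm (y - T x) < d" if y: "y \<in> ?Y" "norm y < e" and d: "d > 0" for y d
  proof -
    have "y0 \<in> G n" using W by auto
    then obtain x1 where x1: "norm x1 < n" "dist (T x1) y0 < d/2"
      unfolding G_def closure_approachable using d by (metis (no_types, lifting) half_gt_zero image_iff mem_ball_0)
    have "y0 + y \<in> ball y0 e \<inter> ?Y" using y subspace_add[OF sub e(2) y(1)] by (simp add: dist_norm)
    then have "y0 + y \<in> G n" using e(3) W(3) by blast
    then obtain x2 where x2: "norm x2 < n" "dist (T x2) (y0+y) < d/2"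
      unfolding G_def closure_approachable using d by (metis (no_types, lifting) half_gt_zero image_iff mem_ball_0)
    have "norm (x2 - x1) < 2*n" using x1 x2 norm_triangle_ineq4[of x2 x1] by simp
    moreover have "norm (y - T (x2 - x1)) < d"
    proof -
      have eq: "y - T (x2 - x1) = (T x1 - y0) - (T x2 - (y0+y))" by (simp add: T.diff)
      show ?thesis unfolding eq using x1 x2 norm_triangle_ineq4[of "T x1 - y0" "T x2 - (y0+y)"]
        unfolding dist_norm by linarith
    qed
    ultimately show ?thesis by auto
  qed
  define C where "C = 4 * real n / e"
  have C0: "C \<ge> 0" using e by (simp add: C_def)
  have step: "\<exists>x. norm x \<le> C * norm y \<and> norm (y - T x) \<le> norm y / 2" if y: "y \<in> ?Y" for y
  proof (cases "y = 0")
    case True then show ?thesis by (intro exI[of _ 0]) (auto simp: T.zero)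
  next
    case False
    define k where "k = e / (2 * norm y)"
    have k: "k > 0" using False e by (simp add: k_def)
    have "k *\<^sub>R y \<in> ?Y" using y sub by (auto intro: subspace_scale)
    moreover have "norm (k *\<^sub>R y) < e" using False e by (simp add: k_def)
    ultimately obtain x where x: "norm x < real (2*n)" "norm (k *\<^sub>R y - T x) < k * norm y / 2"
      using half[of "k *\<^sub>R y" "k * norm y / 2"] k False by auto
    have eq: "y - T (x /\<^sub>R k) = (k *\<^sub>R y - T x) /\<^sub>R k" using k by (simp add: T.scaleR algebra_simps)
    have "norm (y - T (x /\<^sub>R k)) = norm (k *\<^sub>R y - T x) / k" unfolding eq norm_scaleR using k by (simp add: divide_inverse mult.commute)
    also have "\<dots> \<le> norm y / 2" using x(2) k by (simp add: divide_simps mult.commute)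
    finally have "norm (y - T (x /\<^sub>R k)) \<le> norm y / 2" .
    moreover have "norm (x /\<^sub>R k) \<le> C * norm y"
      using x(1) k False e by (simp add: C_def k_def field_simps)
    ultimately show ?thesis by blast
  qed
  define f where "f y = (SOME x. norm x \<le> C * norm y \<and> norm (y - T x) \<le> norm y / 2)" for y
  have f: "norm (f y) \<le> C * norm y" "norm (y - T (f y)) \<le> norm y / 2" if "y \<in> ?Y" for y
    using someI_ex[OF step[OF that]] unfolding f_def by auto
  have "\<exists>x. T x = y \<and> norm x \<le> (2 * C + 1) * norm y" if y: "y \<in> ?Y" for y
  proof -
    \<comment> \<open>\<open>Z k\<close> is the residual after \<open>k\<close> corrections. Each
      correction halves it, so the corrections \<open>f (Z k)\<close> form an absolutely convergent
      series whose sum is an exact preimage; no linearity of the selector \<open>f\<close> is needed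
      for this.\<close>
    define Z where "Z k = ((\<lambda>z. z - T (f z)) ^^ k) y" for k
    have ZY: "Z k \<in> ?Y" for k
      by (induction k) (use y sub in \<open>auto simp: Z_def intro: subspace_diff\<close>)
    have Zn: "norm (Z k) \<le> norm y * (1/2)^k" for k
    proof (induction k)
      case (Suc k)
      have "norm (Z (Suc k)) \<le> norm (Z k) / 2" using f(2)[OF ZY[of k]] by (simp add: Z_def)
      then show ?case using Suc by simp
    qed (simp add: Z_def)
    have fn: "norm (f (Z k)) \<le> (C * norm y) * (1/2)^k" for k
      using f(1)[OF ZY[of k]] mult_left_mono[OF Zn[of k] C0] by (simp add: mult.assoc)
    have sg: "summable (\<lambda>k. (C * norm y) * (1/2::real)^k)" by (intro summable_mult summable_geometric) simp
    have sn: "summable (\<lambda>k. norm (f (Z k)))"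
      by (rule summable_comparison_test'[OF sg, of 0]) (use fn in auto)
    then have sm: "summable (\<lambda>k. f (Z k))" by (rule summable_norm_cancel)
    let ?x = "\<Sum>k. f (Z k)"
    have ps: "T (\<Sum>k<m. f (Z k)) = y - Z m" for m
      by (induction m) (auto simp: Z_def T.zero T.add)
    have "Z \<longlonglongrightarrow> 0"
    proof (rule Lim_null_comparison)
      show "\<forall>\<^sub>F k in sequentially. norm (Z k) \<le> norm y * (1/2)^k" using Zn by auto
      show "(\<lambda>k. norm y * (1/2::real)^k) \<longlonglongrightarrow> 0" by (intro tendsto_mult_right_zero LIMSEQ_realpow_zero) auto
    qed
    then have "(\<lambda>m. T (\<Sum>k<m. f (Z k))) \<longlonglongrightarrow> y" unfolding ps by (auto intro!: tendsto_eq_intros)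
    moreover have "(\<lambda>m. T (\<Sum>k<m. f (Z k))) \<longlonglongrightarrow> T ?x"
      using summable_LIMSEQ[OF sm] by (rule T.tendsto)
    ultimately have "T ?x = y" using LIMSEQ_unique by blast
    moreover have "norm ?x \<le> (2 * C + 1) * norm y"
    proof -
      have "norm ?x \<le> (\<Sum>k. norm (f (Z k)))" by (rule summable_norm[OF sn])
      also have "\<dots> \<le> (\<Sum>k. (C * norm y) * (1/2::real)^k)" by (rule suminf_le[OF fn sn sg])
      also have "\<dots> = 2 * C * norm y" by (subst suminf_mult) (auto simp: suminf_geometric summable_geometric)
      also have "\<dots> \<le> (2 * C + 1) * norm y" by (simp add: algebra_simps)
      finally show ?thesis .
    qed
    ultimately show ?thesis by auto
  qed
  then show ?thesis by (intro exI[of _ "2*C+1"]) (use C0 in auto)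
qed

text \<open>Under injectivity the preimage of controlled norm is the only one. Lower bounds of this
  kind survive small perturbations, and that is how invertibility is transported later.\<close>

lemma inj_closed_range_bounded_below:
  fixes T :: "'a::banach \<Rightarrow> 'b::banach"
  assumes T: "bounded_linear T" and cl: "closed (range T)" and inj: "inj T"
  shows "\<exists>c>0. \<forall>x. c * norm x \<le> norm (T x)"
proof -
  obtain C where C: "C > 0" "\<forall>y\<in>range T. \<exists>x. T x = y \<and> norm x \<le> C * norm y"
    using open_mapping_closed_range[OF T cl] by blast
  have "(1/C) * norm x \<le> norm (T x)" for x
  proof -
    obtain x' where "T x' = T x" "norm x' \<le> C * norm (T x)" using C by blast
    then have "norm x \<le> C * norm (T x)" using inj by (auto dest: injD)
    then show ?thesis using C by (simp add: field_simps)
  qed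
  then show ?thesis using C by (intro exI[of _ "1/C"]) auto
qed

text \<open>Solving \<open>F x = y\<close> given that \<open>F + E\<close> is invertible: iterate \<open>x \<mapsto> (F + E)\<^sup>-\<^sup>1 (y + E x)\<close>.\<close>

lemma onto_perturbation:
  fixes F E :: "'b::banach \<Rightarrow> 'b"
  assumes F: "linear F" and E: "linear E"
    and S: "subspace S" "closed S" and ES: "\<And>x. x \<in> S \<Longrightarrow> E x \<in> S"
    and onto: "S \<subseteq> (\<lambda>x. F x + E x) ` S"
    and below: "\<And>x. x \<in> S \<Longrightarrow> c * norm x \<le> norm (F x)"
    and small: "\<And>x. x \<in> S \<Longrightarrow> norm (E x) \<le> \<epsilon> * norm x"
    and eps: "0 \<le> \<epsilon>" "2 * \<epsilon> < c"
  shows "S \<subseteq> F ` S"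
proof
  fix y assume y: "y \<in> S"
  \<comment> \<open>An arbitrary right inverse of \<open>F + E\<close> on \<open>S\<close>. It need
    not be linear or continuous: the lower bound for \<open>F\<close> controls the differences of
    its values.\<close>
  define g where "g w = (SOME x. x \<in> S \<and> F x + E x = w)" for w
  have g: "g w \<in> S" "F (g w) + E (g w) = w" if "w \<in> S" for w
  proof -
    have "\<exists>x. x \<in> S \<and> F x + E x = w" using onto that by blast
    from someI_ex[OF this] show "g w \<in> S" "F (g w) + E (g w) = w" unfolding g_def by auto
  qed
  define h where "h x = g (y + E x)" for x
  have yE: "y + E x \<in> S" if "x \<in> S" for x using that y S ES by (auto intro: subspace_add)
  have hS: "h x \<in> S" if "x \<in> S" for x using g yE that by (auto simp: h_def)
  have "\<exists>!x\<in>S. h x = x"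
  proof (rule Banach_fix)
    show "Topological_Spaces.complete S" using S by (simp add: complete_eq_closed)
    show "S \<noteq> {}" using y by auto
    \<comment> \<open>\<open>2 * \<epsilon> < c\<close> is the condition under which this
      contraction constant lies below 1.\<close>
    show "0 \<le> \<epsilon> / (c - \<epsilon>)" "\<epsilon> / (c - \<epsilon>) < 1" using eps by auto
    show "h ` S \<subseteq> S" using hS by auto
    fix x x' assume x: "x \<in> S" and x': "x' \<in> S"
    let ?z = "h x - h x'"
    have z: "?z \<in> S" using hS x x' S by (auto intro: subspace_diff)
    have "F ?z + E ?z = E (x - x')"
      using g(2)[OF yE[OF x]] g(2)[OF yE[OF x']] by (simp add: h_def linear_diff[OF F] linear_diff[OF E] algebra_simps)
    then have "F ?z = E (x - x') - E ?z" by (simp add: algebra_simps)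
    then have "norm (F ?z) \<le> norm (E (x - x')) + norm (E ?z)" by (metis norm_triangle_ineq4)
    also have "\<dots> \<le> \<epsilon> * norm (x - x') + \<epsilon> * norm ?z"
      using small[OF z] small[OF subspace_diff[OF S(1) x x']] by auto
    finally have "(c - \<epsilon>) * norm ?z \<le> \<epsilon> * norm (x - x')" using below[OF z] by (simp add: algebra_simps)
    then show "dist (h x) (h x') \<le> \<epsilon> / (c - \<epsilon>) * dist x x'"
      using eps by (simp add: dist_norm field_simps)
  qed
  then obtain x where x: "x \<in> S" "h x = x" by blast
  have "F x + E x = y + E x" using g(2)[OF yE[OF x(1)]] x(2) by (simp add: h_def)
  then show "y \<in> F ` S" using x by auto
qed

section \<open>Powers of bounded operators\<close>

lemma op_pow_Suc: "op_pow T (Suc n) = T o\<^sub>L op_pow T n"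
  by (simp add: op_pow_def)

lemma op_pow_0: "op_pow T 0 = id_blinfun"
  by (simp add: op_pow_def)

lemma op_pow_apply: "blinfun_apply (op_pow T n) x = (blinfun_apply T ^^ n) x"
  by (induction n) (auto simp: op_pow_Suc op_pow_0)

lemma op_pow_add: "op_pow T (m + n) = op_pow T m o\<^sub>L op_pow T n"
  by (rule blinfun_eqI) (simp add: op_pow_apply funpow_add)

lemma op_pow_commute: "T o\<^sub>L op_pow T n = op_pow T n o\<^sub>L T"
  by (rule blinfun_eqI) (simp add: op_pow_apply funpow_swap1)

lemma norm_op_pow_add: "norm (op_pow T (m + n)) \<le> norm (op_pow T m) * norm (op_pow T n)"
  unfolding op_pow_add by (rule norm_blinfun_compose)

text \<open>A geometric sum of a nontrivial \<open>n\<close>-th root of unity. Averaging a geometric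
  series of length \<open>n\<close> over all \<open>n\<close>-th roots therefore keeps its constant
  term alone.\<close>

lemma sum_powers_root_of_unity:
  assumes "0 < j" "j < n"
  shows "(\<Sum>k<n. cis (2 * pi / real n) ^ (k * j)) = 0"
proof -
  let ?z = "cis (2 * pi / real n) ^ j"
  have n: "n \<noteq> 0" using assms by auto
  have zn: "?z ^ n = 1"
  proof -
    have "?z ^ n = (cis (2 * pi / real n) ^ n) ^ j" by (simp flip: power_mult add: mult.commute)
    also have "cis (2 * pi / real n) ^ n = 1" by (subst Complex.DeMoivre) (use n in simp)
    finally show ?thesis by simp
  qed
  have "?z \<noteq> 1"
  proof
    assume "?z = 1"
    moreover have "?z = cis (real j * (2 * pi / real n))" by (rule Complex.DeMoivre)
    moreover have "\<dots> = exp (2 * of_real pi * \<i> * of_nat j / of_nat n)"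
      unfolding cis_conv_exp by (rule arg_cong[of _ _ exp]) simp
    ultimately have "n dvd j" using complex_root_unity_eq_1[of n j] n by simp
    then show False using assms by (auto dest: dvd_imp_le)
  qed
  then have "(\<Sum>k<n. ?z ^ k) = 0" using zn by (simp add: sum_gp_strict)
  then show ?thesis by (simp flip: power_mult add: mult.commute)
qed

section \<open>Spectral theory for the complex structure \<open>cs\<close>\<close>

locale complex_banach =
  fixes cs :: "complex \<Rightarrow> 'b::banach \<Rightarrow> 'b"
  assumes cbs: "complex_banach_structure cs"
begin

lemma cs_add_right: "cs a (x + y) = cs a x + cs a y"
  and cs_add_left: "cs (a + b) x = cs a x + cs b x"
  and cs_mult: "cs (a * b) x = cs a (cs b x)"
  and cs_of_real: "cs (complex_of_real r) x = r *\<^sub>R x"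
  and norm_cs: "norm (cs a x) = cmod a * norm x"
  using cbs unfolding complex_banach_structure_def by auto

lemma cs_one [simp]: "cs 1 x = x"
  using cs_of_real[of 1 x] by simp

text \<open>Seen as a real bilinear map, the complex scalar multiplication inherits the calculus of
  bounded bilinear maps, in particular the later closure rules for Taylor expansions.\<close>

sublocale cs: bounded_bilinear cs
proof (unfold_locales)
  have sc: "cs (r *\<^sub>R a) x = r *\<^sub>R cs a x" for r a x
    by (metis cs_mult cs_of_real scaleR_conv_of_real)
  then show "cs (r *\<^sub>R a) x = r *\<^sub>R cs a x" for r a x .
  show "cs a (r *\<^sub>R x) = r *\<^sub>R cs a x" for r a x
    by (metis cs_mult cs_of_real mult.commute)
  show "\<exists>K. \<forall>a b. norm (cs a b) \<le> norm a * norm b * K" by (intro exI[of _ 1]) (simp add: norm_cs)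
qed (simp_all add: cs_add_right cs_add_left)

lemma cs_eq_0_iff [simp]: "cs a x = 0 \<longleftrightarrow> a = 0 \<or> x = 0"
  by (metis norm_cs norm_eq_zero mult_eq_0_iff)

lemma cs_inverse_cancel: "a \<noteq> 0 \<Longrightarrow> cs a (cs (1 / a) x) = x" "a \<noteq> 0 \<Longrightarrow> cs (1 / a) (cs a x) = x"
  by (simp_all flip: cs_mult)

lemma clinear_opD: "clinear_op cs T \<Longrightarrow> T (cs a x) = cs a (T x)"
  unfolding clinear_op_def by auto

lemma sum_cs_left: "cs (\<Sum>i\<in>A. g i) x = (\<Sum>i\<in>A. cs (g i) x)"
  by (rule cs.sum_left)

text \<open>An elementary form of the spectral radius theorem: the averages of the resolvent
  \<open>(1 - w Q)\<^sup>-\<^sup>1\<close> over the \<open>n\<close>-th roots of unity are \<open>(1 - w\<^sup>n Q\<^sup>n)\<^sup>-\<^sup>1\<close> and are equicontinuous in \<open>w\<close>,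
  so \<open>w\<^sup>n Q\<^sup>n \<longrightarrow> 0\<close> propagates from \<open>w = 0\<close> to \<open>w = 1\<close>.\<close>

lemma op_pow_tendsto_0:
  assumes Q: "clinear_op cs Q"
    and bij: "\<And>w. cmod w \<le> 1 \<Longrightarrow> bij (\<lambda>x. x - cs w (Q x))"
  shows "(\<lambda>n. norm (op_pow Q n)) \<longlonglongrightarrow> 0"
proof -
  let ?D = "cball (0::complex) 1"
  define G where "G w x = x - cs w (Q x)" for w x
  have Glin: "bounded_linear (G w)" for w
    unfolding G_def
    by (intro bounded_linear_sub bounded_linear_ident cs.bounded_linear_right[THEN bounded_linear_compose]
        blinfun.bounded_linear_right)
  have Gbij: "bij (G w)" if "w \<in> ?D" for w using bij[of w] that unfolding G_def by auto
  have below: "\<exists>c>0. \<forall>x. c * norm x \<le> norm (G w x)" if "w \<in> ?D" for w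
  proof (rule inj_closed_range_bounded_below[OF Glin])
    have "range (G w) = UNIV" using Gbij[OF that] by (rule bij_is_surj)
    then show "closed (range (G w))" by simp
    show "inj (G w)" using Gbij[OF that] by (rule bij_is_inj)
  qed
  define R where "R w = Blinfun (inv (G w))" for w
  have GR: "G w (inv (G w) x) = x" if "w \<in> ?D" for w x using Gbij[OF that] by (simp add: bij_is_surj surj_f_inv_f)
  have RG: "inv (G w) (G w x) = x" if "w \<in> ?D" for w x using Gbij[OF that] by (simp add: bij_is_inj)
  have Rapp: "blinfun_apply (R w) = inv (G w)" and
    Rbound: "c > 0 \<Longrightarrow> \<forall>x. c * norm x \<le> norm (G w x) \<Longrightarrow> norm (R w) \<le> 1 / c" if w: "w \<in> ?D" for w c
  proof -
    interpret Gw: bounded_linear "G w" by (rule Glin)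
    obtain c0 where c0: "c0 > 0" "\<And>x. c0 * norm x \<le> norm (G w x)" using below[OF w] by blast
    have bl: "bounded_linear (inv (G w))"
    proof
      show "inv (G w) (x + y) = inv (G w) x + inv (G w) y" for x y
        by (metis GR Gw.add RG w)
      show "inv (G w) (r *\<^sub>R x) = r *\<^sub>R inv (G w) x" for r x
        by (metis GR Gw.scaleR RG w)
      show "\<exists>K. \<forall>x. norm (inv (G w) x) \<le> norm x * K"
        by (intro exI[of _ "1/c0"] allI) (use c0(2)[of "inv (G w) _"] c0(1) GR[OF w] in \<open>simp add: field_simps\<close>)
    qed
    then show app: "blinfun_apply (R w) = inv (G w)" unfolding R_def by (rule bounded_linear_Blinfun_apply)
    assume c: "c > 0" "\<forall>x. c * norm x \<le> norm (G w x)"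
    show "norm (R w) \<le> 1 / c"
    proof (rule norm_blinfun_bound)
      fix x show "norm (R w x) \<le> 1 / c * norm x"
        using c(2)[rule_format, of "inv (G w) x"] c(1) GR[OF w] by (simp add: app field_simps)
    qed (use c in auto)
  qed
  \<comment> \<open>The resolvent identity \<open>R w - R w' = (w - w') R w Q R w'\<close>, turned
    into a norm estimate.\<close>
  have Rdiff: "norm (R w - R w') \<le> norm (R w) * (cmod (w - w') * norm Q * norm (R w'))"
    if w: "w \<in> ?D" "w' \<in> ?D" for w w'
  proof (rule norm_blinfun_bound)
    fix x
    let ?y = "R w' x"
    have "G w ?y = x + cs (w' - w) (Q ?y)"
      using GR[OF w(2), of x] unfolding Rapp[OF w(2)] by (simp add: G_def cs.diff_left algebra_simps)
    then have "?y = R w x + R w (cs (w' - w) (Q ?y))"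
      by (metis RG Rapp blinfun.add_right w(1))
    then have "(R w - R w') x = - R w (cs (w' - w) (Q ?y))"
      by (simp add: blinfun.diff_left algebra_simps)
    then have "norm ((R w - R w') x) \<le> norm (R w) * norm (cs (w' - w) (Q ?y))"
      by (simp add: norm_blinfun)
    also have "norm (cs (w' - w) (Q ?y)) \<le> cmod (w - w') * (norm Q * (norm (R w') * norm x))"
      unfolding norm_cs norm_minus_commute[of w' w]
      by (intro mult_left_mono order_trans[OF norm_blinfun] norm_blinfun) auto
    finally show "norm ((R w - R w') x) \<le> norm (R w) * (cmod (w - w') * norm Q * norm (R w')) * norm x"
      by (simp add: mult_left_mono mult.assoc)
  qed auto
  have cont: "continuous_on ?D R"
    unfolding continuous_on_iff
  proof (intro ballI allI impI)
    fix w0 and e :: real assume w0: "w0 \<in> ?D" and e: "e > 0"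
    obtain c where c: "c > 0" "\<forall>x. c * norm x \<le> norm (G w0 x)" using below[OF w0] by blast
    define K where "K = (2 / c) * (norm Q + 1) * (1 / c)"
    have K: "K > 0" unfolding K_def using c by (simp add: add_nonneg_pos)
    \<comment> \<open>The first bound keeps half of the lower bound \<open>c\<close> at
      \<open>w\<close>, so that \<open>norm (R w) \<le> 2 / c\<close>; the second makes the
      resulting estimate \<open>K * d\<close> of the resolvent difference smaller than
      \<open>e\<close>.\<close>
    define d where "d = min (c / (2 * (norm Q + 1))) (e / (2*K))"
    have d: "d > 0" unfolding d_def using c e K by (simp add: add_nonneg_pos)
    have "dist (R w) (R w0) < e" if w: "w \<in> ?D" "dist w w0 < d" for w
    proof -
      have dw: "cmod (w - w0) < d" using w by (simp add: dist_norm)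
      have "norm Q * d \<le> c / 2"
      proof -
        have "norm Q * d \<le> (norm Q + 1) * (c / (2 * (norm Q + 1)))"
          using d unfolding d_def by (intro mult_mono) auto
        also have "\<dots> = c / 2" using c by (simp add: field_simps add_nonneg_eq_0_iff)
        finally show ?thesis .
      qed
      then have s: "cmod (w - w0) * norm Q \<le> c / 2"
        using dw mult_right_mono[of "cmod (w-w0)" d "norm Q"] by (simp add: mult.commute)
      have "(c/2) * norm x \<le> norm (G w x)" for x
      proof -
        have "G w0 x = G w x + cs (w - w0) (Q x)" by (simp add: G_def cs.diff_left)
        then have "norm (G w0 x) \<le> norm (G w x) + cmod (w - w0) * norm (Q x)"
          by (metis norm_triangle_ineq norm_cs)
        also have "cmod (w - w0) * norm (Q x) \<le> cmod (w - w0) * (norm Q * norm x)"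
          by (intro mult_left_mono norm_blinfun) auto
        also have "\<dots> \<le> c/2 * norm x" using mult_right_mono[OF s, of "norm x"] by (simp add: mult.assoc)
        finally show ?thesis using c(2)[rule_format, of x] by (simp add: algebra_simps)
      qed
      then have b1: "norm (R w) \<le> 2 / c" using Rbound[OF w(1), of "c/2"] c(1) by simp
      have b2: "norm (R w0) \<le> 1 / c" using Rbound[OF w0 c] .
      have "norm (R w - R w0) \<le> norm (R w) * (cmod (w - w0) * norm Q * norm (R w0))"
        by (rule Rdiff[OF w(1) w0])
      also have "\<dots> \<le> (2/c) * (d * (norm Q + 1) * (1/c))"
        using b1 b2 dw c d by (intro mult_mono) auto
      also have "\<dots> = K * d" by (simp add: K_def)
      also have "\<dots> \<le> K * (e / (2*K))" unfolding d_def using K by (intro mult_left_mono) auto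
      also have "\<dots> < e" using e K by simp
      finally show ?thesis by (simp add: dist_norm)
    qed
    then show "\<exists>d>0. \<forall>x'\<in>?D. dist x' w0 < d \<longrightarrow> dist (R x') (R w0) < e" using d by auto
  qed
  have unif: "uniformly_continuous_on ?D R" by (rule compact_uniformly_continuous[OF cont compact_cball])
  obtain M where M: "M > 0" "\<And>w. w \<in> ?D \<Longrightarrow> norm (R w) \<le> M"
    using compact_imp_bounded[OF compact_continuous_image[OF cont compact_cball]]
    unfolding bounded_pos by auto
  define \<omega> where "\<omega> n = cis (2 * pi / real n)" for n :: nat
  \<comment> \<open>The average of the resolvent over the \<open>n\<close> points of modulus
    \<open>r\<close> on the rays through the roots of unity. It is a left inverse of
    \<open>1 - r^n Q^n\<close>, and its bound \<open>M\<close> and its modulus of continuity in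
    \<open>r\<close> do not depend on \<open>n\<close>.\<close>
  define Av where "Av n r = (1 / real n) *\<^sub>R (\<Sum>k<n. R (\<omega> n ^ k * complex_of_real r))" for n r
  have wD: "\<omega> n ^ k * complex_of_real r \<in> ?D" if "0 \<le> r" "r \<le> 1" for n k r
    using that by (simp add: norm_mult norm_power \<omega>_def)
  have R_geom: "R z (x - cs (z ^ n) ((blinfun_apply Q ^^ n) x)) = (\<Sum>j<n. cs (z ^ j) ((blinfun_apply Q ^^ j) x))" if z: "z \<in> ?D" for z n x
  proof -
    have "G z (\<Sum>j<n. cs (z ^ j) ((blinfun_apply Q ^^ j) x)) = x - cs (z ^ n) ((blinfun_apply Q ^^ n) x)"
    proof (induction n)
      case (Suc n)
      have "G z (\<Sum>j<Suc n. cs (z ^ j) ((blinfun_apply Q ^^ j) x)) = G z (\<Sum>j<n. cs (z ^ j) ((blinfun_apply Q ^^ j) x)) + G z (cs (z ^ n) ((blinfun_apply Q ^^ n) x))"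
        using bounded_linear.linear[OF Glin[of z]] by (simp add: linear_add)
      also have "G z (cs (z ^ n) ((blinfun_apply Q ^^ n) x)) = cs (z ^ n) ((blinfun_apply Q ^^ n) x) - cs (z ^ Suc n) ((blinfun_apply Q ^^ Suc n) x)"
        by (simp add: G_def clinear_opD[OF Q] cs_mult)
      finally show ?case using Suc by simp
    qed (simp add: G_def blinfun.zero_right)
    then show ?thesis using RG[OF z] Rapp[OF z] by metis
  qed
  have Av_inv: "Av n r (x - (r ^ n) *\<^sub>R (blinfun_apply Q ^^ n) x) = x" if r: "0 \<le> r" "r \<le> 1" and n: "n > 0" for n r x
  proof -
    have wn: "\<omega> n ^ n = 1" using n by (simp add: \<omega>_def Complex.DeMoivre)
    have zn: "(\<omega> n ^ k * complex_of_real r) ^ n = complex_of_real (r ^ n)" for k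
    proof -
      have "(\<omega> n ^ k * complex_of_real r) ^ n = (\<omega> n ^ n) ^ k * complex_of_real (r ^ n)"
        by (simp add: power_mult_distrib flip: power_mult add: mult.commute)
      then show ?thesis using wn by simp
    qed
    let ?y = "x - (r ^ n) *\<^sub>R (blinfun_apply Q ^^ n) x"
    have "R (\<omega> n ^ k * complex_of_real r) ?y = (\<Sum>j<n. cs ((\<omega> n ^ k * complex_of_real r) ^ j) ((blinfun_apply Q ^^ j) x))" for k
      using R_geom[where z = "\<omega> n ^ k * complex_of_real r" and n = n and x = x, OF wD[OF r]] unfolding zn cs_of_real .
    then have "Av n r ?y = (1 / real n) *\<^sub>R (\<Sum>k<n. \<Sum>j<n. cs ((\<omega> n ^ k * complex_of_real r) ^ j) ((blinfun_apply Q ^^ j) x))"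
      by (simp add: Av_def blinfun.scaleR_left blinfun.sum_left)
    also have "(\<Sum>k<n. \<Sum>j<n. cs ((\<omega> n ^ k * complex_of_real r) ^ j) ((blinfun_apply Q ^^ j) x))
       = (\<Sum>j<n. \<Sum>k<n. cs ((\<omega> n ^ k * complex_of_real r) ^ j) ((blinfun_apply Q ^^ j) x))" by (rule sum.swap)
    also have "\<dots> = (\<Sum>j<n. cs (of_real (r ^ j) * (\<Sum>k<n. \<omega> n ^ (k * j))) ((blinfun_apply Q ^^ j) x))"
    proof (rule sum.cong)
      fix j
      have "(\<omega> n ^ k * complex_of_real r) ^ j = of_real (r ^ j) * \<omega> n ^ (k * j)" for k
        by (simp add: power_mult_distrib power_mult)
      then show "(\<Sum>k<n. cs ((\<omega> n ^ k * complex_of_real r) ^ j) ((blinfun_apply Q ^^ j) x))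
          = cs (of_real (r ^ j) * (\<Sum>k<n. \<omega> n ^ (k * j))) ((blinfun_apply Q ^^ j) x)"
        by (simp only: sum_cs_left sum_distrib_left)
    qed simp
    also have "\<dots> = (\<Sum>j<n. if j = 0 then real n *\<^sub>R x else 0)"
    proof (rule sum.cong)
      fix j assume "j \<in> {..<n}"
      show "cs (of_real (r ^ j) * (\<Sum>k<n. \<omega> n ^ (k * j))) ((blinfun_apply Q ^^ j) x) = (if j = 0 then real n *\<^sub>R x else 0)"
      proof (cases "j = 0")
        case True then show ?thesis using cs_of_real[of "real n" x] by simp
      next
        case False
        then have "(\<Sum>k<n. \<omega> n ^ (k * j)) = 0" unfolding \<omega>_def using \<open>j \<in> {..<n}\<close>
          by (intro sum_powers_root_of_unity) auto
        then show ?thesis using False by simp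
      qed
    qed auto
    also have "\<dots> = real n *\<^sub>R x" using n by simp
    finally show ?thesis using n by simp
  qed
  have Av_bound: "norm (Av n r) \<le> M" if r: "0 \<le> r" "r \<le> 1" and n: "n > 0" for n r
  proof -
    have "norm (\<Sum>k<n. R (\<omega> n ^ k * complex_of_real r)) \<le> (\<Sum>k<n. M)"
      by (intro sum_norm_le M wD r)
    then show ?thesis using n by (simp add: Av_def field_simps)
  qed
  define q where "q n = norm (op_pow Q n)" for n
  \<comment> \<open>If \<open>r^n Q^n\<close> tends to 0, then \<open>Av n r\<close> is eventually
    within \<open>\<epsilon>\<close> of the identity. Equicontinuity puts \<open>Av n r'\<close>
    within \<open>2 * \<epsilon>\<close> of it, and the left inverse property reads this back as a
    bound for \<open>r'^n Q^n\<close>. The radius \<open>d\<close> depends on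
    \<open>\<epsilon>\<close> alone.\<close>
  have step: "\<exists>d>0. \<forall>r r'. 0 \<le> r \<longrightarrow> r \<le> 1 \<longrightarrow> 0 \<le> r' \<longrightarrow> r' \<le> 1 \<longrightarrow> \<bar>r - r'\<bar> < d \<longrightarrow> (\<lambda>n. r ^ n * q n) \<longlonglongrightarrow> 0 \<longrightarrow>
       (\<forall>\<^sub>F n in sequentially. r' ^ n * q n \<le> 4 * \<epsilon>)" if eps: "0 < \<epsilon>" "\<epsilon> \<le> 1/4" for \<epsilon>
  proof -
    obtain d where d: "d > 0" "\<And>w w'. w \<in> ?D \<Longrightarrow> w' \<in> ?D \<Longrightarrow> dist w w' < d \<Longrightarrow> dist (R w) (R w') < \<epsilon>"
      using unif[unfolded uniformly_continuous_on_def] eps by metis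
    have "\<forall>\<^sub>F n in sequentially. r' ^ n * q n \<le> 4 * \<epsilon>"
      if r: "0 \<le> r" "r \<le> 1" and r': "0 \<le> r'" "r' \<le> 1" and rr: "\<bar>r - r'\<bar> < d" and lim: "(\<lambda>n. r ^ n * q n) \<longlonglongrightarrow> 0" for r r'
    proof -
      have "\<forall>\<^sub>F n in sequentially. r ^ n * q n < \<epsilon> / M"
        by (rule order_tendstoD(2)[OF lim]) (use eps M in auto)
      then show ?thesis using eventually_gt_at_top[of 0]
      proof eventually_elim
        case (elim n)
        then have n: "n > 0" by simp
        have a1: "norm (Av n r x - x) \<le> \<epsilon> * norm x" for x
        proof -
          have "Av n r x - x = Av n r ((r ^ n) *\<^sub>R (blinfun_apply Q ^^ n) x)" using Av_inv[OF r n, of x]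
            by (simp add: blinfun.diff_right algebra_simps)
          also have "norm \<dots> \<le> M * norm ((r ^ n) *\<^sub>R (blinfun_apply Q ^^ n) x)"
            by (rule order_trans[OF norm_blinfun mult_right_mono[OF Av_bound[OF r n]]]) auto
          also have "norm ((r ^ n) *\<^sub>R (blinfun_apply Q ^^ n) x) \<le> (r ^ n * q n) * norm x"
            using norm_blinfun[of "op_pow Q n" x] r by (simp add: op_pow_apply q_def mult.assoc mult_left_mono)
          also have "M * ((r ^ n * q n) * norm x) \<le> M * ((\<epsilon> / M) * norm x)"
            using elim M by (intro mult_left_mono mult_right_mono) auto
          finally show ?thesis using M by (simp add: mult_left_mono)
        qed
        have a2: "norm (Av n r' - Av n r) \<le> \<epsilon>"
        proof -
          have "norm (\<Sum>k<n. R (\<omega> n ^ k * complex_of_real r') - R (\<omega> n ^ k * complex_of_real r)) \<le> (\<Sum>k<n. \<epsilon>)"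
          proof (rule sum_norm_le)
            fix k
            have "dist (\<omega> n ^ k * complex_of_real r') (\<omega> n ^ k * complex_of_real r) = \<bar>r - r'\<bar>"
              by (simp add: dist_norm norm_mult norm_power \<omega>_def flip: right_diff_distrib of_real_diff)
            then show "norm (R (\<omega> n ^ k * complex_of_real r') - R (\<omega> n ^ k * complex_of_real r)) \<le> \<epsilon>"
              using d(2)[OF wD[OF r'] wD[OF r]] rr by (metis dist_norm less_imp_le)
          qed
          then have sn: "norm (\<Sum>k<n. R (\<omega> n ^ k * complex_of_real r') - R (\<omega> n ^ k * complex_of_real r)) \<le> real n * \<epsilon>" by simp
          have "Av n r' - Av n r = (1 / real n) *\<^sub>R (\<Sum>k<n. R (\<omega> n ^ k * complex_of_real r') - R (\<omega> n ^ k * complex_of_real r))"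
            unfolding Av_def by (simp only: sum_subtractf scaleR_diff_right)
          also have "norm \<dots> \<le> (1 / real n) * (real n * \<epsilon>)"
            unfolding norm_scaleR using sn by (intro mult_mono) auto
          finally show ?thesis using n by simp
        qed
        have "norm (op_pow Q n) * r' ^ n \<le> 4 * \<epsilon>"
        proof -
          have "norm ((r' ^ n) *\<^sub>R op_pow Q n) \<le> 4 * \<epsilon>"
          proof (rule norm_blinfun_bound)
            fix x
            let ?p = "(r' ^ n) *\<^sub>R (blinfun_apply Q ^^ n) x"
            have "norm (Av n r' (x - ?p) - (x - ?p)) \<le> 2 * \<epsilon> * norm (x - ?p)"
            proof -
              have "Av n r' (x - ?p) - (x - ?p) = (Av n r' - Av n r) (x - ?p) + (Av n r (x - ?p) - (x - ?p))"
                by (simp add: blinfun.diff_left)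
              also have "norm \<dots> \<le> norm (Av n r' - Av n r) * norm (x - ?p) + \<epsilon> * norm (x - ?p)"
                by (intro order_trans[OF norm_triangle_ineq] add_mono norm_blinfun a1)
              also have "\<dots> \<le> \<epsilon> * norm (x - ?p) + \<epsilon> * norm (x - ?p)"
                using a2 by (intro add_mono mult_right_mono) auto
              finally show ?thesis by simp
            qed
            then have "norm ?p \<le> 2 * \<epsilon> * norm (x - ?p)" using Av_inv[OF r' n, of x] by simp
            also have "\<dots> \<le> 2 * \<epsilon> * (norm x + norm ?p)" using eps by (intro mult_left_mono norm_triangle_ineq4) auto
            finally have "(1 - 2 * \<epsilon>) * norm ?p \<le> 2 * \<epsilon> * norm x" by (simp add: algebra_simps)
            moreover have "(1/2) * norm ?p \<le> (1 - 2 * \<epsilon>) * norm ?p" using eps by (intro mult_right_mono) auto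
            ultimately have "norm ?p \<le> 4 * \<epsilon> * norm x" by linarith
            then show "norm (((r' ^ n) *\<^sub>R op_pow Q n) x) \<le> 4 * \<epsilon> * norm x"
              by (simp add: op_pow_apply blinfun.scaleR_left)
          qed (use eps in auto)
          then show ?thesis using r' by (simp add: mult.commute)
        qed
        then show ?case by (simp add: q_def mult.commute)
      qed
    qed
    then show ?thesis using d(1) by blast
  qed
  have below1: "(\<lambda>n. r ^ n * q n) \<longlonglongrightarrow> 0" if r: "0 \<le> r" "r < 1" for r
  proof -
    obtain d where d: "d > 0" "\<And>r r'. 0 \<le> r \<Longrightarrow> r \<le> 1 \<Longrightarrow> 0 \<le> r' \<Longrightarrow> r' \<le> 1 \<Longrightarrow> \<bar>r - r'\<bar> < d \<Longrightarrow> (\<lambda>n. r ^ n * q n) \<longlonglongrightarrow> 0 \<Longrightarrow>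
       (\<forall>\<^sub>F n in sequentially. r' ^ n * q n \<le> 1)" using step[of "1/4"] by auto
    \<comment> \<open>The propagation gives only boundedness at the radius \<open>t\<close>;
      retreating from \<open>t\<close> to \<open>s' < t\<close> gains the factor
      \<open>(s' / t)^n\<close> and restores convergence to 0. Hence the interval
      \<open>[0, 1)\<close> is covered by finitely many steps of a fixed length.\<close>
    have next_r: "(\<lambda>n. s' ^ n * q n) \<longlonglongrightarrow> 0" if s: "0 \<le> s" "s \<le> s'" "s' < s + d" "s' < 1" and lim: "(\<lambda>n. s ^ n * q n) \<longlonglongrightarrow> 0" for s s'
    proof -
      define t where "t = min ((s' + (s + d)) / 2) ((s' + 1) / 2)"
      have t: "s' < t" "t < s + d" "t < 1" using s unfolding t_def min_def by (auto simp: field_simps)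
      have ev: "\<forall>\<^sub>F n in sequentially. t ^ n * q n \<le> 1"
        by (rule d(2)[of s t]) (use s t lim in auto)
      have "\<forall>\<^sub>F n in sequentially. norm (s' ^ n * q n) \<le> (s' / t) ^ n"
        using ev
      proof eventually_elim
        case (elim n)
        have "s' ^ n * q n = (s' / t) ^ n * (t ^ n * q n)" using t s by (simp add: power_divide)
        also have "\<dots> \<le> (s' / t) ^ n * 1" using elim s t by (intro mult_left_mono) auto
        finally show ?case using s by (simp add: q_def)
      qed
      moreover have "(\<lambda>n. (s' / t) ^ n) \<longlonglongrightarrow> 0" using s t by (intro LIMSEQ_realpow_zero) auto
      ultimately show ?thesis by (rule Lim_null_comparison)
    qed
    obtain m where m: "r / d < real m" using reals_Archimedean2 by blast
    have m0: "real m > 0" using m r d(1) by (meson divide_nonneg_pos order_le_less_trans)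
    have "(\<lambda>n. (r * (real k / real m)) ^ n * q n) \<longlonglongrightarrow> 0" if "k \<le> m" for k
      using that
    proof (induction k)
      case 0
      have "\<forall>\<^sub>F n in sequentially. (r * (real 0 / real m)) ^ n * q n = 0"
        using eventually_gt_at_top[of "0::nat"] by eventually_elim auto
      then show ?case by (rule tendsto_eventually)
    next
      case (Suc k)
      show ?case
      proof (rule next_r[of "r * (real k / real m)"])
        show "r * (real (Suc k) / real m) < r * (real k / real m) + d"
          using m m0 d(1) by (simp add: field_simps)
        have "r * (real (Suc k) / real m) \<le> r * 1" using Suc.prems m0 r by (intro mult_left_mono) (auto simp: field_simps)
        then show "r * (real (Suc k) / real m) < 1" using r by simp
      qed (use r m0 Suc in \<open>auto simp: field_simps intro!: mult_left_mono divide_right_mono\<close>)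
    qed
    from this[of m] show ?thesis using m0 by simp
  qed
  \<comment> \<open>At radius 1 there is no larger radius to retreat from. Here
    \<open>\<epsilon>\<close> is made small instead, and 1 is reached from some \<open>r < 1\<close>
    within the distance \<open>d\<close> belonging to this \<open>\<epsilon>\<close>.\<close>
  have "q \<longlonglongrightarrow> 0"
  proof (rule tendstoI)
    fix e :: real assume e: "e > 0"
    define \<epsilon> where "\<epsilon> = min (1/4) (e/8)"
    have eps: "0 < \<epsilon>" "\<epsilon> \<le> 1/4" "4 * \<epsilon> < e" using e by (auto simp: \<epsilon>_def min_def)
    obtain d where d: "d > 0" "\<And>r r'. 0 \<le> r \<Longrightarrow> r \<le> 1 \<Longrightarrow> 0 \<le> r' \<Longrightarrow> r' \<le> 1 \<Longrightarrow> \<bar>r - r'\<bar> < d \<Longrightarrow> (\<lambda>n. r ^ n * q n) \<longlonglongrightarrow> 0 \<Longrightarrow>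
       (\<forall>\<^sub>F n in sequentially. r' ^ n * q n \<le> 4 * \<epsilon>)" using step[OF eps(1,2)] by blast
    define r where "r = max 0 (1 - d/2)"
    have "\<forall>\<^sub>F n in sequentially. 1 ^ n * q n \<le> 4 * \<epsilon>"
      by (rule d(2)[of r 1]) (use d(1) below1[of r] in \<open>auto simp: r_def max_def\<close>)
    then show "\<forall>\<^sub>F n in sequentially. dist (q n) 0 < e"
      by eventually_elim (use eps in \<open>auto simp: q_def\<close>)
  qed
  then show ?thesis unfolding q_def .
qed

lemma shifted_op_bounded_linear: "bounded_linear (shifted_op cs T mu)"
  unfolding shifted_op_def
  by (intro bounded_linear_sub cs.bounded_linear_right blinfun.bounded_linear_right)

lemma shifted_op_perturb: "shifted_op cs T mu x = shifted_op cs T nu x + cs (mu - nu) x"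
  by (simp add: shifted_op_def cs.diff_left)

text \<open>The Fredholm property supplies a closed range, and the absence of an eigenvalue supplies
  injectivity.\<close>

lemma shifted_op_below:
  assumes "\<not> is_eigenvalue cs T mu" "mu \<notin> essential_spectrum cs T"
  shows "\<exists>c>0. \<forall>x. c * norm x \<le> norm (shifted_op cs T mu x)"
proof (rule inj_closed_range_bounded_below[OF shifted_op_bounded_linear])
  show "closed (range (shifted_op cs T mu))"
    using assms(2) unfolding essential_spectrum_def fredholm_map_def by blast
  show "inj (shifted_op cs T mu)"
    unfolding linear_injective_0[OF bounded_linear.linear[OF shifted_op_bounded_linear]]
    using assms(1) unfolding is_eigenvalue_def shifted_op_def by auto
qed

text \<open>The two operators differ by the scalar \<open>nu - mu\<close>. The lower bound is
  required at the target \<open>mu\<close> only, so surjectivity becomes locally constant wherever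
  lower bounds hold.\<close>

lemma shifted_op_surj_transfer:
  assumes below: "\<And>x. c * norm x \<le> norm (shifted_op cs T mu x)"
    and surj: "surj (shifted_op cs T nu)" and near: "2 * cmod (nu - mu) < c"
  shows "surj (shifted_op cs T mu)"
proof -
  have "UNIV \<subseteq> shifted_op cs T mu ` UNIV"
  proof (rule onto_perturbation[where E = "cs (nu - mu)" and c = c and \<epsilon> = "cmod (nu - mu)"])
    show "linear (shifted_op cs T mu)" using shifted_op_bounded_linear bounded_linear.linear by blast
    show "linear (cs (nu - mu))" using cs.bounded_linear_right bounded_linear.linear by blast
    show "UNIV \<subseteq> range (\<lambda>x. shifted_op cs T mu x + cs (nu - mu) x)"
      using surj by (simp flip: shifted_op_perturb)
  qed (use below near in \<open>auto simp: norm_cs\<close>)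
  then show ?thesis by auto
qed

text \<open>Invertibility is carried along the ray from \<open>mu\<close> to infinity, on which \<open>mu s - T\<close> is injective
  with closed range.\<close>

lemma bij_shifted_op_outside:
  assumes noev: "\<And>mu. 1 \<le> cmod mu \<Longrightarrow> mu \<noteq> 1 \<Longrightarrow> \<not> is_eigenvalue cs T mu"
    and noess: "\<And>mu. 1 \<le> cmod mu \<Longrightarrow> mu \<notin> essential_spectrum cs T"
    and mu: "1 \<le> cmod mu" "mu \<noteq> 1"
  shows "bij (shifted_op cs T mu)"
proof -
  have ray: "1 \<le> cmod (of_real s * mu)" "of_real s * mu \<noteq> 1" if "s \<ge> 1" for s :: real
  proof -
    have *: "s * cmod mu \<ge> s * 1" using mu that by (intro mult_left_mono) auto
    have "cmod (of_real s * mu) = s * cmod mu" using that by (simp add: norm_mult)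
    then show "1 \<le> cmod (of_real s * mu)" using * that by linarith
    show "of_real s * mu \<noteq> 1"
    proof
      assume a: "of_real s * mu = 1"
      then have "s * cmod mu = 1" using that by (metis abs_of_nonneg norm_mult norm_of_real norm_one order_trans zero_le_one)
      then have "s = 1" using * that by linarith
      then show False using a mu by simp
    qed
  qed
  let ?F = "\<lambda>s::real. shifted_op cs T (of_real s * mu)"
  have below: "\<exists>c>0. \<forall>x. c * norm x \<le> norm (?F s x)" if "s \<ge> 1" for s
    using shifted_op_below noev noess ray[OF that] by blast
  \<comment> \<open>Far out on the ray, \<open>T\<close> is a small perturbation of a scalar
    multiplication, which is onto. The factor 3 gives
    \<open>B * cmod mu - norm T > 2 * norm T\<close>, the smallness that
    \<open>onto_perturbation\<close> asks for.\<close>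
  define B where "B = 3 * norm T + 1"
  have B1: "B \<ge> 1" by (simp add: B_def)
  have surjB: "surj (?F B)"
  proof -
    have lower: "(B * cmod mu - norm T) * norm x \<le> norm (?F B x)" for x
    proof -
      have "norm (cs (of_real B * mu) x) \<le> norm (?F B x) + norm (T x)"
        unfolding shifted_op_def by (metis diff_add_cancel norm_triangle_ineq)
      moreover have "norm (cs (of_real B * mu) x) = B * cmod mu * norm x" using B1 by (simp add: norm_cs norm_mult)
      ultimately show ?thesis using norm_blinfun[of T x] by (simp add: algebra_simps)
    qed
    have "UNIV \<subseteq> ?F B ` UNIV"
    proof (rule onto_perturbation[where E = "blinfun_apply T" and c = "B * cmod mu - norm T" and \<epsilon> = "norm T"])
      show "linear (?F B)" using shifted_op_bounded_linear bounded_linear.linear by blast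
      show "linear (blinfun_apply T)" using blinfun.bounded_linear_right bounded_linear.linear by blast
      have "of_real B * mu \<noteq> 0" using ray(1)[OF B1] by auto
      then have "surj (\<lambda>x. cs (of_real B * mu) x)" by (metis cs_inverse_cancel(1) surjI)
      then show "UNIV \<subseteq> range (\<lambda>x. ?F B x + T x)" by (simp add: shifted_op_def)
      have "B * 1 \<le> B * cmod mu" using B1 mu by (intro mult_left_mono) auto
      then show "2 * norm T < B * cmod mu - norm T" by (simp add: B_def)
    qed (use lower norm_blinfun in auto)
    then show ?thesis by auto
  qed
  have "surj (?F 1) = surj (?F B)"
  proof (rule connected_local_const[where A = "{1..}" and f = "\<lambda>s. surj (?F s)"])
    show "connected {1::real..}" by auto
    show "\<forall>a\<in>{1..}. \<forall>\<^sub>F b in at a within {1..}. surj (?F a) = surj (?F b)"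
    proof
      fix a :: real assume "a \<in> {1..}" then have a: "a \<ge> 1" by simp
      obtain c where c: "c > 0" "\<And>x. c * norm x \<le> norm (?F a x)" using below[OF a] by blast
      have m0: "cmod mu > 0" using mu by auto
      \<comment> \<open>Within this distance the scalar perturbation is below \<open>c / 4\<close>,
        so \<open>?F b\<close> keeps the lower bound \<open>3/4 * c\<close>. Twice the perturbation
        is then smaller than either lower bound, and surjectivity transfers both ways.\<close>
      have "surj (?F a) = surj (?F b)" if b: "dist b a < c / (4 * cmod mu)" for b
      proof -
        have eq: "cmod (of_real b * mu - of_real a * mu) = \<bar>b - a\<bar> * cmod mu"
          by (metis left_diff_distrib norm_mult norm_of_real of_real_diff)
        have n1: "4 * cmod (of_real b * mu - of_real a * mu) < c"
          using b m0 unfolding eq by (simp add: dist_real_def field_simps)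
        have n2: "4 * cmod (of_real a * mu - of_real b * mu) < c" using n1 by (simp add: norm_minus_commute)
        have lower: "(3/4 * c) * norm x \<le> norm (?F b x)" for x
        proof -
          have "norm (?F a x) \<le> norm (?F b x) + norm (cs (of_real a * mu - of_real b * mu) x)"
            unfolding shifted_op_perturb[of T "of_real a * mu" x "of_real b * mu"] by (rule norm_triangle_ineq)
          moreover have "norm (cs (of_real a * mu - of_real b * mu) x) \<le> c / 4 * norm x"
            unfolding norm_cs using n2 by (intro mult_right_mono) auto
          ultimately show ?thesis using c(2)[of x] by (simp add: algebra_simps)
        qed
        show ?thesis
        proof
          assume "surj (?F a)" then show "surj (?F b)"
            by (rule shifted_op_surj_transfer[OF lower]) (use n2 c in linarith)
        next
          assume "surj (?F b)" then show "surj (?F a)"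
            by (rule shifted_op_surj_transfer[OF c(2)]) (use n1 c in linarith)
        qed
      qed
      then show "\<forall>\<^sub>F b in at a within {1..}. surj (?F a) = surj (?F b)"
        unfolding eventually_at using c(1) m0 by (intro exI[of _ "c / (4 * cmod mu)"]) auto
    qed
  qed (use B1 in auto)
  then have surj: "surj (shifted_op cs T mu)" using surjB by simp
  obtain c where c: "c > 0" "\<And>x. c * norm x \<le> norm (shifted_op cs T mu x)"
    using shifted_op_below[of T mu] noev noess mu by blast
  have "inj (shifted_op cs T mu)"
    unfolding linear_injective_0[OF bounded_linear.linear[OF shifted_op_bounded_linear]]
    using c by (metis mult_le_0_iff norm_le_zero_iff norm_zero not_le)
  then show ?thesis using surj by (simp add: bij_def)
qed

text \<open>The closed range of \<open>1 - T\<close> serves as the complement of the eigenline. It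
  meets the kernel trivially because the eigenvalue is simple, and \<open>1 - T\<close> maps it onto
  itself because 1 is isolated. The functional \<open>a\<close> reads off the coefficient of
  \<open>e\<close>, and \<open>Q\<close> is \<open>T\<close> on the complement and 0 on
  \<open>e\<close>, that is, \<open>T\<close> with the eigenvalue 1 moved to 0.\<close>

theorem spectral_gap:
  assumes T: "clinear_op cs T"
    and simple: "simple_eigenvalue cs T 1"
    and isolated: "isolated_in_spectrum cs T 1"
    and others: "\<And>mu. is_eigenvalue cs T mu \<Longrightarrow> mu \<noteq> 1 \<Longrightarrow> cmod mu < 1"
    and ess: "\<exists>\<rho><1. \<forall>mu\<in>essential_spectrum cs T. cmod mu \<le> \<rho>"
  obtains e a Q where "clinear_functional cs a" "clinear_op cs Q" "blinfun_apply a e = 1"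
    "\<And>x. T x = cs (a x) e + Q x" "blinfun_apply Q e = 0" "\<And>x. a (Q x) = 0"
    "\<And>w. cmod w \<le> 1 \<Longrightarrow> bij (\<lambda>x. x - cs w (Q x))"
proof -
  let ?F = "shifted_op cs T 1"
  have Fdef: "?F x = x - T x" for x by (simp add: shifted_op_def)
  interpret F: bounded_linear ?F by (rule shifted_op_bounded_linear)
  have noess: "mu \<notin> essential_spectrum cs T" if "1 \<le> cmod mu" for mu using ess that by force
  have noev: "\<not> is_eigenvalue cs T mu" if "1 \<le> cmod mu" "mu \<noteq> 1" for mu using others that by force
  have bij: "bij (shifted_op cs T mu)" if "1 \<le> cmod mu" "mu \<noteq> 1" for mu
    by (rule bij_shifted_op_outside) (use noess noev that in auto)
  have Fcs: "?F (cs a x) = cs a (?F x)" for a x by (simp add: Fdef clinear_opD[OF T] cs.diff_right)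
  let ?Y = "range ?F"
  have closed: "closed ?Y"
    using noess[of 1] unfolding essential_spectrum_def fredholm_map_def by simp
  have sub: "subspace ?Y" using F.linear_axioms linear_subspace_image subspace_UNIV by blast
  obtain e where e: "e \<noteq> 0" "gen_eigenspace cs T 1 = range (\<lambda>c. cs c e)"
    using simple unfolding simple_eigenvalue_def by blast
  obtain x0 where x0: "x0 \<noteq> 0" "T x0 = x0" using simple unfolding simple_eigenvalue_def is_eigenvalue_def by auto
  have genI: "x \<in> range (\<lambda>c. cs c e)" if "(?F ^^ k) x = 0" for x k
    using that e(2) unfolding gen_eigenspace_def by blast
  have Fe: "?F e = 0"
  proof -
    have "x0 \<in> range (\<lambda>c. cs c e)" using genI[of 1 x0] x0 by (simp add: Fdef)
    then obtain c where c: "x0 = cs c e" by auto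
    then have "c \<noteq> 0" using x0 by auto
    have "cs c (?F e) = ?F (cs c e)" by (rule Fcs[symmetric])
    also have "\<dots> = 0" using x0(2) c by (simp add: Fdef)
    finally have "cs c (?F e) = 0" .
    then show ?thesis using \<open>c \<noteq> 0\<close> by simp
  qed
  have ker: "\<exists>c. x = cs c e" if "?F x = 0" for x using genI[of 1 x] that by auto
  \<comment> \<open>Simplicity enters here: if \<open>y = ?F x\<close> and \<open>?F y = 0\<close>,
    then \<open>x\<close> belongs to the generalised eigenspace, hence to the line of
    \<open>e\<close>, and so \<open>y = ?F x\<close> vanishes.\<close>
  have ker2: "y = 0" if y: "y \<in> ?Y" "?F y = 0" for y
  proof -
    obtain x where x: "y = ?F x" using y by auto
    have "x \<in> range (\<lambda>c. cs c e)" by (rule genI[of 2]) (use y x in \<open>simp add: numeral_2_eq_2\<close>)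
    then show ?thesis using x Fcs Fe by auto
  qed
  have Ycs: "cs a y \<in> ?Y" if "y \<in> ?Y" for a y using that Fcs by (metis imageE range_eqI)
  have eY: "e \<notin> ?Y" using ker2[of e] Fe e by blast
  obtain d where d: "d > 0" "\<And>y. y \<in> ?Y \<Longrightarrow> d \<le> dist y e"
  proof -
    have "open (- ?Y)" using closed by (rule open_Compl)
    then obtain d where "d > 0" "ball e d \<subseteq> - ?Y" using eY unfolding open_contains_ball by blast
    then show ?thesis using that[of d] by (force simp: subset_iff dist_commute not_less[symmetric])
  qed
  \<comment> \<open>The positive distance from \<open>e\<close> to the closed range, rescaled. It
    bounds the component along \<open>e\<close>, which gives uniqueness and continuity of the
    coefficient \<open>f\<close>.\<close>
  have sep: "d * cmod a \<le> norm (y + cs a e)" if y: "y \<in> ?Y" for a y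
  proof (cases "a = 0")
    case False
    have "cs (- 1 / a) y \<in> ?Y" by (rule Ycs[OF y])
    then have "d \<le> norm (cs (- 1 / a) y - e)" using d(2) by (simp add: dist_norm)
    also have "cs (- 1 / a) y - e = - cs (1 / a) (y + cs a e)"
      using False by (simp add: cs.add_right cs_inverse_cancel cs.minus_left)
    also have "norm \<dots> = norm (y + cs a e) / cmod a" by (simp add: norm_cs norm_divide)
    finally show ?thesis using False by (simp add: field_simps)
  qed simp
  obtain C where C: "C > 0" "\<And>y. y \<in> ?Y \<Longrightarrow> \<exists>x. ?F x = y \<and> norm x \<le> C * norm y"
    using open_mapping_closed_range[OF shifted_op_bounded_linear closed] by blast
  \<comment> \<open>A preimage \<open>x\<close> of \<open>?F y\<close> with
    \<open>norm x \<le> C * norm (?F y)\<close> differs from \<open>y\<close> by a multiple of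
    \<open>e\<close>, which \<open>sep\<close> bounds by \<open>norm e / d * norm x\<close>. The two
    constants multiply to \<open>1 / c\<close>.\<close>
  define c where "c = 1 / (C * (1 + norm e / d))"
  have c: "c > 0" unfolding c_def using C d by (simp add: add_pos_nonneg)
  have belowY: "c * norm y \<le> norm (?F y)" if y: "y \<in> ?Y" for y
  proof -
    obtain x where x: "?F x = ?F y" "norm x \<le> C * norm (?F y)" using C by blast
    have "?F (x - y) = 0" using x by (simp add: F.diff)
    then obtain a where a: "x - y = cs a e" using ker by blast
    then have xy: "x = y + cs a e" by (simp add: algebra_simps)
    have "cmod a \<le> norm x / d" using sep[OF y, of a] d xy by (simp add: field_simps)
    then have "cmod a * norm e \<le> norm x / d * norm e" by (intro mult_right_mono) auto
    moreover have "norm y \<le> norm x + cmod a * norm e" using xy by (metis add_diff_cancel_right' norm_cs norm_triangle_ineq4)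
    ultimately have "norm y \<le> (1 + norm e / d) * norm x" by (simp add: algebra_simps)
    also have "\<dots> \<le> (1 + norm e / d) * (C * norm (?F y))" using x d by (intro mult_left_mono) auto
    finally show ?thesis using C d unfolding c_def by (simp add: divide_simps mult_ac add_pos_nonneg)
  qed
  obtain \<epsilon>0 where e0: "\<epsilon>0 > 0" "op_spectrum cs T \<inter> ball 1 \<epsilon>0 = {1}"
    using isolated unfolding isolated_in_spectrum_def by blast
  \<comment> \<open>\<open>1 + \<eta>\<close> lies in the punctured disc free of spectrum, and
    \<open>\<eta>\<close> is small compared with the lower bound \<open>c\<close> on the
    range.\<close>
  define \<eta> where "\<eta> = min (\<epsilon>0 / 2) (c / 3)"
  have eta: "\<eta> > 0" "\<eta> < \<epsilon>0" "2 * \<eta> < c" using e0 c by (auto simp: \<eta>_def min_def)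
  have bij_eta: "bij (shifted_op cs T (1 + of_real \<eta>))"
  proof -
    have "1 + of_real \<eta> \<in> ball (1::complex) \<epsilon>0" using eta by (simp add: dist_norm)
    moreover have "1 + of_real \<eta> \<noteq> (1::complex)" using eta by simp
    ultimately have "1 + of_real \<eta> \<notin> op_spectrum cs T" using e0 by blast
    then show ?thesis by (simp add: op_spectrum_def)
  qed
  have Y_return: "x \<in> ?Y" if "shifted_op cs T mu x \<in> ?Y" "mu \<noteq> 1" for x mu
  proof -
    have "cs (mu - 1) x = shifted_op cs T mu x - ?F x" using shifted_op_perturb[of T mu x 1] by simp
    then have "cs (mu - 1) x \<in> ?Y" using that sub by (auto intro: subspace_diff)
    then have "cs (1 / (mu - 1)) (cs (mu - 1) x) \<in> ?Y" by (rule Ycs)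
    then show ?thesis using that by (simp add: cs_inverse_cancel)
  qed
  \<comment> \<open>\<open>1 + \<eta> - T\<close> is bijective, and solutions of its equation stay
    in the range when the data lie there (\<open>Y_return\<close>). It thus maps the range onto
    itself, and the lower bound \<open>belowY\<close> allows the removal of the perturbation
    \<open>\<eta>\<close>.\<close>
  have FY: "?Y \<subseteq> ?F ` ?Y"
  proof (rule onto_perturbation[where E = "\<lambda>x. \<eta> *\<^sub>R x" and c = c and \<epsilon> = \<eta>])
    show "linear ?F" by (rule F.linear_axioms)
    show "linear ((*\<^sub>R) \<eta>)" by (simp add: linear_scale_self)
    show "?Y \<subseteq> (\<lambda>x. ?F x + \<eta> *\<^sub>R x) ` ?Y"
    proof
      fix y assume y: "y \<in> ?Y"
      obtain x where x: "shifted_op cs T (1 + of_real \<eta>) x = y" using bij_eta by (metis bij_pointE)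
      have "x \<in> ?Y" by (rule Y_return[of "1 + of_real \<eta>"]) (use x y eta in auto)
      moreover have "y = ?F x + \<eta> *\<^sub>R x" using x shifted_op_perturb[of T "1 + of_real \<eta>" x 1] by (simp add: cs_of_real)
      ultimately show "y \<in> (\<lambda>x. ?F x + \<eta> *\<^sub>R x) ` ?Y" by blast
    qed
  qed (use sub closed eta belowY in \<open>auto intro: subspace_scale\<close>)
  \<comment> \<open>\<open>?F x\<close> also has a preimage inside the range by \<open>FY\<close>;
    subtracting it from \<open>x\<close> leaves an element of the kernel, a multiple of
    \<open>e\<close>.\<close>
  have dec: "\<exists>a. x - cs a e \<in> ?Y" for x
  proof -
    have "?F x \<in> ?F ` ?Y" using FY by blast
    then obtain y where y: "y \<in> ?Y" "?F x = ?F y" by blast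
    then have "?F (x - y) = 0" by (simp add: F.diff)
    then obtain a where "x - y = cs a e" using ker by blast
    then have "x - cs a e = y" by (simp add: algebra_simps)
    then show ?thesis using y by metis
  qed
  define f where "f x = (SOME a. x - cs a e \<in> ?Y)" for x
  have f: "x - cs (f x) e \<in> ?Y" for x unfolding f_def by (rule someI_ex[OF dec])
  have funiq: "f x = a" if "x - cs a e \<in> ?Y" for x a
  proof -
    have "(x - cs a e) - (x - cs (f x) e) \<in> ?Y" using that f sub by (blast intro: subspace_diff)
    then have "cs (f x - a) e \<in> ?Y" by (simp add: cs.diff_left)
    then have "d * cmod (a - f x) \<le> norm (cs (f x - a) e + cs (a - f x) e)" by (rule sep)
    also have "\<dots> = 0" by (simp flip: cs.add_left)
    finally show ?thesis using d by (simp add: mult_le_0_iff)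
  qed
  have fbl: "bounded_linear f"
  proof
    show "f (x + y) = f x + f y" for x y
      using subspace_add[OF sub f[of x] f[of y]] by (intro funiq) (simp add: cs.add_left algebra_simps)
    show "f (r *\<^sub>R x) = r *\<^sub>R f x" for r x
      using subspace_scale[OF sub f[of x], of r] by (intro funiq) (simp add: cs.scaleR_left scaleR_diff_right)
    have "cmod (f x) \<le> norm x * (1/d)" for x
      using sep[OF f[of x], of "f x"] d by (simp add: field_simps)
    then show "\<exists>K. \<forall>x. norm (f x) \<le> norm x * K" by blast
  qed
  define a where "a = Blinfun f"
  have a: "blinfun_apply a = f" unfolding a_def by (rule bounded_linear_Blinfun_apply[OF fbl])
  have aY: "a y = 0" if "y \<in> ?Y" for y unfolding a by (rule funiq) (use that in \<open>simp add: cs.zero_left\<close>)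
  have ae: "a e = 1" unfolding a by (rule funiq) (use subspace_0[OF sub] in simp)
  have acs: "a (cs z x) = z * a x" for z x
    unfolding a using Ycs[OF f[of x], of z] by (intro funiq) (simp add: cs.diff_right cs_mult)
  have aT: "a (T x) = a x" for x
  proof -
    have "a (?F x) = 0" by (rule aY) simp
    then show ?thesis by (simp add: Fdef blinfun.diff_right)
  qed
  define Q where "Q = Blinfun (\<lambda>x. T x - cs (a x) e)"
  have Qx: "Q x = T x - cs (a x) e" for x
    unfolding Q_def
    by (subst bounded_linear_Blinfun_apply)
       (auto intro!: bounded_linear_sub blinfun.bounded_linear_right bounded_linear_compose[OF cs.bounded_linear_left])
  have aQ: "a (Q x) = 0" for x by (simp add: Qx blinfun.diff_right acs ae aT)
  have Te: "T e = e" using Fe by (simp add: Fdef)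
  \<comment> \<open>For \<open>w \<noteq> 1\<close> the equation on the complement is solved by the
    inverse of \<open>1/w - T\<close>, which exists since \<open>1/w\<close> lies outside the open
    unit disc and differs from 1. For \<open>w = 1\<close> the solution comes from
    \<open>FY\<close>. On the line of \<open>e\<close>, \<open>Q\<close> vanishes and the operator
    is the identity.\<close>
  have bijw: "bij (\<lambda>x. x - cs w (Q x))" if w: "cmod w \<le> 1" for w
  proof (cases "w = 0")
    case True then show ?thesis using bij_id by (simp add: cs.zero_left id_def)
  next
    case False
    have lin: "linear (\<lambda>x. x - cs w (Q x))"
      by (intro bounded_linear.linear bounded_linear_sub bounded_linear_ident
          bounded_linear_compose[OF cs.bounded_linear_right] blinfun.bounded_linear_right)
    have w1: "1 \<le> cmod (1 / w)" using w False by (simp add: norm_divide)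
    have "inj (\<lambda>x. x - cs w (Q x))"
      unfolding linear_injective_0[OF lin]
    proof (intro allI impI)
      fix x assume x: "x - cs w (Q x) = 0"
      then have "a x = w * a (Q x)" by (metis acs eq_iff_diff_eq_0)
      then have ax: "a x = 0" by (simp add: aQ)
      then have xT: "x = cs w (T x)" using x by (simp add: Qx cs.zero_left)
      show "x = 0"
      proof (cases "w = 1")
        case True
        then have "?F x = 0" using xT by (simp add: Fdef)
        then obtain z where "x = cs z e" using ker by blast
        then show ?thesis using ax by (simp add: acs ae)
      next
        case nw: False
        have "T x = cs (1/w) x" using xT False by (metis cs_inverse_cancel(2))
        moreover have "\<not> is_eigenvalue cs T (1/w)" using noev[OF w1] nw False by (simp add: field_simps)
        ultimately show ?thesis unfolding is_eigenvalue_def by blast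
      qed
    qed
    moreover have "\<exists>x. x - cs w (Q x) = y" for y
    proof -
      define y1 where "y1 = y - cs (f y) e"
      have y1: "y1 \<in> ?Y" unfolding y1_def by (rule f)
      have "\<exists>x1\<in>?Y. x1 - cs w (T x1) = y1"
      proof (cases "w = 1")
        case True
        have "y1 \<in> ?F ` ?Y" using y1 FY by blast
        then show ?thesis using True by (auto simp: Fdef)
      next
        case nw: False
        then have nw': "1 / w \<noteq> 1" using False by (simp add: field_simps)
        obtain x1 where x1: "shifted_op cs T (1/w) x1 = cs (1/w) y1" using bij[OF w1 nw'] by (metis bij_pointE)
        have "x1 \<in> ?Y" by (rule Y_return[OF _ nw']) (use x1 Ycs[OF y1] in simp)
        moreover have "x1 - cs w (T x1) = y1"
        proof -
          have "cs w (shifted_op cs T (1/w) x1) = cs w (cs (1/w) y1)" using x1 by simp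
          then show ?thesis using False by (simp add: shifted_op_def cs.diff_right cs_inverse_cancel)
        qed
        ultimately show ?thesis by blast
      qed
      then obtain x1 where x1: "x1 \<in> ?Y" "x1 - cs w (T x1) = y1" by blast
      have "Q x1 = T x1" using aY[OF x1(1)] by (simp add: Qx)
      moreover have "Q (cs (f y) e) = 0" using Te by (simp add: Qx clinear_opD[OF T] acs ae)
      ultimately have "Q (x1 + cs (f y) e) = T x1" by (simp add: blinfun.add_right)
      moreover have "(x1 + cs (f y) e) - cs w (T x1) = (x1 - cs w (T x1)) + cs (f y) e" by simp
      ultimately have "(x1 + cs (f y) e) - cs w (Q (x1 + cs (f y) e)) = y"
        using x1(2) y1_def by simp
      then show ?thesis by blast
    qed
    ultimately show ?thesis unfolding bij_def surj_def by metis
  qed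
  show ?thesis
  proof (rule that[of a Q e])
    show "clinear_functional cs a" unfolding clinear_functional_def by (simp add: acs)
    show "clinear_op cs Q" unfolding clinear_op_def
      by (simp add: Qx acs clinear_opD[OF T] cs.diff_right cs_mult)
    show "Q e = 0" using Te by (simp add: Qx ae)
  qed (use ae aQ bijw in \<open>auto simp: Qx\<close>)
qed

end

section \<open>Exponential decay of powers, locally uniform in the parameter\<close>

lemma isCont_op_pow: "isCont T t \<Longrightarrow> isCont (\<lambda>t. op_pow (T t) n) t"
  by (induction n) (auto simp: op_pow_0 op_pow_Suc intro!: continuous_intros)

text \<open>A single power \<open>m\<close> with norm below 1/2 at \<open>t0\<close> keeps this
  bound nearby by continuity, and submultiplicativity iterates it at the rate
  \<open>(1/2) powr (1 / m)\<close>. Rounding \<open>n / m\<close> down costs the factor 2, the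
  incomplete last block at most \<open>B ^ m\<close>.\<close>

lemma op_pow_local_decay:
  fixes T :: "real \<Rightarrow> 'b::banach \<Rightarrow>\<^sub>L 'b"
  assumes cont: "isCont T t0" and lim: "(\<lambda>n. norm (op_pow (T t0) n)) \<longlonglongrightarrow> 0"
  shows "\<exists>d>0. \<exists>C\<ge>0. \<exists>\<theta>. 0 < \<theta> \<and> \<theta> < 1 \<and> (\<forall>t. \<bar>t - t0\<bar> < d \<longrightarrow> (\<forall>n. norm (op_pow (T t) n) \<le> C * \<theta> ^ n))"
proof -
  have "\<forall>\<^sub>F n in sequentially. norm (op_pow (T t0) n) < 1/2 \<and> n > 0"
    using order_tendstoD(2)[OF lim, of "1/2"] eventually_gt_at_top[of 0] by (auto intro: eventually_conj)
  then obtain m where m: "norm (op_pow (T t0) m) < 1/2" "m > 0"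
    by (metis (mono_tags, lifting) eventually_sequentially order_refl)
  define B where "B = norm (T t0) + 1"
  have B: "B \<ge> 1" by (simp add: B_def)
  have "((\<lambda>t. op_pow (T t) m) \<longlongrightarrow> op_pow (T t0) m) (nhds t0)" "(T \<longlongrightarrow> T t0) (nhds t0)"
    using isCont_op_pow[OF cont, of m] cont unfolding isCont_def
    by (simp_all add: tendsto_at_iff_tendsto_nhds[of "\<lambda>t. op_pow (T t) m"] tendsto_at_iff_tendsto_nhds[of T])
  then have "((\<lambda>t. norm (op_pow (T t) m)) \<longlongrightarrow> norm (op_pow (T t0) m)) (nhds t0)"
      "((\<lambda>t. norm (T t)) \<longlongrightarrow> norm (T t0)) (nhds t0)" by (auto intro: tendsto_norm)
  then have "\<forall>\<^sub>F t in nhds t0. norm (op_pow (T t) m) < 1/2" "\<forall>\<^sub>F t in nhds t0. norm (T t) < B"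
    using m(1) by (auto intro!: order_tendstoD(2) simp: B_def)
  then have "\<forall>\<^sub>F t in nhds t0. norm (op_pow (T t) m) < 1/2 \<and> norm (T t) < B" by (rule eventually_conj)
  then obtain d where d: "d > 0" "\<And>t. dist t t0 < d \<Longrightarrow> norm (op_pow (T t) m) < 1/2 \<and> norm (T t) < B"
    unfolding eventually_nhds_metric by blast
  define \<theta> where "\<theta> = (1/2::real) powr (1 / real m)"
  have th: "0 < \<theta>" "\<theta> < 1" using m powr_less_mono2[of "1 / real m" "1/2" 1] by (auto simp: \<theta>_def)
  have "norm (op_pow (T t) n) \<le> (2 * B ^ m) * \<theta> ^ n" if t: "\<bar>t - t0\<bar> < d" for t n
  proof -
    have tb: "norm (op_pow (T t) m) \<le> 1/2" "norm (T t) \<le> B" using d(2)[of t] t by (auto simp: dist_real_def)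
    have small: "norm (op_pow (T t) j) \<le> B ^ j" for j
    proof (induction j)
      case (Suc j)
      have "norm (op_pow (T t) (Suc j)) \<le> norm (T t) * norm (op_pow (T t) j)"
        unfolding op_pow_Suc by (rule norm_blinfun_compose)
      also have "\<dots> \<le> B * B ^ j" using Suc tb B by (intro mult_mono) auto
      finally show ?case by simp
    qed (simp add: op_pow_0 norm_blinfun_id_le)
    have blocks: "norm (op_pow (T t) (m * k)) \<le> (1/2) ^ k" for k
    proof (induction k)
      case (Suc k)
      have "norm (op_pow (T t) (m * Suc k)) \<le> norm (op_pow (T t) m) * norm (op_pow (T t) (m * k))"
        using norm_op_pow_add[of "T t" m "m * k"] by simp
      also have "\<dots> \<le> 1/2 * (1/2) ^ k" using Suc tb by (intro mult_mono) auto
      finally show ?case by simp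
    qed (simp add: op_pow_0 norm_blinfun_id_le)
    have "norm (op_pow (T t) n) \<le> norm (op_pow (T t) (m * (n div m))) * norm (op_pow (T t) (n mod m))"
      using norm_op_pow_add[of "T t" "m * (n div m)" "n mod m"] by simp
    also have "\<dots> \<le> (1/2) ^ (n div m) * B ^ (n mod m)" by (intro mult_mono blocks small) auto
    also have "B ^ (n mod m) \<le> B ^ m" using B m by (intro power_increasing) (auto intro: less_imp_le)
    also have "(1/2::real) ^ (n div m) \<le> 2 * \<theta> ^ n"
    proof -
      have "real n / real m \<le> real (n div m) + 1"
        using m(2) floor_divide_of_nat_eq[of n m, where 'a = real] by linarith
      then have "(1/2::real) powr (real (n div m) + 1) \<le> (1/2) powr (real n / real m)"
        by (intro powr_mono') auto
      also have "(1/2::real) powr (real n / real m) = \<theta> ^ n"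
        using th by (simp add: \<theta>_def powr_powr flip: powr_realpow)
      also have "(1/2::real) powr (real (n div m) + 1) = (1/2) ^ (n div m) * (1/2)"
        by (simp add: powr_add powr_realpow)
      finally show ?thesis by simp
    qed
    finally show ?thesis using B by (simp add: mult_ac)
  qed
  then show ?thesis using d(1) th B by (intro exI[of _ d] conjI exI[of _ "2 * B ^ m"] exI[of _ \<theta>]) auto
qed

lemma op_pow_compact_decay:
  fixes T :: "real \<Rightarrow> 'b::banach \<Rightarrow>\<^sub>L 'b"
  assumes cont: "continuous_on UNIV T" and S: "compact S"
    and lim: "\<And>t. t \<in> S \<Longrightarrow> (\<lambda>n. norm (op_pow (T t) n)) \<longlonglongrightarrow> 0"
  shows "\<exists>C\<ge>0. \<exists>\<theta>. 0 < \<theta> \<and> \<theta> < 1 \<and> (\<forall>t\<in>S. \<forall>n. norm (op_pow (T t) n) \<le> C * \<theta> ^ n)"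
proof -
  have "\<exists>d C \<theta>. d > 0 \<and> C \<ge> 0 \<and> 0 < \<theta> \<and> \<theta> < 1 \<and> (\<forall>t. \<bar>t - t0\<bar> < d \<longrightarrow> (\<forall>n. norm (op_pow (T t) n) \<le> C * \<theta> ^ n))"
    if "t0 \<in> S" for t0
    using op_pow_local_decay[where T = T and ?t0.0 = t0] cont lim[OF that] by (auto simp: continuous_on_eq_continuous_at)
  then obtain d C \<theta> where *: "\<And>t0::real. t0 \<in> S \<Longrightarrow> d t0 > (0::real) \<and> C t0 \<ge> (0::real) \<and> 0 < \<theta> t0 \<and> \<theta> t0 < (1::real) \<and>
      (\<forall>t. \<bar>t - t0\<bar> < d t0 \<longrightarrow> (\<forall>n. norm (op_pow (T t) n) \<le> C t0 * \<theta> t0 ^ n))"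
    by metis
  have "S \<subseteq> (\<Union>t0\<in>S. ball t0 (d t0))" using * by fastforce
  then obtain F where F: "F \<subseteq> S" "finite F" "S \<subseteq> (\<Union>t0\<in>F. ball t0 (d t0))"
    by (rule compactE_image[OF S open_ball])
  \<comment> \<open>The entry 1/2 keeps the maximum meaningful and positive even when the finite
    subcover is empty.\<close>
  define q where "q = Max (insert (1/2) (\<theta> ` F))"
  have q: "0 < q" "q < 1" "\<And>t0. t0 \<in> F \<Longrightarrow> \<theta> t0 \<le> q"
  proof -
    have "1/2 \<le> q" unfolding q_def using F by (intro Max_ge) auto
    then show "0 < q" by simp
    show "q < 1" unfolding q_def using F * by (subst Max_less_iff) auto
    show "\<theta> t0 \<le> q" if "t0 \<in> F" for t0 unfolding q_def using F that by (intro Max_ge) auto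
  qed
  have "norm (op_pow (T t) n) \<le> sum C F * q ^ n" if t: "t \<in> S" for t n
  proof -
    obtain t0 where t0: "t0 \<in> F" "\<bar>t - t0\<bar> < d t0" using F t by (auto simp: dist_real_def abs_minus_commute)
    then have t0S: "t0 \<in> S" using F by auto
    have "norm (op_pow (T t) n) \<le> C t0 * \<theta> t0 ^ n" using * t0 t0S by blast
    also have "\<dots> \<le> sum C F * q ^ n"
      using * t0 t0S F q by (intro mult_mono member_le_sum power_mono sum_nonneg) (auto intro: less_imp_le)
    finally show ?thesis .
  qed
  then show ?thesis using q * F by (intro exI[of _ "sum C F"] conjI exI[of _ q] sum_nonneg) auto
qed

lemma (in complex_banach) op_pow_tendsto_0_if_spectrum:
  assumes T: "clinear_op cs T" and sp: "op_spectrum cs T \<subseteq> {z. cmod z < 1}"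
  shows "(\<lambda>n. norm (op_pow T n)) \<longlonglongrightarrow> 0"
proof (rule op_pow_tendsto_0[OF T])
  fix w assume w: "cmod w \<le> 1"
  show "bij (\<lambda>x. x - cs w (T x))"
  proof (cases "w = 0")
    case True then show ?thesis using bij_id by (simp add: cs.zero_left id_def)
  next
    case False
    have "1 \<le> cmod (1/w)" using w False by (simp add: norm_divide)
    then have "1/w \<notin> op_spectrum cs T" using sp by force
    then have b: "bij (shifted_op cs T (1/w))" by (simp add: op_spectrum_def)
    have c: "bij (cs w)"
      by (rule bij_betw_byWitness[where f' = "cs (1/w)"]) (use False cs_inverse_cancel in auto)
    have "(\<lambda>x. x - cs w (T x)) = cs w \<circ> shifted_op cs T (1/w)"
      using False by (auto simp: shifted_op_def cs.diff_right cs_inverse_cancel)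
    then show ?thesis using bij_comp[OF b c] by simp
  qed
qed

section \<open>Taylor expansions at a point\<close>

text \<open>\<open>peano m f\<close>: the function \<open>f\<close> has a Taylor expansion of order \<open>m\<close> at 0 with remainder \<open>o(t\<^sup>m)\<close>;
  the recursive form makes closure under products, compositions and fixed points a plain induction.\<close>

primrec peano :: "nat \<Rightarrow> (real \<Rightarrow> 'a::real_normed_vector) \<Rightarrow> bool" where
  "peano 0 f = isCont f 0"
| "peano (Suc m) f = (\<exists>g. (\<forall>t. f t = f 0 + t *\<^sub>R g t) \<and> peano m g)"

lemma peano_isCont: "peano m f \<Longrightarrow> isCont f 0"
proof (induction m arbitrary: f)
  case (Suc m)
  then obtain g where g: "\<And>t. f t = f 0 + t *\<^sub>R g t" "isCont g 0" by auto
  have "isCont (\<lambda>t. f 0 + t *\<^sub>R g t) 0" using g(2) by (intro continuous_intros)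
  moreover have "(\<lambda>t. f 0 + t *\<^sub>R g t) = f" by (rule ext) (rule g(1)[symmetric])
  ultimately show ?case by simp
qed simp

lemma peano_Suc_D: "peano (Suc m) f \<Longrightarrow> peano m f"
proof (induction m arbitrary: f)
  case 0 then show ?case using peano_isCont[of "Suc 0" f] by simp
next
  case (Suc m) then show ?case by auto
qed

lemma peano_le: "k \<le> m \<Longrightarrow> peano m f \<Longrightarrow> peano k f"
proof (induction rule: dec_induct)
  case (step n)
  then show ?case using peano_Suc_D by blast
qed

lemma peano_const [simp]: "peano m (\<lambda>t. c)"
  by (induction m arbitrary: c) (auto intro!: exI[of _ "\<lambda>t. 0"])

lemma peano_SucI: assumes "peano m g" "\<And>t. f t = c + t *\<^sub>R g t" shows "peano (Suc m) f"
proof -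
  have "f 0 = c" using assms(2)[of 0] by simp
  then have "\<forall>t. f t = f 0 + t *\<^sub>R g t" using assms(2) by blast
  then show ?thesis unfolding peano.simps using assms(1) by blast
qed

lemma peano_linear:
  assumes "bounded_linear h" shows "peano m f \<Longrightarrow> peano m (\<lambda>t. h (f t))"
proof (induction m arbitrary: f)
  case 0 then show ?case using bounded_linear.isCont[OF assms] by simp
next
  case (Suc m)
  interpret bounded_linear h by fact
  from Suc obtain g where g: "\<And>t. f t = f 0 + t *\<^sub>R g t" "peano m g" by auto
  have "h (f t) = h (f 0) + t *\<^sub>R h (g t)" for t using g(1)[of t] by (metis add scaleR)
  then show ?case using Suc.IH[OF g(2)] by (intro peano_SucI)
qed

lemma peano_add: "peano m f \<Longrightarrow> peano m g \<Longrightarrow> peano m (\<lambda>t. f t + g t)"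
proof (induction m arbitrary: f g)
  case (Suc m)
  from Suc obtain f1 where f: "\<And>t. f t = f 0 + t *\<^sub>R f1 t" "peano m f1" by auto
  from Suc obtain g1 where g: "\<And>t. g t = g 0 + t *\<^sub>R g1 t" "peano m g1" by auto
  have "f t + g t = (f 0 + g 0) + t *\<^sub>R (f1 t + g1 t)" for t
    using f(1)[of t] g(1)[of t] by (simp add: scaleR_add_right)
  then show ?case using Suc.IH[OF f(2) g(2)] by (intro peano_SucI)
qed (auto intro: continuous_intros)

lemma peano_minus: "peano m f \<Longrightarrow> peano m (\<lambda>t. - f t)"
  by (rule peano_linear[OF bounded_linear_minus[OF bounded_linear_ident]])

lemma peano_diff: "peano m f \<Longrightarrow> peano m g \<Longrightarrow> peano m (\<lambda>t. f t - g t)"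
  using peano_add[OF _ peano_minus] by fastforce

lemma peano_bilinear:
  assumes "bounded_bilinear h"
  shows "peano m f \<Longrightarrow> peano m g \<Longrightarrow> peano m (\<lambda>t. h (f t) (g t))"
proof (induction m arbitrary: f g)
  case 0 then show ?case using bounded_bilinear.isCont[OF assms] by simp
next
  case (Suc m)
  interpret bounded_bilinear h by fact
  from Suc obtain f1 where f: "\<And>t. f t = f 0 + t *\<^sub>R f1 t" "peano m f1" by auto
  from Suc obtain g1 where g: "\<And>t. g t = g 0 + t *\<^sub>R g1 t" "peano m g1" by auto
  have "h (f t) (g t) = h (f 0) (g 0) + t *\<^sub>R (h (f1 t) (g t) + h (f 0) (g1 t))" for t
  proof -
    have "h (f t) (g t) = h (f 0 + t *\<^sub>R f1 t) (g t)" using f(1)[of t] by simp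
    also have "\<dots> = h (f 0) (g t) + t *\<^sub>R h (f1 t) (g t)" by (simp add: add_left scaleR_left)
    also have "h (f 0) (g t) = h (f 0) (g 0 + t *\<^sub>R g1 t)" using g(1)[of t] by simp
    also have "\<dots> = h (f 0) (g 0) + t *\<^sub>R h (f 0) (g1 t)" by (simp add: add_right scaleR_right)
    finally show ?thesis by (simp add: scaleR_add_right)
  qed
  moreover have "peano m (\<lambda>t. h (f1 t) (g t) + h (f 0) (g1 t))"
    using Suc.IH[OF f(2) peano_Suc_D[OF Suc.prems(2)]] Suc.IH[OF peano_const g(2)] by (rule peano_add)
  ultimately show ?case by (intro peano_SucI)
qed

text \<open>The defining identity is demanded for all \<open>t\<close>, but away from 0 any function
  satisfies it with its own difference quotient. Only the germ at 0 matters, which allows arbitrary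
  continuations of functions that are controlled only near 0.\<close>

lemma peano_cong:
  assumes "\<forall>\<^sub>F t in nhds 0. f t = g t" "peano m f"
  shows "peano m g"
  using assms
proof (induction m arbitrary: f g)
  case 0
  then show ?case using isCont_cong by fastforce
next
  case (Suc m)
  then obtain h where h: "\<And>t. f t = f 0 + t *\<^sub>R h t" "peano m h" by auto
  define h' where "h' t = (if t = 0 then h 0 else (g t - g 0) /\<^sub>R t)" for t
  have g0: "f 0 = g 0" using Suc.prems(1) by (rule eventually_nhds_x_imp_x)
  have "\<forall>\<^sub>F t in nhds 0. h t = h' t"
    using Suc.prems(1)
  proof eventually_elim
    case (elim t)
    have "f t - f 0 = t *\<^sub>R h t" using h(1)[of t] by (metis add_diff_cancel_left')
    then have "g t - g 0 = t *\<^sub>R h t" by (simp only: elim g0)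
    then show ?case by (simp add: h'_def)
  qed
  then have "peano m h'" using Suc.IH h(2) by blast
  then show ?case by (rule peano_SucI) (auto simp: h'_def)
qed

text \<open>The difference quotient of \<open>F\<close> at \<open>f 0\<close> is holomorphic again
  by removal of the singularity, so the induction runs over \<open>F\<close> and \<open>f\<close>
  together and no formula for higher derivatives of compositions appears.\<close>

lemma peano_holomorphic:
  fixes f :: "real \<Rightarrow> complex"
  assumes "F holomorphic_on S" "open S" "f 0 \<in> S"
  shows "peano m f \<Longrightarrow> peano m (\<lambda>t. F (f t))"
  using assms
proof (induction m arbitrary: F f)
  case 0
  then have "isCont F (f 0)" by (metis continuous_on_eq_continuous_at holomorphic_on_imp_continuous_on)
  then show ?case using 0 by (auto intro: isCont_o2)
next
  case (Suc m)
  from Suc obtain g where g: "\<And>t. f t = f 0 + t *\<^sub>R g t" "peano m g" by auto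
  let ?c = "f 0"
  define F1 where "F1 z = (if z = ?c then deriv F ?c else (F z - F ?c) / (z - ?c))" for z
  have "F1 holomorphic_on S" unfolding F1_def by (rule pole_lemma_open) (use Suc in auto)
  then have "peano m (\<lambda>t. F1 (f t))" using Suc.IH peano_Suc_D[OF Suc.prems(1)] Suc.prems by blast
  then have "peano m (\<lambda>t. g t * F1 (f t))" by (rule peano_bilinear[OF bounded_bilinear_mult g(2)])
  moreover have "F (f t) = F ?c + t *\<^sub>R (g t * F1 (f t))" for t
  proof -
    have "F z = F ?c + (z - ?c) * F1 z" for z by (simp add: F1_def)
    moreover have "f t - ?c = t *\<^sub>R g t" using g(1)[of t] by (simp add: algebra_simps)
    ultimately show ?thesis by (metis mult_scaleR_left)
  qed
  ultimately show ?case by (rule peano_SucI)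
qed

lemma peano_iff_remainder:
  fixes f :: "real \<Rightarrow> 'a::real_normed_vector"
  shows "peano m f \<longleftrightarrow> (\<exists>c \<eta>. isCont \<eta> 0 \<and> \<eta> 0 = 0 \<and> (\<forall>t. f t = (\<Sum>k\<le>m. t ^ k *\<^sub>R c k) + t ^ m *\<^sub>R \<eta> t))"
proof (induction m arbitrary: f)
  case 0
  show ?case
  proof
    assume "peano 0 f"
    then show "\<exists>c \<eta>. isCont \<eta> 0 \<and> \<eta> 0 = 0 \<and> (\<forall>t. f t = (\<Sum>k\<le>0. t ^ k *\<^sub>R c k) + t ^ 0 *\<^sub>R \<eta> t)"
      by (intro exI[of _ "\<lambda>_. f 0"] exI[of _ "\<lambda>t. f t - f 0"]) (auto intro!: continuous_intros)
  next
    assume "\<exists>c \<eta>. isCont \<eta> 0 \<and> \<eta> 0 = 0 \<and> (\<forall>t. f t = (\<Sum>k\<le>0. t ^ k *\<^sub>R c k) + t ^ 0 *\<^sub>R \<eta> t)"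
    then obtain c \<eta> where c: "isCont \<eta> 0" "\<And>t. f t = c (0::nat) + \<eta> t" by auto
    have "isCont (\<lambda>t. c 0 + \<eta> t) 0" using c(1) by (intro continuous_intros)
    then show "peano 0 f" by (simp flip: c(2))
  qed
next
  case (Suc m)
  have sum_eq: "(\<Sum>k\<le>Suc m. t ^ k *\<^sub>R c k) = c 0 + t *\<^sub>R (\<Sum>k\<le>m. t ^ k *\<^sub>R c (Suc k))" for t :: real and c :: "nat \<Rightarrow> 'a"
    unfolding sum.atMost_Suc_shift by (simp add: scaleR_sum_right)
  show ?case
  proof
    assume "peano (Suc m) f"
    then obtain g where g: "\<And>t. f t = f 0 + t *\<^sub>R g t" "peano m g" by auto
    from Suc g(2) obtain c \<eta> where c: "isCont \<eta> 0" "\<eta> 0 = 0" "\<And>t. g t = (\<Sum>k\<le>m. t ^ k *\<^sub>R c k) + t ^ m *\<^sub>R \<eta> t" by blast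
    define c' where "c' = case_nat (f 0) c"
    have "f t = (\<Sum>k\<le>Suc m. t ^ k *\<^sub>R c' k) + t ^ Suc m *\<^sub>R \<eta> t" for t
      unfolding sum_eq using g(1)[of t] c(3)[of t] by (simp add: c'_def scaleR_add_right)
    then show "\<exists>c \<eta>. isCont \<eta> 0 \<and> \<eta> 0 = 0 \<and> (\<forall>t. f t = (\<Sum>k\<le>Suc m. t ^ k *\<^sub>R c k) + t ^ Suc m *\<^sub>R \<eta> t)"
      using c by blast
  next
    assume "\<exists>c \<eta>. isCont \<eta> 0 \<and> \<eta> 0 = 0 \<and> (\<forall>t. f t = (\<Sum>k\<le>Suc m. t ^ k *\<^sub>R c k) + t ^ Suc m *\<^sub>R \<eta> t)"
    then obtain c \<eta> where c: "isCont \<eta> 0" "\<eta> 0 = 0" "\<And>t. f t = (\<Sum>k\<le>Suc m. t ^ k *\<^sub>R c k) + t ^ Suc m *\<^sub>R \<eta> t" by blast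
    have "peano m (\<lambda>t. (\<Sum>k\<le>m. t ^ k *\<^sub>R c (Suc k)) + t ^ m *\<^sub>R \<eta> t)"
      unfolding Suc by (intro exI[of _ "\<lambda>k. c (Suc k)"] exI[of _ \<eta>]) (use c in auto)
    then show "peano (Suc m) f" by (rule peano_SucI[where c = "c 0"]) (use c(3) sum_eq in \<open>simp add: scaleR_add_right\<close>)
  qed
qed

text \<open>Peano expansions may be integrated: the mean value inequality bounds the error of the
  integrated Taylor polynomial by \<open>\<bar>t\<bar> ^ (m+1)\<close> times the supremum of the old
  remainder between \<open>-\<bar>t\<bar>\<close> and \<open>\<bar>t\<bar>\<close>.\<close>

lemma peano_antiderivative:
  fixes f :: "real \<Rightarrow> 'a::real_normed_vector"
  assumes \<delta>: "\<delta> > 0" and der: "\<And>t. t \<in> {-\<delta>..\<delta>} \<Longrightarrow> (f has_vector_derivative f' t) (at t within {-\<delta>..\<delta>})"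
    and f': "peano m f'"
  shows "peano (Suc m) f"
proof -
  obtain c \<eta> where c: "isCont \<eta> 0" "\<eta> 0 = 0" "\<And>t. f' t = (\<Sum>k\<le>m. t ^ k *\<^sub>R c k) + t ^ m *\<^sub>R \<eta> t"
    using f' unfolding peano_iff_remainder by blast
  define p where "p t = (\<Sum>k\<le>m. t ^ Suc k *\<^sub>R (c k /\<^sub>R real (Suc k)))" for t
  define \<rho> where "\<rho> t = f t - f 0 - p t" for t
  have der_p: "(p has_vector_derivative (\<Sum>k\<le>m. t ^ k *\<^sub>R c k)) (at t within A)" for t A
    unfolding p_def
    by (auto intro!: derivative_eq_intros has_vector_derivative_sum sum.cong simp del: power_Suc)
  have der_rho: "(\<rho> has_vector_derivative t ^ m *\<^sub>R \<eta> t) (at t within {-\<delta>..\<delta>})" if "t \<in> {-\<delta>..\<delta>}" for t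
    unfolding \<rho>_def using der[OF that] der_p[of t "{-\<delta>..\<delta>}"] c(3)[of t]
    by (auto intro!: derivative_eq_intros)
  define \<eta>2 where "\<eta>2 t = (if t = 0 then 0 else \<rho> t /\<^sub>R t ^ Suc m)" for t
  have "isCont \<eta>2 0"
    unfolding continuous_at_eps_delta
  proof (intro allI impI)
    fix e :: real assume e: "e > 0"
    obtain d where d: "d > 0" "\<And>t. \<bar>t\<bar> < d \<Longrightarrow> norm (\<eta> t) < e / 2"
      using c(1)[unfolded continuous_at_eps_delta, rule_format, of "e/2"] c(2) e by (auto simp: dist_norm)
    have "norm (\<eta>2 t) \<le> e / 2" if t: "\<bar>t\<bar> < min d \<delta>" for t
    proof (cases "t = 0")
      case False
      let ?S = "{-\<bar>t\<bar>..\<bar>t\<bar>}"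
      have "norm (\<rho> t - \<rho> 0) \<le> (\<bar>t\<bar> ^ m * (e/2)) * norm (t - 0)"
      proof (rule differentiable_bound[where S = ?S and f' = "\<lambda>u h. h *\<^sub>R (u ^ m *\<^sub>R \<eta> u)"])
        fix u assume u: "u \<in> ?S"
        have "(\<rho> has_vector_derivative u ^ m *\<^sub>R \<eta> u) (at u within ?S)"
          by (rule has_vector_derivative_within_subset[OF der_rho]) (use u t in auto)
        then show "(\<rho> has_derivative (\<lambda>h. h *\<^sub>R (u ^ m *\<^sub>R \<eta> u))) (at u within ?S)"
          by (simp add: has_vector_derivative_def)
        have ut: "\<bar>u\<bar> \<le> \<bar>t\<bar>" using u by auto
        then have "norm (\<eta> u) \<le> e / 2" using d(2)[of u] t by simp
        then have "norm (u ^ m *\<^sub>R \<eta> u) \<le> \<bar>t\<bar> ^ m * (e/2)"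
          unfolding norm_scaleR power_abs using ut by (intro mult_mono power_mono) auto
        then show "onorm (\<lambda>h. h *\<^sub>R (u ^ m *\<^sub>R \<eta> u)) \<le> \<bar>t\<bar> ^ m * (e/2)"
          using mult_left_mono[of "norm (u ^ m *\<^sub>R \<eta> u)" "\<bar>t\<bar> ^ m * (e/2)" "\<bar>h\<bar>" for h]
          by (intro onorm_le) (metis abs_ge_zero mult.commute norm_scaleR real_norm_def)
      qed auto
      then have "norm (\<rho> t) \<le> \<bar>t\<bar> ^ Suc m * (e/2)" by (simp add: \<rho>_def p_def mult_ac)
      then show ?thesis using False by (simp add: \<eta>2_def field_simps power_abs abs_mult)
    qed (use e in \<open>auto simp: \<eta>2_def\<close>)
    then have "\<And>t. \<bar>t\<bar> < min d \<delta> \<Longrightarrow> norm (\<eta>2 t) < e" using e by fastforce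
    then show "\<exists>d>0. \<forall>x'. dist x' 0 < d \<longrightarrow> dist (\<eta>2 x') (\<eta>2 0) < e"
      using d(1) \<delta> by (intro exI[of _ "min d \<delta>"]) (auto simp: \<eta>2_def dist_norm)
  qed
  then have "peano m (\<lambda>t. (\<Sum>k\<le>m. t ^ k *\<^sub>R (c k /\<^sub>R real (Suc k))) + t ^ m *\<^sub>R \<eta>2 t)"
    unfolding peano_iff_remainder by (intro exI[of _ "\<lambda>k. c k /\<^sub>R real (Suc k)"] exI[of _ \<eta>2]) (auto simp: \<eta>2_def)
  then show ?thesis
  proof (rule peano_SucI)
    fix t
    have "t *\<^sub>R (t ^ m *\<^sub>R \<eta>2 t) = \<rho> t"
    proof (cases "t = 0")
      case False
      then have "t * (t ^ m * inverse (t ^ Suc m)) = 1" by (simp add: field_simps)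
      then show ?thesis using False by (simp only: \<eta>2_def if_False scaleR_scaleR scaleR_one)
    qed (simp add: \<eta>2_def \<rho>_def p_def)
    moreover have "t *\<^sub>R (\<Sum>k\<le>m. t ^ k *\<^sub>R (c k /\<^sub>R real (Suc k))) = p t"
      unfolding p_def scaleR_sum_right power_Suc scaleR_scaleR by (simp add: mult.assoc)
    ultimately show "f t = f 0 + t *\<^sub>R ((\<Sum>k\<le>m. t ^ k *\<^sub>R (c k /\<^sub>R real (Suc k))) + t ^ m *\<^sub>R \<eta>2 t)"
      unfolding scaleR_add_right by (simp add: \<rho>_def)
  qed
qed

text \<open>The continuous top derivative has an expansion of order 0, and each integration gains
  one order, down to \<open>D 0\<close>. Since \<open>D 0\<close> and \<open>L\<close> agree only on
  the interval, the conclusion passes through germs.\<close>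

lemma Cs_on_interval_peano:
  assumes "\<delta> > 0" "Cs_on_interval s \<delta> L"
  shows "peano s L"
proof -
  obtain D where D0: "\<And>t. t\<in>{-\<delta>..\<delta>} \<Longrightarrow> D 0 t = L t"
    and D: "\<And>k t. k < s \<Longrightarrow> t\<in>{-\<delta>..\<delta>} \<Longrightarrow> (D k has_vector_derivative D (Suc k) t) (at t within {-\<delta>..\<delta>})"
    and Ds: "continuous_on {-\<delta>..\<delta>} (D s)"
    using assms(2) unfolding Cs_on_interval_def by metis
  have "peano j (D (s - j))" if "j \<le> s" for j
    using that
  proof (induction j)
    case 0
    have "isCont (D s) 0" using Ds assms(1) by (intro continuous_on_interior[OF Ds]) auto
    then show ?case by simp
  next
    case (Suc j)
    have "Suc (s - Suc j) = s - j" using Suc by simp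
    then show ?case using D[of "s - Suc j"] Suc
      by (intro peano_antiderivative[OF assms(1), where f' = "D (s - j)"]) auto
  qed
  then have p: "peano s (D 0)" by (metis diff_self_eq_0 order_refl)
  show ?thesis
  proof (rule peano_cong[OF _ p])
    show "\<forall>\<^sub>F t in nhds 0. D 0 t = L t"
      unfolding eventually_nhds_metric using assms(1) by (intro exI[of _ \<delta>]) (auto simp: dist_real_def intro!: D0)
  qed
qed

section \<open>Perturbation of the leading eigenvalue\<close>

lemma isCont_bounded_near_0:
  fixes g :: "real \<Rightarrow> 'a::real_normed_vector"
  assumes "isCont g 0"
  shows "\<exists>d>0. \<forall>t. \<bar>t\<bar> < d \<longrightarrow> norm (g t) \<le> norm (g 0) + 1"
proof -
  obtain d where d: "d > 0" "\<And>t. dist t 0 < d \<Longrightarrow> dist (g t) (g 0) < 1"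
    using assms unfolding continuous_at_eps_delta by (metis zero_less_one)
  have "norm (g t) \<le> norm (g 0) + 1" if "\<bar>t\<bar> < d" for t
    using d(2)[of t] that norm_triangle_sub[of "g t" "g 0"] by (simp add: dist_norm)
  then show ?thesis using d(1) by blast
qed

text \<open>The factor \<open>t\<close> in front of \<open>\<Psi>\<close> acts twice: for small
  \<open>t\<close> it makes the map a contraction, and in
  \<open>w t = x0 + t *\<^sub>R \<Psi> t (w t)\<close> it turns an expansion of order
  \<open>m\<close> on the right into one of order \<open>m + 1\<close> on the left. This bootstrap
  replaces an implicit function theorem. The closed set \<open>S\<close> lets the solution inherit a
  property such as complex linearity.\<close>

lemma peano_fixed_point:
  fixes \<Psi> :: "real \<Rightarrow> 'e::banach \<Rightarrow> 'e"
  assumes S: "closed S" "x0 \<in> S" and pos: "M > 0" "d0 > 0"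
    and bd: "\<And>t x. \<bar>t\<bar> < d0 \<Longrightarrow> x \<in> S \<Longrightarrow> x \<in> cball x0 1 \<Longrightarrow> norm (\<Psi> t x) \<le> M"
    and lip: "\<And>t x y. \<bar>t\<bar> < d0 \<Longrightarrow> x \<in> S \<Longrightarrow> y \<in> S \<Longrightarrow> x \<in> cball x0 1 \<Longrightarrow> y \<in> cball x0 1 \<Longrightarrow>
      norm (\<Psi> t x - \<Psi> t y) \<le> M * norm (x - y)"
    and inv: "\<And>t x. \<bar>t\<bar> < d0 \<Longrightarrow> x \<in> S \<Longrightarrow> x0 + t *\<^sub>R \<Psi> t x \<in> S"
    and boot: "\<And>m w. m \<le> s \<Longrightarrow> peano m w \<Longrightarrow> w 0 = x0 \<Longrightarrow> peano m (\<lambda>t. \<Psi> t (w t))"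
  shows "\<exists>w d. d > 0 \<and> w 0 = x0 \<and> (\<forall>t. \<bar>t\<bar> < d \<longrightarrow> w t \<in> S \<and> w t = x0 + t *\<^sub>R \<Psi> t (w t)) \<and> peano (Suc s) w"
proof -
  \<comment> \<open>With \<open>\<bar>t\<bar> * M \<le> 1/2\<close> the map preserves the unit ball
    around \<open>x0\<close> and has Lipschitz constant 1/2.\<close>
  define d where "d = min d0 (1 / (2 * M))"
  have d: "d > 0" "d \<le> d0" "d * M \<le> 1/2" using pos by (auto simp: d_def min_def field_simps)
  let ?B = "S \<inter> cball x0 1"
  have small: "\<bar>t\<bar> * M \<le> 1/2" if "\<bar>t\<bar> < d" for t
    using mult_right_mono[of "\<bar>t\<bar>" d M] that d pos by linarith
  have "\<exists>x. x \<in> ?B \<and> x0 + t *\<^sub>R \<Psi> t x = x" if t: "\<bar>t\<bar> < d" for t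
  proof -
    have td: "\<bar>t\<bar> < d0" using t d by linarith
    have "\<exists>!x\<in>?B. x0 + t *\<^sub>R \<Psi> t x = x"
    proof (rule Banach_fix[where c = "1/2"])
      show "Topological_Spaces.complete ?B" using S by (simp add: complete_eq_closed closed_Int)
      have "x0 \<in> ?B" using S by simp
      then show "?B \<noteq> {}" by blast
      show "(0::real) \<le> 1/2" "1/2 < (1::real)" by auto
      show "(\<lambda>x. x0 + t *\<^sub>R \<Psi> t x) ` ?B \<subseteq> ?B"
      proof (rule image_subsetI)
        fix x assume x: "x \<in> ?B"
        have "norm (t *\<^sub>R \<Psi> t x) \<le> \<bar>t\<bar> * M" using bd[OF td, of x] x by (simp add: mult_left_mono)
        then have "norm (t *\<^sub>R \<Psi> t x) \<le> 1" using small[OF t] by linarith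
        then show "x0 + t *\<^sub>R \<Psi> t x \<in> ?B"
          using inv[OF td] x by (simp add: dist_norm)
      qed
      fix x y assume xy: "x \<in> ?B" "y \<in> ?B"
      have "dist (x0 + t *\<^sub>R \<Psi> t x) (x0 + t *\<^sub>R \<Psi> t y) = \<bar>t\<bar> * norm (\<Psi> t x - \<Psi> t y)"
        by (simp add: dist_norm flip: scaleR_diff_right)
      also have "\<dots> \<le> \<bar>t\<bar> * (M * norm (x - y))" using lip[OF td, of x y] xy by (intro mult_left_mono) auto
      also have "\<dots> \<le> 1/2 * norm (x - y)" using mult_right_mono[OF small[OF t], of "norm (x - y)"] by (simp add: mult.assoc)
      finally show "dist (x0 + t *\<^sub>R \<Psi> t x) (x0 + t *\<^sub>R \<Psi> t y) \<le> 1/2 * dist x y" by (simp add: dist_norm)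
    qed
    then show ?thesis by blast
  qed
  then obtain w' where w': "\<And>t. \<bar>t\<bar> < d \<Longrightarrow> w' t \<in> ?B \<and> x0 + t *\<^sub>R \<Psi> t (w' t) = w' t" by metis
  define w where "w t = (if \<bar>t\<bar> < d then w' t else x0)" for t
  have w: "w t \<in> ?B" "w t = x0 + t *\<^sub>R \<Psi> t (w t)" if "\<bar>t\<bar> < d" for t using w'[OF that] that by (auto simp: w_def)
  have w0: "w 0 = x0" using w(2)[of 0] d by simp
  have lipw: "norm (w t - x0) \<le> M * \<bar>t\<bar>" for t
  proof (cases "\<bar>t\<bar> < d")
    case True
    have "w t - x0 = t *\<^sub>R \<Psi> t (w t)" using w(2)[OF True] by (metis add_diff_cancel_left')
    then have "norm (w t - x0) = \<bar>t\<bar> * norm (\<Psi> t (w t))" by simp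
    also have "\<dots> \<le> \<bar>t\<bar> * M" using w(1)[OF True] bd True d by (intro mult_left_mono) auto
    finally show ?thesis by (simp add: mult.commute)
  qed (use pos in \<open>simp add: w_def\<close>)
  have cont: "isCont w 0"
    unfolding continuous_at_eps_delta
  proof (intro allI impI)
    fix \<epsilon> :: real assume e: "\<epsilon> > 0"
    have "dist (w t) (w 0) < \<epsilon>" if "dist t 0 < \<epsilon> / M" for t
    proof -
      have "M * \<bar>t\<bar> < \<epsilon>" using that pos by (simp add: dist_real_def field_simps)
      then show ?thesis using lipw[of t] unfolding w0 dist_norm by linarith
    qed
    then show "\<exists>d>0. \<forall>x'. dist x' 0 < d \<longrightarrow> dist (w x') (w 0) < \<epsilon>" using e pos by (intro exI[of _ "\<epsilon>/M"]) auto
  qed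
  have "peano m w" if "m \<le> Suc s" for m
    using that
  proof (induction m)
    case 0 then show ?case using cont by simp
  next
    case (Suc m)
    have "peano (Suc m) (\<lambda>t. x0 + t *\<^sub>R \<Psi> t (w t))"
      by (rule peano_SucI[OF boot[of m w]]) (use Suc w0 in auto)
    then show ?case
    proof (rule peano_cong[rotated])
      show "\<forall>\<^sub>F t in nhds 0. x0 + t *\<^sub>R \<Psi> t (w t) = w t"
        unfolding eventually_nhds_metric using d w(2) by (intro exI[of _ d]) (auto simp: dist_real_def)
    qed
  qed
  from this[of "Suc s"] have "peano (Suc s) w" by blast
  then show ?thesis using d(1) w0 w by blast
qed

section \<open>Rank-one operators and the spectral decomposition of \<open>L t\<close>\<close>

context complex_banach
begin

definition rank_one :: "('b \<Rightarrow>\<^sub>L complex) \<Rightarrow> 'b \<Rightarrow> ('b \<Rightarrow>\<^sub>L 'b)" where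
  "rank_one b u = Blinfun (\<lambda>x. cs (b x) u)"

lemma rank_one_apply [simp]: "blinfun_apply (rank_one b u) x = cs (b x) u"
  unfolding rank_one_def
  by (subst bounded_linear_Blinfun_apply)
     (auto intro!: bounded_linear_compose[OF cs.bounded_linear_left] blinfun.bounded_linear_right)

lemma bounded_bilinear_rank_one: "bounded_bilinear rank_one"
proof
  show "\<exists>K. \<forall>b u. norm (rank_one b u) \<le> norm b * norm u * K"
  proof (intro exI[of _ 1] allI norm_blinfun_bound)
    fix b u x
    show "norm (rank_one b u x) \<le> norm b * norm u * 1 * norm x"
      using mult_right_mono[OF norm_blinfun[of b x], of "norm u"] by (simp add: norm_cs mult_ac)
  qed auto
qed (auto intro!: blinfun_eqI simp: blinfun.add_left blinfun.scaleR_left cs.add_left cs.add_right cs.scaleR_left cs.scaleR_right)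

end

definition blinfun_cmul :: "complex \<Rightarrow> ('b::real_normed_vector \<Rightarrow>\<^sub>L complex) \<Rightarrow> ('b \<Rightarrow>\<^sub>L complex)" where
  "blinfun_cmul z b = blinfun_mult_right z o\<^sub>L b"

lemma blinfun_cmul_apply [simp]: "blinfun_apply (blinfun_cmul z b) x = z * b x"
  by (simp add: blinfun_cmul_def)

lemma norm_blinfun_cmul: "norm (blinfun_cmul z b) \<le> cmod z * norm b"
  by (rule norm_blinfun_bound) (auto simp: norm_mult mult.assoc intro!: mult_left_mono norm_blinfun)

lemma bounded_bilinear_cmul: "bounded_bilinear blinfun_cmul"
proof
  show "\<exists>K. \<forall>a b. norm (blinfun_cmul a b) \<le> norm a * norm b * K"
    by (intro exI[of _ 1]) (simp add: norm_blinfun_cmul)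
qed (auto intro!: blinfun_eqI simp: blinfun.add_left blinfun.scaleR_left algebra_simps)

text \<open>Telescoping as the sum of \<open>A^i (A - B) B^(n-1-i)\<close>: there are
  \<open>n\<close> terms of total power \<open>n - 1\<close>, hence the factor \<open>n\<close> and
  the division by \<open>\<theta>\<close>. The factor \<open>norm (A - B)\<close> later supplies the
  factor \<open>|t|\<close> in the remainder.\<close>

lemma op_pow_diff_bound:
  assumes A: "\<And>n. norm (op_pow A n) \<le> C * \<theta> ^ n" and B: "\<And>n. norm (op_pow B n) \<le> C * \<theta> ^ n"
    and pos: "0 \<le> C" "0 < \<theta>"
  shows "norm (op_pow A n - op_pow B n) \<le> (C\<^sup>2 / \<theta>) * norm (A - B) * real n * \<theta> ^ n"
proof -
  have eq: "op_pow A n - op_pow B n = (\<Sum>i<n. op_pow A i o\<^sub>L (A - B) o\<^sub>L op_pow B (n - 1 - i))"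
  proof (induction n)
    case (Suc n)
    have "op_pow A (Suc n) - op_pow B (Suc n) = (op_pow A n o\<^sub>L (A - B)) + ((op_pow A n - op_pow B n) o\<^sub>L B)"
      unfolding op_pow_Suc op_pow_commute[of A n] op_pow_commute[of B n] by (intro blinfun_eqI) (simp add: blinfun.diff_left blinfun.diff_right blinfun.add_left)
    also have "(op_pow A n - op_pow B n) o\<^sub>L B = (\<Sum>i<n. op_pow A i o\<^sub>L (A - B) o\<^sub>L op_pow B (n - i))"
      unfolding Suc
    proof -
      have "(\<Sum>i<n. op_pow A i o\<^sub>L (A - B) o\<^sub>L op_pow B (n - 1 - i)) o\<^sub>L B = (\<Sum>i<n. (op_pow A i o\<^sub>L (A - B) o\<^sub>L op_pow B (n - 1 - i)) o\<^sub>L B)"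
        by (rule bounded_bilinear.sum_left[OF bounded_bilinear_blinfun_compose])
      also have "\<dots> = (\<Sum>i<n. op_pow A i o\<^sub>L (A - B) o\<^sub>L op_pow B (n - i))"
      proof (rule sum.cong)
        fix i assume "i \<in> {..<n}"
        then have "n - i = Suc (n - 1 - i)" by auto
        then have "op_pow B (n - i) = op_pow B (n - 1 - i) o\<^sub>L B" by (simp only: op_pow_Suc op_pow_commute[of B "n - 1 - i"])
        then show "(op_pow A i o\<^sub>L (A - B) o\<^sub>L op_pow B (n - 1 - i)) o\<^sub>L B = op_pow A i o\<^sub>L (A - B) o\<^sub>L op_pow B (n - i)"
          by (intro blinfun_eqI) simp
      qed simp
      finally show "(\<Sum>i<n. op_pow A i o\<^sub>L (A - B) o\<^sub>L op_pow B (n - 1 - i)) o\<^sub>L B = (\<Sum>i<n. op_pow A i o\<^sub>L (A - B) o\<^sub>L op_pow B (n - i))" .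
    qed
    finally show ?case by (intro blinfun_eqI) (simp add: op_pow_0 blinfun.add_left add.commute)
  qed (simp add: op_pow_0)
  have "norm (op_pow A i o\<^sub>L (A - B) o\<^sub>L op_pow B (n - 1 - i)) \<le> (C\<^sup>2 / \<theta>) * norm (A - B) * \<theta> ^ n" if i: "i < n" for i
  proof -
    have "norm (op_pow A i o\<^sub>L (A - B) o\<^sub>L op_pow B (n - 1 - i)) \<le> norm (op_pow A i) * norm (A - B) * norm (op_pow B (n - 1 - i))"
      by (rule order_trans[OF norm_blinfun_compose mult_right_mono[OF norm_blinfun_compose norm_ge_zero]])
    also have "\<dots> \<le> (C * \<theta> ^ i) * norm (A - B) * (C * \<theta> ^ (n - 1 - i))"
      using pos by (intro mult_mono A B) auto
    also have "\<dots> = C\<^sup>2 * norm (A - B) * \<theta> ^ (n - 1)"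
    proof -
      have "\<theta> ^ i * \<theta> ^ (n - 1 - i) = \<theta> ^ (n - 1)" using i by (simp flip: power_add)
      then show ?thesis by (simp add: power2_eq_square mult_ac)
    qed
    also have "\<theta> ^ (n - 1) = \<theta> ^ n / \<theta>" using i pos by (cases n) auto
    finally show ?thesis by (simp add: mult_ac)
  qed
  then have "norm (op_pow A n - op_pow B n) \<le> (\<Sum>i<n. (C\<^sup>2 / \<theta>) * norm (A - B) * \<theta> ^ n)"
    unfolding eq by (intro sum_norm_le) auto
  then show ?thesis by (simp add: mult_ac)
qed

context complex_banach
begin

lemma clinear_functionalD: "clinear_functional cs l \<Longrightarrow> l (cs a x) = a * l x"
  unfolding clinear_functional_def by auto

text \<open>An eigenvector \<open>u t\<close> and an eigenfunctional \<open>b t\<close> are both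
  built as fixed points, with the same eigenvalue \<open>lam t\<close>. Subtracting the
  corresponding rank-one part leaves an operator that is continuous in \<open>t\<close> and equals
  \<open>Q\<close> at 0, so its powers still decay exponentially. The amplitude is
  \<open>Z t = b t v * l (u t) / b t (u t)\<close>.\<close>

theorem perturbed_powers:
  assumes Lclin: "\<And>t. clinear_op cs (L t)" and lclin: "clinear_functional cs l"
    and smooth: "peano (Suc s) L"
    and simple: "simple_eigenvalue cs (L 0) 1"
    and isolated: "isolated_in_spectrum cs (L 0) 1"
    and others: "\<And>mu. is_eigenvalue cs (L 0) mu \<Longrightarrow> mu \<noteq> 1 \<Longrightarrow> cmod mu < 1"
    and ess: "\<exists>\<rho><1. \<forall>mu\<in>essential_spectrum cs (L 0). cmod mu \<le> \<rho>"
  obtains lam Z :: "real \<Rightarrow> complex" and d C \<theta> :: real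
  where "peano (Suc s) lam" "peano (Suc s) Z" "lam 0 = 1" "d > 0" "C \<ge> 0" "0 < \<theta>" "\<theta> < 1"
    "\<And>t N. \<bar>t\<bar> < d \<Longrightarrow> N \<ge> 1 \<Longrightarrow> cmod (l (op_pow (L t) N v) - lam t ^ N * Z t) \<le> C * \<theta> ^ N"
    "\<And>t N. \<bar>t\<bar> < d \<Longrightarrow> N \<ge> 1 \<Longrightarrow>
      cmod ((l (op_pow (L t) N v) - lam t ^ N * Z t) - (l (op_pow (L 0) N v) - Z 0)) \<le> C * \<bar>t\<bar> * real N * \<theta> ^ N"
proof -
  obtain e a Q where a: "clinear_functional cs a" and Q: "clinear_op cs Q" and ae: "blinfun_apply a e = 1"
    and L0: "\<And>x. L 0 x = cs (a x) e + Q x" and Qe: "blinfun_apply Q e = 0" and aQ: "\<And>x. a (Q x) = 0"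
    and bijQ: "\<And>w. cmod w \<le> 1 \<Longrightarrow> bij (\<lambda>x. x - cs w (Q x))"
    by (rule spectral_gap[OF Lclin simple isolated others ess]) (auto intro: that)
  have Qlim: "(\<lambda>n. norm (op_pow Q n)) \<longlonglongrightarrow> 0" by (rule op_pow_tendsto_0[OF Q bijQ])
  have acs: "a (cs z x) = z * a x" for z x by (rule clinear_functionalD[OF a])
  define G where "G x = x - Q x" for x
  have Gbl: "bounded_linear G" unfolding G_def by (intro bounded_linear_sub bounded_linear_ident blinfun.bounded_linear_right)
  have Gbij: "bij G" using bijQ[of 1] by (simp add: G_def[abs_def])
  obtain c0 where c0: "c0 > 0" "\<And>x. c0 * norm x \<le> norm (G x)"
  proof -
    have "closed (range G)" by (simp only: bij_is_surj[OF Gbij] closed_UNIV)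
    then show ?thesis using inj_closed_range_bounded_below[OF Gbl _ bij_is_inj[OF Gbij]] that by blast
  qed
  have GR: "G (inv G x) = x" for x using surj_f_inv_f[OF bij_is_surj[OF Gbij], of x] .
  have RG: "inv G (G x) = x" for x using inv_f_f[OF bij_is_inj[OF Gbij], of x] .
  \<comment> \<open>\<open>Sop = (1 - Q)^(-1)\<close>, the substitute for the inverse of the
    singular operator \<open>1 - L 0\<close>. It fixes \<open>e\<close>, and \<open>a\<close> is
    invariant under it.\<close>
  define Sop where "Sop = Blinfun (inv G)"
  have Sapp: "blinfun_apply Sop = inv G"
    unfolding Sop_def
  proof (rule bounded_linear_Blinfun_apply)
    interpret G: bounded_linear G by fact
    show "bounded_linear (inv G)"
    proof
      show "inv G (x + y) = inv G x + inv G y" for x y by (metis GR G.add RG)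
      show "inv G (r *\<^sub>R x) = r *\<^sub>R inv G x" for r x by (metis GR G.scaleR RG)
      have "norm (inv G x) \<le> norm x * (1/c0)" for x
        using c0(2)[of "inv G x"] c0(1) GR[of x] by (simp add: field_simps)
      then show "\<exists>K. \<forall>x. norm (inv G x) \<le> norm x * K" by blast
    qed
  qed
  have QS: "Sop x - Q (Sop x) = x" for x using GR[of x] by (simp add: Sapp G_def)
  have SQ: "Sop (x - Q x) = x" for x using RG[of x] by (simp add: Sapp G_def)
  have Se: "Sop e = e" using SQ[of e] Qe by simp
  have Scs: "Sop (cs z x) = cs z (Sop x)" for z x
  proof -
    have "cs z (Sop x) - Q (cs z (Sop x)) = cs z x"
      using QS[of x] by (metis clinear_opD[OF Q] cs.diff_right)
    then show ?thesis by (metis SQ)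
  qed
  have aS: "a (Sop x) = a x" for x using QS[of x] aQ by (metis blinfun.diff_right diff_zero)
  obtain W where W: "\<And>t. L t = L 0 + t *\<^sub>R W t" "peano s W" using smooth by auto
  have Lx: "L t x = cs (a x) e + Q x + t *\<^sub>R W t x" for t x
    by (subst W(1)) (simp add: L0 blinfun.add_left blinfun.scaleR_left)
  obtain d1 where d1: "d1 > 0" "\<And>t. \<bar>t\<bar> < d1 \<Longrightarrow> norm (W t) \<le> norm (W 0) + 1"
    using isCont_bounded_near_0[OF peano_isCont[OF W(2)]] by blast
  define K where "K = norm (W 0) + 1"
  have K: "K > 0" by (simp add: K_def add_nonneg_pos)
  \<comment> \<open>With \<open>a u = 1\<close> and eigenvalue \<open>1 + t * \<mu>\<close>, where
    \<open>\<mu> = a (W t u)\<close>, the equation \<open>L t u = (1 + t * \<mu>) u\<close> reads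
    \<open>(1 - Q) u = e + t * (W t u - \<mu> u)\<close>. Applying \<open>Sop\<close>, which fixes
    \<open>e\<close>, gives the fixed point form \<open>u = e + t * \<Psi> t u\<close>.\<close>
  define \<Psi> where "\<Psi> t x = Sop (W t x - cs (a (W t x)) x)" for t x
  define E where "E = norm e + 1"
  have E: "E > 0" by (simp add: E_def add_nonneg_pos)
  have "\<exists>u d. d > 0 \<and> u 0 = e \<and> (\<forall>t. \<bar>t\<bar> < d \<longrightarrow> u t \<in> UNIV \<and> u t = e + t *\<^sub>R \<Psi> t (u t)) \<and> peano (Suc s) u"
  proof (rule peano_fixed_point)
    \<comment> \<open>The sum of a supremum bound and a Lipschitz bound for \<open>\<Psi>\<close> on
      the unit ball around \<open>e\<close>, so that one constant serves both; the final 1 makes it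
      positive.\<close>
    define M where "M = norm Sop * (K * E + norm a * K * E * E + K + 2 * norm a * K * E) + 1"
    show "M > 0" unfolding M_def using K E by (intro add_nonneg_pos mult_nonneg_nonneg add_nonneg_nonneg) auto
    show "d1 > 0" by fact
    fix t assume t: "\<bar>t\<bar> < d1"
    have Wn: "norm (W t x) \<le> K * norm x" for x
      using order_trans[OF norm_blinfun mult_right_mono[OF d1(2)[OF t] norm_ge_zero]] by (simp add: K_def)
    have aW: "cmod (a (W t x)) \<le> norm a * K * norm x" for x
      using order_trans[OF norm_blinfun mult_left_mono[OF Wn[of x] norm_ge_zero]] by (simp add: mult.assoc)
    have xE: "norm x \<le> E" if "x \<in> cball e 1" for x
      using that norm_triangle_sub[of x e] by (simp add: E_def dist_norm norm_minus_commute)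
    fix x assume x: "x \<in> cball e 1"
    have "norm (W t x - cs (a (W t x)) x) \<le> norm (W t x) + cmod (a (W t x)) * norm x"
      by (metis norm_cs norm_triangle_ineq4)
    also have "\<dots> \<le> K * E + (norm a * K * E) * E"
      using Wn[of x] aW[of x] xE[OF x] K E
      by (intro add_mono mult_mono order_trans[OF Wn] order_trans[OF aW] mult_left_mono) auto
    finally have 1: "norm (W t x - cs (a (W t x)) x) \<le> K * E + norm a * K * E * E" by simp
    have "norm (\<Psi> t x) \<le> norm Sop * (K * E + norm a * K * E * E)"
      unfolding \<Psi>_def by (rule order_trans[OF norm_blinfun mult_left_mono[OF 1 norm_ge_zero]])
    also have "\<dots> \<le> M" unfolding M_def using K E by (simp add: algebra_simps add_nonneg_nonneg)
    finally show "norm (\<Psi> t x) \<le> M" .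
    fix y assume y: "y \<in> cball e 1"
    have eq: "(W t x - cs (a (W t x)) x) - (W t y - cs (a (W t y)) y)
        = W t (x - y) - cs (a (W t (x - y))) x - cs (a (W t y)) (x - y)"
      by (simp add: blinfun.diff_right cs.diff_left cs.diff_right)
    have "norm \<dots> \<le> norm (W t (x - y)) + cmod (a (W t (x - y))) * norm x + cmod (a (W t y)) * norm (x - y)"
      by (metis (no_types, opaque_lifting) norm_cs norm_triangle_ineq4 order_trans add_right_mono)
    also have "\<dots> \<le> K * norm (x - y) + (norm a * K * norm (x - y)) * E + (norm a * K * E) * norm (x - y)"
      using xE[OF x] xE[OF y] K E
      by (intro add_mono mult_mono Wn aW order_trans[OF aW] mult_left_mono) auto
    also have "\<dots> = (K + 2 * norm a * K * E) * norm (x - y)" by (simp add: algebra_simps)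
    finally have 2: "norm ((W t x - cs (a (W t x)) x) - (W t y - cs (a (W t y)) y)) \<le> (K + 2 * norm a * K * E) * norm (x - y)"
      unfolding eq .
    have "norm (\<Psi> t x - \<Psi> t y) \<le> norm Sop * ((K + 2 * norm a * K * E) * norm (x - y))"
      unfolding \<Psi>_def blinfun.diff_right[symmetric]
      by (rule order_trans[OF norm_blinfun mult_left_mono[OF 2 norm_ge_zero]])
    also have "\<dots> \<le> M * norm (x - y)"
      unfolding mult.assoc[symmetric] M_def using K E by (intro mult_right_mono) (simp_all add: algebra_simps add_nonneg_nonneg)
    finally show "norm (\<Psi> t x - \<Psi> t y) \<le> M * norm (x - y)" .
  next
    fix m and w :: "real \<Rightarrow> 'b" assume m: "m \<le> s" "peano m w"
    have Wm: "peano m W" by (rule peano_le[OF m(1) W(2)])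
    have Ww: "peano m (\<lambda>t. W t (w t))" by (rule peano_bilinear[OF bounded_bilinear_blinfun_apply Wm m(2)])
    have "peano m (\<lambda>t. cs (a (W t (w t))) (w t))"
      by (rule peano_bilinear[OF cs.bounded_bilinear_axioms peano_linear[OF blinfun.bounded_linear_right Ww] m(2)])
    then show "peano m (\<lambda>t. \<Psi> t (w t))"
      unfolding \<Psi>_def by (intro peano_linear[OF blinfun.bounded_linear_right] peano_diff Ww)
  qed auto
  then obtain u d2 where d2: "d2 > 0" and u0: "u 0 = e"
    and ufix: "\<And>t. \<bar>t\<bar> < d2 \<Longrightarrow> u t = e + t *\<^sub>R \<Psi> t (u t)" and pu: "peano (Suc s) u" by blast
  have pu': "peano s u" by (rule peano_Suc_D[OF pu])
  define \<mu> where "\<mu> t = a (W t (u t))" for t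
  have pmu: "peano s \<mu>" unfolding \<mu>_def
    by (intro peano_linear[OF blinfun.bounded_linear_right] peano_bilinear[OF bounded_bilinear_blinfun_apply] W(2) pu')
  define lam where "lam t = 1 + t *\<^sub>R \<mu> t" for t
  have plam: "peano (Suc s) lam" by (rule peano_SucI[OF pmu]) (simp add: lam_def)
  obtain d3 where d3: "d3 > 0" "\<And>t. \<bar>t\<bar> < d3 \<Longrightarrow> cmod (\<mu> t) \<le> cmod (\<mu> 0) + 1"
    using isCont_bounded_near_0[OF peano_isCont[OF pmu]] by blast
  define K' where "K' = cmod (\<mu> 0) + 1"
  have K': "K' > 0" by (simp add: K'_def add_nonneg_pos)
  define d4 where "d4 = min (min d1 d2) (min d3 (1 / (2 * K')))"
  have d4: "d4 > 0" "d4 \<le> d1" "d4 \<le> d2" "d4 \<le> d3" "d4 \<le> 1 / (2 * K')" using d1 d2 d3 K' by (auto simp: d4_def)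
  have u1: "u t - Q (u t) = e + t *\<^sub>R W t (u t) - cs (t *\<^sub>R \<mu> t) (u t)"
    and au: "a (u t) = 1" if t: "\<bar>t\<bar> < d4" for t
  proof -
    have "u t = Sop (e + t *\<^sub>R (W t (u t) - cs (\<mu> t) (u t)))"
      using ufix[of t] t d4 by (simp add: \<Psi>_def \<mu>_def blinfun.add_right blinfun.scaleR_right Se)
    then show eq: "u t - Q (u t) = e + t *\<^sub>R W t (u t) - cs (t *\<^sub>R \<mu> t) (u t)"
      using QS by (metis (no_types, lifting) add_diff_eq cs.scaleR_left scaleR_diff_right)
    have "a (u t) = a (u t - Q (u t))" by (simp add: blinfun.diff_right aQ)
    also have "\<dots> = 1 + t *\<^sub>R \<mu> t - t *\<^sub>R \<mu> t * a (u t)"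
      unfolding eq by (simp add: blinfun.diff_right blinfun.add_right blinfun.scaleR_right ae acs \<mu>_def)
    \<comment> \<open>The normalisation \<open>a (u t) = 1\<close> was used to derive the fixed
      point equation and has to be recovered from it. It follows because the other factor, the
      eigenvalue, is nonzero for \<open>\<bar>t\<bar> < d4\<close>.\<close>
    finally have z: "(a (u t) - 1) * (1 + t *\<^sub>R \<mu> t) = 0" by (simp add: algebra_simps)
    have "cmod (t *\<^sub>R \<mu> t) \<le> \<bar>t\<bar> * K'" using d3(2)[of t] t d4 by (simp add: K'_def mult_left_mono)
    also have "\<dots> \<le> (1 / (2 * K')) * K'" using t d4 K' by (intro mult_right_mono) auto
    also have "\<dots> < 1" using K' by simp
    finally have "1 + t *\<^sub>R \<mu> t \<noteq> 0" by (metis add_eq_0_iff norm_minus_cancel norm_one order_less_irrefl)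
    then show "a (u t) = 1" using z by simp
  qed
  have Lu: "L t (u t) = cs (lam t) (u t)" if t: "\<bar>t\<bar> < d4" for t
    using u1[OF t] au[OF t] by (simp add: Lx lam_def cs.add_left algebra_simps)
  \<comment> \<open>The dual equation. If \<open>b e = 1\<close>, then
    \<open>b (L t x) = (1 + t * \<mu> t) * b x\<close> means
    \<open>b (x - Q x) = a x + t * (b (W t x) - \<mu> t * b x)\<close>. Substituting
    \<open>Sop x\<close> for \<open>x\<close> and using \<open>a (Sop x) = a x\<close> gives
    \<open>b = a + t * \<Phi> t b\<close>. The eigenvalue is prescribed by \<open>u t\<close>, so
    this equation is linear in \<open>b\<close>.\<close>
  define \<Phi> where "\<Phi> t b = (b o\<^sub>L W t o\<^sub>L Sop) - blinfun_cmul (\<mu> t) (b o\<^sub>L Sop)" for t b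
  have "\<exists>b d. d > 0 \<and> b 0 = a \<and> (\<forall>t. \<bar>t\<bar> < d \<longrightarrow> b t \<in> {b. clinear_functional cs b} \<and> b t = a + t *\<^sub>R \<Phi> t (b t)) \<and> peano (Suc s) b"
  proof (rule peano_fixed_point)
    define M where "M = (norm a + 1) * ((K + K') * norm Sop) + 1"
    show "M > 0" unfolding M_def using K K' by (intro add_nonneg_pos mult_nonneg_nonneg) auto
    have "{b. clinear_functional cs b} = (\<Inter>z x. {b :: 'b \<Rightarrow>\<^sub>L complex. b (cs z x) = z * b x})"
      by (auto simp: clinear_functional_def)
    also have "closed \<dots>" by (intro closed_INT ballI closed_Collect_eq continuous_intros)
    finally show "closed {b. clinear_functional cs b}" .
    show "a \<in> {b. clinear_functional cs b}" using a by simp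
    show "d4 > 0" by fact
    fix t assume t: "\<bar>t\<bar> < d4"
    have Phi_bound: "norm (\<Phi> t b) \<le> norm b * ((K + K') * norm Sop)" for b
    proof -
      have "norm (b o\<^sub>L W t o\<^sub>L Sop) \<le> norm b * K * norm Sop"
        using d1(2)[of t] t d4 by (intro order_trans[OF norm_blinfun_compose] mult_right_mono mult_left_mono)
          (auto simp: K_def)
      moreover have "norm (blinfun_cmul (\<mu> t) (b o\<^sub>L Sop)) \<le> K' * (norm b * norm Sop)"
        using d3(2)[of t] t d4 by (intro order_trans[OF norm_blinfun_cmul] mult_mono norm_blinfun_compose) (auto simp: K'_def)
      ultimately show ?thesis unfolding \<Phi>_def
        using norm_triangle_ineq4[of "b o\<^sub>L W t o\<^sub>L Sop" "blinfun_cmul (\<mu> t) (b o\<^sub>L Sop)"] by (simp add: algebra_simps)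
    qed
    fix b
    { assume b: "b \<in> cball a 1"
      have nb: "norm b \<le> norm a + 1"
        using b norm_triangle_sub[of b a] by (simp add: dist_norm norm_minus_commute)
      have "norm (\<Phi> t b) \<le> (norm a + 1) * ((K + K') * norm Sop)"
        using nb K K' by (intro order_trans[OF Phi_bound] mult_right_mono) auto
      also have "\<dots> \<le> M" by (simp add: M_def)
      finally show "norm (\<Phi> t b) \<le> M" . }
    { fix b'
      have "\<Phi> t b - \<Phi> t b' = \<Phi> t (b - b')"
        unfolding \<Phi>_def
        by (intro blinfun_eqI, simp only: blinfun.diff_left blinfun_apply_blinfun_compose blinfun_cmul_apply)
          (simp add: algebra_simps)
      then have "norm (\<Phi> t b - \<Phi> t b') \<le> 1 * ((K + K') * norm Sop) * norm (b - b')"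
        using Phi_bound[of "b - b'"] by (simp add: mult_ac)
      also have "\<dots> \<le> M * norm (b - b')"
      proof (rule mult_right_mono)
        have "1 * ((K + K') * norm Sop) \<le> (norm a + 1) * ((K + K') * norm Sop)"
          using K K' by (intro mult_right_mono) auto
        then show "1 * ((K + K') * norm Sop) \<le> M" by (simp add: M_def)
      qed simp
      finally show "norm (\<Phi> t b - \<Phi> t b') \<le> M * norm (b - b')" . }
    assume "b \<in> {b. clinear_functional cs b}"
    then have bcs: "b (cs z x) = z * b x" for z x by (simp add: clinear_functional_def)
    have "(a + t *\<^sub>R \<Phi> t b) (cs z x) = z * (a + t *\<^sub>R \<Phi> t b) x" for z x
    \<comment> \<open>Complex linearity of \<open>W t\<close> is read off from the difference
      \<open>L t - L 0\<close>, which is possible for \<open>t \<noteq> 0\<close>; at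
      \<open>t = 0\<close> the term with \<open>W\<close> is multiplied by 0.\<close>
    proof (cases "t = 0")
      case True then show ?thesis by (simp add: blinfun.add_left acs)
    next
      case False
      have tW: "t *\<^sub>R W t y = L t y - L 0 y" for y using Lx[of t y] Lx[of 0 y] by simp
      have "t *\<^sub>R W t (cs z y) = cs z (t *\<^sub>R W t y)" for y
        unfolding tW by (simp add: clinear_opD[OF Lclin] cs.diff_right)
      then have "W t (cs z y) = cs z (W t y)" for y using False by (simp add: cs.scaleR_right)
      then show ?thesis by (simp add: \<Phi>_def blinfun.add_left blinfun.diff_left blinfun.scaleR_left acs bcs Scs algebra_simps)
    qed
    then show "a + t *\<^sub>R \<Phi> t b \<in> {b. clinear_functional cs b}" by (simp add: clinear_functional_def)
  next
    fix m and w :: "real \<Rightarrow> 'b \<Rightarrow>\<^sub>L complex" assume m: "m \<le> s" "peano m w"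
    have Wm: "peano m W" "peano m \<mu>" using peano_le[OF m(1)] W(2) pmu by auto
    show "peano m (\<lambda>t. \<Phi> t (w t))"
      unfolding \<Phi>_def
      by (intro peano_diff peano_bilinear[OF bounded_bilinear_blinfun_compose] peano_bilinear[OF bounded_bilinear_cmul]
          Wm m(2) peano_const)
  qed
  then obtain b d5 where d5: "d5 > 0" and b0: "b 0 = a" and bcl: "\<And>t. \<bar>t\<bar> < d5 \<Longrightarrow> clinear_functional cs (b t)"
    and bfix: "\<And>t. \<bar>t\<bar> < d5 \<Longrightarrow> b t = a + t *\<^sub>R \<Phi> t (b t)" and pb: "peano (Suc s) b" by blast
  define bu where "bu t = b t (u t)" for t
  have pbu: "peano (Suc s) bu" unfolding bu_def by (rule peano_bilinear[OF bounded_bilinear_blinfun_apply pb pu])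
  have bu0: "bu 0 = 1" by (simp add: bu_def b0 u0 ae)
  obtain d6 where d6: "d6 > 0" "\<And>t. \<bar>t\<bar> < d6 \<Longrightarrow> bu t \<noteq> 0"
  proof -
    obtain d where d: "d > 0" "\<And>t. dist t 0 < d \<Longrightarrow> dist (bu t) (bu 0) < 1"
      using peano_isCont[OF pbu] unfolding continuous_at_eps_delta by (metis zero_less_one)
    have "bu t \<noteq> 0" if "\<bar>t\<bar> < d" for t
      using d(2)[of t] that unfolding bu0 by (auto simp: dist_norm)
    then show ?thesis using that d(1) by blast
  qed
  define d7 where "d7 = min d4 (min d5 d6)"
  have d7: "d7 > 0" "d7 \<le> d4" "d7 \<le> d5" "d7 \<le> d6" using d4 d5 d6 by (auto simp: d7_def)
  have bL: "b t (L t x) = lam t * b t x" if t: "\<bar>t\<bar> < d7" for t x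
  proof -
    have t4: "\<bar>t\<bar> < d4" "\<bar>t\<bar> < d5" "\<bar>t\<bar> < d6" using t d7 by auto
    have eq: "b t (x - Q x) = a x + b t (t *\<^sub>R W t x) - t *\<^sub>R \<mu> t * b t x" for x
    proof -
      have "b t (x - Q x) = (a + t *\<^sub>R \<Phi> t (b t)) (x - Q x)" using bfix[OF t4(2)] by simp
      also have "\<dots> = a x + b t (t *\<^sub>R W t x) - t *\<^sub>R \<mu> t * b t x"
        by (simp add: \<Phi>_def blinfun.add_left blinfun.diff_left blinfun.scaleR_left blinfun.scaleR_right SQ aQ blinfun.diff_right[of a] algebra_simps)
      finally show ?thesis .
    qed
    have bLx: "b t (L t x) = (b t e - 1) * a x + lam t * b t x" for x
      using eq[of x] clinear_functionalD[OF bcl[OF t4(2)]]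
      by (simp add: Lx blinfun.add_right blinfun.diff_right lam_def algebra_simps)
    \<comment> \<open>The fixed point equation makes \<open>b t\<close> an eigenfunctional up to the
      defect \<open>(b t e - 1) * a x\<close>. Evaluating at the eigenvector \<open>u t\<close>,
      where \<open>a (u t) = 1\<close>, shows that the defect vanishes.\<close>
    have "lam t * bu t = b t (L t (u t))" unfolding bu_def Lu[OF t4(1)] by (rule clinear_functionalD[OF bcl[OF t4(2)], symmetric])
    also have "\<dots> = (b t e - 1) + lam t * bu t" unfolding bLx au[OF t4(1)] bu_def by simp
    finally have "b t e = 1" by simp
    then show ?thesis by (simp add: bLx)
  qed
  have inv_hol: "inverse holomorphic_on - {0 :: complex}" by (intro holomorphic_intros) auto
  have pinv: "peano (Suc s) (\<lambda>t. inverse (bu t))"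
    by (rule peano_holomorphic[OF inv_hol _ _ pbu]) (use bu0 in auto)
  define Z where "Z t = b t v * l (u t) * inverse (bu t)" for t
  have pZ: "peano (Suc s) Z"
    unfolding Z_def
    by (intro peano_bilinear[OF bounded_bilinear_mult] pinv peano_linear[OF blinfun.bounded_linear_right pu]
        peano_bilinear[OF bounded_bilinear_blinfun_apply pb] peano_const)
  \<comment> \<open>Dividing by \<open>bu t = b t (u t)\<close> normalises the pairing, so that what
    is subtracted is \<open>lam t\<close> times the projection onto the line of \<open>u t\<close>
    along the kernel of \<open>b t\<close>.\<close>
  define Qt where "Qt t = L t - rank_one (blinfun_cmul (lam t * inverse (bu t)) (b t)) (u t)" for t
  have pQt: "peano (Suc s) Qt"
    unfolding Qt_def
    by (intro peano_diff smooth peano_bilinear[OF bounded_bilinear_rank_one] peano_bilinear[OF bounded_bilinear_cmul]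
        peano_bilinear[OF bounded_bilinear_mult] pinv pb pu plam)
  have Qt0: "Qt 0 = Q"
    by (rule blinfun_eqI) (simp add: Qt_def blinfun.diff_left L0 bu0 b0 u0 lam_def)
  obtain d8 C \<theta> where d8: "d8 > 0" "C \<ge> 0" "0 < \<theta>" "\<theta> < 1"
    and dec: "\<And>t n. \<bar>t\<bar> < d8 \<Longrightarrow> norm (op_pow (Qt t) n) \<le> C * \<theta> ^ n"
    using op_pow_local_decay[where T = Qt and ?t0.0 = 0] peano_isCont[OF pQt] Qlim Qt0 by auto
  obtain Gt where Gt: "\<And>t. Qt t = Qt 0 + t *\<^sub>R Gt t" "peano s Gt" using pQt by auto
  obtain d9 where d9: "d9 > 0" "\<And>t. \<bar>t\<bar> < d9 \<Longrightarrow> norm (Gt t) \<le> norm (Gt 0) + 1"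
    using isCont_bounded_near_0[OF peano_isCont[OF Gt(2)]] by blast
  define d where "d = min d7 (min d8 d9)"
  have d: "d > 0" "d \<le> d7" "d \<le> d8" "d \<le> d9" using d7 d8 d9 by (auto simp: d_def)
  \<comment> \<open>\<open>b t\<close> vanishes on the range of \<open>Qt t\<close>, so
    \<open>L t\<close> and \<open>Qt t\<close> agree there and the two parts do not mix. For
    \<open>N = 0\<close> the right-hand side would exceed \<open>v\<close> by the spectral part,
    hence \<open>N \<ge> 1\<close>.\<close>
  have pow: "op_pow (L t) N v = cs (lam t ^ N * b t v * inverse (bu t)) (u t) + op_pow (Qt t) N v" if t: "\<bar>t\<bar> < d" and N: "N \<ge> 1" for t N
  proof -
    have t7: "\<bar>t\<bar> < d7" "\<bar>t\<bar> < d4" "\<bar>t\<bar> < d5" "\<bar>t\<bar> < d6" using t d d7 by auto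
    have Qtx: "Qt t x = L t x - cs (lam t * inverse (bu t) * b t x) (u t)" for x by (simp add: Qt_def blinfun.diff_left)
    have bQ: "b t (Qt t x) = 0" for x
      using clinear_functionalD[OF bcl[OF t7(3)]] bL[OF t7(1)] d6(2)[OF t7(4)]
      by (simp add: Qtx blinfun.diff_right bu_def[symmetric])
    show ?thesis
      using N
    proof (induction N rule: dec_induct)
      case base
      show ?case by (simp add: op_pow_Suc op_pow_0 Qtx mult_ac)
    next
      case (step N)
      obtain M where M: "N = Suc M" using step(1) by (cases N) auto
      have "b t (op_pow (Qt t) N v) = 0" unfolding M op_pow_Suc by (simp add: bQ)
      then have "L t (op_pow (Qt t) N v) = Qt t (op_pow (Qt t) N v)" by (simp add: Qtx)
      then show ?case
        using step.IH by (simp add: op_pow_Suc blinfun.add_right clinear_opD[OF Lclin] Lu[OF t7(2)] mult_ac flip: cs_mult)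
    qed
  qed
  have rem: "l (op_pow (L t) N v) - lam t ^ N * Z t = l (op_pow (Qt t) N v)" if "\<bar>t\<bar> < d" "N \<ge> 1" for t N
    unfolding pow[OF that] by (simp add: blinfun.add_right clinear_functionalD[OF lclin] Z_def)
  define C' where "C' = norm l * norm v * (C + C\<^sup>2 / \<theta> * (norm (Gt 0) + 1))"
  have b1: "cmod (l (op_pow (L t) N v) - lam t ^ N * Z t) \<le> C' * \<theta> ^ N" if t: "\<bar>t\<bar> < d" and N: "N \<ge> 1" for t N
  proof -
    have "cmod (l (op_pow (Qt t) N v)) \<le> norm l * (norm (op_pow (Qt t) N) * norm v)"
      by (intro order_trans[OF norm_blinfun] mult_left_mono norm_blinfun) auto
    also have "\<dots> \<le> norm l * ((C * \<theta> ^ N) * norm v)"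
      using dec[of t N] t d by (intro mult_left_mono mult_right_mono) auto
    also have "\<dots> = norm l * norm v * C * \<theta> ^ N" by simp
    also have "\<dots> \<le> C' * \<theta> ^ N"
      unfolding C'_def using d8 by (intro mult_right_mono mult_left_mono) auto
    finally show ?thesis unfolding rem[OF t N] .
  qed
  have b2: "cmod ((l (op_pow (L t) N v) - lam t ^ N * Z t) - (l (op_pow (L 0) N v) - Z 0)) \<le> C' * \<bar>t\<bar> * real N * \<theta> ^ N"
    if t: "\<bar>t\<bar> < d" and N: "N \<ge> 1" for t N
  proof -
    have r0: "l (op_pow (L 0) N v) - Z 0 = l (op_pow (Qt 0) N v)" using rem[of 0 N] d N by (simp add: lam_def)
    have "cmod (l (op_pow (Qt t) N v) - l (op_pow (Qt 0) N v)) \<le> norm l * (norm (op_pow (Qt t) N - op_pow (Qt 0) N) * norm v)"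
      unfolding blinfun.diff_right[symmetric] blinfun.diff_left[symmetric]
      by (intro order_trans[OF norm_blinfun] mult_left_mono norm_blinfun) auto
    also have "\<dots> \<le> norm l * ((C\<^sup>2 / \<theta> * (\<bar>t\<bar> * (norm (Gt 0) + 1)) * real N * \<theta> ^ N) * norm v)"
    proof (intro mult_left_mono mult_right_mono)
      have "Qt t - Qt 0 = t *\<^sub>R Gt t" using Gt(1)[of t] by (metis add_diff_cancel_left')
      then have q: "norm (Qt t - Qt 0) \<le> \<bar>t\<bar> * (norm (Gt 0) + 1)" using d9(2)[of t] t d by (simp add: mult_left_mono)
      have "norm (op_pow (Qt t) N - op_pow (Qt 0) N) \<le> (C\<^sup>2 / \<theta>) * norm (Qt t - Qt 0) * real N * \<theta> ^ N"
        using d8 t d dec[of t] dec[of 0] by (intro op_pow_diff_bound) auto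
      also have "\<dots> \<le> C\<^sup>2 / \<theta> * (\<bar>t\<bar> * (norm (Gt 0) + 1)) * real N * \<theta> ^ N"
        using d8 by (intro mult_right_mono mult_left_mono q) auto
      finally show "norm (op_pow (Qt t) N - op_pow (Qt 0) N) \<le> C\<^sup>2 / \<theta> * (\<bar>t\<bar> * (norm (Gt 0) + 1)) * real N * \<theta> ^ N" .
    qed auto
    also have "\<dots> = (norm l * norm v * (C\<^sup>2 / \<theta> * (norm (Gt 0) + 1))) * (\<bar>t\<bar> * real N * \<theta> ^ N)" by (simp add: mult_ac)
    also have "\<dots> \<le> C' * (\<bar>t\<bar> * real N * \<theta> ^ N)"
      unfolding C'_def using d8 by (intro mult_right_mono mult_left_mono) auto
    finally show ?thesis unfolding rem[OF t N] r0 by (simp add: mult.assoc)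
  qed
  have "C' \<ge> 0" unfolding C'_def using d8 by auto
  moreover have "lam 0 = 1" by (simp add: lam_def)
  ultimately show ?thesis using that[of lam Z d C' \<theta>] plam pZ d(1) d8(3,4) b1 b2 by blast
qed

end

section \<open>Fourier inversion for averaged distribution functions\<close>

lemma (in pair_sigma_finite) integrable_dominated_by_product:
  fixes f :: "'a \<Rightarrow> 'b \<Rightarrow> complex" and g :: "'a \<Rightarrow> real" and h :: "'b \<Rightarrow> real"
  assumes f: "case_prod f \<in> borel_measurable (M1 \<Otimes>\<^sub>M M2)"
    and g: "integrable M1 g" and h: "integrable M2 h"
    and bd: "\<And>x y. x \<in> space M1 \<Longrightarrow> y \<in> space M2 \<Longrightarrow> norm (f x y) \<le> g x * h y"
  shows "integrable (M1 \<Otimes>\<^sub>M M2) (case_prod f)"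
proof (rule Bochner_Integration.integrable_bound[OF _ f])
  have [measurable]: "g \<in> borel_measurable M1" "h \<in> borel_measurable M2" using g h by auto
  show "integrable (M1 \<Otimes>\<^sub>M M2) (\<lambda>p. g (fst p) * h (snd p))"
  proof (rule Fubini_integrable)
    show "integrable M1 (\<lambda>x. LINT y|M2. norm (g (fst (x, y)) * h (snd (x, y))))"
      using g by (simp add: abs_mult)
  qed (use h in auto)
  show "AE p in M1 \<Otimes>\<^sub>M M2. norm (case_prod f p) \<le> norm (g (fst p) * h (snd p))"
    by (rule AE_I2) (use bd in \<open>force simp: space_pair_measure intro: order_trans[OF _ abs_ge_self]\<close>)
qed

lemma (in pair_sigma_finite) Fubini_dominated:
  fixes f :: "'a \<Rightarrow> 'b \<Rightarrow> complex" and g :: "'a \<Rightarrow> real" and h :: "'b \<Rightarrow> real"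
  assumes f: "case_prod f \<in> borel_measurable (M1 \<Otimes>\<^sub>M M2)"
    and g: "integrable M1 g" and h: "integrable M2 h"
    and bd: "\<And>x y. x \<in> space M1 \<Longrightarrow> y \<in> space M2 \<Longrightarrow> norm (f x y) \<le> g x * h y"
  shows "(LINT x|M1. LINT y|M2. f x y) = (LINT y|M2. LINT x|M1. f x y)"
  using Fubini_integral[OF integrable_dominated_by_product[OF assms]] by simp

lemma gauss_ft:
  assumes s: "s > 0"
  shows "(LINT x|lborel. iexp (t * x) * complex_of_real (normal_density 0 s x)) = complex_of_real (exp (- (s * t)\<^sup>2 / 2))"
proof -
  have "(LINT x|lborel. iexp (t * x) * complex_of_real (normal_density 0 s x))
      = \<bar>s\<bar> *\<^sub>R (LINT x|lborel. iexp (t * (0 + s * x)) * complex_of_real (normal_density 0 s (0 + s * x)))"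
    by (rule lborel_integral_real_affine) (use s in auto)
  also have "\<dots> = (LINT x|lborel. std_normal_density x *\<^sub>R iexp ((s * t) * x))"
    unfolding integral_scaleR_right[symmetric]
  proof (rule Bochner_Integration.integral_cong[OF refl])
    fix x
    have "s * normal_density 0 s (s * x) = std_normal_density x"
      using s by (simp add: normal_density_def real_sqrt_mult field_simps power_mult_distrib)
    then have "complex_of_real s * complex_of_real (normal_density 0 s (s * x)) = complex_of_real (std_normal_density x)"
      by (metis of_real_mult)
    then show "\<bar>s\<bar> *\<^sub>R (iexp (t * (0 + s * x)) * complex_of_real (normal_density 0 s (0 + s * x))) =
        std_normal_density x *\<^sub>R iexp ((s * t) * x)"
      using s by (simp add: scaleR_conv_of_real mult_ac)
  qed
  also have "\<dots> = char std_normal_distribution (s * t)"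
    unfolding char_def by (subst integral_density) auto
  finally show ?thesis by (simp add: char_std_normal_distribution)
qed

lemma gauss_eq_normal_density:
  assumes s: "s > 0"
  shows "exp (- (s * t)\<^sup>2 / 2) = sqrt (2 * pi) / s * normal_density 0 (1 / s) t"
proof -
  have 1: "sqrt (2 * pi / s\<^sup>2) = sqrt (2 * pi) / s" using s by (simp add: real_sqrt_divide)
  have 2: "- (t\<^sup>2 * s\<^sup>2) / 2 = - (s * t)\<^sup>2 / 2" by (simp add: power_mult_distrib mult.commute)
  have "normal_density 0 (1 / s) t = 1 / sqrt (2 * pi / s\<^sup>2) * exp (- (t\<^sup>2 * s\<^sup>2) / 2)"
    unfolding normal_density_def by (simp add: power_divide)
  then show ?thesis unfolding 1 2 using s by simp
qed

lemma integrable_gauss [intro]: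
  fixes s :: real
  assumes "s > 0" shows "integrable lborel (\<lambda>t. exp (- (s * t)\<^sup>2 / 2))"
  unfolding gauss_eq_normal_density[OF assms] using assms by (intro integrable_mult_right integrable_normal_density) simp

text \<open>The transform of a Gaussian is again a Gaussian, so inversion is an explicit computation
  here. The inversion formulas below rest on this case.\<close>

lemma gauss_inversion:
  assumes s: "s > 0"
  shows "complex_of_real (normal_density 0 s v) = (LINT t|lborel. iexp (- (t * v)) * complex_of_real (exp (- (s * t)\<^sup>2 / 2))) / (2 * pi)"
proof -
  have "(LINT t|lborel. iexp (- (t * v)) * complex_of_real (exp (- (s * t)\<^sup>2 / 2)))
     = (LINT t|lborel. complex_of_real (sqrt (2 * pi) / s) * (iexp ((- v) * t) * complex_of_real (normal_density 0 (1 / s) t)))"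
    unfolding gauss_eq_normal_density[OF s] by (intro Bochner_Integration.integral_cong refl) (simp add: mult_ac)
  also have "\<dots> = complex_of_real (sqrt (2 * pi) / s) * complex_of_real (exp (- ((1 / s) * (- v))\<^sup>2 / 2))"
    unfolding integral_mult_right_zero using s by (subst gauss_ft) auto
  also have "\<dots> = complex_of_real (2 * pi * normal_density 0 s v)"
  proof -
    have "sqrt (2 * pi) / s * exp (- ((1 / s) * (- v))\<^sup>2 / 2) = 2 * pi * normal_density 0 s v"
    proof -
      have "normal_density 0 s v = 1 / (sqrt (2 * pi) * s) * exp (- ((1 / s) * (- v))\<^sup>2 / 2)"
        using s by (simp add: normal_density_def real_sqrt_mult power_divide)
      moreover have "2 * pi * (1 / (sqrt (2 * pi) * s)) = sqrt (2 * pi) / s"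
      proof -
        have "2 * pi = sqrt (2 * pi) * sqrt (2 * pi)" by simp
        then show ?thesis using s by (simp add: field_simps)
      qed
      ultimately show ?thesis by (metis mult.assoc)
    qed
    then show ?thesis by (metis of_real_mult)
  qed
  finally show ?thesis by simp
qed

text \<open>Multiplied out instead of divided by \<open>-it\<close>, so that the identity includes
  \<open>t = 0\<close>, where both sides vanish.\<close>

lemma iexp_window:
  assumes "a < b"
  shows "(LINT u|lborel. indicator {a<..b} u *\<^sub>R iexp (- (t * u))) * (- (\<i> * t)) = iexp (- (t * b)) - iexp (- (t * a))"
proof -
  have "(LINT u|lborel. indicator {a..b} u *\<^sub>R ((- (\<i> * t)) * iexp (- (t * u)))) = iexp (- (t * b)) - iexp (- (t * a))"
  proof (rule integral_FTC_Icc)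
    fix x
    show "((\<lambda>u. iexp (- (t * u))) has_vector_derivative (- (\<i> * t)) * iexp (- (t * x))) (at x within {a..b})"
    proof -
      have "((\<lambda>u. iexp (- (t * u))) has_vector_derivative (- t) *\<^sub>R (\<i> * iexp (- (t * x)))) (at x within {a..b})"
        by (rule vector_diff_chain_within[of "\<lambda>u. - (t * u)" "- t" x "{a..b}" iexp, unfolded o_def])
           (auto intro!: derivative_eq_intros simp: has_vector_derivative_at_within)
      then show ?thesis by (simp add: scaleR_conv_of_real mult_ac)
    qed
  qed (use assms in \<open>auto intro!: continuous_intros\<close>)
  also have "(LINT u|lborel. indicator {a..b} u *\<^sub>R ((- (\<i> * t)) * iexp (- (t * u)))) =
     (LINT u|lborel. (indicator {a<..b} u *\<^sub>R iexp (- (t * u))) * (- (\<i> * t)))"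
  proof (rule integral_cong_AE)
    have "AE u in lborel. u \<noteq> a" by (rule AE_lborel_singleton)
    then show "AE u in lborel. indicator {a..b} u *\<^sub>R ((- (\<i> * t)) * iexp (- (t * u))) = (indicator {a<..b} u *\<^sub>R iexp (- (t * u))) * (- (\<i> * t))"
      by eventually_elim (auto split: split_indicator)
  qed measurable
  also have "\<dots> = (LINT u|lborel. indicator {a<..b} u *\<^sub>R iexp (- (t * u))) * (- (\<i> * t))"
    by (rule integral_mult_left_zero)
  finally show ?thesis .
qed

lemma norm_iexp_window:
  assumes "a < b"
  shows "cmod (LINT u|lborel. indicator {a<..b} u *\<^sub>R iexp (- (t * u))) \<le> b - a"
proof -
  have "cmod (LINT u|lborel. indicator {a<..b} u *\<^sub>R iexp (- (t * u))) \<le> (LINT u|lborel. cmod (indicator {a<..b} u *\<^sub>R iexp (- (t * u))))"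
    by (rule integral_norm_bound)
  also have "\<dots> = (LINT u|lborel. indicator {a<..b} u)"
    by (intro Bochner_Integration.integral_cong refl) (auto split: split_indicator)
  also have "\<dots> = b - a" using assms by simp
  finally show ?thesis .
qed

text \<open>Inversion for the law convolved with a Gaussian: the increment is the mean of a window
  indicator, into which \<open>gauss_inversion\<close> is inserted. Increments are used because the
  transform of a window is bounded by \<open>b - a\<close>, so that a single law can be treated
  without dividing by \<open>t\<close>.\<close>

lemma smoothed_cdf_increment:
  assumes M: "real_distribution M" and s: "s > 0" and ab: "a < b"
  shows "complex_of_real (LINT w|lborel. std_normal_density w * (cdf M (b + s * w) - cdf M (a + s * w)))
    = (LINT t|lborel. char M t * complex_of_real (exp (- (s * t)\<^sup>2 / 2)) * (LINT u|lborel. indicator {a<..b} u *\<^sub>R iexp (- (t * u)))) / (2 * pi)"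
proof -
  interpret M: real_distribution M by fact
  interpret P1: pair_sigma_finite lborel M ..
  interpret P2: pair_sigma_finite M lborel ..
  let ?E = "\<lambda>t. complex_of_real (exp (- (s * t)\<^sup>2 / 2))"
  define A where "A t = (LINT u|lborel. indicator {a<..b} u *\<^sub>R iexp (- (t * u)))" for t
  have A_meas [measurable]: "A \<in> borel_measurable borel"
    unfolding A_def by measurable
  have E_int: "integrable lborel (\<lambda>t. exp (- (s * t)\<^sup>2 / 2))" by (rule integrable_gauss[OF s])
  have "complex_of_real (LINT w|lborel. std_normal_density w * (cdf M (b + s * w) - cdf M (a + s * w)))
     = (LINT w|lborel. complex_of_real (std_normal_density w * (cdf M (b + s * w) - cdf M (a + s * w))))"
    by (rule integral_complex_of_real[symmetric])
  also have "\<dots> = (LINT w|lborel. LINT y|M. complex_of_real (std_normal_density w * indicator {a + s * w<..b + s * w} y))"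
  proof (rule Bochner_Integration.integral_cong[OF refl])
    fix w
    have "cdf M (b + s * w) - cdf M (a + s * w) = measure M {a + s * w<..b + s * w}"
      by (rule M.cdf_diff_eq) (use ab in auto)
    also have "\<dots> = (LINT y|M. indicator {a + s * w<..b + s * w} y)" by simp
    finally show "complex_of_real (std_normal_density w * (cdf M (b + s * w) - cdf M (a + s * w))) =
        (LINT y|M. complex_of_real (std_normal_density w * indicator {a + s * w<..b + s * w} y))"
      by (simp del: integral_indicator)
  qed
  also have "\<dots> = (LINT y|M. LINT w|lborel. complex_of_real (std_normal_density w * indicator {a + s * w<..b + s * w} y))"
  proof (rule P1.Fubini_dominated[where g = std_normal_density and h = "\<lambda>_. 1"])
    have "(\<lambda>(w, y). complex_of_real (std_normal_density w * indicator {p. a + s * fst p < snd p \<and> snd p \<le> b + s * fst p} (w, y))) \<in> borel_measurable (lborel \<Otimes>\<^sub>M M)"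
      by measurable
    also have "(\<lambda>(w, y). complex_of_real (std_normal_density w * indicator {p. a + s * fst p < snd p \<and> snd p \<le> b + s * fst p} (w, y)))
       = (\<lambda>(w, y). complex_of_real (std_normal_density w * indicator {a + s * w<..b + s * w} y))"
      by (auto simp: fun_eq_iff split: split_indicator)
    finally show "(\<lambda>(w, y). complex_of_real (std_normal_density w * indicator {a + s * w<..b + s * w} y)) \<in> borel_measurable (lborel \<Otimes>\<^sub>M M)" .
  qed (auto split: split_indicator simp: abs_mult)
  also have "\<dots> = (LINT y|M. LINT t|lborel. ?E t * iexp (t * y) * A t / (2 * pi))"
  proof (rule Bochner_Integration.integral_cong[OF refl])
    fix y
    \<comment> \<open>The substitution \<open>u = y - s * w\<close> turns the moving window around
      \<open>y\<close> into the fixed window from \<open>a\<close> to \<open>b\<close>.\<close>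
    have "(LINT w|lborel. complex_of_real (std_normal_density w * indicator {a + s * w<..b + s * w} y))
       = \<bar>- 1 / s\<bar> *\<^sub>R (LINT u|lborel. complex_of_real (std_normal_density (y / s + (- 1 / s) * u) * indicator {a + s * (y / s + (- 1 / s) * u)<..b + s * (y / s + (- 1 / s) * u)} y))"
      by (rule lborel_integral_real_affine) (use s in auto)
    also have "\<dots> = (LINT u|lborel. indicator {a<..b} u *\<^sub>R complex_of_real (normal_density 0 s (u - y)))"
      unfolding integral_scaleR_right[symmetric]
    proof (rule Bochner_Integration.integral_cong[OF refl])
      fix u
      have "y / s + (- 1 / s) * u = (y - u) / s" by (simp add: diff_divide_distrib)
      moreover have "s * ((y - u) / s) = y - u" using s by simp
      moreover have "std_normal_density ((y - u) / s) / s = normal_density 0 s (u - y)"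
        using s by (simp add: normal_density_def real_sqrt_mult power_divide power2_commute field_simps)
      ultimately show "\<bar>- 1 / s\<bar> *\<^sub>R complex_of_real (std_normal_density (y / s + (- 1 / s) * u) * indicator {a + s * (y / s + (- 1 / s) * u)<..b + s * (y / s + (- 1 / s) * u)} y)
         = indicator {a<..b} u *\<^sub>R complex_of_real (normal_density 0 s (u - y))"
        using s by (auto split: split_indicator simp: scaleR_conv_of_real simp flip: of_real_mult of_real_divide)
    qed
    also have "\<dots> = (LINT u|lborel. LINT t|lborel. indicator {a<..b} u *\<^sub>R (iexp (- (t * u)) * iexp (t * y) * ?E t / (2 * pi)))"
    proof (rule Bochner_Integration.integral_cong[OF refl])
      fix u
      have "complex_of_real (normal_density 0 s (u - y)) = (LINT t|lborel. iexp (- (t * (u - y))) * ?E t / (2 * pi))"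
        unfolding gauss_inversion[OF s] by simp
      also have "\<dots> = (LINT t|lborel. iexp (- (t * u)) * iexp (t * y) * ?E t / (2 * pi))"
        by (intro Bochner_Integration.integral_cong refl) (simp add: algebra_simps flip: exp_add)
      finally show "indicator {a<..b} u *\<^sub>R complex_of_real (normal_density 0 s (u - y)) = (LINT t|lborel. indicator {a<..b} u *\<^sub>R (iexp (- (t * u)) * iexp (t * y) * ?E t / (2 * pi)))"
        by simp
    qed
    also have "\<dots> = (LINT t|lborel. LINT u|lborel. indicator {a<..b} u *\<^sub>R (iexp (- (t * u)) * iexp (t * y) * ?E t / (2 * pi)))"
    proof (rule lborel_pair.Fubini_dominated[where g = "\<lambda>u. indicator {a<..b} u" and h = "\<lambda>t. exp (- (s * t)\<^sup>2 / 2) / (2 * pi)"])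
      show "integrable lborel (\<lambda>u. indicator {a<..b} u :: real)" by (rule integrable_real_indicator) (use ab in auto)
      show "integrable lborel (\<lambda>t. exp (- (s * t)\<^sup>2 / 2) / (2 * pi))" using E_int by simp
    qed (auto simp: norm_mult norm_divide split: split_indicator)
    also have "\<dots> = (LINT t|lborel. ?E t * iexp (t * y) * A t / (2 * pi))"
    proof (rule Bochner_Integration.integral_cong[OF refl])
      fix t
      have "(LINT u|lborel. indicator {a<..b} u *\<^sub>R (iexp (- (t * u)) * iexp (t * y) * ?E t / (2 * pi)))
         = (LINT u|lborel. (indicator {a<..b} u *\<^sub>R iexp (- (t * u))) * (iexp (t * y) * ?E t / (2 * pi)))"
        by (intro Bochner_Integration.integral_cong refl) (simp add: scaleR_conv_of_real)
      also have "\<dots> = A t * (iexp (t * y) * ?E t / (2 * pi))" unfolding A_def by (rule integral_mult_left_zero)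
      finally show "(LINT u|lborel. indicator {a<..b} u *\<^sub>R (iexp (- (t * u)) * iexp (t * y) * ?E t / (2 * pi))) = ?E t * iexp (t * y) * A t / (2 * pi)"
        by (simp add: mult_ac)
    qed
    finally show "(LINT w|lborel. complex_of_real (std_normal_density w * indicator {a + s * w<..b + s * w} y)) = (LINT t|lborel. ?E t * iexp (t * y) * A t / (2 * pi))" .
  qed
  also have "\<dots> = (LINT t|lborel. LINT y|M. ?E t * iexp (t * y) * A t / (2 * pi))"
  proof (rule P2.Fubini_dominated[where g = "\<lambda>_. (b - a) / (2 * pi)" and h = "\<lambda>t. exp (- (s * t)\<^sup>2 / 2)"])
    show "integrable lborel (\<lambda>t. exp (- (s * t)\<^sup>2 / 2))" by (rule E_int)
    fix y t
    have "cmod (A t) \<le> b - a" unfolding A_def by (rule norm_iexp_window[OF ab])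
    then have "cmod (A t) / (2 * pi) * exp (- (s * t)\<^sup>2 / 2) \<le> (b - a) / (2 * pi) * exp (- (s * t)\<^sup>2 / 2)"
      by (intro mult_right_mono divide_right_mono) auto
    then show "cmod (?E t * iexp (t * y) * A t / (2 * pi)) \<le> (b - a) / (2 * pi) * exp (- (s * t)\<^sup>2 / 2)"
      by (simp add: norm_mult norm_divide mult_ac)
  qed auto
  also have "\<dots> = (LINT t|lborel. char M t * ?E t * A t / (2 * pi))"
  proof (rule Bochner_Integration.integral_cong[OF refl])
    fix t
    have "(LINT y|M. ?E t * iexp (t * y) * A t / (2 * pi)) = (LINT y|M. iexp (t * y) * (?E t * A t / (2 * pi)))"
      by (intro Bochner_Integration.integral_cong refl) simp
    also have "\<dots> = char M t * (?E t * A t / (2 * pi))" unfolding char_def by (rule integral_mult_left_zero)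
    finally show "(LINT y|M. ?E t * iexp (t * y) * A t / (2 * pi)) = char M t * ?E t * A t / (2 * pi)" by simp
  qed
  finally show ?thesis by (simp add: A_def)
qed

lemma (in real_distribution) cdf_measurable [measurable]: "cdf M \<in> borel_measurable borel"
  by (intro borel_measurable_mono monoI cdf_nondecreasing)

lemma real_distribution_AE_continuous:
  assumes "real_distribution M"
  shows "AE y in lborel. isCont (cdf M) (z + y)"
proof -
  interpret M: real_distribution M by fact
  have "countable {x. measure M {x} > 0}" by (rule M.countable_atoms)
  then have "countable ((\<lambda>x. x - z) ` {x. measure M {x} > 0})" by (rule countable_image)
  then have "(\<lambda>x. x - z) ` {x. measure M {x} > 0} \<in> null_sets lborel" by (rule countable_imp_null_set_lborel)
  then have "AE y in lborel. y \<notin> (\<lambda>x. x - z) ` {x. measure M {x} > 0}" by (rule AE_not_in)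
  then show ?thesis
  proof eventually_elim
    case (elim y)
    have "\<not> measure M {z + y} > 0"
    proof
      assume "measure M {z + y} > 0"
      then have "y \<in> (\<lambda>x. x - z) ` {x. measure M {x} > 0}" by (intro image_eqI[of _ _ "z + y"]) auto
      then show False using elim by simp
    qed
    then show ?case using measure_nonneg[of M "{z + y}"] by (simp add: M.isCont_cdf)
  qed
qed

section \<open>Difference of two laws: distribution functions against characteristic
  functions\<close>

locale two_distributions =
  fixes M1 M2 :: "real measure"
  assumes M1: "real_distribution M1" and M2: "real_distribution M2"
begin

sublocale M1: real_distribution M1 by (rule M1)
sublocale M2: real_distribution M2 by (rule M2)

definition "cdf_diff x = cdf M1 x - cdf M2 x"
definition "char_diff t = char M1 t - char M2 t"
text \<open>At \<open>t = 0\<close> the quotient is the junk value 0, which is irrelevant under the integral.\<close>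
definition "char_quot t = char_diff t / (- (\<i> * t))"
text \<open>The Gaussian average at scale \<open>s\<close>; in frequency it amounts to the damping
  factor \<open>exp (- (s * t)\<^sup>2 / 2)\<close>.\<close>

definition "smooth_diff s x = (LINT w|lborel. std_normal_density w * cdf_diff (x + s * w))"

lemma cdf_diff_measurable [measurable]: "cdf_diff \<in> borel_measurable borel"
  unfolding cdf_diff_def by measurable

lemma char_quot_measurable [measurable]: "char_quot \<in> borel_measurable borel"
  unfolding char_quot_def char_diff_def by measurable

lemma abs_cdf_diff_le: "\<bar>cdf_diff x\<bar> \<le> 1"
  unfolding cdf_diff_def using M1.cdf_bounded_prob[of x] M2.cdf_bounded_prob[of x] M1.cdf_nonneg[of x] M2.cdf_nonneg[of x]
  by linarith

lemma cdf_diff_integrable: "integrable lborel (\<lambda>w. std_normal_density w * cdf_diff (x + s * w))"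
proof (rule Bochner_Integration.integrable_bound[of lborel std_normal_density])
  show "AE w in lborel. norm (std_normal_density w * cdf_diff (x + s * w)) \<le> norm (std_normal_density w)"
    by (rule AE_I2) (use abs_cdf_diff_le in \<open>auto simp: abs_mult intro!: mult_left_le\<close>)
qed auto

lemma smooth_diff_measurable [measurable]: "smooth_diff s \<in> borel_measurable borel"
  unfolding smooth_diff_def by measurable

lemma abs_smooth_diff_le: "\<bar>smooth_diff s x\<bar> \<le> 1"
proof -
  have "\<bar>smooth_diff s x\<bar> \<le> (LINT w|lborel. \<bar>std_normal_density w * cdf_diff (x + s * w)\<bar>)"
    unfolding smooth_diff_def by (rule integral_abs_bound)
  also have "\<dots> \<le> (LINT w|lborel. std_normal_density w)"
    by (intro integral_mono integrable_abs cdf_diff_integrable)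
       (use abs_cdf_diff_le in \<open>auto simp: abs_mult intro!: mult_left_le\<close>)
  finally show ?thesis by simp
qed

text \<open>For the difference of two laws the division by \<open>-it\<close> is harmless as long as
  the damped quotient is integrable. The window transform then splits into the contributions of its
  two endpoints.\<close>

lemma smooth_diff_increment:
  assumes s: "s > 0" and ab: "a < b"
    and int: "integrable lborel (\<lambda>t. char_quot t * complex_of_real (exp (- (s * t)\<^sup>2 / 2)))"
  shows "complex_of_real (smooth_diff s b - smooth_diff s a) =
    (LINT t|lborel. iexp (- (t * b)) * (char_quot t * complex_of_real (exp (- (s * t)\<^sup>2 / 2)))) / (2 * pi) -
    (LINT t|lborel. iexp (- (t * a)) * (char_quot t * complex_of_real (exp (- (s * t)\<^sup>2 / 2)))) / (2 * pi)"
proof -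
  let ?E = "\<lambda>t. complex_of_real (exp (- (s * t)\<^sup>2 / 2))"
  let ?A = "\<lambda>t. (LINT u|lborel. indicator {a<..b} u *\<^sub>R iexp (- (t * u)))"
  have [measurable]: "?A \<in> borel_measurable borel" by measurable
  have intc: "integrable lborel (\<lambda>w. std_normal_density w * (cdf M (b + s * w) - cdf M (a + s * w)))" if "real_distribution M" for M
  proof -
    interpret M: real_distribution M by fact
    have "\<bar>cdf M (b + s * w) - cdf M (a + s * w)\<bar> \<le> 1" for w
      using M.cdf_bounded_prob[of "b + s * w"] M.cdf_bounded_prob[of "a + s * w"] M.cdf_nonneg[of "b + s * w"] M.cdf_nonneg[of "a + s * w"] by linarith
    then have bd: "\<bar>std_normal_density w * (cdf M (b + s * w) - cdf M (a + s * w))\<bar> \<le> \<bar>std_normal_density w\<bar>" for w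
      unfolding abs_mult by (intro mult_left_le) auto
    show ?thesis
    proof (rule Bochner_Integration.integrable_bound[of lborel std_normal_density])
      show "AE w in lborel. norm (std_normal_density w * (cdf M (b + s * w) - cdf M (a + s * w))) \<le> norm (std_normal_density w)"
        unfolding real_norm_def by (rule AE_I2) (rule bd)
      show "(\<lambda>w. std_normal_density w * (cdf M (b + s * w) - cdf M (a + s * w))) \<in> borel_measurable lborel"
        by measurable
    qed simp
  qed
  have intA: "integrable lborel (\<lambda>t. char M t * ?E t * ?A t)" if "real_distribution M" for M
  proof -
    interpret M: real_distribution M by fact
    show ?thesis
    proof (rule Bochner_Integration.integrable_bound[of lborel "\<lambda>t. exp (- (s * t)\<^sup>2 / 2) * (b - a)"])
      show "integrable lborel (\<lambda>t. exp (- (s * t)\<^sup>2 / 2) * (b - a))" by (intro integrable_mult_left integrable_gauss s)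
      have "norm (char M t * ?E t * ?A t) \<le> norm (exp (- (s * t)\<^sup>2 / 2) * (b - a))" for t
      proof -
        have "norm (char M t * ?E t * ?A t) = cmod (char M t) * exp (- (s * t)\<^sup>2 / 2) * cmod (?A t)" by (simp add: norm_mult)
        also have "\<dots> \<le> 1 * exp (- (s * t)\<^sup>2 / 2) * (b - a)"
          using ab by (intro mult_mono M.cmod_char_le_1 norm_iexp_window) auto
        finally show ?thesis using ab by simp
      qed
      then show "AE t in lborel. norm (char M t * ?E t * ?A t) \<le> norm (exp (- (s * t)\<^sup>2 / 2) * (b - a))" by simp
    qed measurable
  qed
  have int_shift: "integrable lborel (\<lambda>t. iexp (- (t * x)) * (char_quot t * ?E t))" for x
    by (rule Bochner_Integration.integrable_bound[OF int]) (auto simp: norm_mult)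
  have "smooth_diff s b - smooth_diff s a =
      (LINT w|lborel. std_normal_density w * cdf_diff (b + s * w) - std_normal_density w * cdf_diff (a + s * w))"
    unfolding smooth_diff_def by (rule Bochner_Integration.integral_diff[symmetric]) (rule cdf_diff_integrable)+
  also have "\<dots> = (LINT w|lborel. std_normal_density w * (cdf M1 (b + s * w) - cdf M1 (a + s * w)) - std_normal_density w * (cdf M2 (b + s * w) - cdf M2 (a + s * w)))"
    by (intro Bochner_Integration.integral_cong refl) (simp add: cdf_diff_def algebra_simps)
  also have "\<dots> = (LINT w|lborel. std_normal_density w * (cdf M1 (b + s * w) - cdf M1 (a + s * w))) - (LINT w|lborel. std_normal_density w * (cdf M2 (b + s * w) - cdf M2 (a + s * w)))"
    by (rule Bochner_Integration.integral_diff) (rule intc, rule M1, rule intc, rule M2)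
  finally have "complex_of_real (smooth_diff s b - smooth_diff s a) =
     (LINT t|lborel. char M1 t * ?E t * ?A t) / (2 * pi) - (LINT t|lborel. char M2 t * ?E t * ?A t) / (2 * pi)"
    by (simp only: of_real_diff smoothed_cdf_increment[OF M1 s ab] smoothed_cdf_increment[OF M2 s ab])
  also have "\<dots> = (LINT t|lborel. char M1 t * ?E t * ?A t - char M2 t * ?E t * ?A t) / (2 * pi)"
    by (subst Bochner_Integration.integral_diff[OF intA[OF M1] intA[OF M2]]) (simp add: diff_divide_distrib)
  also have "(LINT t|lborel. char M1 t * ?E t * ?A t - char M2 t * ?E t * ?A t) =
     (LINT t|lborel. iexp (- (t * b)) * (char_quot t * ?E t) - iexp (- (t * a)) * (char_quot t * ?E t))"
  proof (rule integral_cong_AE)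
    have "AE t in lborel. t \<noteq> (0::real)" by (rule AE_lborel_singleton)
    then show "AE t in lborel. char M1 t * ?E t * ?A t - char M2 t * ?E t * ?A t = iexp (- (t * b)) * (char_quot t * ?E t) - iexp (- (t * a)) * (char_quot t * ?E t)"
    proof eventually_elim
      case (elim t)
      have nz: "- (\<i> * t) \<noteq> 0" using elim by simp
      then have A: "?A t = (iexp (- (t * b)) - iexp (- (t * a))) / (- (\<i> * t))"
        using iexp_window[OF ab, of t] nonzero_eq_divide_eq[OF nz] by blast
      show ?case unfolding A char_quot_def char_diff_def using elim by (simp add: field_simps)
    qed
  qed measurable
  also have "\<dots> = (LINT t|lborel. iexp (- (t * b)) * (char_quot t * ?E t)) - (LINT t|lborel. iexp (- (t * a)) * (char_quot t * ?E t))"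
    by (rule Bochner_Integration.integral_diff) (rule int_shift)+
  finally show ?thesis by (simp add: diff_divide_distrib)
qed

lemma cdf_diff_tendsto_0:
  assumes "filterlim X at_top sequentially \<or> filterlim X at_bot sequentially"
  shows "(\<lambda>n. cdf_diff (X n)) \<longlonglongrightarrow> 0"
proof -
  have "(cdf_diff \<longlongrightarrow> 1 - 1) at_top"
    unfolding cdf_diff_def by (intro tendsto_diff M1.cdf_lim_at_top_prob M2.cdf_lim_at_top_prob)
  moreover have "(cdf_diff \<longlongrightarrow> 0 - 0) at_bot"
    unfolding cdf_diff_def by (intro tendsto_diff M1.cdf_lim_at_bot M2.cdf_lim_at_bot)
  ultimately show ?thesis using assms by (auto intro: filterlim_compose)
qed

lemma smooth_diff_tendsto_0:
  assumes "filterlim X at_top sequentially \<or> filterlim X at_bot sequentially"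
  shows "(\<lambda>n. smooth_diff s (X n)) \<longlonglongrightarrow> 0"
proof -
  have "(\<lambda>n. LINT w|lborel. std_normal_density w * cdf_diff (X n + s * w)) \<longlonglongrightarrow> (LINT w|(lborel :: real measure). (0::real))"
  proof (rule integral_dominated_convergence[where w = std_normal_density and f = "\<lambda>_. 0"])
    have "(\<lambda>n. std_normal_density w * cdf_diff (X n + s * w)) \<longlonglongrightarrow> 0" for w
    proof -
      have "filterlim (\<lambda>n. X n + s * w) at_top sequentially" if "filterlim X at_top sequentially"
        using that unfolding filterlim_at_top
        by (intro allI) (drule_tac x = "Z - s * w" in spec, auto elim: eventually_mono)
      moreover have "filterlim (\<lambda>n. X n + s * w) at_bot sequentially" if "filterlim X at_bot sequentially"
        using that unfolding filterlim_at_bot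
        by (intro allI) (drule_tac x = "Z - s * w" in spec, auto elim: eventually_mono)
      ultimately have "filterlim (\<lambda>n. X n + s * w) at_top sequentially \<or> filterlim (\<lambda>n. X n + s * w) at_bot sequentially"
        using assms by blast
      from tendsto_mult_right_zero[OF cdf_diff_tendsto_0[OF this]] show ?thesis .
    qed
    then show "AE w in lborel. (\<lambda>n. std_normal_density w * cdf_diff (X n + s * w)) \<longlonglongrightarrow> 0" by simp
    show "AE w in lborel. norm (std_normal_density w * cdf_diff (X n + s * w)) \<le> std_normal_density w" for n
      by (rule AE_I2) (use abs_cdf_diff_le in \<open>auto simp: abs_mult intro!: mult_left_le\<close>)
  qed auto
  then show ?thesis by (simp add: smooth_diff_def)
qed

text \<open>The increments determine both sides up to a common constant \<open>c\<close>. Averaging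
  over a Gaussian of width \<open>n\<close> identifies it: the smoothed difference tends to 0 at
  both infinities, while on the Fourier side the average inserts
  \<open>exp (- (n * t)\<^sup>2 / 2)\<close>, which tends to 0 for every
  \<open>t \<noteq> 0\<close>. Hence \<open>c = 0\<close>.\<close>

lemma smooth_diff_eq:
  assumes s: "s > 0"
    and int: "integrable lborel (\<lambda>t. char_quot t * complex_of_real (exp (- (s * t)\<^sup>2 / 2)))"
  shows "complex_of_real (smooth_diff s x) =
    (LINT t|lborel. iexp (- (t * x)) * (char_quot t * complex_of_real (exp (- (s * t)\<^sup>2 / 2)))) / (2 * pi)"
proof -
  let ?E = "\<lambda>t. complex_of_real (exp (- (s * t)\<^sup>2 / 2))"
  define \<psi> where "\<psi> t = char_quot t * ?E t" for t
  have [measurable]: "\<psi> \<in> borel_measurable borel" unfolding \<psi>_def by measurable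
  have psi: "integrable lborel \<psi>" using int by (simp add: \<psi>_def[abs_def])
  define G where "G x = (LINT t|lborel. iexp (- (t * x)) * \<psi> t) / (2 * pi)" for x
  have G_meas [measurable]: "G \<in> borel_measurable borel" unfolding G_def by measurable
  have G_bound: "cmod (G x) \<le> (LINT t|lborel. cmod (\<psi> t)) / (2 * pi)" for x
  proof -
    have "cmod (LINT t|lborel. iexp (- (t * x)) * \<psi> t) \<le> (LINT t|lborel. cmod (iexp (- (t * x)) * \<psi> t))"
      by (rule integral_norm_bound)
    then show ?thesis by (simp add: G_def norm_divide norm_mult divide_right_mono)
  qed
  define c where "c = complex_of_real (smooth_diff s x) - G x"
  have incr: "complex_of_real (smooth_diff s b) - complex_of_real (smooth_diff s a) = G b - G a" if "a < b" for a b
    using smooth_diff_increment[OF s that int] by (simp add: G_def \<psi>_def)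
  have const: "complex_of_real (smooth_diff s y) - G y = c" for y
  proof -
    consider "y < x" | "y = x" | "x < y" by linarith
    then show ?thesis
    proof cases
      case 1 then show ?thesis using incr[OF 1] unfolding c_def by (simp add: algebra_simps)
    next
      case 3 then show ?thesis using incr[OF 3] unfolding c_def by (simp add: algebra_simps)
    qed (simp add: c_def)
  qed
  let ?N = "\<lambda>w. complex_of_real (std_normal_density w)"
  have avg: "(LINT w|lborel. ?N w * complex_of_real (smooth_diff s (real n * w))) - (LINT w|lborel. ?N w * G (real n * w)) = c" for n
  proof -
    have i1: "integrable lborel (\<lambda>w. ?N w * complex_of_real (smooth_diff s (real n * w)))"
    proof (rule Bochner_Integration.integrable_bound[of lborel std_normal_density])
      show "AE w in lborel. norm (?N w * complex_of_real (smooth_diff s (real n * w))) \<le> norm (std_normal_density w)"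
        by (rule AE_I2) (use abs_smooth_diff_le in \<open>auto simp: norm_mult intro!: mult_left_le\<close>)
    qed auto
    have i2: "integrable lborel (\<lambda>w. ?N w * G (real n * w))"
    proof (rule Bochner_Integration.integrable_bound[of lborel "\<lambda>w. std_normal_density w * ((LINT t|lborel. cmod (\<psi> t)) / (2 * pi))"])
      show "AE w in lborel. norm (?N w * G (real n * w)) \<le> norm (std_normal_density w * ((LINT t|lborel. cmod (\<psi> t)) / (2 * pi)))"
        by (rule AE_I2) (simp only: norm_mult norm_of_real real_norm_def abs_mult, intro mult_left_mono, use G_bound in \<open>auto intro: order_trans[OF _ abs_ge_self]\<close>)
    qed auto
    have "(LINT w|lborel. ?N w * complex_of_real (smooth_diff s (real n * w))) - (LINT w|lborel. ?N w * G (real n * w))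
       = (LINT w|lborel. ?N w * complex_of_real (smooth_diff s (real n * w)) - ?N w * G (real n * w))"
      by (rule Bochner_Integration.integral_diff[OF i1 i2, symmetric])
    also have "\<dots> = (LINT w|lborel. ?N w * c)"
      by (intro Bochner_Integration.integral_cong refl) (simp only: right_diff_distrib[symmetric] const)
    also have "\<dots> = c" by simp
    finally show ?thesis .
  qed
  have lim1: "(\<lambda>n. LINT w|lborel. ?N w * complex_of_real (smooth_diff s (real n * w))) \<longlonglongrightarrow> (LINT w|(lborel :: real measure). (0::complex))"
  proof (rule integral_dominated_convergence[where w = std_normal_density and f = "\<lambda>_. 0"])
    have "AE w in lborel. w \<noteq> (0::real)" by (rule AE_lborel_singleton)
    then show "AE w in lborel. (\<lambda>n. ?N w * complex_of_real (smooth_diff s (real n * w))) \<longlonglongrightarrow> 0"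
    proof eventually_elim
      case (elim w)
      have "filterlim (\<lambda>n. real n * w) at_top sequentially \<or> filterlim (\<lambda>n. real n * w) at_bot sequentially"
      proof (cases "w > 0")
        case True
        then show ?thesis using filterlim_tendsto_pos_mult_at_top[OF tendsto_const[of w] True filterlim_real_sequentially]
          by (simp add: mult.commute)
      next
        case False
        then have "w < 0" using elim by simp
        then show ?thesis using filterlim_tendsto_neg_mult_at_bot[OF tendsto_const[of w] _ filterlim_real_sequentially]
          by (simp add: mult.commute)
      qed
      from smooth_diff_tendsto_0[OF this, of s]
      have "(\<lambda>n. complex_of_real (smooth_diff s (real n * w))) \<longlonglongrightarrow> 0" by (metis tendsto_of_real of_real_0)
      then show ?case by (rule tendsto_mult_right_zero)
    qed
    show "AE w in lborel. norm (?N w * complex_of_real (smooth_diff s (real n * w))) \<le> std_normal_density w" for n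
      by (rule AE_I2) (use abs_smooth_diff_le in \<open>auto simp: norm_mult intro!: mult_left_le\<close>)
  qed auto
  have G_avg: "(LINT w|lborel. ?N w * G (real n * w)) = (LINT t|lborel. \<psi> t * complex_of_real (exp (- (real n * t)\<^sup>2 / 2))) / (2 * pi)" for n
  proof -
    have "(LINT w|lborel. ?N w * G (real n * w)) = (LINT w|lborel. (LINT t|lborel. ?N w * (iexp (- (t * (real n * w))) * \<psi> t)) / (2 * pi))"
      unfolding G_def by (intro Bochner_Integration.integral_cong refl) simp
    also have "\<dots> = (LINT w|lborel. LINT t|lborel. ?N w * (iexp (- (t * (real n * w))) * \<psi> t)) / (2 * pi)" by simp
    also have "(LINT w|lborel. LINT t|lborel. ?N w * (iexp (- (t * (real n * w))) * \<psi> t)) = (LINT t|lborel. LINT w|lborel. ?N w * (iexp (- (t * (real n * w))) * \<psi> t))"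
      by (rule lborel_pair.Fubini_dominated[where g = std_normal_density and h = "\<lambda>t. cmod (\<psi> t)"])
         (use psi in \<open>auto simp: norm_mult\<close>)
    also have "\<dots> = (LINT t|lborel. \<psi> t * complex_of_real (exp (- (real n * t)\<^sup>2 / 2)))"
    proof (rule Bochner_Integration.integral_cong[OF refl])
      fix t
      have "(LINT w|lborel. ?N w * (iexp (- (t * (real n * w))) * \<psi> t)) = (LINT w|lborel. \<psi> t * (iexp ((- (real n * t)) * w) * complex_of_real (normal_density 0 1 w)))"
        by (intro Bochner_Integration.integral_cong refl) (simp add: mult_ac)
      also have "\<dots> = \<psi> t * complex_of_real (exp (- (1 * (- (real n * t)))\<^sup>2 / 2))"
        unfolding integral_mult_right_zero by (subst gauss_ft) auto
      finally show "(LINT w|lborel. ?N w * (iexp (- (t * (real n * w))) * \<psi> t)) = \<psi> t * complex_of_real (exp (- (real n * t)\<^sup>2 / 2))" by simp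
    qed
    finally show ?thesis .
  qed
  have "(\<lambda>n. LINT t|lborel. \<psi> t * complex_of_real (exp (- (real n * t)\<^sup>2 / 2))) \<longlonglongrightarrow> (LINT t|(lborel :: real measure). (0::complex))"
  proof (rule integral_dominated_convergence[where w = "\<lambda>t. cmod (\<psi> t)" and f = "\<lambda>_. 0"])
    show "AE t in lborel. norm (\<psi> t * complex_of_real (exp (- (real n * t)\<^sup>2 / 2))) \<le> cmod (\<psi> t)" for n
      by (rule AE_I2) (auto simp: norm_mult intro!: mult_left_le)
    have "AE w in lborel. w \<noteq> (0::real)" by (rule AE_lborel_singleton)
    then show "AE t in lborel. (\<lambda>n. \<psi> t * complex_of_real (exp (- (real n * t)\<^sup>2 / 2))) \<longlonglongrightarrow> 0"
    proof eventually_elim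
      case (elim t)
      have "(\<lambda>n. exp (- (real n * t)\<^sup>2 / 2)) \<longlonglongrightarrow> 0" using elim by real_asymp
      then have "(\<lambda>n. complex_of_real (exp (- (real n * t)\<^sup>2 / 2))) \<longlonglongrightarrow> 0" by (metis tendsto_of_real of_real_0)
      then show ?case by (rule tendsto_mult_right_zero)
    qed
  qed (use psi in auto)
  then have lim2: "(\<lambda>n. LINT w|lborel. ?N w * G (real n * w)) \<longlonglongrightarrow> 0"
    unfolding G_avg by (intro tendsto_divide_zero) simp
  have "(\<lambda>n. (LINT w|lborel. ?N w * complex_of_real (smooth_diff s (real n * w))) - (LINT w|lborel. ?N w * G (real n * w))) \<longlonglongrightarrow> 0 - 0"
    using lim1 lim2 by (intro tendsto_diff) simp_all
  then have "c = 0" unfolding avg by (simp add: LIMSEQ_const_iff)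
  then show ?thesis using const[of x] by (simp add: G_def \<psi>_def)
qed

text \<open>The smoothing scale tends to 0. On the left, convergence holds wherever both
  distribution functions are continuous, thus almost everywhere, with majorant \<open>|f|\<close>.
  On the right the product of the quotient and the transform of \<open>f\<close> is the majorant,
  which is what \<open>intF\<close> provides.\<close>

lemma integral_cdf_diff:
  fixes f :: "real \<Rightarrow> real"
  assumes f: "integrable lborel f"
    and int: "\<And>s. s > 0 \<Longrightarrow> integrable lborel (\<lambda>t. char_quot t * complex_of_real (exp (- (s * t)\<^sup>2 / 2)))"
    and intF: "integrable lborel (\<lambda>t. char_quot t * (LINT y|lborel. iexp (- (t * y)) * f y))"
  shows "complex_of_real (LINT y|lborel. cdf_diff (z + y) * f y) =
    (LINT t|lborel. iexp (- (t * z)) * (char_quot t * (LINT y|lborel. iexp (- (t * y)) * f y))) / (2 * pi)"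
proof -
  define F where "F t = (LINT y|lborel. iexp (- (t * y)) * f y)" for t
  have [measurable]: "f \<in> borel_measurable borel" using f by auto
  have [measurable]: "F \<in> borel_measurable borel" unfolding F_def by measurable
  define s where "s n = 1 / real (Suc n)" for n
  have s: "s n > 0" for n by (simp add: s_def)
  have s0: "s \<longlonglongrightarrow> 0" unfolding s_def by real_asymp
  let ?E = "\<lambda>n t. complex_of_real (exp (- (s n * t)\<^sup>2 / 2))"
  have eq: "complex_of_real (LINT y|lborel. smooth_diff (s n) (z + y) * f y) = (LINT t|lborel. iexp (- (t * z)) * (char_quot t * ?E n t * F t)) / (2 * pi)" for n
  proof -
    have "complex_of_real (LINT y|lborel. smooth_diff (s n) (z + y) * f y) = (LINT y|lborel. complex_of_real (smooth_diff (s n) (z + y) * f y))"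
      by (rule integral_complex_of_real[symmetric])
    also have "\<dots> = (LINT y|lborel. (LINT t|lborel. iexp (- (t * (z + y))) * (char_quot t * ?E n t) * f y) / (2 * pi))"
      by (intro Bochner_Integration.integral_cong refl) (simp add: smooth_diff_eq[OF s int[OF s]])
    also have "\<dots> = (LINT y|lborel. LINT t|lborel. iexp (- (t * (z + y))) * (char_quot t * ?E n t) * f y) / (2 * pi)" by simp
    also have "(LINT y|lborel. LINT t|lborel. iexp (- (t * (z + y))) * (char_quot t * ?E n t) * f y) = (LINT t|lborel. LINT y|lborel. iexp (- (t * (z + y))) * (char_quot t * ?E n t) * f y)"
    proof (rule lborel_pair.Fubini_dominated[where g = "\<lambda>y. \<bar>f y\<bar>" and h = "\<lambda>t. cmod (char_quot t * ?E n t)"])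
      show "integrable lborel (\<lambda>t. cmod (char_quot t * ?E n t))" by (rule integrable_norm[OF int[OF s]])
    qed (use f in \<open>auto simp: norm_mult\<close>)
    also have "\<dots> = (LINT t|lborel. iexp (- (t * z)) * (char_quot t * ?E n t * F t))"
    proof (rule Bochner_Integration.integral_cong[OF refl])
      fix t
      have "(LINT y|lborel. iexp (- (t * (z + y))) * (char_quot t * ?E n t) * f y) = (LINT y|lborel. (iexp (- (t * z)) * (char_quot t * ?E n t)) * (iexp (- (t * y)) * f y))"
      proof (intro Bochner_Integration.integral_cong refl)
        fix y
        have "iexp (- (t * (z + y))) = iexp (- (t * z)) * iexp (- (t * y))" by (simp add: algebra_simps flip: exp_add)
        then show "iexp (- (t * (z + y))) * (char_quot t * ?E n t) * f y = (iexp (- (t * z)) * (char_quot t * ?E n t)) * (iexp (- (t * y)) * f y)"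
          by (simp only: mult_ac)
      qed
      also have "\<dots> = (iexp (- (t * z)) * (char_quot t * ?E n t)) * F t" unfolding F_def by (rule integral_mult_right_zero)
      finally show "(LINT y|lborel. iexp (- (t * (z + y))) * (char_quot t * ?E n t) * f y) = iexp (- (t * z)) * (char_quot t * ?E n t * F t)" by (simp only: mult.assoc)
    qed
    finally show ?thesis .
  qed
  have "(\<lambda>n. LINT y|lborel. smooth_diff (s n) (z + y) * f y) \<longlonglongrightarrow> (LINT y|lborel. cdf_diff (z + y) * f y)"
  proof (rule integral_dominated_convergence[where w = "\<lambda>y. \<bar>f y\<bar>"])
    show "AE y in lborel. norm (smooth_diff (s n) (z + y) * f y) \<le> \<bar>f y\<bar>" for n
      by (rule AE_I2) (use abs_smooth_diff_le in \<open>auto simp: abs_mult intro!: mult_left_le_one_le\<close>)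
    show "AE y in lborel. (\<lambda>n. smooth_diff (s n) (z + y) * f y) \<longlonglongrightarrow> cdf_diff (z + y) * f y"
      using real_distribution_AE_continuous[OF M1, of z] real_distribution_AE_continuous[OF M2, of z]
    proof eventually_elim
      case (elim y)
      then have "isCont cdf_diff (z + y)" unfolding cdf_diff_def[abs_def] by (intro continuous_intros)
      then have c: "(\<lambda>n. cdf_diff (z + y + s n * w)) \<longlonglongrightarrow> cdf_diff (z + y)" for w
        by (rule isCont_tendsto_compose) (auto intro!: tendsto_eq_intros s0)
      have "(\<lambda>n. LINT w|lborel. std_normal_density w * cdf_diff (z + y + s n * w)) \<longlonglongrightarrow> (LINT w|lborel. std_normal_density w * cdf_diff (z + y))"
      proof (rule integral_dominated_convergence[where w = std_normal_density])
        show "AE w in lborel. norm (std_normal_density w * cdf_diff (z + y + s n * w)) \<le> std_normal_density w" for n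
          by (rule AE_I2) (use abs_cdf_diff_le in \<open>auto simp: abs_mult intro!: mult_left_le\<close>)
      qed (auto intro!: tendsto_intros c)
      then have "(\<lambda>n. smooth_diff (s n) (z + y)) \<longlonglongrightarrow> cdf_diff (z + y)" by (simp add: smooth_diff_def)
      then show ?case by (intro tendsto_intros)
    qed
  qed (use f in auto)
  then have "(\<lambda>n. complex_of_real (LINT y|lborel. smooth_diff (s n) (z + y) * f y)) \<longlonglongrightarrow> complex_of_real (LINT y|lborel. cdf_diff (z + y) * f y)"
    by (rule tendsto_of_real)
  moreover have "(\<lambda>n. (LINT t|lborel. iexp (- (t * z)) * (char_quot t * ?E n t * F t)) / (2 * pi)) \<longlonglongrightarrow> (LINT t|lborel. iexp (- (t * z)) * (char_quot t * F t)) / (2 * pi)"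
  proof (intro tendsto_divide tendsto_const integral_dominated_convergence[where w = "\<lambda>t. cmod (char_quot t * F t)"])
    show "integrable lborel (\<lambda>t. cmod (char_quot t * F t))" using intF by (intro integrable_norm) (simp add: F_def)
    show "AE t in lborel. norm (iexp (- (t * z)) * (char_quot t * ?E n t * F t)) \<le> cmod (char_quot t * F t)" for n
      by (rule AE_I2) (auto simp: norm_mult intro!: mult_right_mono mult_left_le)
    have "(\<lambda>n. ?E n t) \<longlonglongrightarrow> 1" for t
    proof -
      have "(\<lambda>n. exp (- (s n * t)\<^sup>2 / 2)) \<longlonglongrightarrow> exp (- (0 * t)\<^sup>2 / 2)" by (intro tendsto_intros s0) auto
      then have "(\<lambda>n. exp (- (s n * t)\<^sup>2 / 2)) \<longlonglongrightarrow> 1" by simp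
      then show ?thesis by (metis tendsto_of_real of_real_1)
    qed
    then have "(\<lambda>n. iexp (- (t * z)) * (char_quot t * ?E n t * F t)) \<longlonglongrightarrow> iexp (- (t * z)) * (char_quot t * 1 * F t)" for t
      by (intro tendsto_intros)
    then show "AE t in lborel. (\<lambda>n. iexp (- (t * z)) * (char_quot t * ?E n t * F t)) \<longlonglongrightarrow> iexp (- (t * z)) * (char_quot t * F t)" by simp
  qed auto
  ultimately show ?thesis unfolding eq F_def by (rule LIMSEQ_unique)
qed

end

section \<open>Fourier transforms of derivatives and of test functions\<close>

lemma integral_derivative_eq_0:
  fixes h h' :: "real \<Rightarrow> complex"
  assumes der: "\<And>x. (h has_vector_derivative h' x) (at x)" and cont: "continuous_on UNIV h'"
    and int: "integrable lborel h" "integrable lborel h'"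
  shows "(LINT x|lborel. h' x) = 0"
proof -
  have [measurable]: "h \<in> borel_measurable borel" "h' \<in> borel_measurable borel" using int by auto
  have shift: "integrable lborel (\<lambda>x. g (x + s))" "(LINT x|lborel. g (x + s)) = (LINT x|lborel. g x)"
    if "integrable lborel g" for g :: "real \<Rightarrow> complex" and s
  proof -
    show "integrable lborel (\<lambda>x. g (x + s))" using lborel_integrable_real_affine[OF that, of 1 s] by (simp add: add.commute)
    show "(LINT x|lborel. g (x + s)) = (LINT x|lborel. g x)"
      using lborel_integral_real_affine[of 1 g s] by (simp add: add.commute)
  qed
  have shift_norm: "(LINT x|lborel. cmod (h' (x + s))) = (LINT x|lborel. cmod (h' x))" for s
    using lborel_integral_real_affine[of 1 "\<lambda>x. cmod (h' x)" s] by (simp add: add.commute)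
  \<comment> \<open>Instead of limits of \<open>h\<close> at infinity, translation invariance is
    used: averaging the integral of \<open>h'\<close> over the shifts by \<open>s\<close> in
    \<open>[0, 1]\<close> and integrating in \<open>s\<close> first gives the integral of
    \<open>h (x + 1) - h x\<close>, which is 0.\<close>
  define f where "f s x = indicator {0..1} s *\<^sub>R h' (x + s)" for s x :: real
  have prod: "integrable (lborel \<Otimes>\<^sub>M lborel) (case_prod f)"
  proof (rule lborel_pair.Fubini_integrable)
    show "case_prod f \<in> borel_measurable (lborel \<Otimes>\<^sub>M lborel)" unfolding f_def by measurable
    have "(\<lambda>s. LINT x|lborel. norm (case_prod f (s, x))) = (\<lambda>s. indicator {0..1} s * (LINT x|lborel. cmod (h' x)))"
      by (rule ext) (simp add: f_def shift_norm)
    then show "integrable lborel (\<lambda>s. LINT x|lborel. norm (case_prod f (s, x)))" by simp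
    show "AE s in lborel. integrable lborel (\<lambda>x. case_prod f (s, x))"
      by (rule AE_I2) (simp add: f_def shift(1)[OF int(2)])
  qed
  have "(LINT x|lborel. h' x) = (LINT s|lborel. LINT x|lborel. f s x)"
    by (simp add: f_def shift(2)[OF int(2)])
  also have "\<dots> = (LINT x|lborel. LINT s|lborel. f s x)"
    by (rule lborel_pair.Fubini_integral[OF prod, symmetric])
  also have "\<dots> = (LINT x|lborel. h (x + 1) - h (x + 0))"
  proof (rule Bochner_Integration.integral_cong[OF refl])
    fix x
    have "(LINT s|lborel. indicator {0..1} s *\<^sub>R h' (x + s)) = h (x + 1) - h (x + 0)"
    proof (rule integral_FTC_Icc)
      fix s
      show "((\<lambda>s. h (x + s)) has_vector_derivative h' (x + s)) (at s within {0..1})"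
      proof -
        have "((\<lambda>s. h (x + s)) has_vector_derivative 1 *\<^sub>R h' (x + s)) (at s)"
          by (rule vector_diff_chain_at[of "\<lambda>s. x + s" 1 s h, unfolded o_def])
             (auto intro!: derivative_eq_intros der)
        then show ?thesis by (simp add: has_vector_derivative_at_within)
      qed
      show "continuous_on {0..1} (\<lambda>s. h' (x + s))"
        by (rule continuous_on_compose2[OF cont]) (auto intro!: continuous_intros)
    qed simp
    then show "(LINT s|lborel. f s x) = h (x + 1) - h (x + 0)" by (simp add: f_def)
  qed
  also have "\<dots> = 0"
    by (subst Bochner_Integration.integral_diff) (auto intro: shift int simp: shift(2)[OF int(1)])
  finally show ?thesis .
qed

lemma iexp_linear_has_vector_derivative:
  "((\<lambda>x. iexp (c * x)) has_vector_derivative \<i> * c * iexp (c * x)) (at x within A)"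
proof -
  have "((\<lambda>u. iexp (c * u)) has_vector_derivative c *\<^sub>R (\<i> * iexp (c * x))) (at x within A)"
    by (rule vector_diff_chain_within[of "\<lambda>u. c * u" c x A iexp, unfolded o_def])
       (auto intro!: derivative_eq_intros simp: has_vector_derivative_at_within)
  then show ?thesis by (simp add: scaleR_conv_of_real mult_ac)
qed

text \<open>Integration by parts without boundary terms: the product of \<open>g\<close> with the
  character is integrable together with its continuous derivative, so that derivative has integral
  0.\<close>

lemma fourier_derivative:
  fixes g g' :: "real \<Rightarrow> complex"
  assumes der: "\<And>x. (g has_vector_derivative g' x) (at x)" and cont: "continuous_on UNIV g'"
    and int: "integrable lborel g" "integrable lborel g'"
  shows "(LINT x|lborel. iexp (c * x) * g' x) = - (\<i> * c) * (LINT x|lborel. iexp (c * x) * g x)"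
proof -
  have contg: "continuous_on UNIV g"
    by (intro continuous_at_imp_continuous_on ballI has_vector_derivative_continuous[OF der])
  have i: "integrable lborel (\<lambda>x. iexp (c * x) * k x)" if "integrable lborel k" for k
    by (rule Bochner_Integration.integrable_bound[OF that]) (use that in \<open>auto simp: norm_mult\<close>)
  have i1: "integrable lborel (\<lambda>x. iexp (c * x) * g' x)" and i2: "integrable lborel (\<lambda>x. (\<i> * c) * (iexp (c * x) * g x))"
    using i[OF int(2)] i[OF int(1)] by (auto simp del: mult_eq_0_iff)
  have "(LINT x|lborel. iexp (c * x) * g' x + (\<i> * c) * (iexp (c * x) * g x)) = 0"
  proof (rule integral_derivative_eq_0[where h = "\<lambda>x. iexp (c * x) * g x"])
    fix x
    show "((\<lambda>x. iexp (c * x) * g x) has_vector_derivative iexp (c * x) * g' x + (\<i> * c) * (iexp (c * x) * g x)) (at x)"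
      using has_vector_derivative_mult[OF iexp_linear_has_vector_derivative[of c x] der[of x]] by (simp add: mult_ac)
    show "continuous_on UNIV (\<lambda>x. iexp (c * x) * g' x + (\<i> * c) * (iexp (c * x) * g x))"
      by (intro continuous_intros cont contg)
    show "integrable lborel (\<lambda>x. iexp (c * x) * g' x + (\<i> * c) * (iexp (c * x) * g x))"
      by (rule Bochner_Integration.integrable_add[OF i1 i2])
  qed (rule i[OF int(1)])
  then have "(LINT x|lborel. iexp (c * x) * g' x) + (LINT x|lborel. (\<i> * c) * (iexp (c * x) * g x)) = 0"
    by (subst (asm) Bochner_Integration.integral_add[OF i1 i2])
  then show ?thesis by (simp add: eq_neg_iff_add_eq_0)
qed

text \<open>This is min(1, |t|^(-q)), with value 1 at \<open>t = 0\<close>, where the expression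
  \<open>1 / \<bar>t\<bar> ^ q\<close> would be 0 for \<open>q \<ge> 1\<close>.\<close>

definition freq_weight :: "nat \<Rightarrow> real \<Rightarrow> real" where
  "freq_weight q t = (if \<bar>t\<bar> \<le> 1 then 1 else 1 / \<bar>t\<bar> ^ q)"

lemma freq_weight_measurable [measurable]: "freq_weight q \<in> borel_measurable borel"
  unfolding freq_weight_def by measurable

lemma freq_weight_nonneg: "0 \<le> freq_weight q t" and freq_weight_le_1: "freq_weight q t \<le> 1"
  by (auto simp: freq_weight_def divide_le_eq_1 intro!: one_le_power)

lemma F_space_fourier_iterate:
  assumes f: "f \<in> F_space q 0" and j: "j \<le> q"
  shows "(LINT y|lborel. iexp (c * y) * complex_of_real ((deriv ^^ j) f y)) = (- (\<i> * c)) ^ j * (LINT y|lborel. iexp (c * y) * complex_of_real (f y))"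
  using j
proof (induction j)
  case (Suc j)
  have int: "integrable lborel ((deriv ^^ i) f)" if "i \<le> q" for i using f that unfolding F_space_def by auto
  have diff: "(deriv ^^ i) f differentiable (at x)" if "i < q" for i x using f that unfolding F_space_def C_m_def by auto
  have "continuous_on UNIV ((deriv ^^ Suc j) f)"
  proof (cases "Suc j = q")
    case True then show ?thesis using f unfolding F_space_def C_m_def by auto
  next
    case False
    then show ?thesis using diff[of "Suc j"] Suc.prems
      by (intro continuous_at_imp_continuous_on ballI differentiable_imp_continuous_within) auto
  qed
  then have cont: "continuous_on UNIV (\<lambda>x. complex_of_real ((deriv ^^ Suc j) f x))" by (intro continuous_intros)
  have der: "((\<lambda>x. complex_of_real ((deriv ^^ j) f x)) has_vector_derivative complex_of_real ((deriv ^^ Suc j) f x)) (at x)" for x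
  proof -
    have "((deriv ^^ j) f has_real_derivative deriv ((deriv ^^ j) f) x) (at x)"
      using diff[of j x] Suc.prems by (simp add: DERIV_deriv_iff_real_differentiable)
    then show ?thesis by (auto intro: has_vector_derivative_of_real simp: has_real_derivative_iff_has_vector_derivative)
  qed
  have "(LINT y|lborel. iexp (c * y) * complex_of_real ((deriv ^^ Suc j) f y)) = - (\<i> * c) * (LINT y|lborel. iexp (c * y) * complex_of_real ((deriv ^^ j) f y))"
    by (rule fourier_derivative[OF der cont]) (intro integrable_of_real int, use Suc.prems in simp)+
  then show ?case using Suc by simp
qed simp

text \<open>For \<open>\<bar>t\<bar> \<le> 1\<close> the L1 norm of \<open>f\<close> bounds the
  transform; otherwise the \<open>q\<close>-th derivative is transformed, which gains
  \<open>|t|^(-q)\<close>. Both L1 norms are dominated by the norm of \<open>f\<close>.\<close>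

lemma F_space_fourier_bound:
  assumes f: "f \<in> F_space q 0"
  shows "cmod (LINT y|lborel. iexp (- (t * y)) * complex_of_real (f y)) \<le> C_norm q 0 f * freq_weight q t"
proof -
  let ?F = "(LINT y|lborel. iexp (- (t * y)) * complex_of_real (f y))"
  let ?D = "(LINT y|lborel. \<bar>(deriv ^^ q) f y\<bar>)"
  have nF: "cmod (LINT y|lborel. iexp (- (t * y)) * complex_of_real (g y)) \<le> (LINT y|lborel. \<bar>g y\<bar>)" for g
    using integral_norm_bound[of lborel "\<lambda>y. iexp (- (t * y)) * complex_of_real (g y)"] by (simp add: norm_mult)
  have up: "(LINT y|lborel. \<bar>(deriv ^^ j) f y\<bar>) \<le> C_upper q f" if "j \<le> q" for j
    unfolding C_upper_def by (rule Max_ge) (use that in auto)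
  have low: "C_lower 0 f = (LINT y|lborel. \<bar>f y\<bar>)" by (simp add: C_lower_def)
  have nn: "0 \<le> C_lower 0 f" "0 \<le> C_upper q f" using up[of 0] by (auto simp: low intro: order_trans[rotated])
  show ?thesis
  proof (cases "\<bar>t\<bar> \<le> 1")
    case True
    then show ?thesis using nF[of f] nn by (simp add: freq_weight_def C_norm_def low)
  next
    case False
    have "(LINT y|lborel. iexp ((- t) * y) * complex_of_real ((deriv ^^ q) f y)) = (- (\<i> * (- t))) ^ q * (LINT y|lborel. iexp ((- t) * y) * complex_of_real (f y))"
      using F_space_fourier_iterate[OF f order_refl, of "- t"] by simp
    then have "cmod (LINT y|lborel. iexp (- (t * y)) * complex_of_real ((deriv ^^ q) f y)) = \<bar>t\<bar> ^ q * cmod ?F"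
      by (simp add: norm_mult norm_power)
    then have "\<bar>t\<bar> ^ q * cmod ?F \<le> ?D" using nF[of "(deriv ^^ q) f"] by simp
    also have "\<dots> \<le> C_norm q 0 f" using up[of q] nn by (simp add: C_norm_def)
    finally show ?thesis using False by (simp add: freq_weight_def field_simps)
  qed
qed

text \<open>\<open>\<kappa>\<close> stands for the transform of the correction after division by
  \<open>-it\<close>, and \<open>T\<close> is its inverse transform. Both averages become integrals
  against the transform of \<open>f\<close>, and they are subtracted there. The shift
  \<open>z\<close> survives only as \<open>iexp (- (t * z))\<close>, of modulus 1.\<close>

lemma (in two_distributions) averaged_difference_bound:
  fixes f :: "real \<Rightarrow> real" and \<kappa> :: "real \<Rightarrow> complex" and T :: "real \<Rightarrow> complex"
  assumes f: "f \<in> F_space q 0" and kap: "integrable lborel \<kappa>"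
    and T: "\<And>x. T x = (LINT t|lborel. iexp (- (t * x)) * \<kappa> t) / (2 * pi)"
    and int: "integrable lborel (\<lambda>t. cmod (char_quot t - \<kappa> t) * freq_weight q t)"
  shows "cmod ((LINT y|lborel. cdf_diff (z + y) * f y) - (LINT y|lborel. T (z + y) * f y)) \<le>
      C_norm q 0 f * (LINT t|lborel. cmod (char_quot t - \<kappa> t) * freq_weight q t) / (2 * pi)"
proof -
  define F where "F t = (LINT y|lborel. iexp (- (t * y)) * complex_of_real (f y))" for t
  have f_int: "integrable lborel f" using f unfolding F_space_def by force
  have [measurable]: "f \<in> borel_measurable borel" "\<kappa> \<in> borel_measurable borel" using f_int kap by auto
  have [measurable]: "F \<in> borel_measurable borel" unfolding F_def by measurable
  have Fb: "cmod (F t) \<le> C_norm q 0 f * freq_weight q t" for t unfolding F_def by (rule F_space_fourier_bound[OF f])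
  have C0: "C_norm q 0 f \<ge> 0" using order_trans[OF norm_ge_zero Fb[of 0]] by (simp add: freq_weight_def)
  have Fb': "cmod (F t) \<le> C_norm q 0 f" for t
    using Fb[of t] freq_weight_le_1[of q t] C0 by (meson mult_left_le order_trans)
  \<comment> \<open>For \<open>\<bar>t\<bar> \<le> 1\<close> the weight is 1 and the assumed
    integrability controls the quotient; beyond that the quotient is at most 2 and the Gaussian
    factor is integrable.\<close>
  have intE: "integrable lborel (\<lambda>t. char_quot t * complex_of_real (exp (- (s * t)\<^sup>2 / 2)))" if s: "s > 0" for s
  proof (rule Bochner_Integration.integrable_bound)
    show "integrable lborel (\<lambda>t. cmod (char_quot t - \<kappa> t) * freq_weight q t + cmod (\<kappa> t) + 2 * exp (- (s * t)\<^sup>2 / 2))"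
      by (intro Bochner_Integration.integrable_add int integrable_norm[OF kap] integrable_mult_right integrable_gauss s)
    show "AE t in lborel. norm (char_quot t * complex_of_real (exp (- (s * t)\<^sup>2 / 2))) \<le> norm (cmod (char_quot t - \<kappa> t) * freq_weight q t + cmod (\<kappa> t) + 2 * exp (- (s * t)\<^sup>2 / 2))"
    proof (rule AE_I2)
      fix t
      let ?g = "exp (- (s * t)\<^sup>2 / 2)"
      have g: "0 < ?g" "?g \<le> 1" by auto
      have "cmod (char_quot t) * ?g \<le> cmod (char_quot t - \<kappa> t) * freq_weight q t + cmod (\<kappa> t) + 2 * ?g"
      proof (cases "\<bar>t\<bar> \<le> 1")
        case True
        have "cmod (char_quot t) * ?g \<le> cmod (char_quot t)" using g by (intro mult_left_le) auto
        also have "\<dots> \<le> cmod (char_quot t - \<kappa> t) + cmod (\<kappa> t)" by (metis diff_add_cancel norm_triangle_ineq)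
        finally have *: "cmod (char_quot t) * ?g \<le> cmod (char_quot t - \<kappa> t) + cmod (\<kappa> t)" .
        have fw: "freq_weight q t = 1" using True by (simp add: freq_weight_def)
        show ?thesis unfolding fw using * g(1) by linarith
      next
        case False
        have "cmod (char_diff t) \<le> 1 + 1"
          unfolding char_diff_def by (rule order_trans[OF norm_triangle_ineq4 add_mono[OF M1.cmod_char_le_1 M2.cmod_char_le_1]])
        then have "cmod (char_quot t) \<le> 2"
          using False unfolding char_quot_def by (simp add: norm_divide norm_mult divide_le_eq)
        then have "cmod (char_quot t) * ?g \<le> 2 * ?g" using g by (intro mult_right_mono) auto
        moreover have "0 \<le> cmod (char_quot t - \<kappa> t) * freq_weight q t" by (simp add: freq_weight_nonneg)
        ultimately show ?thesis using norm_ge_zero[of "\<kappa> t"] by linarith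
      qed
      then show "norm (char_quot t * complex_of_real ?g) \<le> norm (cmod (char_quot t - \<kappa> t) * freq_weight q t + cmod (\<kappa> t) + 2 * ?g)"
        by (simp add: norm_mult)
    qed
  qed measurable
  have intKF: "integrable lborel (\<lambda>t. \<kappa> t * F t)"
  proof (rule Bochner_Integration.integrable_bound)
    show "integrable lborel (\<lambda>t. cmod (\<kappa> t) * C_norm q 0 f)" using kap by simp
    show "AE t in lborel. norm (\<kappa> t * F t) \<le> norm (cmod (\<kappa> t) * C_norm q 0 f)"
      using Fb' C0 by (auto simp: norm_mult intro!: mult_left_mono)
  qed measurable
  have intDF: "integrable lborel (\<lambda>t. (char_quot t - \<kappa> t) * F t)"
  proof (rule Bochner_Integration.integrable_bound)
    show "integrable lborel (\<lambda>t. (cmod (char_quot t - \<kappa> t) * freq_weight q t) * C_norm q 0 f)" using int by simp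
    show "AE t in lborel. norm ((char_quot t - \<kappa> t) * F t) \<le> norm ((cmod (char_quot t - \<kappa> t) * freq_weight q t) * C_norm q 0 f)"
    proof (rule AE_I2)
      fix t
      have "cmod (char_quot t - \<kappa> t) * cmod (F t) \<le> cmod (char_quot t - \<kappa> t) * (C_norm q 0 f * freq_weight q t)"
        by (intro mult_left_mono Fb) auto
      then show "norm ((char_quot t - \<kappa> t) * F t) \<le> norm ((cmod (char_quot t - \<kappa> t) * freq_weight q t) * C_norm q 0 f)"
        using C0 freq_weight_nonneg[of q t] by (simp add: norm_mult abs_mult mult_ac)
    qed
  qed measurable
  have intQF: "integrable lborel (\<lambda>t. char_quot t * F t)"
    using Bochner_Integration.integrable_add[OF intDF intKF] by (simp add: algebra_simps)
  have shift: "integrable lborel (\<lambda>t. iexp (- (t * z)) * g t)" if "integrable lborel g" for g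
    by (rule Bochner_Integration.integrable_bound[OF that]) (use that in \<open>auto simp: norm_mult\<close>)
  have 1: "complex_of_real (LINT y|lborel. cdf_diff (z + y) * f y) = (LINT t|lborel. iexp (- (t * z)) * (char_quot t * F t)) / (2 * pi)"
    using integral_cdf_diff[OF f_int intE, of z] intQF unfolding F_def by simp
  have 2: "(LINT y|lborel. T (z + y) * f y) = (LINT t|lborel. iexp (- (t * z)) * (\<kappa> t * F t)) / (2 * pi)"
  proof -
    have "(LINT y|lborel. T (z + y) * f y) = (LINT y|lborel. (LINT t|lborel. iexp (- (t * (z + y))) * \<kappa> t * f y) / (2 * pi))"
      unfolding T by (intro Bochner_Integration.integral_cong refl) simp
    also have "\<dots> = (LINT y|lborel. LINT t|lborel. iexp (- (t * (z + y))) * \<kappa> t * f y) / (2 * pi)" by simp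
    also have "(LINT y|lborel. LINT t|lborel. iexp (- (t * (z + y))) * \<kappa> t * f y) = (LINT t|lborel. LINT y|lborel. iexp (- (t * (z + y))) * \<kappa> t * f y)"
    proof (rule lborel_pair.Fubini_dominated[where g = "\<lambda>y. \<bar>f y\<bar>" and h = "\<lambda>t. cmod (\<kappa> t)"])
      show "integrable lborel (\<lambda>t. cmod (\<kappa> t))" by (rule integrable_norm[OF kap])
    qed (use f_int in \<open>auto simp: norm_mult\<close>)
    also have "\<dots> = (LINT t|lborel. iexp (- (t * z)) * (\<kappa> t * F t))"
    proof (rule Bochner_Integration.integral_cong[OF refl])
      fix t
      have "(LINT y|lborel. iexp (- (t * (z + y))) * \<kappa> t * f y) = (LINT y|lborel. (iexp (- (t * z)) * \<kappa> t) * (iexp (- (t * y)) * f y))"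
      proof (intro Bochner_Integration.integral_cong refl)
        fix y
        have "iexp (- (t * (z + y))) = iexp (- (t * z)) * iexp (- (t * y))" by (simp add: algebra_simps flip: exp_add)
        then show "iexp (- (t * (z + y))) * \<kappa> t * f y = (iexp (- (t * z)) * \<kappa> t) * (iexp (- (t * y)) * f y)"
          by (simp only: mult_ac)
      qed
      also have "\<dots> = (iexp (- (t * z)) * \<kappa> t) * F t" unfolding F_def by (rule integral_mult_right_zero)
      finally show "(LINT y|lborel. iexp (- (t * (z + y))) * \<kappa> t * f y) = iexp (- (t * z)) * (\<kappa> t * F t)" by (simp only: mult.assoc)
    qed
    finally show ?thesis .
  qed
  have "complex_of_real (LINT y|lborel. cdf_diff (z + y) * f y) - (LINT y|lborel. T (z + y) * f y)
      = (LINT t|lborel. iexp (- (t * z)) * (char_quot t * F t) - iexp (- (t * z)) * (\<kappa> t * F t)) / (2 * pi)"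
    unfolding 1 2 by (subst Bochner_Integration.integral_diff[OF shift[OF intQF] shift[OF intKF]]) (simp add: diff_divide_distrib)
  also have "cmod \<dots> \<le> (LINT t|lborel. cmod (iexp (- (t * z)) * (char_quot t * F t) - iexp (- (t * z)) * (\<kappa> t * F t))) / (2 * pi)"
  proof -
    have n: "cmod (complex_of_real (2 * pi)) = 2 * pi" by simp
    show ?thesis unfolding norm_divide n by (intro divide_right_mono integral_norm_bound) simp
  qed
  also have "\<dots> \<le> (LINT t|lborel. C_norm q 0 f * (cmod (char_quot t - \<kappa> t) * freq_weight q t)) / (2 * pi)"
  proof (intro divide_right_mono integral_mono)
    show "integrable lborel (\<lambda>t. cmod (iexp (- (t * z)) * (char_quot t * F t) - iexp (- (t * z)) * (\<kappa> t * F t)))"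
      by (intro integrable_norm Bochner_Integration.integrable_diff shift intQF intKF)
    show "integrable lborel (\<lambda>t. C_norm q 0 f * (cmod (char_quot t - \<kappa> t) * freq_weight q t))" using int by simp
    fix t
    have "iexp (- (t * z)) * (char_quot t * F t) - iexp (- (t * z)) * (\<kappa> t * F t) = iexp (- (t * z)) * ((char_quot t - \<kappa> t) * F t)"
      by (simp add: algebra_simps)
    then have "cmod (iexp (- (t * z)) * (char_quot t * F t) - iexp (- (t * z)) * (\<kappa> t * F t)) = cmod (char_quot t - \<kappa> t) * cmod (F t)"
      by (simp add: norm_mult)
    also have "\<dots> \<le> cmod (char_quot t - \<kappa> t) * (C_norm q 0 f * freq_weight q t)" by (intro mult_left_mono Fb) auto
    finally show "cmod (iexp (- (t * z)) * (char_quot t * F t) - iexp (- (t * z)) * (\<kappa> t * F t)) \<le> C_norm q 0 f * (cmod (char_quot t - \<kappa> t) * freq_weight q t)"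
      by (simp add: mult_ac)
  qed simp
  finally show ?thesis by simp
qed

section \<open>Inverse transforms of polynomials times a Gaussian\<close>

lemma integrable_gauss_poly:
  fixes B :: "complex poly"
  assumes v: "v > 0"
  shows "integrable lborel (\<lambda>t. poly B (complex_of_real t) * complex_of_real (exp (- v * t\<^sup>2 / 2)))"
proof -
  have eq: "- v * t\<^sup>2 / 2 = - (sqrt v * t)\<^sup>2 / 2" for t using v by (simp add: power_mult_distrib)
  have 1: "integrable lborel (\<lambda>t. t ^ k * exp (- v * t\<^sup>2 / 2))" for k
  proof -
    have "integrable lborel (\<lambda>t. (sqrt (2 * pi) / sqrt v) * (normal_density 0 (1 / sqrt v) t * (t - 0) ^ k))"
      using v by (intro integrable_mult_right integrable_normal_moment) simp
    then show ?thesis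
      unfolding eq gauss_eq_normal_density[OF real_sqrt_gt_zero[OF v]] by (simp add: mult_ac)
  qed
  have "integrable lborel (\<lambda>t. \<Sum>i\<le>degree B. coeff B i * complex_of_real (t ^ i * exp (- v * t\<^sup>2 / 2)))"
    by (intro Bochner_Integration.integrable_sum integrable_mult_right integrable_of_real 1)
  then show ?thesis by (simp add: poly_altdef sum_distrib_right mult.assoc)
qed

text \<open>The polynomials are Hermite polynomials up to scaling and powers of \<open>\<i>\<close>.
  They come from the three-term recursion obtained by transforming the derivative of
  \<open>t^k\<close> times the Gaussian.\<close>

lemma gauss_moment_transform:
  assumes v: "v > 0"
  shows "\<exists>P :: complex poly. \<forall>x. (LINT t|lborel. iexp (- (t * x)) * (complex_of_real t ^ k * complex_of_real (exp (- v * t\<^sup>2 / 2)))) = poly P (complex_of_real x) * complex_of_real (nfrak v x)"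
proof -
  let ?E = "\<lambda>t. complex_of_real (exp (- v * t\<^sup>2 / 2))"
  define I where "I k x = (LINT t|lborel. iexp ((- x) * t) * (complex_of_real t ^ k * ?E t))" for k :: nat and x :: real
  have int: "integrable lborel (\<lambda>t. complex_of_real t ^ k * ?E t)" for k
    using integrable_gauss_poly[OF v, of "monom 1 k"] by (simp add: poly_monom)
  have int': "integrable lborel (\<lambda>t. iexp ((- x) * t) * (complex_of_real t ^ k * ?E t))" for k x
    by (rule Bochner_Integration.integrable_bound[OF int[of k]]) (auto simp: norm_mult)
  have base: "I 0 x = complex_of_real (2 * pi * nfrak v x)" for x
  proof -
    have eq: "- v * t\<^sup>2 / 2 = - (sqrt v * t)\<^sup>2 / 2" for t using v by (simp add: power_mult_distrib)
    have "complex_of_real (normal_density 0 (sqrt v) x) = I 0 x / (2 * pi)"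
      unfolding I_def eq using gauss_inversion[OF real_sqrt_gt_zero[OF v], of x] by (simp add: mult.commute)
    moreover have "normal_density 0 (sqrt v) x = nfrak v x" using v by (simp add: normal_density_def nfrak_def)
    ultimately show ?thesis by (simp add: field_simps)
  qed
  \<comment> \<open>For \<open>k = 0\<close> the index \<open>k - 1\<close> is truncated to 0, but
    the term carries the factor \<open>k = 0\<close>.\<close>
  have rec: "v * I (Suc k) x = - (\<i> * x) * I k x + k * I (k - 1) x" for k x
  proof -
    define g where "g t = complex_of_real t ^ k * ?E t" for t
    define g' where "g' t = of_nat k * (complex_of_real t ^ (k - 1) * ?E t) - v * (complex_of_real t ^ Suc k * ?E t)" for t
    have der: "(g has_vector_derivative g' t) (at t)" for t
    proof -
      have "((\<lambda>t. t ^ k * exp (- v * t\<^sup>2 / 2)) has_real_derivative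
          real k * t ^ (k - 1) * exp (- v * t\<^sup>2 / 2) + t ^ k * (exp (- v * t\<^sup>2 / 2) * (- v * t))) (at t)"
        by (auto intro!: derivative_eq_intros)
      then have "((\<lambda>t. complex_of_real (t ^ k * exp (- v * t\<^sup>2 / 2))) has_vector_derivative
          complex_of_real (real k * t ^ (k - 1) * exp (- v * t\<^sup>2 / 2) + t ^ k * (exp (- v * t\<^sup>2 / 2) * (- v * t)))) (at t)"
        by (intro has_vector_derivative_of_real) (simp add: has_real_derivative_iff_has_vector_derivative)
      moreover have "(\<lambda>t. complex_of_real (t ^ k * exp (- v * t\<^sup>2 / 2))) = g" by (auto simp: g_def)
      moreover have "complex_of_real (real k * t ^ (k - 1) * exp (- v * t\<^sup>2 / 2) + t ^ k * (exp (- v * t\<^sup>2 / 2) * (- v * t))) = g' t"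
        by (simp add: g'_def algebra_simps)
      ultimately show ?thesis by simp
    qed
    have i1: "integrable lborel (\<lambda>t. of_nat k * (iexp ((- x) * t) * (complex_of_real t ^ (k - 1) * ?E t)))"
      and i2: "integrable lborel (\<lambda>t. v * (iexp ((- x) * t) * (complex_of_real t ^ Suc k * ?E t)))"
      by (intro integrable_mult_right int')+
    have "(LINT t|lborel. iexp ((- x) * t) * g' t) = - (\<i> * (- x)) * (LINT t|lborel. iexp ((- x) * t) * g t)"
    proof (rule fourier_derivative[OF der])
      show "continuous_on UNIV g'" unfolding g'_def by (intro continuous_intros) auto
      show "integrable lborel g" unfolding g_def by (rule int)
      show "integrable lborel g'" unfolding g'_def by (intro Bochner_Integration.integrable_diff integrable_mult_right int)
    qed
    also have "(LINT t|lborel. iexp ((- x) * t) * g t) = I k x" by (simp add: I_def g_def)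
    also have "(LINT t|lborel. iexp ((- x) * t) * g' t) = (LINT t|lborel. of_nat k * (iexp ((- x) * t) * (complex_of_real t ^ (k - 1) * ?E t)) - v * (iexp ((- x) * t) * (complex_of_real t ^ Suc k * ?E t)))"
      by (intro Bochner_Integration.integral_cong refl) (simp add: g'_def algebra_simps)
    also have "\<dots> = of_nat k * I (k - 1) x - v * I (Suc k) x"
      unfolding I_def Bochner_Integration.integral_diff[OF i1 i2] integral_mult_right_zero ..
    finally show ?thesis by (simp add: algebra_simps)
  qed
  have "\<exists>P :: complex poly. \<forall>x. I k x = poly P (complex_of_real x) * complex_of_real (nfrak v x)"
  proof (induction k rule: less_induct)
    case (less k)
    show ?case
    proof (cases k)
      case 0
      then show ?thesis using base by (intro exI[of _ "[:complex_of_real (2 * pi):]"]) simp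
    next
      case (Suc j)
      obtain P1 where P1: "\<And>x. I j x = poly P1 (complex_of_real x) * complex_of_real (nfrak v x)" using less[of j] Suc by auto
      obtain P2 where P2: "\<And>x. of_nat j * I (j - 1) x = poly P2 (complex_of_real x) * complex_of_real (nfrak v x)"
      proof (cases j)
        case 0 then show ?thesis using that[of 0] by simp
      next
        case (Suc i)
        then obtain P where "\<And>x. I i x = poly P (complex_of_real x) * complex_of_real (nfrak v x)" using less[of i] \<open>k = Suc j\<close> by auto
        then show ?thesis using that[of "smult (of_nat j) P"] Suc by simp
      qed
      have "I k x = poly (smult (1 / complex_of_real v) ([:0, - \<i>:] * P1 + P2)) (complex_of_real x) * complex_of_real (nfrak v x)" for x
      proof -
        have "v * I k x = poly ([:0, - \<i>:] * P1 + P2) (complex_of_real x) * complex_of_real (nfrak v x)"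
          unfolding Suc rec P1 P2 by (simp add: algebra_simps)
        then show ?thesis using v by (simp add: field_simps)
      qed
      then show ?thesis by blast
    qed
  qed
  then show ?thesis by (simp add: I_def mult.commute)
qed

lemma gauss_poly_transform:
  fixes B :: "complex poly"
  assumes v: "v > 0"
  shows "\<exists>P :: complex poly. \<forall>x. (LINT t|lborel. iexp (- (t * x)) * (poly B (complex_of_real t) * complex_of_real (exp (- v * t\<^sup>2 / 2)))) / (2 * pi) = poly P (complex_of_real x) * complex_of_real (nfrak v x)"
proof -
  let ?E = "\<lambda>t. complex_of_real (exp (- v * t\<^sup>2 / 2))"
  have "\<forall>k. \<exists>P :: complex poly. \<forall>x. (LINT t|lborel. iexp (- (t * x)) * (complex_of_real t ^ k * ?E t)) = poly P (complex_of_real x) * complex_of_real (nfrak v x)"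
    using gauss_moment_transform[OF v] by (rule allI)
  from choice[OF this] obtain P :: "nat \<Rightarrow> complex poly" where
    P: "(LINT t|lborel. iexp (- (t * x)) * (complex_of_real t ^ k * ?E t)) = poly (P k) (complex_of_real x) * complex_of_real (nfrak v x)" for k x
    by blast
  have int: "integrable lborel (\<lambda>t. iexp (- (t * x)) * (complex_of_real t ^ k * ?E t))" for x k
    by (rule Bochner_Integration.integrable_bound[OF integrable_gauss_poly[OF v, of "monom 1 k"]]) (auto simp: norm_mult poly_monom)
  have "(LINT t|lborel. iexp (- (t * x)) * (poly B (complex_of_real t) * ?E t)) / (2 * pi) =
      poly (smult (1 / complex_of_real (2 * pi)) (\<Sum>i\<le>degree B. smult (coeff B i) (P i))) (complex_of_real x) * complex_of_real (nfrak v x)" for x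
  proof -
    have "(LINT t|lborel. iexp (- (t * x)) * (poly B (complex_of_real t) * ?E t)) = (LINT t|lborel. (\<Sum>i\<le>degree B. coeff B i * (iexp (- (t * x)) * (complex_of_real t ^ i * ?E t))))"
      by (intro Bochner_Integration.integral_cong refl) (simp add: poly_altdef sum_distrib_left sum_distrib_right mult_ac)
    also have "\<dots> = (\<Sum>i\<le>degree B. LINT t|lborel. coeff B i * (iexp (- (t * x)) * (complex_of_real t ^ i * ?E t)))"
      by (rule Bochner_Integration.integral_sum) (intro integrable_mult_right int)
    also have "\<dots> = (\<Sum>i\<le>degree B. coeff B i * (poly (P i) (complex_of_real x) * complex_of_real (nfrak v x)))"
      unfolding integral_mult_right_zero P ..
    finally show ?thesis by (simp add: poly_sum sum_distrib_right sum_divide_distrib mult.assoc)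
  qed
  then show ?thesis by blast
qed

section \<open>The Edgeworth polynomials\<close>

text \<open>The principal logarithm is holomorphic near \<open>lam 0 = 1\<close>, and it turns
  \<open>N\<close>-th powers into multiples. The exponential form is restricted to a neighbourhood
  of 0, where \<open>lam\<close> has no zeros.\<close>

lemma log_expansion:
  fixes lam :: "real \<Rightarrow> complex"
  assumes "peano m lam" "lam 0 = 1"
  shows "\<exists>c \<eta> d. d > 0 \<and> isCont \<eta> 0 \<and> \<eta> 0 = 0 \<and> c 0 = 0 \<and>
    (\<forall>t. \<bar>t\<bar> < d \<longrightarrow> lam t = exp ((\<Sum>k\<le>m. complex_of_real t ^ k * c k) + complex_of_real t ^ m * \<eta> t))"
proof -
  have hol: "Ln holomorphic_on - \<real>\<^sub>\<le>\<^sub>0" by (intro holomorphic_intros) auto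
  have op: "open (- \<real>\<^sub>\<le>\<^sub>0 :: complex set)" by (simp add: open_Compl)
  have "peano m (\<lambda>t. Ln (lam t))" by (rule peano_holomorphic[OF hol op _ assms(1)]) (simp add: assms(2))
  then obtain c \<eta> where c: "isCont \<eta> 0" "\<eta> 0 = 0" "\<And>t. Ln (lam t) = (\<Sum>k\<le>m. t ^ k *\<^sub>R c k) + t ^ m *\<^sub>R \<eta> t"
    unfolding peano_iff_remainder by blast
  have "(\<Sum>k\<le>m. (0::real) ^ k *\<^sub>R c k) = c 0"
    by (subst sum.atMost_shift) (simp add: lessThan_Suc_atMost)
  then have c0: "c 0 = 0" using c(3)[of 0] c(2) assms(2) by simp
  obtain d where d: "d > 0" "\<And>t. dist t 0 < d \<Longrightarrow> dist (lam t) (lam 0) < 1"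
    using peano_isCont[OF assms(1)] unfolding continuous_at_eps_delta by (metis zero_less_one)
  have "lam t = exp ((\<Sum>k\<le>m. complex_of_real t ^ k * c k) + complex_of_real t ^ m * \<eta> t)" if "\<bar>t\<bar> < d" for t
  proof -
    have "lam t \<noteq> 0" using d(2)[of t] that assms(2) by (auto simp: dist_norm)
    then have "lam t = exp (Ln (lam t))" by simp
    then show ?thesis unfolding c(3) by (simp add: scaleR_conv_of_real)
  qed
  then show ?thesis using d(1) c(1,2) c0 by blast
qed

text \<open>The modulus at \<open>s = 1\<close> forces a vanishing real part; if the imaginary part
  were nonzero, \<open>s = pi / \<bar>Im u\<bar>\<close> would give the value -1. Only
  \<open>s \<ge> 0\<close> is assumed because \<open>s\<close> is a square when the second cumulant
  is identified.\<close>

lemma exp_mult_eq_1_imp_0: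
  fixes u :: complex
  assumes "\<And>s::real. s \<ge> 0 \<Longrightarrow> exp (u * of_real s) = 1"
  shows "u = 0"
proof -
  have "cmod (exp (u * of_real 1)) = 1" using assms[of 1] by simp
  then have re: "Re u = 0" by (simp add: norm_exp_eq_Re)
  show ?thesis
  proof (rule ccontr)
    assume "u \<noteq> 0"
    then have im: "Im u \<noteq> 0" using re by (simp add: complex_eq_iff)
    have "Re (exp (u * of_real (pi / \<bar>Im u\<bar>))) = -1"
      unfolding Re_exp using im re by (cases "Im u > 0") (simp_all add: abs_if)
    moreover have "exp (u * of_real (pi / \<bar>Im u\<bar>)) = 1" by (rule assms) simp
    ultimately show False by simp
  qed
qed

text \<open>Comparing the limit along \<open>N = n\<^sup>2\<close> and \<open>N = (n + 1)\<^sup>2\<close> forces the linear term to vanish.\<close>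

lemma cumulants_from_clt:
  fixes lam :: "real \<Rightarrow> complex" and c1 c2 :: complex
  assumes d: "d > 0" and lam: "\<And>t. \<bar>t\<bar> < d \<Longrightarrow> lam t = exp (t * c1 + t\<^sup>2 * c2 + t\<^sup>2 * \<eta> t)"
    and eta: "isCont \<eta> 0" "\<eta> 0 = 0"
    and lim: "\<And>t::real. (\<lambda>N. lam (t / sqrt (real N)) ^ N * iexp (- (sqrt (real N) * t * A))) \<longlonglongrightarrow> complex_of_real (exp (- v * t\<^sup>2 / 2))"
  shows "c1 = \<i> * complex_of_real A" "c2 = - complex_of_real v / 2"
proof -
  define w where "w = c1 - \<i> * complex_of_real A"
  define u where "u = - complex_of_real v / 2 - c2"
  \<comment> \<open>\<open>w\<close> and \<open>u\<close> are the discrepancies of the linear and of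
    the quadratic coefficient. Dividing the given limit by the quadratic part of \<open>lam\<close>
    leaves a relation between these two alone.\<close>
  have lim2: "(\<lambda>N. exp (sqrt (real N) * t * w)) \<longlonglongrightarrow> exp (u * t\<^sup>2)" for t :: real
  proof -
    have tz: "(\<lambda>N. t / sqrt (real N)) \<longlonglongrightarrow> 0" by real_asymp
    have e0: "(\<lambda>N. \<eta> (t / sqrt (real N))) \<longlonglongrightarrow> 0"
      using isCont_tendsto_compose[OF eta(1) tz] eta(2) by simp
    have "(\<lambda>N. exp (- (t\<^sup>2 * c2 + t\<^sup>2 * \<eta> (t / sqrt (real N))))) \<longlonglongrightarrow> exp (- (t\<^sup>2 * c2 + t\<^sup>2 * (0::complex)))"
      by (intro tendsto_intros e0)
    from tendsto_mult[OF lim[of t] this]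
    have "(\<lambda>N. lam (t / sqrt (real N)) ^ N * iexp (- (sqrt (real N) * t * A)) * exp (- (t\<^sup>2 * c2 + t\<^sup>2 * \<eta> (t / sqrt (real N)))))
        \<longlonglongrightarrow> complex_of_real (exp (- v * t\<^sup>2 / 2)) * exp (- (t\<^sup>2 * c2))" by simp
    also have "complex_of_real (exp (- v * t\<^sup>2 / 2)) * exp (- (t\<^sup>2 * c2)) = exp (u * t\<^sup>2)"
      unfolding exp_of_real[symmetric] exp_add[symmetric]
      by (rule arg_cong[of _ _ exp]) (simp add: u_def algebra_simps)
    finally have l: "(\<lambda>N. lam (t / sqrt (real N)) ^ N * iexp (- (sqrt (real N) * t * A)) * exp (- (t\<^sup>2 * c2 + t\<^sup>2 * \<eta> (t / sqrt (real N))))) \<longlonglongrightarrow> exp (u * t\<^sup>2)" .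
    have near: "\<forall>\<^sub>F N in sequentially. \<bar>t / sqrt (real N)\<bar> < d"
      using order_tendstoD(2)[OF tendsto_rabs[OF tz], of d] d by simp
    have "\<forall>\<^sub>F N in sequentially. lam (t / sqrt (real N)) ^ N * iexp (- (sqrt (real N) * t * A)) * exp (- (t\<^sup>2 * c2 + t\<^sup>2 * \<eta> (t / sqrt (real N)))) = exp (sqrt (real N) * t * w)"
      using near eventually_gt_at_top[of 0]
    proof eventually_elim
      case (elim N)
      define s where "s = sqrt (real N)"
      have s: "s > 0" "real N = s * s" using elim by (auto simp: s_def)
      have sN: "complex_of_nat N = of_real s * of_real s" using s(2) by (metis of_real_mult of_real_of_nat_eq)
      define y where "y = \<eta> (t / s)"
      have "lam (t / s) ^ N = exp (of_nat N * (complex_of_real (t / s) * c1 + (t / s)\<^sup>2 * c2 + (t / s)\<^sup>2 * y))"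
        unfolding y_def exp_of_nat_mult using lam[of "t / s"] elim by (simp add: s_def)
      also have "of_nat N * (complex_of_real (t / s) * c1 + (t / s)\<^sup>2 * c2 + (t / s)\<^sup>2 * y) = s * t * c1 + (t\<^sup>2 * c2 + t\<^sup>2 * y)"
        unfolding sN using s(1) by (simp add: field_simps power2_eq_square)
      finally have L: "lam (t / s) ^ N = exp (s * t * c1 + (t\<^sup>2 * c2 + t\<^sup>2 * y))" .
      have "s * t * c1 + (t\<^sup>2 * c2 + t\<^sup>2 * y) + \<i> * complex_of_real (- (s * t * A)) + - (t\<^sup>2 * c2 + t\<^sup>2 * y) = s * t * w"
        by (simp add: w_def algebra_simps)
      then show ?case unfolding s_def[symmetric] y_def[symmetric] L exp_add[symmetric] by (simp only:)
    qed
    then show ?thesis using l by (rule Lim_transform_eventually[rotated])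
  qed
  have "exp (w * of_real t) = 1" for t :: real
  proof -
    have sq: "filterlim (\<lambda>n::nat. n * n) sequentially sequentially"
      by (rule filterlim_at_top_mono[OF filterlim_ident]) (auto simp: eventually_sequentially intro!: exI[of _ 1])
    have "(\<lambda>n. exp (sqrt (real (n * n)) * t * w)) \<longlonglongrightarrow> exp (u * t\<^sup>2)"
      using filterlim_compose[OF lim2[of t] sq] by simp
    then have a: "(\<lambda>n. exp (real n * t * w)) \<longlonglongrightarrow> exp (u * t\<^sup>2)" by simp
    then have "(\<lambda>n. exp (real (Suc n) * t * w)) \<longlonglongrightarrow> exp (u * t\<^sup>2)" by (rule LIMSEQ_Suc)
    moreover have "(\<lambda>n. exp (real (Suc n) * t * w)) = (\<lambda>n. exp (real n * t * w) * exp (w * t))"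
      by (auto simp: algebra_simps simp flip: exp_add)
    ultimately have "(\<lambda>n. exp (real n * t * w) * exp (w * t)) \<longlonglongrightarrow> exp (u * t\<^sup>2)" by simp
    moreover have "(\<lambda>n. exp (real n * t * w) * exp (w * t)) \<longlonglongrightarrow> exp (u * t\<^sup>2) * exp (w * t)" by (rule tendsto_mult[OF a tendsto_const])
    ultimately have "exp (u * t\<^sup>2) = exp (u * t\<^sup>2) * exp (w * t)" by (rule LIMSEQ_unique)
    then show ?thesis by simp
  qed
  then have w0: "w = 0" by (rule exp_mult_eq_1_imp_0)
  then show "c1 = \<i> * complex_of_real A" by (simp add: w_def)
  have "exp (u * of_real s) = 1" if "s \<ge> 0" for s :: real
  proof -
    have "(\<lambda>N::nat. 1) \<longlonglongrightarrow> exp (u * complex_of_real ((sqrt s)\<^sup>2))" using lim2[of "sqrt s"] by (simp add: w0)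
    from LIMSEQ_unique[OF tendsto_const this] show ?thesis using that by simp
  qed
  then have "u = 0" by (rule exp_mult_eq_1_imp_0)
  then show "c2 = - complex_of_real v / 2" by (simp add: u_def algebra_simps)
qed

lemma poly_growth:
  fixes p :: "complex poly"
  shows "\<exists>K\<ge>0. \<forall>x::real. cmod (poly p (of_real x)) \<le> K * (1 + \<bar>x\<bar>) ^ degree p"
proof -
  have "cmod (poly p (of_real x)) \<le> (\<Sum>i\<le>degree p. cmod (coeff p i)) * (1 + \<bar>x\<bar>) ^ degree p" for x :: real
  proof -
    have "cmod (poly p (of_real x)) \<le> (\<Sum>i\<le>degree p. cmod (coeff p i * of_real x ^ i))"
      unfolding poly_altdef by (rule norm_sum)
    also have "\<dots> \<le> (\<Sum>i\<le>degree p. cmod (coeff p i) * (1 + \<bar>x\<bar>) ^ degree p)"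
    proof (rule sum_mono)
      fix i assume i: "i \<in> {..degree p}"
      have "\<bar>x\<bar> ^ i \<le> (1 + \<bar>x\<bar>) ^ i" by (rule power_mono) auto
      also have "\<dots> \<le> (1 + \<bar>x\<bar>) ^ degree p" using i by (intro power_increasing) auto
      finally show "cmod (coeff p i * of_real x ^ i) \<le> cmod (coeff p i) * (1 + \<bar>x\<bar>) ^ degree p"
        by (simp add: norm_mult norm_power mult_left_mono)
    qed
    finally show ?thesis by (simp add: sum_distrib_right)
  qed
  then show ?thesis by (intro exI[of _ "\<Sum>i\<le>degree p. cmod (coeff p i)"]) (auto intro: sum_nonneg)
qed

definition eval2 :: "complex poly poly \<Rightarrow> complex \<Rightarrow> complex \<Rightarrow> complex" where
  "eval2 P x h = poly (poly P [:h:]) x"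

lemma eval2_mult: "eval2 (P * Q) x h = eval2 P x h * eval2 Q x h"
  and eval2_sum: "eval2 (sum F A) x h = (\<Sum>i\<in>A. eval2 (F i) x h)"
  and eval2_smult: "eval2 (smult q P) x h = poly q x * eval2 P x h"
  and eval2_power: "eval2 (P ^ n) x h = eval2 P x h ^ n"
  by (simp_all add: eval2_def poly_sum poly_power)

lemma eval2_altdef: "eval2 P x h = (\<Sum>i\<le>degree P. poly (coeff P i) x * h ^ i)"
proof -
  have "poly ([:h:] ^ i) x = h ^ i" for i by (simp add: poly_power)
  then show ?thesis unfolding eval2_def poly_altdef[of P] by (simp add: poly_sum)
qed

lemma eval2_monom: "eval2 (monom (monom c i) j) x h = c * x ^ i * h ^ j"
  by (simp add: eval2_def poly_monom poly_power)

text \<open>The polynomials \<open>a p\<close> collect, order by order in \<open>h = N\<^sup>-\<^sup>1\<^sup>/\<^sup>2\<close>, the product of the truncated exponential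
  of the higher cumulants and of the expansion of \<open>Z\<close>; outer variable \<open>h\<close>, inner variable \<open>x\<close>.\<close>

lemma edgeworth_polynomials:
  fixes c z :: "nat \<Rightarrow> complex"
  assumes z0: "z 0 = 1"
  shows "\<exists>(a :: nat \<Rightarrow> complex poly) K m. K \<ge> 0 \<and> (\<forall>(x::real) (h::real). 0 \<le> h \<longrightarrow> h \<le> 1 \<longrightarrow>
    cmod ((\<Sum>j\<le>r. (\<Sum>i=1..r. c i * complex_of_real x ^ (i + 2) * complex_of_real h ^ i) ^ j / fact j) *
        (\<Sum>k\<le>r. z k * complex_of_real x ^ k * complex_of_real h ^ k)
      - (1 + (\<Sum>p=1..r. complex_of_real h ^ p * (complex_of_real x * poly (a p) (complex_of_real x))))) \<le> h ^ (r + 1) * \<bar>x\<bar> * K * (1 + \<bar>x\<bar>) ^ m)"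
proof -
  define G where "G = (\<Sum>i=1..r. monom (monom (c i) (i + 2)) i)"
  define Zp where "Zp = (\<Sum>k\<le>r. monom (monom (z k) k) k)"
  define P where "P = (\<Sum>j\<le>r. smult [:1 / fact j:] (G ^ j)) * Zp"
  have evG: "eval2 G x h = (\<Sum>i=1..r. c i * x ^ (i + 2) * h ^ i)" for x h
    by (simp add: G_def eval2_sum eval2_monom)
  have evZ: "eval2 Zp x h = (\<Sum>k\<le>r. z k * x ^ k * h ^ k)" for x h
    by (simp add: Zp_def eval2_sum eval2_monom)
  have evP: "eval2 P x h = (\<Sum>j\<le>r. eval2 G x h ^ j / fact j) * eval2 Zp x h" for x h
    by (simp add: P_def eval2_mult eval2_sum eval2_smult eval2_power)
  have e0: "(\<Sum>j\<le>r. (0::complex) ^ j / fact j) = 1"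
    by (subst sum.atMost_shift) simp
  have Z00: "(\<Sum>k\<le>r. z k * x ^ k * h ^ k) = 1" if "x = 0 \<or> h = 0" for x h
    using that z0 by (subst sum.atMost_shift) auto
  have P_h0: "eval2 P x 0 = 1" for x
  proof -
    have "eval2 G x 0 = 0" unfolding evG by (rule sum.neutral) auto
    then show ?thesis using e0 Z00[of x 0] by (simp add: evP evZ)
  qed
  have P_x0: "eval2 P 0 h = 1" for h
  proof -
    have "eval2 G 0 h = 0" unfolding evG by (rule sum.neutral) auto
    then show ?thesis using e0 Z00[of 0 h] by (simp add: evP evZ)
  qed
  have coeff0: "poly (coeff P 0) x = 1" for x
  proof -
    have "eval2 P x 0 = poly (coeff P 0) x" by (simp add: eval2_def poly_0_coeff_0)
    then show ?thesis using P_h0 by simp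
  qed
  \<comment> \<open>At \<open>x = 0\<close> the whole expression is 1 for every \<open>h\<close>, so
    each coefficient of \<open>h^p\<close> with \<open>p \<ge> 1\<close> vanishes there and is
    divisible by \<open>x\<close>. This is the factor that later absorbs the division by
    \<open>t\<close>.\<close>
  have coeffp: "poly (coeff P p) 0 = 0" if "p \<ge> 1" for p
  proof -
    define Q where "Q = (\<Sum>i\<le>degree P. monom (poly (coeff P i) 0) i)"
    have "poly Q h = poly 1 h" for h
      using P_x0[of h] by (simp add: Q_def poly_sum poly_monom eval2_altdef)
    then have "poly Q = poly 1" by (rule ext)
    then have "Q = 1" by (simp only: poly_eq_poly_eq_iff)
    then have "coeff Q p = 0" using that by simp
    moreover have "coeff Q p = (if p \<le> degree P then poly (coeff P p) 0 else 0)"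
      by (simp add: Q_def coeff_sum)
    ultimately show ?thesis by (auto split: if_splits simp: coeff_eq_0)
  qed
  then have "\<exists>q. coeff P p = [:0, 1:] * q" if "p \<ge> 1" for p
    using that poly_eq_0_iff_dvd[of "coeff P p" 0] by (auto simp: dvd_def)
  then obtain a where a: "\<And>p. p \<ge> 1 \<Longrightarrow> coeff P p = [:0, 1:] * a p" by metis
  have "\<forall>p. \<exists>k::real. k \<ge> 0 \<and> (\<forall>x::real. cmod (poly (a p) (of_real x)) \<le> k * (1 + \<bar>x\<bar>) ^ degree (a p))"
    using poly_growth by blast
  from choice[OF this] obtain Kp :: "nat \<Rightarrow> real"
    where Kp: "\<And>p. Kp p \<ge> 0" "\<And>p x. cmod (poly (a p) (of_real x)) \<le> Kp p * (1 + \<bar>x\<bar>) ^ degree (a p)" by blast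
  \<comment> \<open>Padding by \<open>r\<close> makes the range contain \<open>1..r\<close> whatever
    the degree of \<open>P\<close> is; coefficients beyond the degree are 0.\<close>
  define D where "D = degree P + r"
  define m where "m = Max ((\<lambda>p. degree (a p)) ` {..D})"
  define K where "K = (\<Sum>p\<le>D. Kp p)"
  have K0: "K \<ge> 0" unfolding K_def using Kp by (intro sum_nonneg) auto
  have evD: "eval2 P x h = (\<Sum>p\<le>D. poly (coeff P p) x * h ^ p)" for x h
    unfolding eval2_altdef by (rule sum.mono_neutral_left) (auto simp: D_def coeff_eq_0)
  have main: "cmod (eval2 P (complex_of_real x) (complex_of_real h) - (1 + (\<Sum>p=1..r. complex_of_real h ^ p * (complex_of_real x * poly (a p) (complex_of_real x))))) \<le> h ^ (r + 1) * \<bar>x\<bar> * K * (1 + \<bar>x\<bar>) ^ m"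
    if h: "0 \<le> h" "h \<le> 1" for x h :: real
  proof -
    have split: "{..D} = insert 0 {1..r} \<union> {r+1..D}" by (auto simp: D_def)
    have "eval2 P (complex_of_real x) (complex_of_real h) = (\<Sum>p\<in>insert 0 {1..r}. poly (coeff P p) (of_real x) * of_real h ^ p) + (\<Sum>p=r+1..D. poly (coeff P p) (of_real x) * of_real h ^ p)"
      unfolding evD split by (rule sum.union_disjoint) auto
    also have "(\<Sum>p\<in>insert 0 {1..r}. poly (coeff P p) (of_real x) * of_real h ^ p) = 1 + (\<Sum>p=1..r. poly (coeff P p) (of_real x) * of_real h ^ p)"
      by (simp add: coeff0)
    also have "(\<Sum>p=1..r. poly (coeff P p) (of_real x) * of_real h ^ p) = (\<Sum>p=1..r. complex_of_real h ^ p * (complex_of_real x * poly (a p) (complex_of_real x)))"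
      by (intro sum.cong refl) (simp add: a)
    finally have "eval2 P (complex_of_real x) (complex_of_real h) - (1 + (\<Sum>p=1..r. complex_of_real h ^ p * (complex_of_real x * poly (a p) (complex_of_real x)))) = (\<Sum>p=r+1..D. poly (coeff P p) (of_real x) * of_real h ^ p)"
      by simp
    also have "cmod \<dots> \<le> (\<Sum>p=r+1..D. h ^ (r + 1) * \<bar>x\<bar> * Kp p * (1 + \<bar>x\<bar>) ^ m)"
    proof (rule sum_norm_le)
      fix p assume p: "p \<in> {r+1..D}"
      have "cmod (poly (coeff P p) (of_real x) * of_real h ^ p) = (\<bar>x\<bar> * cmod (poly (a p) (of_real x))) * h ^ p"
        using p h by (simp add: a norm_mult norm_power)
      also have "\<dots> \<le> (\<bar>x\<bar> * (Kp p * (1 + \<bar>x\<bar>) ^ m)) * h ^ (r + 1)"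
      proof (intro mult_mono mult_left_mono)
        have "degree (a p) \<le> m" unfolding m_def using p by (intro Max_ge) auto
        then have "(1 + \<bar>x\<bar>) ^ degree (a p) \<le> (1 + \<bar>x\<bar>) ^ m" by (intro power_increasing) auto
        then show "cmod (poly (a p) (of_real x)) \<le> Kp p * (1 + \<bar>x\<bar>) ^ m"
          using Kp(2)[of p x] mult_left_mono[OF _ Kp(1)[of p]] order_trans by blast
        show "h ^ p \<le> h ^ (r + 1)" using p h by (intro power_decreasing) auto
      qed (use h Kp in auto)
      finally show "cmod (poly (coeff P p) (of_real x) * of_real h ^ p) \<le> h ^ (r + 1) * \<bar>x\<bar> * Kp p * (1 + \<bar>x\<bar>) ^ m"
        by (simp only: mult_ac)
    qed
    also have "\<dots> = h ^ (r + 1) * \<bar>x\<bar> * (\<Sum>p=r+1..D. Kp p) * (1 + \<bar>x\<bar>) ^ m"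
      by (simp add: sum_distrib_left sum_distrib_right)
    also have "\<dots> \<le> h ^ (r + 1) * \<bar>x\<bar> * K * (1 + \<bar>x\<bar>) ^ m"
      unfolding K_def using h Kp by (intro mult_right_mono mult_left_mono sum_mono2) auto
    finally show ?thesis .
  qed
  show ?thesis
    using main K0 unfolding evP evG evZ by (intro exI[of _ a] exI[of _ K] exI[of _ m] conjI allI impI)
qed

lemma norm_exp_minus_1_le:
  fixes w :: complex
  shows "cmod (exp w - 1) \<le> exp (cmod w) * cmod w"
proof -
  have "cmod (exp w - 1) \<le> exp \<bar>Re w\<bar> * cmod w" using Taylor_exp[of w 0] by simp
  also have "\<dots> \<le> exp (cmod w) * cmod w" by (intro mult_right_mono) (auto simp: abs_Re_le_cmod)
  finally show ?thesis .
qed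

lemma norm_exp_taylor_le:
  fixes g :: complex
  shows "cmod (exp g - (\<Sum>j\<le>r. g ^ j / fact j)) \<le> exp (cmod g) * cmod g ^ Suc r"
proof -
  have "cmod (exp g - (\<Sum>j\<le>r. g ^ j / fact j)) \<le> exp \<bar>Re g\<bar> * cmod g ^ Suc r / fact r" by (rule Taylor_exp)
  also have "\<dots> \<le> exp \<bar>Re g\<bar> * cmod g ^ Suc r / 1" by (intro divide_left_mono fact_ge_1) auto
  also have "\<dots> \<le> exp (cmod g) * cmod g ^ Suc r" by (simp, intro mult_right_mono) (auto simp: abs_Re_le_cmod)
  finally show ?thesis .
qed

text \<open>The argument \<open>t\<close> is the frequency of the unnormalised sum and
  \<open>x\<close> that of the normalised one; the summand 1 belongs to the limiting
  Gaussian.\<close>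

definition edgeworth_ft :: "real \<Rightarrow> (nat \<Rightarrow> complex poly) \<Rightarrow> nat \<Rightarrow> nat \<Rightarrow> real \<Rightarrow> complex" where
  "edgeworth_ft v a r N t = (let x = sqrt (real N) * t in complex_of_real (exp (- v * x\<^sup>2 / 2)) *
     (1 + (\<Sum>p=1..r. complex_of_real (1 / sqrt (real N)) ^ p * (complex_of_real x * poly (a p) (complex_of_real x)))))"

text \<open>In terms of \<open>x = sqrt N * t\<close> and \<open>h = 1 / sqrt N\<close>, the centred
  \<open>N\<close>-th power is \<open>exp (- v * x\<^sup>2 / 2 + g + w)\<close>, where
  \<open>g\<close> collects the higher cumulants and \<open>w\<close> the Taylor remainder. For
  small \<open>t\<close>, \<open>|g| + |w| \<le> v * x\<^sup>2 / 4\<close>, so half of the Gaussian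
  exponent pays for bounding the exponentials. Each error is then \<open>\<epsilon> * h^r\<close>
  times a polynomial in \<open>|x|\<close> with a factor \<open>|x|\<close>; for the remainder of
  \<open>Z\<close>, this factor comes from \<open>|x|^r\<close> and
  \<open>r \<ge> 1\<close>.\<close>

lemma edgeworth_local:
  fixes lam Z \<eta> \<zeta> :: "real \<Rightarrow> complex" and c z :: "nat \<Rightarrow> complex" and A v d0 :: real
  assumes v: "v > 0" and r: "r \<ge> 1" and d0: "d0 > 0"
    and lam: "\<And>t. \<bar>t\<bar> < d0 \<Longrightarrow> lam t = exp (\<i> * complex_of_real (A * t) - complex_of_real (v * t\<^sup>2 / 2) +
        (\<Sum>i=1..r. c i * complex_of_real t ^ (i + 2)) + complex_of_real t ^ (r + 2) * \<eta> t)"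
    and eta: "isCont \<eta> 0" "\<eta> 0 = 0"
    and Z: "\<And>t. Z t = (\<Sum>k\<le>r. z k * complex_of_real t ^ k) + complex_of_real t ^ r * \<zeta> t"
    and zeta: "isCont \<zeta> 0" "\<zeta> 0 = 0" and z0: "z 0 = 1"
  shows "\<exists>(a :: nat \<Rightarrow> complex poly) K m. K \<ge> 0 \<and> (\<forall>\<epsilon>>0. \<exists>\<delta>>0. \<exists>N1. \<forall>N\<ge>N1. \<forall>t. \<bar>t\<bar> \<le> \<delta> \<longrightarrow>
    cmod (lam t ^ N * Z t * iexp (- (real N * A * t)) - edgeworth_ft v a r N t)
      \<le> \<epsilon> * (1 / sqrt (real N)) ^ r * \<bar>sqrt (real N) * t\<bar> * K * (1 + \<bar>sqrt (real N) * t\<bar>) ^ m * exp (- v * (sqrt (real N) * t)\<^sup>2 / 4))"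
proof -
  obtain a :: "nat \<Rightarrow> complex poly" and K4 m4 where K4: "K4 \<ge> 0" and T4: "\<And>(x::real) (h::real). 0 \<le> h \<Longrightarrow> h \<le> 1 \<Longrightarrow>
    cmod ((\<Sum>j\<le>r. (\<Sum>i=1..r. c i * complex_of_real x ^ (i + 2) * complex_of_real h ^ i) ^ j / fact j) *
        (\<Sum>k\<le>r. z k * complex_of_real x ^ k * complex_of_real h ^ k)
      - (1 + (\<Sum>p=1..r. complex_of_real h ^ p * (complex_of_real x * poly (a p) (complex_of_real x))))) \<le> h ^ (r + 1) * \<bar>x\<bar> * K4 * (1 + \<bar>x\<bar>) ^ m4"
    using edgeworth_polynomials[where c = c and z = z and r = r, OF z0] by blast
  define Cg where "Cg = (\<Sum>i=1..r. cmod (c i))"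
  define Cz where "Cz = (\<Sum>k\<le>r. cmod (z k))"
  have Cg: "Cg \<ge> 0" and Cz: "Cz \<ge> 0" by (auto simp: Cg_def Cz_def intro: sum_nonneg)
  define K where "K = (Cz + 1) + 1 + Cg ^ (r + 1) * Cz + K4"
  \<comment> \<open>\<open>3 * r + 3\<close> is the power of \<open>|x|\<close> in
    \<open>|g|^(r+1)\<close>, since \<open>|g|\<close> is at most a constant times
    \<open>h * |x|^3\<close>; \<open>m4\<close> comes from the truncation in
    \<open>h\<close>.\<close>
  define m where "m = max (3 * r + 3) m4"
  have K: "K \<ge> 0" unfolding K_def using Cg Cz K4 by simp
  show ?thesis
  proof (rule exI[of _ a], rule exI[of _ K], rule exI[of _ m], intro conjI K allI impI)
    fix \<epsilon> :: real assume eps: "\<epsilon> > 0"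
    \<comment> \<open>\<open>v / 8\<close> keeps \<open>|w|\<close> below
      \<open>v * x\<^sup>2 / 8\<close>, and 1 keeps \<open>Z t\<close> bounded by
      \<open>Cz + 1\<close>.\<close>
    define e1 where "e1 = min \<epsilon> (min (v / 8) 1)"
    have e1: "e1 > 0" "e1 \<le> \<epsilon>" "e1 \<le> v / 8" "e1 \<le> 1" using eps v by (auto simp: e1_def)
    obtain d1 where d1: "d1 > 0" "\<And>t. \<bar>t\<bar> < d1 \<Longrightarrow> cmod (\<eta> t) < e1"
      using eta e1(1) unfolding continuous_at_eps_delta by (auto simp: dist_norm)
    obtain d2 where d2: "d2 > 0" "\<And>t. \<bar>t\<bar> < d2 \<Longrightarrow> cmod (\<zeta> t) < e1"
      using zeta e1(1) unfolding continuous_at_eps_delta by (auto simp: dist_norm)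
    \<comment> \<open>The last entry gives \<open>Cg * |t| \<le> v / 8\<close> and thus
      \<open>|g| \<le> v * x\<^sup>2 / 8\<close>; \<open>\<delta> \<le> 1\<close> lets powers of
      \<open>t\<close> be dropped.\<close>
    define \<delta> where "\<delta> = min (min (d0 / 2) (d1 / 2)) (min (d2 / 2) (min 1 (v / (8 * (Cg + 1)))))"
    have \<delta>: "\<delta> > 0" "\<delta> < d0" "\<delta> < d1" "\<delta> < d2" "\<delta> \<le> 1" "\<delta> \<le> v / (8 * (Cg + 1))"
      using d0 d1 d2 v Cg by (auto simp: \<delta>_def)
    \<comment> \<open>This size of \<open>N\<close> gives \<open>h \<le> \<epsilon>\<close>. The two
      truncation errors are of order \<open>h^(r+1)\<close>, and their extra factor \<open>h\<close>
      is turned into \<open>\<epsilon>\<close>.\<close>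
    obtain N1 :: nat where N1: "real N1 > 1 / \<epsilon>\<^sup>2 + 1" using reals_Archimedean2 by blast
    have "cmod (lam t ^ N * Z t * iexp (- (real N * A * t)) - edgeworth_ft v a r N t)
      \<le> \<epsilon> * (1 / sqrt (real N)) ^ r * \<bar>sqrt (real N) * t\<bar> * K * (1 + \<bar>sqrt (real N) * t\<bar>) ^ m * exp (- v * (sqrt (real N) * t)\<^sup>2 / 4)"
      if N: "N \<ge> N1" and t: "\<bar>t\<bar> \<le> \<delta>" for N t
    proof -
      define s where "s = sqrt (real N)"
      define h where "h = 1 / s"
      define x where "x = s * t"
      have Nbig: "real N > 1 / \<epsilon>\<^sup>2 + 1" using N1 N by linarith
      then have N0: "real N > 1" using eps by (smt (verit) zero_less_divide_1_iff zero_less_power)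
      have s: "s > 1" "s * s = real N" unfolding s_def using N0 by auto
      have h: "h > 0" "h \<le> 1" "s * h = 1" using s by (auto simp: h_def)
      have he: "h \<le> \<epsilon>"
      proof -
        have "(1 / \<epsilon>)\<^sup>2 \<le> s\<^sup>2" using Nbig s by (simp add: power2_eq_square[of s] power_divide)
        then have "1 / \<epsilon> \<le> s" by (rule power2_le_imp_le) (use s in simp)
        then show ?thesis using eps s by (simp add: h_def field_simps)
      qed
      have th: "t = h * x" using h by (simp add: x_def mult.assoc[symmetric] mult.commute)
      have abs_t: "\<bar>t\<bar> = h * \<bar>x\<bar>" using th h by (simp add: abs_mult)
      have t1: "\<bar>t\<bar> \<le> 1" using t \<delta> by linarith
      define y where "y = 1 + \<bar>x\<bar>"
      have y: "y \<ge> 1" "\<bar>x\<bar> \<le> y" by (auto simp: y_def)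
      have xpow: "\<bar>x\<bar> ^ i \<le> \<bar>x\<bar> * y ^ m" if i: "1 \<le> i" "i \<le> Suc m" for i
      proof -
        obtain j where j: "i = Suc j" using i by (cases i) auto
        have "\<bar>x\<bar> ^ j \<le> y ^ j" using y by (intro power_mono) auto
        also have "\<dots> \<le> y ^ m" using y i j by (intro power_increasing) auto
        finally show ?thesis unfolding j power_Suc by (intro mult_left_mono) auto
      qed
      define g where "g = (\<Sum>i=1..r. c i * complex_of_real x ^ (i + 2) * complex_of_real h ^ i)"
      define w where "w = complex_of_real (real N) * complex_of_real t ^ (r + 2) * \<eta> t"
      define Zr where "Zr = (\<Sum>k\<le>r. z k * complex_of_real x ^ k * complex_of_real h ^ k)"
      define Tr where "Tr = (\<Sum>j\<le>r. g ^ j / fact j)"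
      define Pr where "Pr = 1 + (\<Sum>p=1..r. complex_of_real h ^ p * (complex_of_real x * poly (a p) (complex_of_real x)))"
      have Nt: "complex_of_real (real N) * complex_of_real t ^ (i + 2) = complex_of_real x ^ (i + 2) * complex_of_real h ^ i" for i
      proof -
        have "real N * t ^ (i + 2) = x ^ (i + 2) * h ^ i"
        proof -
          have "real N * t ^ (i + 2) = (s * h) * (s * h) * (x ^ (i + 2) * h ^ i)"
            unfolding th s(2)[symmetric] by (simp add: power_mult_distrib algebra_simps)
          then show ?thesis by (simp add: h(3))
        qed
        then show ?thesis by (metis of_real_mult of_real_power)
      qed
      have w_eq: "w = complex_of_real x ^ (r + 2) * complex_of_real h ^ r * \<eta> t" unfolding w_def Nt ..
      have Zt: "Z t = Zr + complex_of_real t ^ r * \<zeta> t"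
        unfolding Z Zr_def by (simp add: th power_mult_distrib mult_ac)
      have main_eq: "lam t ^ N * iexp (- (real N * A * t)) = complex_of_real (exp (- v * x\<^sup>2 / 2)) * exp (g + w)"
      proof -
        have "lam t ^ N = exp (of_nat N * (\<i> * complex_of_real (A * t) - complex_of_real (v * t\<^sup>2 / 2) +
          (\<Sum>i=1..r. c i * complex_of_real t ^ (i + 2)) + complex_of_real t ^ (r + 2) * \<eta> t))"
          unfolding exp_of_nat_mult using lam[of t] t \<delta> by simp
        also have "of_nat N * (\<i> * complex_of_real (A * t) - complex_of_real (v * t\<^sup>2 / 2) +
          (\<Sum>i=1..r. c i * complex_of_real t ^ (i + 2)) + complex_of_real t ^ (r + 2) * \<eta> t)
          = \<i> * complex_of_real (real N * A * t) + complex_of_real (- v * x\<^sup>2 / 2) + (g + w)"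
        proof -
          have "of_nat N * (\<Sum>i=1..r. c i * complex_of_real t ^ (i + 2)) = g"
            unfolding g_def sum_distrib_left
          proof (rule sum.cong[OF refl])
            fix i
            have "of_nat N * (c i * complex_of_real t ^ (i + 2)) = c i * (complex_of_real (real N) * complex_of_real t ^ (i + 2))" by simp
            then show "of_nat N * (c i * complex_of_real t ^ (i + 2)) = c i * complex_of_real x ^ (i + 2) * complex_of_real h ^ i"
              unfolding Nt by simp
          qed
          note eqS = this
          have eqV: "of_nat N * complex_of_real (v * t\<^sup>2 / 2) = - complex_of_real (- v * x\<^sup>2 / 2)"
          proof -
            have "x\<^sup>2 = real N * t\<^sup>2" unfolding x_def s(2)[symmetric] by (simp add: power2_eq_square)
            then have "real N * (v * t\<^sup>2 / 2) = - (- v * x\<^sup>2 / 2)" by simp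
            then show ?thesis by (metis of_real_minus of_real_mult of_real_of_nat_eq)
          qed
          have eqA: "of_nat N * (\<i> * complex_of_real (A * t)) = \<i> * complex_of_real (real N * A * t)" by simp
          have eqW: "of_nat N * (complex_of_real t ^ (r + 2) * \<eta> t) = w" by (simp add: w_def mult.assoc)
          show ?thesis unfolding distrib_left right_diff_distrib eqS eqV eqA eqW by simp
        qed
        finally have "lam t ^ N * iexp (- (real N * A * t)) = exp (\<i> * complex_of_real (real N * A * t) + complex_of_real (- v * x\<^sup>2 / 2) + (g + w) + \<i> * complex_of_real (- (real N * A * t)))"
          by (simp only: exp_add)
        also have "\<i> * complex_of_real (real N * A * t) + complex_of_real (- v * x\<^sup>2 / 2) + (g + w) + \<i> * complex_of_real (- (real N * A * t)) = complex_of_real (- v * x\<^sup>2 / 2) + (g + w)"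
          by (simp add: algebra_simps)
        finally show ?thesis by (simp only: exp_add exp_of_real)
      qed
      have g_bound: "cmod g \<le> Cg * (h * \<bar>x\<bar> ^ 3)"
      proof -
        have "cmod g \<le> (\<Sum>i=1..r. cmod (c i) * (h * \<bar>x\<bar> ^ 3))"
          unfolding g_def
        proof (rule sum_norm_le)
          fix i assume i: "i \<in> {1..r}"
          have "\<bar>x\<bar> ^ (i + 2) * h ^ i = \<bar>x\<bar>\<^sup>2 * \<bar>t\<bar> ^ i" unfolding abs_t by (simp only: power_mult_distrib power_add mult_ac)
          also have "\<dots> \<le> \<bar>x\<bar>\<^sup>2 * \<bar>t\<bar> ^ 1" using i t1 by (intro mult_left_mono power_decreasing) auto
          also have "\<dots> = h * \<bar>x\<bar> ^ 3" unfolding abs_t by (simp only: power2_eq_square power3_eq_cube power_one_right mult_ac)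
          finally have "\<bar>x\<bar> ^ (i + 2) * h ^ i \<le> h * \<bar>x\<bar> ^ 3" .
          then show "cmod (c i * complex_of_real x ^ (i + 2) * complex_of_real h ^ i) \<le> cmod (c i) * (h * \<bar>x\<bar> ^ 3)"
            using h by (simp add: norm_mult norm_power mult.assoc mult_left_mono)
        qed
        then show ?thesis by (simp add: Cg_def sum_distrib_right)
      qed
      have g_small: "cmod g \<le> v * x\<^sup>2 / 8"
      proof -
        have "Cg * (h * \<bar>x\<bar> ^ 3) = (Cg * \<bar>t\<bar>) * x\<^sup>2" unfolding abs_t by (simp add: power3_eq_cube power2_eq_square)
        also have "Cg * \<bar>t\<bar> \<le> (Cg + 1) * (v / (8 * (Cg + 1)))" using t \<delta> Cg by (intro mult_mono) auto
        also have "(Cg + 1) * (v / (8 * (Cg + 1))) = v / 8" using Cg by (simp add: field_simps)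
        finally show ?thesis using g_bound by (simp add: mult_right_mono)
      qed
      have eta_t: "cmod (\<eta> t) \<le> e1" and zeta_t: "cmod (\<zeta> t) \<le> e1" using d1(2)[of t] d2(2)[of t] t \<delta> by auto
      have w_bound: "cmod w \<le> h ^ r * \<bar>x\<bar> ^ (r + 2) * e1"
      proof -
        have "cmod w = h ^ r * \<bar>x\<bar> ^ (r + 2) * cmod (\<eta> t)"
          unfolding w_eq norm_mult norm_power norm_of_real using h(1) by (simp only: abs_of_pos mult_ac)
        also have "\<dots> \<le> h ^ r * \<bar>x\<bar> ^ (r + 2) * e1" by (intro mult_left_mono eta_t) (use h in auto)
        finally show ?thesis .
      qed
      have w_small: "cmod w \<le> v * x\<^sup>2 / 8"
      proof -
        have "h ^ r * \<bar>x\<bar> ^ (r + 2) * e1 = \<bar>t\<bar> ^ r * (x\<^sup>2 * e1)" unfolding abs_t by (simp only: power_mult_distrib power_add power2_abs mult_ac)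
        also have "\<dots> \<le> 1 * (x\<^sup>2 * (v / 8))" using t1 e1 by (intro mult_mono power_le_one) auto
        finally show ?thesis using w_bound by (simp add: mult_ac)
      qed
      define Y where "Y = exp (v * x\<^sup>2 / 4)"
      have Y: "Y \<ge> 1" unfolding Y_def using v by simp
      have gw: "cmod g + cmod w \<le> v * x\<^sup>2 / 4" using g_small w_small by linarith
      have egw: "exp (cmod g) * exp (cmod w) \<le> Y" unfolding Y_def exp_add[symmetric] using gw by simp
      have "cmod g \<le> v * x\<^sup>2 / 4" using gw norm_ge_zero[of w] by linarith
      then have eg: "exp (cmod g) \<le> Y" unfolding Y_def by simp
      have Zr_bound: "cmod Zr \<le> Cz"
      proof -
        have "cmod Zr \<le> (\<Sum>k\<le>r. cmod (z k))"
          unfolding Zr_def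
        proof (rule sum_norm_le)
          fix k
          have "cmod (z k * complex_of_real x ^ k * complex_of_real h ^ k) = cmod (z k) * \<bar>t\<bar> ^ k"
            unfolding abs_t using h by (simp add: norm_mult norm_power power_mult_distrib mult_ac)
          also have "\<dots> \<le> cmod (z k) * 1" using t1 by (intro mult_left_mono power_le_one) auto
          finally show "cmod (z k * complex_of_real x ^ k * complex_of_real h ^ k) \<le> cmod (z k)" by simp
        qed
        then show ?thesis by (simp add: Cz_def)
      qed
      have ZZr: "cmod (Z t - Zr) \<le> h ^ r * \<bar>x\<bar> ^ r * e1"
      proof -
        have "cmod (Z t - Zr) = \<bar>t\<bar> ^ r * cmod (\<zeta> t)" by (simp add: Zt norm_mult norm_power)
        also have "\<dots> \<le> \<bar>t\<bar> ^ r * e1" by (intro mult_left_mono zeta_t) auto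
        finally show ?thesis by (simp only: abs_t power_mult_distrib)
      qed
      have Z_bound: "cmod (Z t) \<le> Cz + 1"
      proof -
        have "cmod (Z t) \<le> cmod Zr + cmod (Z t - Zr)" by (metis add.commute diff_add_cancel norm_triangle_ineq)
        moreover have "h ^ r * \<bar>x\<bar> ^ r * e1 \<le> 1 * 1"
          using t1 e1 unfolding power_mult_distrib[symmetric] abs_t[symmetric] by (intro mult_mono power_le_one) auto
        ultimately show ?thesis using ZZr Zr_bound by linarith
      qed
      let ?U = "\<epsilon> * h ^ r * \<bar>x\<bar> * y ^ m * Y"
      have xm: "\<bar>x\<bar> ^ (r + 2) \<le> \<bar>x\<bar> * y ^ m" "\<bar>x\<bar> ^ r \<le> \<bar>x\<bar> * y ^ m" "\<bar>x\<bar> ^ (3 * r + 3) \<le> \<bar>x\<bar> * y ^ m"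
        by (rule xpow; use r in \<open>simp add: m_def\<close>)+
      have exg: "cmod (exp g) \<le> exp (cmod g)" by (simp add: complex_Re_le_cmod)
      have b1: "cmod (exp g * (exp w - 1) * Z t) \<le> ?U * (Cz + 1)"
      proof -
        have "cmod (exp g * (exp w - 1) * Z t) \<le> (exp (cmod g) * (exp (cmod w) * cmod w)) * (Cz + 1)"
          unfolding norm_mult by (intro mult_mono exg norm_exp_minus_1_le Z_bound mult_nonneg_nonneg) auto
        also have "\<dots> = (exp (cmod g) * exp (cmod w)) * cmod w * (Cz + 1)" by simp
        also have "\<dots> \<le> Y * (h ^ r * (\<bar>x\<bar> * y ^ m) * \<epsilon>) * (Cz + 1)"
        proof (intro mult_right_mono mult_mono egw)
          have "h ^ r * \<bar>x\<bar> ^ (r + 2) * e1 \<le> h ^ r * (\<bar>x\<bar> * y ^ m) * \<epsilon>"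
            using xm e1 h y by (intro mult_mono mult_left_mono) auto
          then show "cmod w \<le> h ^ r * (\<bar>x\<bar> * y ^ m) * \<epsilon>" using w_bound by linarith
        qed (use Y Cz in auto)
        finally show ?thesis by (simp add: mult_ac)
      qed
      have b2: "cmod (exp g * (Z t - Zr)) \<le> ?U * 1"
      proof -
        have "cmod (exp g * (Z t - Zr)) \<le> Y * (h ^ r * (\<bar>x\<bar> * y ^ m) * \<epsilon>)"
          unfolding norm_mult
        proof (intro mult_mono order_trans[OF exg eg])
          have "h ^ r * \<bar>x\<bar> ^ r * e1 \<le> h ^ r * (\<bar>x\<bar> * y ^ m) * \<epsilon>"
            using xm e1 h y by (intro mult_mono mult_left_mono) auto
          then show "cmod (Z t - Zr) \<le> h ^ r * (\<bar>x\<bar> * y ^ m) * \<epsilon>" using ZZr by linarith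
        qed (use Y in auto)
        then show ?thesis by (simp add: mult_ac)
      qed
      have b3: "cmod ((exp g - Tr) * Zr) \<le> ?U * (Cg ^ (r + 1) * Cz)"
      proof -
        have "cmod ((exp g - Tr) * Zr) \<le> (exp (cmod g) * cmod g ^ Suc r) * Cz"
          unfolding norm_mult Tr_def by (intro mult_mono norm_exp_taylor_le Zr_bound) auto
        also have "\<dots> \<le> (Y * (Cg * (h * \<bar>x\<bar> ^ 3)) ^ Suc r) * Cz"
          using Cz Y by (intro mult_right_mono mult_mono eg power_mono g_bound) auto
        also have "(Cg * (h * \<bar>x\<bar> ^ 3)) ^ Suc r = Cg ^ (r + 1) * (h * h ^ r) * \<bar>x\<bar> ^ (3 * r + 3)"
          by (simp add: power_mult_distrib power_mult[symmetric] power_add mult_ac flip: power_Suc)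
        also have "(Y * (Cg ^ (r + 1) * (h * h ^ r) * \<bar>x\<bar> ^ (3 * r + 3))) * Cz \<le> (Y * (Cg ^ (r + 1) * (\<epsilon> * h ^ r) * (\<bar>x\<bar> * y ^ m))) * Cz"
          using Cz Cg Y h he y xm by (intro mult_right_mono mult_left_mono mult_mono) auto
        finally show ?thesis by (simp add: mult_ac)
      qed
      have b4: "cmod (Tr * Zr - Pr) \<le> ?U * K4"
      proof -
        have "cmod (Tr * Zr - Pr) \<le> h ^ (r + 1) * \<bar>x\<bar> * K4 * (1 + \<bar>x\<bar>) ^ m4"
          unfolding Tr_def Zr_def Pr_def g_def by (rule T4) (use h in auto)
        also have "\<dots> \<le> (\<epsilon> * h ^ r) * \<bar>x\<bar> * K4 * y ^ m"
        proof (intro mult_mono)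
          show "h ^ (r + 1) \<le> \<epsilon> * h ^ r" using he h by (simp add: mult_right_mono)
          show "(1 + \<bar>x\<bar>) ^ m4 \<le> y ^ m" unfolding y_def m_def by (intro power_increasing) auto
        qed (use h eps K4 y in auto)
        also have "\<dots> = (\<epsilon> * h ^ r * \<bar>x\<bar> * y ^ m) * K4 * 1" by simp
        also have "\<dots> \<le> (\<epsilon> * h ^ r * \<bar>x\<bar> * y ^ m) * K4 * Y" using Y h eps K4 y by (intro mult_left_mono mult_nonneg_nonneg) auto
        finally show ?thesis by (simp add: mult_ac)
      qed
      \<comment> \<open>Four replacements in a row: drop the remainder \<open>w\<close>, truncate
        \<open>Z\<close>, truncate the exponential of \<open>g\<close>, and discard the powers of
        \<open>h\<close> above \<open>r\<close>.\<close>
      have "exp (g + w) * Z t - Pr = exp g * (exp w - 1) * Z t + exp g * (Z t - Zr) + (exp g - Tr) * Zr + (Tr * Zr - Pr)"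
        by (simp add: exp_add algebra_simps)
      then have "cmod (exp (g + w) * Z t - Pr) \<le> ?U * (Cz + 1) + ?U * 1 + ?U * (Cg ^ (r + 1) * Cz) + ?U * K4"
        using b1 b2 b3 b4 by (metis (no_types, lifting) add_mono norm_triangle_mono)
      also have "\<dots> = ?U * K" by (simp add: K_def algebra_simps)
      finally have inner: "cmod (exp (g + w) * Z t - Pr) \<le> ?U * K" .
      have "lam t ^ N * Z t * iexp (- (real N * A * t)) - edgeworth_ft v a r N t = complex_of_real (exp (- v * x\<^sup>2 / 2)) * (exp (g + w) * Z t - Pr)"
      proof -
        have "lam t ^ N * Z t * iexp (- (real N * A * t)) = (lam t ^ N * iexp (- (real N * A * t))) * Z t" by (simp only: mult_ac)
        moreover have "edgeworth_ft v a r N t = complex_of_real (exp (- v * x\<^sup>2 / 2)) * Pr"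
          by (simp only: edgeworth_ft_def Let_def Pr_def s_def x_def h_def)
        ultimately show ?thesis unfolding main_eq by (simp only: right_diff_distrib mult.assoc)
      qed
      then have "cmod (lam t ^ N * Z t * iexp (- (real N * A * t)) - edgeworth_ft v a r N t) = exp (- v * x\<^sup>2 / 2) * cmod (exp (g + w) * Z t - Pr)"
        by (simp only: norm_mult norm_of_real abs_exp_cancel)
      also have "\<dots> \<le> exp (- v * x\<^sup>2 / 2) * (?U * K)" using inner by (intro mult_left_mono) auto
      also have "\<dots> = \<epsilon> * h ^ r * \<bar>x\<bar> * K * y ^ m * (exp (- v * x\<^sup>2 / 2) * Y)" by (simp only: mult_ac)
      also have "exp (- v * x\<^sup>2 / 2) * Y = exp (- v * x\<^sup>2 / 4)"
        unfolding Y_def exp_add[symmetric] by (rule arg_cong[of _ _ exp]) (simp add: field_simps)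
      finally show ?thesis by (simp only: s_def x_def h_def y_def)
    qed
    then show "\<exists>\<delta>>0. \<exists>N1. \<forall>N\<ge>N1. \<forall>t. \<bar>t\<bar> \<le> \<delta> \<longrightarrow>
       cmod (lam t ^ N * Z t * iexp (- (real N * A * t)) - edgeworth_ft v a r N t)
      \<le> \<epsilon> * (1 / sqrt (real N)) ^ r * \<bar>sqrt (real N) * t\<bar> * K * (1 + \<bar>sqrt (real N) * t\<bar>) ^ m * exp (- v * (sqrt (real N) * t)\<^sup>2 / 4)"
      using \<delta>(1) by blast
  qed
qed

section \<open>The error integral\<close>

lemma power_times_geometric_tendsto_0:
  fixes \<theta> :: real
  assumes "0 < \<theta>" "\<theta> < 1"
  shows "(\<lambda>N. real N ^ k * \<theta> ^ N) \<longlonglongrightarrow> 0"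
proof (cases "k = 0")
  case True then show ?thesis using assms by (simp add: LIMSEQ_realpow_zero)
next
  case False
  define \<rho> where "\<rho> = root k \<theta>"
  have rho: "0 < \<rho>" "\<rho> < 1" "\<rho> ^ k = \<theta>" using False assms by (auto simp: \<rho>_def real_root_lt_1_iff)
  have "(\<lambda>N. (real N * \<rho> ^ N) ^ k) \<longlonglongrightarrow> 0 ^ k"
    using powser_times_n_limit_0[of \<rho>] rho by (intro tendsto_power) simp
  moreover have "(real N * \<rho> ^ N) ^ k = real N ^ k * \<theta> ^ N" for N
    unfolding rho(3)[symmetric] by (simp add: power_mult_distrib mult.commute flip: power_mult)
  ultimately show ?thesis using False by (simp add: zero_power)
qed

lemma integrable_gauss_growth:
  fixes v :: real
  assumes v: "v > 0"
  shows "integrable lborel (\<lambda>x. (1 + \<bar>x\<bar>) ^ m * exp (- v * x\<^sup>2 / 4))"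
proof -
  let ?s = "sqrt (v / 2)"
  have s: "?s > 0" using v by simp
  have eq: "- v * x\<^sup>2 / 4 = - (?s * x)\<^sup>2 / 2" for x using v by (simp add: power_mult_distrib)
  have 1: "integrable lborel (\<lambda>x. \<bar>x\<bar> ^ k * exp (- v * x\<^sup>2 / 4))" for k
  proof -
    have "integrable lborel (\<lambda>x. (sqrt (2 * pi) / ?s) * (normal_density 0 (1 / ?s) x * \<bar>x - 0\<bar> ^ k))"
      using s by (intro integrable_mult_right integrable_normal_moment_abs) simp
    then show ?thesis unfolding eq gauss_eq_normal_density[OF s] by (simp add: mult_ac)
  qed
  have "integrable lborel (\<lambda>x. \<Sum>k\<le>m. real (m choose k) * (\<bar>x\<bar> ^ k * exp (- v * x\<^sup>2 / 4)))"
    by (intro Bochner_Integration.integrable_sum integrable_mult_right 1)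
  moreover have "(\<Sum>k\<le>m. real (m choose k) * (\<bar>x\<bar> ^ k * exp (- v * x\<^sup>2 / 4))) = (1 + \<bar>x\<bar>) ^ m * exp (- v * x\<^sup>2 / 4)" for x
    using binomial_ring[of "\<bar>x\<bar>" 1 m] by (simp add: add.commute sum_distrib_right mult.assoc)
  ultimately show ?thesis by simp
qed

lemma gauss_growth_scaled:
  fixes v s :: real
  assumes v: "v > 0" and s: "s > 0"
  shows "has_bochner_integral lborel (\<lambda>t. s * ((1 + \<bar>s * t\<bar>) ^ m * exp (- v * (s * t)\<^sup>2 / 4)))
    (LINT x|lborel. (1 + \<bar>x\<bar>) ^ m * exp (- v * x\<^sup>2 / 4))"
proof -
  let ?f = "\<lambda>x. (1 + \<bar>x\<bar>) ^ m * exp (- v * x\<^sup>2 / 4)"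
  have "integrable lborel (\<lambda>t. ?f (0 + s * t))"
    by (rule lborel_integrable_real_affine[OF integrable_gauss_growth[OF v]]) (use s in simp)
  then have "integrable lborel (\<lambda>t. s * ?f (s * t))" by (intro integrable_mult_right) simp
  moreover have "(LINT t|lborel. s * ?f (s * t)) = (LINT x|lborel. ?f x)"
    using lborel_integral_real_affine[of s ?f 0] s by simp
  ultimately show ?thesis by (simp add: has_bochner_integral_iff)
qed

text \<open>Beyond \<open>R \<ge> 1\<close> this is the weight \<open>|t|^(-q)\<close> times the
  \<open>1 / \<bar>t\<bar>\<close> of the error integral; the exponent \<open>q + 1 \<ge> 2\<close>
  makes it integrable.\<close>

definition power_tail :: "nat \<Rightarrow> real \<Rightarrow> real \<Rightarrow> real" where
  "power_tail q R t = (if R < \<bar>t\<bar> then 1 / \<bar>t\<bar> ^ (q + 1) else 0)"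

lemma power_tail_measurable [measurable]: "power_tail q R \<in> borel_measurable borel"
  unfolding power_tail_def by measurable

lemma integrable_power_tail_1:
  assumes q: "q \<ge> 1" shows "integrable lborel (power_tail q 1)"
proof (rule Bochner_Integration.integrable_bound)
  have "integrable lborel (\<lambda>x::real. inverse (1 + x\<^sup>2))"
    using integrable_inverse_1_plus_square by (simp add: set_integrable_def)
  then show "integrable lborel (\<lambda>x::real. 2 * inverse (1 + x\<^sup>2))" by simp
  show "AE x in lborel. norm (power_tail q 1 x) \<le> norm (2 * inverse (1 + x\<^sup>2))"
  proof (rule AE_I2)
    fix x :: real
    show "norm (power_tail q 1 x) \<le> norm (2 * inverse (1 + x\<^sup>2))"
    proof (cases "1 < \<bar>x\<bar>")
      case True
      have "x\<^sup>2 \<le> \<bar>x\<bar> ^ (q + 1)" using True q power_increasing[of 2 "q + 1" "\<bar>x\<bar>"] by simp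
      moreover have "1 < x\<^sup>2" using one_less_power[OF True, of 2] by simp
      ultimately have "1 + x\<^sup>2 \<le> 2 * \<bar>x\<bar> ^ (q + 1)" by linarith
      moreover have "0 < \<bar>x\<bar> ^ (q + 1)" using True by simp
      moreover have "0 < 1 + x\<^sup>2" by (simp add: add_pos_nonneg)
      ultimately have "1 / \<bar>x\<bar> ^ (q + 1) \<le> 2 / (1 + x\<^sup>2)" by (simp add: divide_simps mult.commute)
      then show ?thesis using True by (simp add: power_tail_def divide_inverse)
    qed (simp add: power_tail_def)
  qed
qed measurable

lemma power_tail_integral:
  assumes q: "q \<ge> 1" and R: "R > 0"
  shows "has_bochner_integral lborel (power_tail q R) ((LINT x|lborel. power_tail q 1 x) / R ^ q)"
proof -
  have eq: "power_tail q R (0 + R * u) = power_tail q 1 u / R ^ (q + 1)" for u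
    using R by (auto simp: power_tail_def abs_mult power_mult_distrib)
  have i: "integrable lborel (\<lambda>u. power_tail q R (0 + R * u))"
    unfolding eq using integrable_power_tail_1[OF q] by simp
  then have "integrable lborel (power_tail q R)"
    using lborel_integrable_real_affine_iff[of R "power_tail q R" 0] R by simp
  moreover have "(LINT x|lborel. power_tail q R x) = (LINT x|lborel. power_tail q 1 x) / R ^ q"
    using lborel_integral_real_affine[of R "power_tail q R" 0] R unfolding eq by simp
  ultimately show ?thesis by (simp add: has_bochner_integral_iff)
qed

lemma edgeworth_ft_growth:
  shows "\<exists>C m. C \<ge> 0 \<and> (\<forall>N t. N \<ge> 1 \<longrightarrow> cmod (edgeworth_ft v a r N t) \<le> C * (1 + \<bar>sqrt (real N) * t\<bar>) ^ m * exp (- v * (sqrt (real N) * t)\<^sup>2 / 2))"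
proof -
  have "\<forall>p. \<exists>k::real. k \<ge> 0 \<and> (\<forall>x::real. cmod (poly (a p) (of_real x)) \<le> k * (1 + \<bar>x\<bar>) ^ degree (a p))"
    using poly_growth by blast
  from choice[OF this] obtain Kp :: "nat \<Rightarrow> real"
    where Kp: "\<And>p. Kp p \<ge> 0" "\<And>p x. cmod (poly (a p) (of_real x)) \<le> Kp p * (1 + \<bar>x\<bar>) ^ degree (a p)" by blast
  define m where "m = Suc (Max ((\<lambda>p. degree (a p)) ` {..r}))"
  define C where "C = 1 + (\<Sum>p=1..r. Kp p)"
  have C: "C \<ge> 0" unfolding C_def using Kp by (simp add: sum_nonneg add_nonneg_nonneg)
  have "cmod (edgeworth_ft v a r N t) \<le> C * (1 + \<bar>sqrt (real N) * t\<bar>) ^ m * exp (- v * (sqrt (real N) * t)\<^sup>2 / 2)" if N: "N \<ge> 1" for N t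
  proof -
    define x where "x = sqrt (real N) * t"
    define h where "h = 1 / sqrt (real N)"
    have h: "0 \<le> h" "h \<le> 1" using N by (auto simp: h_def)
    define y where "y = 1 + \<bar>x\<bar>"
    have y: "y \<ge> 1" "\<bar>x\<bar> \<le> y" by (auto simp: y_def)
    have summand: "cmod (complex_of_real h ^ p * (complex_of_real x * poly (a p) (complex_of_real x))) \<le> Kp p * y ^ m" if p: "p \<in> {1..r}" for p
    proof -
      have "cmod (complex_of_real h ^ p * (complex_of_real x * poly (a p) (complex_of_real x))) = h ^ p * (\<bar>x\<bar> * cmod (poly (a p) (complex_of_real x)))"
        using h by (simp add: norm_mult norm_power)
      also have "\<dots> \<le> 1 * (y * (Kp p * y ^ degree (a p)))"
        using h y Kp(2)[of p x] unfolding y_def[symmetric] by (intro mult_mono power_le_one) auto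
      also have "\<dots> = Kp p * y ^ Suc (degree (a p))" by simp
      also have "\<dots> \<le> Kp p * y ^ m"
      proof (intro mult_left_mono power_increasing y Kp)
        have "degree (a p) \<le> Max ((\<lambda>p. degree (a p)) ` {..r})" using p by (intro Max_ge) auto
        then show "Suc (degree (a p)) \<le> m" by (simp add: m_def)
      qed
      finally show ?thesis .
    qed
    have "cmod (1 + (\<Sum>p=1..r. complex_of_real h ^ p * (complex_of_real x * poly (a p) (complex_of_real x)))) \<le> cmod 1 + (\<Sum>p=1..r. Kp p * y ^ m)"
      by (rule order_trans[OF norm_triangle_ineq add_left_mono[OF sum_norm_le[OF summand]]])
    also have "\<dots> \<le> y ^ m + (\<Sum>p=1..r. Kp p * y ^ m)" using y by (simp add: one_le_power)
    also have "\<dots> = C * y ^ m" by (simp add: C_def distrib_right sum_distrib_right)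
    finally have "cmod (1 + (\<Sum>p=1..r. complex_of_real h ^ p * (complex_of_real x * poly (a p) (complex_of_real x)))) \<le> C * y ^ m" .
    then have "exp (- v * x\<^sup>2 / 2) * cmod (1 + (\<Sum>p=1..r. complex_of_real h ^ p * (complex_of_real x * poly (a p) (complex_of_real x)))) \<le> exp (- v * x\<^sup>2 / 2) * (C * y ^ m)"
      by (intro mult_left_mono) auto
    then show ?thesis
      unfolding edgeworth_ft_def Let_def x_def[symmetric] h_def[symmetric] y_def[symmetric] norm_mult norm_of_real abs_exp_cancel
      by (simp only: mult_ac)
  qed
  then show ?thesis using C by blast
qed

lemma has_bochner_integral_symmetric_window:
  fixes R c :: real
  assumes "R \<ge> 0"
  shows "has_bochner_integral lborel (\<lambda>t. indicator {-R..R} t * c) (2 * R * c)"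
proof -
  have "integrable lborel (\<lambda>t. indicator {-R..R} t * c)"
    by (intro integrable_mult_left integrable_real_indicator) (use assms in auto)
  then show ?thesis using assms by (simp add: has_bochner_integral_iff)
qed

text \<open>Only the local term fails to vanish on its own after multiplication by
  \<open>sqrt N ^ r\<close>; it contributes at most \<open>\<epsilon>\<close> times a constant. The
  exponent in \<open>high\<close> is chosen so that \<open>r/2\<close> pays for
  \<open>sqrt N ^ r\<close> and \<open>r1\<close> for the length of the frequency window, leaving
  \<open>1/N\<close>.\<close>

lemma error_integral_tendsto_0:
  fixes \<phi> :: "nat \<Rightarrow> real \<Rightarrow> complex" and a :: "nat \<Rightarrow> complex poly" and v r1 K0 C0 \<theta>0 Kl :: real and r q ml :: nat
  assumes v: "v > 0" and r1: "r1 > 0" and q: "q \<ge> 1" "real q > real r / (2 * r1)" and K0: "K0 > 0"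
    and phi_le: "\<And>N t. N \<ge> 1 \<Longrightarrow> cmod (\<phi> N t) \<le> 1"
    and C0: "C0 \<ge> 0" "0 < \<theta>0" "\<theta>0 < 1" and Kl: "Kl \<ge> 0"
    and local: "\<And>\<epsilon>. \<epsilon> > 0 \<Longrightarrow> \<exists>\<delta>>0. \<exists>N1. \<forall>N\<ge>N1. \<forall>t. \<bar>t\<bar> \<le> \<delta> \<longrightarrow> cmod (\<phi> N t - edgeworth_ft v a r N t) \<le>
        \<epsilon> * (1 / sqrt (real N)) ^ r * \<bar>sqrt (real N) * t\<bar> * Kl * (1 + \<bar>sqrt (real N) * t\<bar>) ^ ml * exp (- v * (sqrt (real N) * t)\<^sup>2 / 4)
        + C0 * \<bar>t\<bar> * real N * \<theta>0 ^ N"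
    and mid: "\<And>\<delta> B. \<delta> > 0 \<Longrightarrow> \<exists>C\<ge>0. \<exists>\<theta>. 0 < \<theta> \<and> \<theta> < 1 \<and> (\<forall>N\<ge>1. \<forall>t. \<delta> \<le> \<bar>t\<bar> \<longrightarrow> \<bar>t\<bar> \<le> B \<longrightarrow> cmod (\<phi> N t) \<le> C * \<theta> ^ N)"
    and high: "\<exists>c>0. \<exists>C\<ge>0. \<exists>N1. \<forall>N\<ge>N1. \<forall>t. K0 \<le> \<bar>t\<bar> \<longrightarrow> \<bar>t\<bar> \<le> c * real N powr r1 \<longrightarrow> cmod (\<phi> N t) \<le> C * real N powr (- (real r / 2 + r1 + 1))"
    and int: "\<And>N. N \<ge> 1 \<Longrightarrow> integrable lborel (\<lambda>t. cmod (\<phi> N t - edgeworth_ft v a r N t) / \<bar>t\<bar> * freq_weight q t)"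
  shows "(\<lambda>N. sqrt (real N) ^ r * (LINT t|lborel. cmod (\<phi> N t - edgeworth_ft v a r N t) / \<bar>t\<bar> * freq_weight q t)) \<longlonglongrightarrow> 0"
proof -
  define f where "f N = sqrt (real N) ^ r * (LINT t|lborel. cmod (\<phi> N t - edgeworth_ft v a r N t) / \<bar>t\<bar> * freq_weight q t)" for N
  have f0: "f N \<ge> 0" for N
    unfolding f_def by (intro mult_nonneg_nonneg integral_nonneg_AE AE_I2) (auto simp: freq_weight_nonneg)
  define J where "J m = (LINT x|lborel. (1 + \<bar>x\<bar>) ^ m * exp (- v * x\<^sup>2 / 4))" for m
  have J0: "J m \<ge> 0" for m unfolding J_def by (intro integral_nonneg_AE AE_I2) auto
  define T1 where "T1 = (LINT x|lborel. power_tail q 1 x)"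
  \<comment> \<open>From \<open>K0\<close> on the estimate \<open>high\<close> applies, and beyond 1
    the weight has its power form.\<close>
  define B where "B = max K0 1"
  have B: "B \<ge> K0" "B \<ge> 1" by (auto simp: B_def)
  obtain C5 m5 where C5: "C5 \<ge> 0" and ft: "\<And>N t. N \<ge> 1 \<Longrightarrow> cmod (edgeworth_ft v a r N t) \<le> C5 * (1 + \<bar>sqrt (real N) * t\<bar>) ^ m5 * exp (- v * (sqrt (real N) * t)\<^sup>2 / 2)"
    using edgeworth_ft_growth[of v a r] by blast
  obtain c C3 N3 where c: "c > 0" and C3: "C3 \<ge> 0" and high': "\<And>N t. N \<ge> N3 \<Longrightarrow> K0 \<le> \<bar>t\<bar> \<Longrightarrow> \<bar>t\<bar> \<le> c * real N powr r1 \<Longrightarrow> cmod (\<phi> N t) \<le> C3 * real N powr (- (real r / 2 + r1 + 1))"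
    using high by blast
  have key: "\<exists>b. b \<longlonglongrightarrow> 0 \<and> (\<forall>\<^sub>F N in sequentially. f N \<le> \<epsilon> * (Kl * J ml) + b N)" if eps: "\<epsilon> > 0" for \<epsilon>
  proof -
    obtain \<delta> N1 where \<delta>: "\<delta> > 0" and loc: "\<And>N t. N \<ge> N1 \<Longrightarrow> \<bar>t\<bar> \<le> \<delta> \<Longrightarrow> cmod (\<phi> N t - edgeworth_ft v a r N t) \<le>
        \<epsilon> * (1 / sqrt (real N)) ^ r * \<bar>sqrt (real N) * t\<bar> * Kl * (1 + \<bar>sqrt (real N) * t\<bar>) ^ ml * exp (- v * (sqrt (real N) * t)\<^sup>2 / 4)
        + C0 * \<bar>t\<bar> * real N * \<theta>0 ^ N"
      using local[OF eps] by blast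
    obtain C2 \<theta>2 where C2: "C2 \<ge> 0" "0 < \<theta>2" "\<theta>2 < 1" and mid': "\<And>N t. N \<ge> 1 \<Longrightarrow> \<delta> \<le> \<bar>t\<bar> \<Longrightarrow> \<bar>t\<bar> \<le> B \<Longrightarrow> cmod (\<phi> N t) \<le> C2 * \<theta>2 ^ N"
      using mid[OF \<delta>, of B] by blast
    define g where "g = exp (- v * \<delta>\<^sup>2 / 4)"
    have g: "0 < g" "g < 1" using v \<delta> by (auto simp: g_def)
    define R where "R N = c * real N powr r1" for N
    define M where "M = real r / 2 + r1 + 1"
    define b where "b N = sqrt (real N) ^ r * (2 * \<delta> * (C0 * real N * \<theta>0 ^ N) + 2 * B * (C2 * \<theta>2 ^ N / \<delta>) + 2 * R N * (C3 * real N powr (- M) / B) + T1 / R N ^ q + (g ^ N * C5 / \<delta>) * J m5)" for N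
    have bound: "f N \<le> \<epsilon> * (Kl * J ml) + b N" if N: "N \<ge> N1" "N \<ge> N3" "N \<ge> 1" for N
    proof -
      define s where "s = sqrt (real N)"
      have s: "s \<ge> 1" "s\<^sup>2 = real N" using N by (auto simp: s_def)
      have RN: "R N > 0" using c N by (simp add: R_def)
      \<comment> \<open>The majorants of the ranges: \<open>D1\<close> the local expansion error,
        \<open>D2\<close> the local exponential remainder, \<open>D3\<close> the compact middle
        range, \<open>D4\<close> the range of \<open>high\<close>, \<open>power_tail\<close> the
        rest, and \<open>D6\<close> the approximation itself away from 0. The factor
        \<open>s\<close> in \<open>D1\<close> and \<open>D6\<close> is the Jacobian that makes their
        integrals free of \<open>N\<close>.\<close>
      define D1 where "D1 t = \<epsilon> * (1 / s) ^ r * Kl * (s * ((1 + \<bar>s * t\<bar>) ^ ml * exp (- v * (s * t)\<^sup>2 / 4)))" for t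
      define D2 where "D2 t = indicator {-\<delta>..\<delta>} t * (C0 * real N * \<theta>0 ^ N)" for t
      define D3 where "D3 t = indicator {-B..B} t * (C2 * \<theta>2 ^ N / \<delta>)" for t
      define D4 where "D4 t = indicator {-R N..R N} t * (C3 * real N powr (- M) / B)" for t
      define D6 where "D6 t = (g ^ N * C5 / \<delta>) * (s * ((1 + \<bar>s * t\<bar>) ^ m5 * exp (- v * (s * t)\<^sup>2 / 4)))" for t
      have I1: "has_bochner_integral lborel D1 (\<epsilon> * (1 / s) ^ r * Kl * J ml)"
        unfolding D1_def J_def by (intro has_bochner_integral_mult_right gauss_growth_scaled v) (use s in simp)
      have I2: "has_bochner_integral lborel D2 (2 * \<delta> * (C0 * real N * \<theta>0 ^ N))"
        unfolding D2_def by (rule has_bochner_integral_symmetric_window) (use \<delta> in simp)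
      have I3: "has_bochner_integral lborel D3 (2 * B * (C2 * \<theta>2 ^ N / \<delta>))"
        unfolding D3_def by (rule has_bochner_integral_symmetric_window) (use B in simp)
      have I4: "has_bochner_integral lborel D4 (2 * R N * (C3 * real N powr (- M) / B))"
        unfolding D4_def by (rule has_bochner_integral_symmetric_window) (use RN in simp)
      have I5: "has_bochner_integral lborel (power_tail q (R N)) (T1 / R N ^ q)"
        unfolding T1_def by (rule power_tail_integral[OF q(1) RN])
      have I6: "has_bochner_integral lborel D6 ((g ^ N * C5 / \<delta>) * J m5)"
        unfolding D6_def J_def by (intro has_bochner_integral_mult_right gauss_growth_scaled v) (use s in simp)
      have I: "has_bochner_integral lborel (\<lambda>t. D1 t + D2 t + D3 t + D4 t + power_tail q (R N) t + D6 t)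
        (\<epsilon> * (1 / s) ^ r * Kl * J ml + 2 * \<delta> * (C0 * real N * \<theta>0 ^ N) + 2 * B * (C2 * \<theta>2 ^ N / \<delta>) + 2 * R N * (C3 * real N powr (- M) / B) + T1 / R N ^ q + (g ^ N * C5 / \<delta>) * J m5)"
        by (intro has_bochner_integral_add I1 I2 I3 I4 I5 I6)
      have nn: "D1 t \<ge> 0" "D2 t \<ge> 0" "D3 t \<ge> 0" "D4 t \<ge> 0" "power_tail q (R N) t \<ge> 0" "D6 t \<ge> 0" for t
        unfolding D1_def D2_def D3_def D4_def D6_def power_tail_def
        using eps s Kl C0 C2 \<delta> C3 B g C5 by (auto intro!: mult_nonneg_nonneg divide_nonneg_nonneg)
      have ptw: "cmod (\<phi> N t - edgeworth_ft v a r N t) / \<bar>t\<bar> * freq_weight q t \<le> D1 t + D2 t + D3 t + D4 t + power_tail q (R N) t + D6 t" for t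
      proof (cases "\<bar>t\<bar> \<le> \<delta>")
        case True
        have "cmod (\<phi> N t - edgeworth_ft v a r N t) / \<bar>t\<bar> * freq_weight q t \<le> cmod (\<phi> N t - edgeworth_ft v a r N t) / \<bar>t\<bar>"
          by (intro mult_left_le freq_weight_le_1) auto
        also have "\<dots> \<le> D1 t + D2 t"
        proof (cases "t = 0")
          \<comment> \<open>The quotient is 0 at \<open>t = 0\<close> by the convention for division
            by 0, so nonnegativity of the majorants suffices.\<close>
          case True then show ?thesis using nn[of t] by simp
        next
          case False
          have "cmod (\<phi> N t - edgeworth_ft v a r N t) / \<bar>t\<bar> \<le> (\<epsilon> * (1 / s) ^ r * \<bar>s * t\<bar> * Kl * (1 + \<bar>s * t\<bar>) ^ ml * exp (- v * (s * t)\<^sup>2 / 4)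
            + C0 * \<bar>t\<bar> * real N * \<theta>0 ^ N) / \<bar>t\<bar>"
            unfolding s_def by (intro divide_right_mono loc N True) auto
          also have "\<dots> = D1 t + C0 * real N * \<theta>0 ^ N"
            using False s by (simp add: D1_def add_divide_distrib abs_mult)
          also have "C0 * real N * \<theta>0 ^ N = D2 t" using True by (simp add: D2_def abs_le_iff)
          finally show ?thesis .
        qed
        also have "\<dots> \<le> D1 t + D2 t + D3 t + D4 t + power_tail q (R N) t + D6 t" using nn[of t] by linarith
        finally show ?thesis .
      next
        case False
        then have t0: "\<bar>t\<bar> > 0" using \<delta> by linarith
        have fw: "0 \<le> freq_weight q t" "freq_weight q t \<le> 1" by (rule freq_weight_nonneg, rule freq_weight_le_1)
        have "cmod (\<phi> N t - edgeworth_ft v a r N t) / \<bar>t\<bar> * freq_weight q t \<le> (cmod (\<phi> N t) + cmod (edgeworth_ft v a r N t)) / \<bar>t\<bar> * freq_weight q t"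
          by (intro mult_right_mono divide_right_mono norm_triangle_ineq4 fw) auto
        also have "\<dots> = cmod (\<phi> N t) / \<bar>t\<bar> * freq_weight q t + cmod (edgeworth_ft v a r N t) / \<bar>t\<bar> * freq_weight q t"
          by (simp add: add_divide_distrib distrib_right)
        also have "cmod (edgeworth_ft v a r N t) / \<bar>t\<bar> * freq_weight q t \<le> D6 t"
        proof -
          have "cmod (edgeworth_ft v a r N t) / \<bar>t\<bar> * freq_weight q t \<le> cmod (edgeworth_ft v a r N t) / \<bar>t\<bar>"
            by (intro mult_left_le fw) auto
          also have "\<dots> \<le> cmod (edgeworth_ft v a r N t) / \<delta>" using False \<delta> by (intro divide_left_mono) auto
          also have "\<dots> \<le> (C5 * (1 + \<bar>s * t\<bar>) ^ m5 * exp (- v * (s * t)\<^sup>2 / 2)) / \<delta>"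
            unfolding s_def using \<delta> by (intro divide_right_mono ft N) auto
          \<comment> \<open>One half of the Gaussian exponent yields the exponential gain
            \<open>g ^ N\<close> from \<open>\<bar>t\<bar> \<ge> \<delta>\<close>, the other half
            keeps the majorant integrable. The factor \<open>s \<ge> 1\<close> is inserted to match
            the scaled integral.\<close>
          also have "exp (- v * (s * t)\<^sup>2 / 2) = exp (- v * (s * t)\<^sup>2 / 4) * exp (- v * (s * t)\<^sup>2 / 4)"
            unfolding exp_add[symmetric] by (rule arg_cong[of _ _ exp]) (simp add: field_simps)
          also have "(C5 * (1 + \<bar>s * t\<bar>) ^ m5 * (exp (- v * (s * t)\<^sup>2 / 4) * exp (- v * (s * t)\<^sup>2 / 4))) / \<delta>
              \<le> (C5 * (1 + \<bar>s * t\<bar>) ^ m5 * (exp (- v * (s * t)\<^sup>2 / 4) * (s * g ^ N))) / \<delta>"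
          proof (intro divide_right_mono mult_left_mono)
            have "\<delta>\<^sup>2 \<le> t\<^sup>2" using False \<delta> by (metis abs_le_square_iff abs_of_pos less_imp_le not_le)
            then have "real N * \<delta>\<^sup>2 \<le> (s * t)\<^sup>2" unfolding power_mult_distrib s(2) by (intro mult_left_mono) auto
            then have "v * (real N * \<delta>\<^sup>2) \<le> v * (s * t)\<^sup>2" using v by (intro mult_left_mono) auto
            then have "exp (- v * (s * t)\<^sup>2 / 4) \<le> exp (real N * (- v * \<delta>\<^sup>2 / 4))" by (simp add: field_simps)
            also have "\<dots> = g ^ N" unfolding g_def by (rule exp_of_nat_mult)
            also have "\<dots> = 1 * g ^ N" by simp
            also have "\<dots> \<le> s * g ^ N" using s g by (intro mult_right_mono) auto
            finally show "exp (- v * (s * t)\<^sup>2 / 4) \<le> s * g ^ N" .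
          qed (use C5 \<delta> in auto)
          also have "\<dots> = D6 t" by (simp add: D6_def)
          finally show ?thesis .
        qed
        also have "cmod (\<phi> N t) / \<bar>t\<bar> * freq_weight q t \<le> D3 t + D4 t + power_tail q (R N) t"
        proof -
          consider "\<bar>t\<bar> \<le> B" | "B < \<bar>t\<bar>" "\<bar>t\<bar> \<le> R N" | "B < \<bar>t\<bar>" "R N < \<bar>t\<bar>" by linarith
          then show ?thesis
          proof cases
            case 1
            have "cmod (\<phi> N t) / \<bar>t\<bar> * freq_weight q t \<le> cmod (\<phi> N t) / \<bar>t\<bar>" by (intro mult_left_le fw) auto
            also have "\<dots> \<le> (C2 * \<theta>2 ^ N) / \<delta>" using False \<delta> C2 1 N by (intro frac_le mid') auto
            also have "\<dots> = D3 t" using 1 by (simp add: D3_def abs_le_iff)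
            finally show ?thesis using nn[of t] by linarith
          next
            case 2
            have "cmod (\<phi> N t) / \<bar>t\<bar> * freq_weight q t \<le> cmod (\<phi> N t) / \<bar>t\<bar>" by (intro mult_left_le fw) auto
            also have "\<dots> \<le> (C3 * real N powr (- M)) / B" using 2 B C3 N unfolding M_def R_def by (intro frac_le high') auto
            also have "\<dots> = D4 t" using 2 by (simp add: D4_def abs_le_iff)
            finally show ?thesis using nn[of t] by linarith
          next
            case 3
            have "cmod (\<phi> N t) / \<bar>t\<bar> * freq_weight q t \<le> 1 / \<bar>t\<bar> * freq_weight q t"
              by (intro mult_right_mono divide_right_mono phi_le N fw) auto
            also have "\<dots> = power_tail q (R N) t" using 3 B by (simp add: freq_weight_def power_tail_def)
            finally show ?thesis using nn[of t] by linarith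
          qed
        qed
        finally show ?thesis using nn[of t] by linarith
      qed
      have "(LINT t|lborel. cmod (\<phi> N t - edgeworth_ft v a r N t) / \<bar>t\<bar> * freq_weight q t) \<le> (LINT t|lborel. D1 t + D2 t + D3 t + D4 t + power_tail q (R N) t + D6 t)"
        using I ptw by (intro integral_mono int N) (auto simp: has_bochner_integral_iff)
      also have "\<dots> = \<epsilon> * (1 / s) ^ r * Kl * J ml + 2 * \<delta> * (C0 * real N * \<theta>0 ^ N) + 2 * B * (C2 * \<theta>2 ^ N / \<delta>) + 2 * R N * (C3 * real N powr (- M) / B) + T1 / R N ^ q + (g ^ N * C5 / \<delta>) * J m5"
        using I by (rule has_bochner_integral_integral_eq)
      finally have "f N \<le> s ^ r * (\<epsilon> * (1 / s) ^ r * Kl * J ml + 2 * \<delta> * (C0 * real N * \<theta>0 ^ N) + 2 * B * (C2 * \<theta>2 ^ N / \<delta>) + 2 * R N * (C3 * real N powr (- M) / B) + T1 / R N ^ q + (g ^ N * C5 / \<delta>) * J m5)"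
        unfolding f_def s_def[symmetric] using s by (intro mult_left_mono) auto
      also have "\<dots> = s ^ r * (1 / s) ^ r * (\<epsilon> * (Kl * J ml)) + b N"
        unfolding b_def s_def[symmetric] by (simp add: distrib_left mult_ac)
      also have "s ^ r * (1 / s) ^ r = 1" using s by (simp flip: power_mult_distrib)
      finally show ?thesis by simp
    qed
    have sr: "sqrt (real N) ^ r \<le> real N ^ r" if "N \<ge> 1" for N
    proof (rule power_mono)
      show "sqrt (real N) \<le> real N" using that by (intro real_le_lsqrt) (auto simp: power2_eq_square)
    qed simp
    have geo: "(\<lambda>N. sqrt (real N) ^ r * (real N ^ k * \<theta> ^ N)) \<longlonglongrightarrow> 0" if "0 < \<theta>" "\<theta> < 1" for \<theta> and k
    proof (rule Lim_null_comparison)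
      show "(\<lambda>N. real N ^ (r + k) * \<theta> ^ N) \<longlonglongrightarrow> 0" by (rule power_times_geometric_tendsto_0[OF that])
      show "\<forall>\<^sub>F N in sequentially. norm (sqrt (real N) ^ r * (real N ^ k * \<theta> ^ N)) \<le> real N ^ (r + k) * \<theta> ^ N"
        using eventually_ge_at_top[of 1]
      proof eventually_elim
        case (elim N)
        have "sqrt (real N) ^ r * (real N ^ k * \<theta> ^ N) \<le> real N ^ r * (real N ^ k * \<theta> ^ N)"
          using that by (intro mult_right_mono sr elim) auto
        then show ?case using that by (simp add: power_add mult.assoc abs_mult)
      qed
    qed
    have sp: "sqrt (real N) ^ r = real N powr (real r / 2)" if "N \<ge> 1" for N
      using that by (simp add: powr_half_sqrt[symmetric] powr_powr flip: powr_realpow)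
    have pw: "(\<lambda>N. real N powr (- e)) \<longlonglongrightarrow> 0" if "e > 0" for e :: real
      by (rule tendsto_neg_powr) (use that filterlim_real_sequentially in auto)
    have L1: "(\<lambda>N. 2 * \<delta> * C0 * (sqrt (real N) ^ r * (real N ^ 1 * \<theta>0 ^ N))) \<longlonglongrightarrow> 0"
      by (intro tendsto_mult_right_zero geo C0)
    have L2: "(\<lambda>N. 2 * B * C2 / \<delta> * (sqrt (real N) ^ r * (real N ^ 0 * \<theta>2 ^ N))) \<longlonglongrightarrow> 0"
      by (intro tendsto_mult_right_zero geo C2)
    have L5: "(\<lambda>N. C5 / \<delta> * J m5 * (sqrt (real N) ^ r * (real N ^ 0 * g ^ N))) \<longlonglongrightarrow> 0"
      by (intro tendsto_mult_right_zero geo g)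
    have L3: "(\<lambda>N. sqrt (real N) ^ r * (2 * R N * (C3 * real N powr (- M) / B))) \<longlonglongrightarrow> 0"
    proof (rule Lim_transform_eventually)
      show "(\<lambda>N. 2 * c * C3 / B * real N powr (- 1)) \<longlonglongrightarrow> 0" by (intro tendsto_mult_right_zero pw) simp
      show "\<forall>\<^sub>F N in sequentially. 2 * c * C3 / B * real N powr (- 1) = sqrt (real N) ^ r * (2 * R N * (C3 * real N powr (- M) / B))"
        using eventually_ge_at_top[of 1]
      proof eventually_elim
        case (elim N)
        have "real N powr (real r / 2) * real N powr r1 * real N powr (- M) = real N powr (- 1)"
          unfolding M_def powr_add[symmetric] by (rule arg_cong2[of _ _ _ _ "(powr)"]) auto
        then show ?case unfolding sp[OF elim] R_def by (simp add: field_simps)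
      qed
    qed
    have L4: "(\<lambda>N. sqrt (real N) ^ r * (T1 / R N ^ q)) \<longlonglongrightarrow> 0"
    proof (rule Lim_transform_eventually)
      have "r1 * real q - real r / 2 > 0" using q(2) r1 by (simp add: field_simps)
      then show "(\<lambda>N. T1 / c ^ q * real N powr (- (r1 * real q - real r / 2))) \<longlonglongrightarrow> 0" by (intro tendsto_mult_right_zero pw)
      show "\<forall>\<^sub>F N in sequentially. T1 / c ^ q * real N powr (- (r1 * real q - real r / 2)) = sqrt (real N) ^ r * (T1 / R N ^ q)"
        using eventually_ge_at_top[of 1]
      proof eventually_elim
        case (elim N)
        have "(real N powr r1) ^ q = real N powr (r1 * real q)" using elim by (simp add: powr_powr flip: powr_realpow)
        then have "R N ^ q = c ^ q * real N powr (r1 * real q)" by (simp add: R_def power_mult_distrib)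
        moreover have "real N powr (- (r1 * real q - real r / 2)) = real N powr (real r / 2) / real N powr (r1 * real q)"
          by (simp add: powr_diff[symmetric])
        ultimately show ?case unfolding sp[OF elim] by simp
      qed
    qed
    have h1: "(\<lambda>N. 2 * \<delta> * C0 * (sqrt (real N) ^ r * (real N ^ 1 * \<theta>0 ^ N)) + 2 * B * C2 / \<delta> * (sqrt (real N) ^ r * (real N ^ 0 * \<theta>2 ^ N))
       + sqrt (real N) ^ r * (2 * R N * (C3 * real N powr (- M) / B)) + sqrt (real N) ^ r * (T1 / R N ^ q)
       + C5 / \<delta> * J m5 * (sqrt (real N) ^ r * (real N ^ 0 * g ^ N))) \<longlonglongrightarrow> 0 + 0 + 0 + 0 + 0"
      by (intro tendsto_add L1 L2 L3 L4 L5)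
    have h2: "b N = 2 * \<delta> * C0 * (sqrt (real N) ^ r * (real N ^ 1 * \<theta>0 ^ N)) + 2 * B * C2 / \<delta> * (sqrt (real N) ^ r * (real N ^ 0 * \<theta>2 ^ N))
       + sqrt (real N) ^ r * (2 * R N * (C3 * real N powr (- M) / B)) + sqrt (real N) ^ r * (T1 / R N ^ q)
       + C5 / \<delta> * J m5 * (sqrt (real N) ^ r * (real N ^ 0 * g ^ N))" for N
      unfolding b_def by (simp add: distrib_left mult_ac)
    have "b \<longlonglongrightarrow> 0" using h1 unfolding h2[symmetric] by simp
    moreover have "\<forall>\<^sub>F N in sequentially. f N \<le> \<epsilon> * (Kl * J ml) + b N"
      using eventually_ge_at_top[of N1] eventually_ge_at_top[of N3] eventually_ge_at_top[of 1] by eventually_elim (rule bound)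
    ultimately show ?thesis by blast
  qed
  have "f \<longlonglongrightarrow> 0"
  proof (rule tendstoI)
    fix e :: real assume e: "e > 0"
    define KJ where "KJ = Kl * J ml"
    have KJ: "KJ \<ge> 0" unfolding KJ_def using Kl J0 by simp
    define \<epsilon> where "\<epsilon> = e / (2 * (KJ + 1))"
    have eps: "\<epsilon> > 0" using e KJ by (simp add: \<epsilon>_def)
    have small: "\<epsilon> * KJ < e / 2"
    proof -
      have "\<epsilon> * KJ < \<epsilon> * (KJ + 1)" using eps by simp
      also have "\<dots> = e / 2" using KJ by (simp add: \<epsilon>_def field_simps)
      finally show ?thesis .
    qed
    obtain b where b: "b \<longlonglongrightarrow> 0" "\<forall>\<^sub>F N in sequentially. f N \<le> \<epsilon> * (Kl * J ml) + b N" using key[OF eps] by blast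
    have "\<forall>\<^sub>F N in sequentially. b N < e / 2" by (rule order_tendstoD(2)[OF b(1)]) (use e in simp)
    with b(2) show "\<forall>\<^sub>F N in sequentially. dist (f N) 0 < e"
    proof eventually_elim
      case (elim N)
      then show ?case using f0[of N] small unfolding KJ_def[symmetric] by (simp add: dist_real_def)
    qed
  qed
  then show ?thesis unfolding f_def .
qed

section \<open>Decay of powers at high frequencies\<close>

lemma norm_op_pow_power: "norm (op_pow T (n * k)) \<le> norm (op_pow T n) ^ k"
proof (induction k)
  case (Suc k)
  have "norm (op_pow T (n * Suc k)) \<le> norm (op_pow T n) * norm (op_pow T (n * k))"
    using norm_op_pow_add[of T n "n * k"] by simp
  also have "\<dots> \<le> norm (op_pow T n) * norm (op_pow T n) ^ k" using Suc by (intro mult_left_mono) auto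
  finally show ?case by simp
qed (simp add: op_pow_0 norm_blinfun_id_le)

text \<open>Splitting \<open>N\<close> into \<open>k\<close> nearly equal blocks upgrades the decay rate from \<open>r2\<close> to \<open>k r2\<close>.\<close>

lemma op_pow_polynomial_decay:
  fixes T :: "real \<Rightarrow> 'b::banach \<Rightarrow>\<^sub>L 'b" and K r1 r2 N0 M :: real
  assumes r: "r1 > 0" "r2 > 0"
    and dec: "\<And>t N. real N > N0 \<Longrightarrow> K \<le> \<bar>t\<bar> \<Longrightarrow> \<bar>t\<bar> \<le> real N powr r1 \<Longrightarrow> norm (op_pow (T t) N) \<le> real N powr (- r2)"
  shows "\<exists>c>0. \<exists>C\<ge>0. \<exists>N1. \<forall>N\<ge>N1. \<forall>t. K \<le> \<bar>t\<bar> \<longrightarrow> \<bar>t\<bar> \<le> c * real N powr r1 \<longrightarrow> norm (op_pow (T t) N) \<le> C * real N powr (- M)"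
proof -
  obtain k0 :: nat where k0: "M / r2 < real k0" using reals_Archimedean2 by blast
  define k where "k = Suc k0"
  have "M < r2 * real k0" using k0 r by (simp add: field_simps)
  also have "r2 * real k0 \<le> r2 * real k" using r by (simp add: k_def)
  finally have k: "k \<ge> 1" "M \<le> r2 * real k" by (auto simp: k_def)
  \<comment> \<open>Blocks have length about \<open>N / k\<close>; the factor 2 absorbs the
    rounding, so that every block is longer than \<open>N / D\<close>. The frequency range shrinks
    accordingly by \<open>(1 / D) powr r1\<close>.\<close>
  define D where "D = 2 * real k"
  have D: "D > 0" "D = 2 * real k" using k by (auto simp: D_def)
  define C where "C = D powr (r2 * real k)"
  obtain N1 :: nat where N1: "max (D * (\<bar>N0\<bar> + 1)) D < real N1" using reals_Archimedean2 by blast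
  have "norm (op_pow (T t) N) \<le> C * real N powr (- M)"
    if N: "N \<ge> N1" and t: "K \<le> \<bar>t\<bar>" "\<bar>t\<bar> \<le> (1 / D) powr r1 * real N powr r1" for N t
  proof -
    have NN: "real N > D * (\<bar>N0\<bar> + 1)" "real N > D" using N1 N by linarith+
    define n where "n = N div k"
    define j where "j = N mod k"
    \<comment> \<open>\<open>j\<close> blocks of length \<open>n + 1\<close> and
      \<open>k - j\<close> blocks of length \<open>n\<close>, so that no short block
      remains.\<close>
    have Nj: "N = (n + 1) * j + n * (k - j)"
    proof -
      have "j \<le> k" using k by (simp add: j_def)
      then have "(n + 1) * j + n * (k - j) = n * k + j" by (simp add: algebra_simps diff_mult_distrib2 flip: add_mult_distrib2)
      also have "\<dots> = N" by (simp add: n_def j_def)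
      finally show ?thesis by simp
    qed
    have "real N / real k < real n + 1"
    proof -
      have "N < k * (n + 1)" using k dividend_less_times_div[of k N] by (simp add: n_def algebra_simps)
      then have "real N < real k * (real n + 1)" by (metis of_nat_1 of_nat_add of_nat_less_iff of_nat_mult)
      then show ?thesis using k by (simp add: field_simps)
    qed
    moreover have "real N / real k = 2 * (real N / D)" using k by (simp add: D_def)
    moreover have ND1: "real N / D > \<bar>N0\<bar> + 1" using NN D by (simp add: field_simps)
    ultimately have nD: "real n > real N / D" by linarith
    have blk: "norm (op_pow (T t) n') \<le> (real N / D) powr (- r2)" if n': "n \<le> n'" for n'
    proof -
      have n'D: "real N / D < real n'" using nD n' by linarith
      have pos: "0 < real N / D" using ND1 by linarith
      have "\<bar>t\<bar> \<le> (real N / D) powr r1" using t(2) D by (simp add: powr_divide)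
      also have "\<dots> \<le> real n' powr r1" using n'D pos r by (intro powr_mono2) auto
      finally have "norm (op_pow (T t) n') \<le> real n' powr (- r2)"
        using n'D ND1 t(1) by (intro dec) auto
      also have "\<dots> \<le> (real N / D) powr (- r2)" using n'D pos r by (intro powr_mono2') auto
      finally show ?thesis .
    qed
    let ?b = "(real N / D) powr (- r2)"
    have "norm (op_pow (T t) N) \<le> norm (op_pow (T t) ((n + 1) * j)) * norm (op_pow (T t) (n * (k - j)))"
      by (subst Nj) (rule norm_op_pow_add)
    also have "\<dots> \<le> norm (op_pow (T t) (n + 1)) ^ j * norm (op_pow (T t) n) ^ (k - j)"
      by (intro mult_mono norm_op_pow_power) auto
    also have "\<dots> \<le> ?b ^ j * ?b ^ (k - j)" by (intro mult_mono power_mono blk) auto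
    also have "\<dots> = ?b ^ k" using k by (simp add: j_def flip: power_add)
    also have "\<dots> = (real N / D) powr (- (r2 * real k))"
    proof -
      have "0 < real N / D" using ND1 by linarith
      then have "real N / D \<noteq> 0" by linarith
      then have "0 < ?b" by (simp only: powr_gt_zero not_False_eq_True)
      then have "?b ^ k = ?b powr real k" by (simp only: powr_realpow)
      then show ?thesis by (simp add: powr_powr)
    qed
    also have "\<dots> = C * real N powr (- (r2 * real k))"
      using D by (simp add: C_def powr_divide powr_minus_divide)
    also have "\<dots> \<le> C * real N powr (- M)"
    proof (intro mult_left_mono powr_mono)
      have "D \<ge> 1" using k by (simp add: D_def)
      then show "1 \<le> real N" using NN by linarith
    qed (use k in \<open>auto simp: C_def\<close>)
    finally show ?thesis .
  qed
  then show ?thesis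
    by (intro exI[of _ "(1 / D) powr r1"] conjI exI[of _ C] exI[of _ N1]) (use D in \<open>auto simp: C_def\<close>)
qed

section \<open>The comparison Gaussian and the inverse transform of the corrections\<close>

lemma nfrak_eq_normal_density: "v > 0 \<Longrightarrow> nfrak v x = normal_density 0 (sqrt v) x"
  by (simp add: nfrak_def normal_density_def)

lemma nfrak_measurable [measurable]: "nfrak v \<in> borel_measurable borel"
  unfolding nfrak_def by measurable

lemma scaled_normal:
  fixes v s :: real
  assumes v: "v > 0" and s: "s > 0"
  defines "G \<equiv> density lborel (normal_density 0 (s * sqrt v))"
  shows scaled_normal_distribution: "real_distribution G"
    and char_scaled_normal: "char G t = complex_of_real (exp (- v * (s * t)\<^sup>2 / 2))"
    and cdf_scaled_normal: "cdf G x = Nfrak v (x / s)"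
proof -
  have sv: "s * sqrt v > 0" using v s by simp
  show "real_distribution G"
    unfolding G_def real_distribution_def real_distribution_axioms_def using prob_space_normal_density[OF sv] by simp
  have "char G t = (LINT x|lborel. iexp (t * x) * complex_of_real (normal_density 0 (s * sqrt v) x))"
    unfolding char_def G_def by (subst integral_density) (auto simp: scaleR_conv_of_real mult.commute)
  also have "\<dots> = complex_of_real (exp (- ((s * sqrt v) * t)\<^sup>2 / 2))" by (rule gauss_ft[OF sv])
  also have "- ((s * sqrt v) * t)\<^sup>2 / 2 = - v * (s * t)\<^sup>2 / 2" using v by (simp add: power_mult_distrib)
  finally show "char G t = complex_of_real (exp (- v * (s * t)\<^sup>2 / 2))" .
  have int: "integrable lborel (\<lambda>u. indicator {..x} u * normal_density 0 (s * sqrt v) u)"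
    using integrable_mult_indicator[OF _ integrable_normal_density[OF sv], of "{..x}"] by simp
  have "cdf G x = (LINT u|lborel. indicator {..x} u * normal_density 0 (s * sqrt v) u)"
  proof -
    have "cdf G x = (LINT u|G. indicator {..x} u)" unfolding cdf_def by (simp add: G_def)
    also have "\<dots> = (LINT u|lborel. normal_density 0 (s * sqrt v) u *\<^sub>R indicator {..x} u)"
      unfolding G_def by (subst integral_density) auto
    finally show ?thesis by (simp add: mult.commute)
  qed
  also have "\<dots> = \<bar>s\<bar> *\<^sub>R (LINT u|lborel. indicator {..x} (0 + s * u) * normal_density 0 (s * sqrt v) (0 + s * u))"
    by (rule lborel_integral_real_affine) (use s in simp)
  also have "\<dots> = (LINT u|lborel. indicator {..x / s} u *\<^sub>R nfrak v u)"
    unfolding integral_scaleR_right[symmetric]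
  proof (rule Bochner_Integration.integral_cong[OF refl])
    fix u
    have "s * normal_density 0 (s * sqrt v) (s * u) = nfrak v u"
      using s v by (simp add: normal_density_def nfrak_def real_sqrt_mult power_mult_distrib field_simps)
    then show "\<bar>s\<bar> *\<^sub>R (indicator {..x} (0 + s * u) * normal_density 0 (s * sqrt v) (0 + s * u)) = indicator {..x / s} u *\<^sub>R nfrak v u"
      using s by (auto split: split_indicator simp: field_simps)
  qed
  finally show "cdf G x = Nfrak v (x / s)" by (simp add: Nfrak_def set_lebesgue_integral_def)
qed

lemma poly_real_part:
  fixes P :: "complex poly"
  shows "\<exists>Q :: real poly. \<forall>x. poly Q x = Re (poly P (complex_of_real x))"
proof -
  have "poly (\<Sum>i\<le>degree P. monom (Re (coeff P i)) i) x = Re (poly P (complex_of_real x))" for x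
    by (simp add: poly_sum poly_monom poly_altdef[of P] flip: of_real_power)
  then show ?thesis by blast
qed

text \<open>Linear vanishing at 0 compensates the division by \<open>t\<close>; beyond 1 the
  quotient is at most \<open>2 / \<bar>t\<bar>\<close> and the weight adds the decay
  \<open>|t|^(-q)\<close>.\<close>

lemma (in two_distributions) char_quot_integrable:
  assumes q: "q \<ge> 1" and d: "d > 0" and near: "\<And>t. \<bar>t\<bar> \<le> d \<Longrightarrow> cmod (char_diff t) \<le> C * \<bar>t\<bar>"
  shows "integrable lborel (\<lambda>t. cmod (char_quot t) * freq_weight q t)"
proof (rule Bochner_Integration.integrable_bound)
  have C: "C \<ge> 0" using near[of d] d norm_ge_zero[of "char_diff d"] by (smt (verit) abs_of_pos mult_neg_pos)
  define D where "D t = indicator {-1..1} t * (C + 2 / d) + 2 * power_tail q 1 t" for t :: real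
  have "integrable lborel (\<lambda>t::real. indicator {-1..1} t * (C + 2 / d))"
    using has_bochner_integral_symmetric_window[of 1 "C + 2 / d"] by (simp add: has_bochner_integral_iff)
  then show "integrable lborel D"
    unfolding D_def by (intro Bochner_Integration.integrable_add integrable_mult_right integrable_power_tail_1 q)
  have cq: "cmod (char_quot t) = cmod (char_diff t) / \<bar>t\<bar>" for t by (simp add: char_quot_def norm_divide norm_mult)
  have two: "cmod (char_diff t) \<le> 2" for t
    using order_trans[OF norm_triangle_ineq4 add_mono[OF M1.cmod_char_le_1[of t] M2.cmod_char_le_1[of t]]] by (simp add: char_diff_def)
  show "AE t in lborel. norm (cmod (char_quot t) * freq_weight q t) \<le> norm (D t)"
  proof (rule AE_I2)
    fix t
    have "cmod (char_quot t) * freq_weight q t \<le> D t"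
    proof (cases "\<bar>t\<bar> \<le> 1")
      case True
      have "cmod (char_quot t) \<le> C + 2 / d"
      proof (cases "\<bar>t\<bar> \<le> d")
        case True
        have "cmod (char_diff t) / \<bar>t\<bar> \<le> C" using near[OF True] C by (cases "t = 0") (auto simp: field_simps)
        then show ?thesis using d by (simp add: cq add_increasing2)
      next
        case False
        have "cmod (char_diff t) / \<bar>t\<bar> \<le> 2 / d" using two[of t] False d by (intro frac_le) auto
        then show ?thesis using C by (simp add: cq)
      qed
      moreover have "power_tail q 1 t = 0" using True by (simp add: power_tail_def)
      ultimately show ?thesis using True by (simp add: D_def freq_weight_def abs_le_iff)
    next
      case False
      have "cmod (char_quot t) * freq_weight q t \<le> (2 / \<bar>t\<bar>) * freq_weight q t"
        unfolding cq by (intro mult_right_mono divide_right_mono two freq_weight_nonneg) auto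
      also have "\<dots> = 2 * power_tail q 1 t" using False by (simp add: freq_weight_def power_tail_def)
      also have "\<dots> \<le> D t" unfolding D_def using C d by simp
      finally show ?thesis .
    qed
    then show "norm (cmod (char_quot t) * freq_weight q t) \<le> norm (D t)"
      using freq_weight_nonneg[of q t] by simp
  qed
qed measurable

text \<open>The factor \<open>\<i>\<close> is \<open>1 / (-\<i>)\<close>: dividing
  \<open>x * a p x\<close> by \<open>-\<i> * x\<close> leaves \<open>\<i> * a p x\<close>.\<close>

definition edgeworth_kernel :: "real \<Rightarrow> (nat \<Rightarrow> complex poly) \<Rightarrow> nat \<Rightarrow> real \<Rightarrow> complex" where
  "edgeworth_kernel v a p t = poly (smult \<i> (a p)) (complex_of_real t) * complex_of_real (exp (- v * t\<^sup>2 / 2))"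

lemma edgeworth_kernel_integrable: "v > 0 \<Longrightarrow> integrable lborel (edgeworth_kernel v a p)"
  unfolding edgeworth_kernel_def by (rule integrable_gauss_poly)

text \<open>In terms of the unnormalised sum the correction has Fourier transform \<open>edgeworth_corr\<close>,
  so that its quotient by \<open>-it\<close> has no pole at 0.\<close>

definition edgeworth_corr :: "real \<Rightarrow> (nat \<Rightarrow> complex poly) \<Rightarrow> nat \<Rightarrow> nat \<Rightarrow> real \<Rightarrow> complex" where
  "edgeworth_corr v a r N t = (\<Sum>p=1..r. complex_of_real (1 / sqrt (real N)) ^ p * (complex_of_real (sqrt (real N)) * edgeworth_kernel v a p (sqrt (real N) * t)))"

lemma edgeworth_corr_integrable:
  assumes v: "v > 0" and N: "N \<ge> 1"
  shows "integrable lborel (edgeworth_corr v a r N)"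
proof -
  have "integrable lborel (\<lambda>t. edgeworth_kernel v a p (0 + sqrt (real N) * t))" for p
    by (rule lborel_integrable_real_affine[OF edgeworth_kernel_integrable[OF v]]) (use N in simp)
  then show ?thesis unfolding edgeworth_corr_def by (intro Bochner_Integration.integrable_sum integrable_mult_right) simp
qed

lemma edgeworth_corr_ft:
  assumes N: "N \<ge> 1"
  shows "- (\<i> * complex_of_real t) * edgeworth_corr v a r N t = edgeworth_ft v a r N t - complex_of_real (exp (- v * (sqrt (real N) * t)\<^sup>2 / 2))"
proof -
  define x where "x = sqrt (real N) * t"
  define E where "E = complex_of_real (exp (- v * x\<^sup>2 / 2))"
  have "- (\<i> * complex_of_real t) * edgeworth_corr v a r N t = (\<Sum>p=1..r. complex_of_real (1 / sqrt (real N)) ^ p * (complex_of_real x * poly (a p) (complex_of_real x)) * E)"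
    unfolding edgeworth_corr_def sum_distrib_left
  proof (rule sum.cong[OF refl])
    fix p
    have "- (\<i> * complex_of_real t) * (complex_of_real (sqrt (real N)) * edgeworth_kernel v a p x) = complex_of_real x * poly (a p) (complex_of_real x) * E"
      unfolding edgeworth_kernel_def E_def by (simp add: x_def mult_ac)
    then show "- (\<i> * complex_of_real t) * (complex_of_real (1 / sqrt (real N)) ^ p * (complex_of_real (sqrt (real N)) * edgeworth_kernel v a p (sqrt (real N) * t)))
        = complex_of_real (1 / sqrt (real N)) ^ p * (complex_of_real x * poly (a p) (complex_of_real x)) * E"
      unfolding x_def[symmetric] by (metis (no_types, opaque_lifting) mult.assoc mult.left_commute)
  qed
  also have "\<dots> = edgeworth_ft v a r N t - E"
    unfolding edgeworth_ft_def Let_def x_def[symmetric] E_def[symmetric] by (simp add: distrib_left sum_distrib_left mult.commute)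
  finally show ?thesis by (simp add: E_def x_def)
qed

text \<open>Rescaling the frequency by \<open>sqrt N\<close> rescales the argument to
  \<open>x / sqrt N\<close>, and the Jacobian cancels the factor \<open>sqrt N\<close> inside
  \<open>edgeworth_corr\<close>.\<close>

lemma edgeworth_corr_transform:
  assumes v: "v > 0" and N: "N \<ge> 1"
    and P: "\<And>p x. (LINT t|lborel. iexp (- (t * x)) * edgeworth_kernel v a p t) / (2 * pi) = poly (P p) (complex_of_real x) * complex_of_real (nfrak v x)"
  shows "(LINT t|lborel. iexp (- (t * x)) * edgeworth_corr v a r N t) / (2 * pi) =
    (\<Sum>p=1..r. complex_of_real (1 / sqrt (real N)) ^ p * (poly (P p) (complex_of_real (x / sqrt (real N))) * complex_of_real (nfrak v (x / sqrt (real N)))))"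
proof -
  let ?s = "sqrt (real N)"
  have s: "?s > 0" using N by simp
  have i: "integrable lborel (\<lambda>t. iexp (- (t * x)) * edgeworth_kernel v a p (?s * t))" for p
  proof (rule Bochner_Integration.integrable_bound)
    show "integrable lborel (\<lambda>t. edgeworth_kernel v a p (?s * t))"
      using lborel_integrable_real_affine[where f = "edgeworth_kernel v a p" and c = ?s and t = 0, OF edgeworth_kernel_integrable[OF v]] s by simp
    then have [measurable]: "(\<lambda>t. edgeworth_kernel v a p (?s * t)) \<in> borel_measurable lborel" by auto
    show "(\<lambda>t. iexp (- (t * x)) * edgeworth_kernel v a p (?s * t)) \<in> borel_measurable lborel" by measurable
  qed (simp add: norm_mult)
  have each: "(LINT t|lborel. complex_of_real ?s * (iexp (- (t * x)) * edgeworth_kernel v a p (?s * t))) = (LINT t|lborel. iexp (- (t * (x / ?s))) * edgeworth_kernel v a p t)" for p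
    using lborel_integral_real_affine[of ?s "\<lambda>t. iexp (- (t * (x / ?s))) * edgeworth_kernel v a p t" 0] s
    by (simp add: scaleR_conv_of_real)
  have "(LINT t|lborel. iexp (- (t * x)) * edgeworth_corr v a r N t) =
     (LINT t|lborel. (\<Sum>p=1..r. complex_of_real (1 / ?s) ^ p * (complex_of_real ?s * (iexp (- (t * x)) * edgeworth_kernel v a p (?s * t)))))"
    unfolding edgeworth_corr_def sum_distrib_left by (intro Bochner_Integration.integral_cong refl sum.cong) (simp only: mult_ac)
  also have "\<dots> = (\<Sum>p=1..r. LINT t|lborel. complex_of_real (1 / ?s) ^ p * (complex_of_real ?s * (iexp (- (t * x)) * edgeworth_kernel v a p (?s * t))))"
    by (rule Bochner_Integration.integral_sum) (intro integrable_mult_right i)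
  also have "\<dots> = (\<Sum>p=1..r. complex_of_real (1 / ?s) ^ p * (LINT t|lborel. iexp (- (t * (x / ?s))) * edgeworth_kernel v a p t))"
    by (intro sum.cong refl) (simp only: integral_mult_right_zero each[symmetric])
  finally have F: "(LINT t|lborel. iexp (- (t * x)) * edgeworth_corr v a r N t) = (\<Sum>p=1..r. complex_of_real (1 / ?s) ^ p * (LINT t|lborel. iexp (- (t * (x / ?s))) * edgeworth_kernel v a p t))" .
  show ?thesis unfolding F sum_divide_distrib times_divide_eq_right[symmetric] P ..
qed

lemma sum_split_first_three:
  fixes f :: "nat \<Rightarrow> complex"
  shows "(\<Sum>k\<le>r + 2. f k) = f 0 + f 1 + f 2 + (\<Sum>i=1..r. f (i + 2))"
  by (induction r) (simp_all add: numeral_2_eq_2 add.assoc)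

text \<open>All terms of order above 2 are lumped into the remainder \<open>\<eta>2\<close>, so that
  the limit theorem determines the first two coefficients while the higher ones are kept as they
  are.\<close>

lemma log_expansion_centered:
  fixes lam :: "real \<Rightarrow> complex" and A v :: real
  assumes lam: "peano (r + 2) lam" "lam 0 = 1"
    and lim: "\<And>t::real. (\<lambda>N. lam (t / sqrt (real N)) ^ N * iexp (- (sqrt (real N) * t * A))) \<longlonglongrightarrow> complex_of_real (exp (- v * t\<^sup>2 / 2))"
  shows "\<exists>c \<eta> d. d > 0 \<and> isCont \<eta> 0 \<and> \<eta> 0 = 0 \<and> (\<forall>t. \<bar>t\<bar> < d \<longrightarrow>
    lam t = exp (\<i> * complex_of_real (A * t) - complex_of_real (v * t\<^sup>2 / 2) +
        (\<Sum>i=1..r. c i * complex_of_real t ^ (i + 2)) + complex_of_real t ^ (r + 2) * \<eta> t))"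
proof -
  obtain c \<eta> d where d: "d > 0" and eta: "isCont \<eta> 0" "\<eta> 0 = 0" and c0: "c 0 = 0"
    and ex: "\<And>t. \<bar>t\<bar> < d \<Longrightarrow> lam t = exp ((\<Sum>k\<le>r + 2. complex_of_real t ^ k * c k) + complex_of_real t ^ (r + 2) * \<eta> t)"
    using log_expansion[OF lam] by blast
  have ex3: "(\<Sum>k\<le>r + 2. complex_of_real t ^ k * c k) = complex_of_real t * c 1 + (complex_of_real t)\<^sup>2 * c 2 + (\<Sum>i=1..r. c (i + 2) * complex_of_real t ^ (i + 2))" for t
    unfolding sum_split_first_three using c0 by (simp add: mult.commute)
  define \<eta>2 where "\<eta>2 t = (\<Sum>i=1..r. c (i + 2) * complex_of_real t ^ i) + complex_of_real t ^ r * \<eta> t" for t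
  have eta2: "isCont \<eta>2 0"
    unfolding \<eta>2_def by (intro continuous_intros eta)
  have "(\<Sum>i=1..r. c (i + 2) * complex_of_real 0 ^ i) = 0" by (rule sum.neutral) auto
  then have eta20: "\<eta>2 0 = 0" using eta(2) by (simp add: \<eta>2_def)
  have lam2: "lam t = exp (complex_of_real t * c 1 + (complex_of_real t)\<^sup>2 * c 2 + (complex_of_real t)\<^sup>2 * \<eta>2 t)" if "\<bar>t\<bar> < d" for t
    unfolding ex[OF that] ex3 \<eta>2_def by (simp add: distrib_left sum_distrib_left power_add power2_eq_square mult_ac add.assoc)
  have c12: "c 1 = \<i> * complex_of_real A" "c 2 = - complex_of_real v / 2"
    using cumulants_from_clt[OF d lam2 eta2 eta20 lim] by blast+
  show ?thesis
  proof (rule exI[of _ "\<lambda>i. c (i + 2)"], rule exI[of _ \<eta>], rule exI[of _ d], intro conjI d eta allI impI)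
    fix t assume t: "\<bar>t\<bar> < d"
    have "complex_of_real t * c 1 + (complex_of_real t)\<^sup>2 * c 2 = \<i> * complex_of_real (A * t) - complex_of_real (v * t\<^sup>2 / 2)"
      unfolding c12 by simp
    then show "lam t = exp (\<i> * complex_of_real (A * t) - complex_of_real (v * t\<^sup>2 / 2) +
        (\<Sum>i=1..r. c (i + 2) * complex_of_real t ^ (i + 2)) + complex_of_real t ^ (r + 2) * \<eta> t)"
      unfolding ex[OF t] ex3 by simp
  qed
qed

section \<open>The averaged expansion for the sums\<close>

lemma peano_op_pow: "peano m L \<Longrightarrow> peano m (\<lambda>t. op_pow (L t) N)"
proof (induction N)
  case (Suc N)
  then show ?case unfolding op_pow_Suc by (intro peano_bilinear[OF bounded_bilinear_blinfun_compose])
qed (simp add: op_pow_0)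

lemma norm_iexp_minus_1_le: "cmod (iexp x - 1) \<le> \<bar>x\<bar>"
  using iexp_approx1[of x 0] by simp

theorem theorem2p6:
  fixes M :: "'a measure"
    and X :: "nat \<Rightarrow> 'a \<Rightarrow> real"
    and cs :: "complex \<Rightarrow> 'b::banach \<Rightarrow> 'b"
    and L :: "real \<Rightarrow> ('b \<Rightarrow>\<^sub>L 'b)"
    and v :: 'b
    and l :: "'b \<Rightarrow>\<^sub>L complex"
    and r q :: nat
    and \<delta> K r1 r2 N0 A \<sigma>2 :: real
  assumes prob: "prob_space M"
    and rv: "\<And>n. n \<ge> 1 \<Longrightarrow> X n \<in> borel_measurable M"
    and cbanach: "complex_banach_structure cs"
    and Lclin: "\<And>t. clinear_op cs (L t)"
    and lclin: "clinear_functional cs l"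
    and charf: "\<And>t N. N \<ge> 1 \<Longrightarrow>
        prob_space.expectation M (\<lambda>\<omega>. cis (t * (\<Sum>n\<in>{1..N}. X n \<omega>)))
          = blinfun_apply l (blinfun_apply (op_pow (L t) N) v)"
    \<comment> \<open>(A1) with s = r + 2\<close>
    and A1_cont: "continuous_on UNIV L"
    and A1_delta: "\<delta> > 0"
    and A1_diff: "Cs_on_interval (r + 2) \<delta> L"
    \<comment> \<open>(A2)\<close>
    and A2_simple: "simple_eigenvalue cs (L 0) 1"
    and A2_isolated: "isolated_in_spectrum cs (L 0) 1"
    and A2_others: "\<And>mu. is_eigenvalue cs (L 0) mu \<Longrightarrow> mu \<noteq> 1 \<Longrightarrow> cmod mu < 1"
    and A2_ess: "\<exists>\<rho><1. \<forall>mu\<in>essential_spectrum cs (L 0). cmod mu \<le> \<rho>"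
    \<comment> \<open>(A3)\<close>
    and A3: "\<And>t. t \<noteq> 0 \<Longrightarrow> op_spectrum cs (L t) \<subseteq> {z. cmod z < 1}"
    \<comment> \<open>(A4)\<close>
    and A4_pos: "K > 0" "r1 > 0" "r2 > 0" "N0 > 0"
    and A4: "\<And>t N. real N > N0 \<Longrightarrow> K \<le> \<bar>t\<bar> \<Longrightarrow> \<bar>t\<bar> \<le> real N powr r1 \<Longrightarrow>
        norm (op_pow (L t) N) \<le> real N powr (- r2)"
    \<comment> \<open>the CLT constants A, \<sigma>^2, with \<sigma>^2 > 0\<close>
    and sigma_pos: "\<sigma>2 > 0"
    and CLT: "weak_conv_m
        (\<lambda>N. distr M borel (\<lambda>\<omega>. ((\<Sum>n\<in>{1..N}. X n \<omega>) - real N * A) / sqrt (real N)))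
        (density lborel (nfrak \<sigma>2))"
    and r_pos: "r \<ge> 1"
    and q_big: "real q > real r / (2 * r1)"
  shows "\<exists>P :: nat \<Rightarrow> real poly. \<exists>\<epsilon> :: nat \<Rightarrow> real. \<epsilon> \<longlonglongrightarrow> 0 \<and>
    (\<forall>N\<ge>1. \<forall>z::real. \<forall>f\<in>F_space q 0.
       \<bar>(LINT y|lborel.
           (prob_space.prob M {\<omega>\<in>space M.
               ((\<Sum>n\<in>{1..N}. X n \<omega>) - real N * A) / sqrt (real N) \<le> z + y / sqrt (real N)}
            - Nfrak \<sigma>2 (z + y / sqrt (real N))) * f y)
        - (\<Sum>p\<in>{1..r}. 1 / sqrt (real N) ^ p *
             (LINT y|lborel. poly (P p) (z + y / sqrt (real N)) * nfrak \<sigma>2 (z + y / sqrt (real N)) * f y))\<bar>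
       \<le> C_norm q 0 f * \<epsilon> N / sqrt (real N) ^ r)"
proof -
  interpret prob_space M by (rule prob)
  interpret complex_banach cs by unfold_locales (rule cbanach)
  have q1: "q \<ge> 1"
  proof -
    have "real r / (2 * r1) > 0" using r_pos A4_pos by simp
    then have "real q > 0" using q_big by linarith
    then show ?thesis by simp
  qed
  define S where "S N \<omega> = (\<Sum>n\<in>{1..N}. X n \<omega>)" for N \<omega>
  have S_meas [measurable]: "S N \<in> borel_measurable M" for N
    unfolding S_def by (intro borel_measurable_sum rv) auto
  \<comment> \<open>The laws are compared at the scale of the unnormalised sum, because this is the
    scale of the averaging variable: \<open>z + y / sqrt N = (sqrt N * z + y) / sqrt N\<close>. Then
    \<open>f\<close> needs no rescaling and its norm stays the same for all
    \<open>N\<close>.\<close>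
  define M1 where "M1 N = distr M borel (\<lambda>\<omega>. S N \<omega> - real N * A)" for N
  define M2 where "M2 N = density lborel (normal_density 0 (sqrt (real N) * sqrt \<sigma>2))" for N :: nat
  have rd1: "real_distribution (M1 N)" for N
    unfolding M1_def by (intro real_distribution_distr) measurable
  have rd2: "real_distribution (M2 N)" if "N \<ge> 1" for N
    unfolding M2_def by (rule scaled_normal_distribution[OF sigma_pos]) (use that in simp)
  define \<phi> where "\<phi> N t = l (op_pow (L t) N v)" for N t
  have char1: "char (M1 N) t = iexp (- (real N * A * t)) * \<phi> N t" if N: "N \<ge> 1" for N t
  proof -
    have "char (M1 N) t = (LINT \<omega>|M. iexp (t * (S N \<omega> - real N * A)))"
      unfolding char_def M1_def by (subst integral_distr) auto
    also have "\<dots> = (LINT \<omega>|M. iexp (- (real N * A * t)) * cis (t * S N \<omega>))"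
      by (intro Bochner_Integration.integral_cong refl) (simp add: cis_conv_exp algebra_simps flip: exp_add)
    also have "\<dots> = iexp (- (real N * A * t)) * \<phi> N t"
      unfolding integral_mult_right_zero \<phi>_def charf[OF N, symmetric] S_def ..
    finally show ?thesis .
  qed
  have norm_char1: "cmod (char (M1 N) t) = cmod (\<phi> N t)" if "N \<ge> 1" for N t
    unfolding char1[OF that] by (simp add: norm_mult)
  have char2: "char (M2 N) t = complex_of_real (exp (- \<sigma>2 * (sqrt (real N) * t)\<^sup>2 / 2))" if "N \<ge> 1" for N t
    unfolding M2_def by (rule char_scaled_normal[OF sigma_pos]) (use that in simp)
  have phi0: "\<phi> N 0 = 1" if N: "N \<ge> 1" for N
    using charf[OF N, of 0] prob_space by (simp add: \<phi>_def)
  have smooth: "peano (r + 2) L" by (rule Cs_on_interval_peano[OF A1_delta A1_diff])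
  then have smooth': "peano (Suc (r + 1)) L" by simp
  obtain lam Z d C \<theta> where plam: "peano (Suc (r + 1)) lam" and pZ: "peano (Suc (r + 1)) Z" and lam0: "lam 0 = 1"
    and d: "d > 0" and C: "C \<ge> 0" and th: "0 < \<theta>" "\<theta> < 1"
    and R1: "\<And>t N. \<bar>t\<bar> < d \<Longrightarrow> N \<ge> 1 \<Longrightarrow> cmod (l (op_pow (L t) N v) - lam t ^ N * Z t) \<le> C * \<theta> ^ N"
    and R2: "\<And>t N. \<bar>t\<bar> < d \<Longrightarrow> N \<ge> 1 \<Longrightarrow>
      cmod ((l (op_pow (L t) N v) - lam t ^ N * Z t) - (l (op_pow (L 0) N v) - Z 0)) \<le> C * \<bar>t\<bar> * real N * \<theta> ^ N"
    by (rule perturbed_powers[OF Lclin lclin smooth' A2_simple A2_isolated A2_others A2_ess, where v = v]) (auto intro: that)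
  have geo: "(\<lambda>N. C * \<theta> ^ N) \<longlonglongrightarrow> 0"
    using th by (intro tendsto_mult_right_zero LIMSEQ_realpow_zero) auto
  \<comment> \<open>At \<open>t = 0\<close> the expectation and the eigenvalue are both 1, so the
    constant \<open>1 - Z 0\<close> is bounded by \<open>C * \<theta> ^ N\<close> for every
    \<open>N \<ge> 1\<close>.\<close>
  have Z0: "Z 0 = 1"
  proof -
    have "\<forall>\<^sub>F N in sequentially. norm (1 - Z 0) \<le> C * \<theta> ^ N"
      using eventually_ge_at_top[of 1]
    proof eventually_elim
      case (elim N)
      then show ?case using R1[of 0 N] d phi0[of N] by (simp add: \<phi>_def lam0)
    qed
    then have "(\<lambda>N::nat. 1 - Z 0) \<longlonglongrightarrow> 0" using geo by (rule Lim_null_comparison)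
    then show ?thesis by (simp add: LIMSEQ_const_iff)
  qed
  \<comment> \<open>The remainder vanishes at \<open>t = 0\<close> since
    \<open>\<phi> N 0 = 1 = Z 0\<close>; the bound on its increment is therefore a bound on the
    remainder itself, with the factor \<open>\<bar>t\<bar>\<close>.\<close>
  have rem: "cmod (\<phi> N t - lam t ^ N * Z t) \<le> C * \<bar>t\<bar> * real N * \<theta> ^ N" if "\<bar>t\<bar> < d" "N \<ge> 1" for N t
    using R2[OF that] phi0[OF that(2)] by (simp add: \<phi>_def Z0)
  have CLT': "(\<lambda>N. char (M1 N) (t / sqrt (real N))) \<longlonglongrightarrow> complex_of_real (exp (- \<sigma>2 * t\<^sup>2 / 2))" for t
  proof -
    have dens: "density lborel (nfrak \<sigma>2) = density lborel (normal_density 0 (1 * sqrt \<sigma>2))"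
      using nfrak_eq_normal_density[OF sigma_pos] by (simp add: fun_eq_iff[symmetric])
    have "(\<lambda>N. char (distr M borel (\<lambda>\<omega>. (S N \<omega> - real N * A) / sqrt (real N))) t) \<longlonglongrightarrow> char (density lborel (nfrak \<sigma>2)) t"
    proof (rule levy_continuity1)
      show "real_distribution (distr M borel (\<lambda>\<omega>. (S N \<omega> - real N * A) / sqrt (real N)))" for N
        by (intro real_distribution_distr) measurable
      show "real_distribution (density lborel (nfrak \<sigma>2))"
        unfolding dens by (rule scaled_normal_distribution[OF sigma_pos]) simp
      show "weak_conv_m (\<lambda>N. distr M borel (\<lambda>\<omega>. (S N \<omega> - real N * A) / sqrt (real N))) (density lborel (nfrak \<sigma>2))"
        using CLT unfolding S_def .
    qed
    moreover have "char (density lborel (nfrak \<sigma>2)) t = complex_of_real (exp (- \<sigma>2 * t\<^sup>2 / 2))"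
      unfolding dens using char_scaled_normal[OF sigma_pos, of 1 t] by simp
    moreover have "char (distr M borel (\<lambda>\<omega>. (S N \<omega> - real N * A) / sqrt (real N))) t = char (M1 N) (t / sqrt (real N))" for N
    proof -
      have "char (distr M borel (\<lambda>\<omega>. (S N \<omega> - real N * A) / sqrt (real N))) t = (LINT \<omega>|M. iexp (t * ((S N \<omega> - real N * A) / sqrt (real N))))"
        unfolding char_def by (subst integral_distr) auto
      also have "\<dots> = (LINT \<omega>|M. iexp ((t / sqrt (real N)) * (S N \<omega> - real N * A)))"
        by (intro Bochner_Integration.integral_cong refl) simp
      also have "\<dots> = char (M1 N) (t / sqrt (real N))"
        unfolding char_def M1_def by (subst integral_distr) auto
      finally show ?thesis .
    qed
    ultimately show ?thesis by simp
  qed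
  \<comment> \<open>The limit theorem speaks about characteristic functions. It passes to the
    eigenvalue because the remainder tends to 0 and the amplitude \<open>Z\<close> tends to 1 along
    \<open>t / sqrt N\<close>.\<close>
  have lam_lim: "(\<lambda>N. lam (t / sqrt (real N)) ^ N * iexp (- (sqrt (real N) * t * A))) \<longlonglongrightarrow> complex_of_real (exp (- \<sigma>2 * t\<^sup>2 / 2))" for t :: real
  proof -
    let ?t = "\<lambda>N::nat. t / sqrt (real N)"
    let ?e = "\<lambda>N::nat. iexp (- (sqrt (real N) * t * A))"
    have t0: "?t \<longlonglongrightarrow> 0" by real_asymp
    have Zlim: "(\<lambda>N. Z (?t N)) \<longlonglongrightarrow> 1"
      using isCont_tendsto_compose[OF peano_isCont[OF pZ] t0] by (simp add: Z0)
    have near: "\<forall>\<^sub>F N in sequentially. \<bar>?t N\<bar> < d"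
      by (rule order_tendstoD(2)[OF tendsto_rabs_zero[OF t0] d])
    have Zne: "\<forall>\<^sub>F N in sequentially. Z (?t N) \<noteq> 0"
      by (rule tendsto_imp_eventually_ne[OF Zlim]) simp
    have err: "(\<lambda>N. ?e N * (\<phi> N (?t N) - lam (?t N) ^ N * Z (?t N))) \<longlonglongrightarrow> 0"
    proof (rule Lim_null_comparison[OF _ geo])
      show "\<forall>\<^sub>F N in sequentially. norm (?e N * (\<phi> N (?t N) - lam (?t N) ^ N * Z (?t N))) \<le> C * \<theta> ^ N"
        using near eventually_ge_at_top[of 1]
        by eventually_elim (simp add: norm_mult R1 \<phi>_def)
    qed
    have "(\<lambda>N. (char (M1 N) (?t N) - ?e N * (\<phi> N (?t N) - lam (?t N) ^ N * Z (?t N))) / Z (?t N)) \<longlonglongrightarrow> (complex_of_real (exp (- \<sigma>2 * t\<^sup>2 / 2)) - 0) / 1"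
      by (intro tendsto_divide tendsto_diff CLT' err Zlim) simp
    moreover have "\<forall>\<^sub>F N in sequentially. (char (M1 N) (?t N) - ?e N * (\<phi> N (?t N) - lam (?t N) ^ N * Z (?t N))) / Z (?t N) = lam (?t N) ^ N * ?e N"
      using Zne eventually_ge_at_top[of 1]
    proof eventually_elim
      case (elim N)
      have "real N * A * (t / sqrt (real N)) = (real N / sqrt (real N)) * t * A" by simp
      also have "real N / sqrt (real N) = sqrt (real N)" by (rule real_div_sqrt) simp
      finally have e: "iexp (- (real N * A * (t / sqrt (real N)))) = ?e N" by simp
      show ?case unfolding char1[OF elim(2)] e using elim(1) by (simp add: field_simps)
    qed
    ultimately show ?thesis by (auto intro: Lim_transform_eventually)
  qed
  obtain c \<eta> d1 where d1: "d1 > 0" and eta: "isCont \<eta> 0" "\<eta> 0 = 0"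
    and lam_eq: "\<And>t. \<bar>t\<bar> < d1 \<Longrightarrow> lam t = exp (\<i> * complex_of_real (A * t) - complex_of_real (\<sigma>2 * t\<^sup>2 / 2) +
        (\<Sum>i=1..r. c i * complex_of_real t ^ (i + 2)) + complex_of_real t ^ (r + 2) * \<eta> t)"
  proof -
    have "peano (r + 2) lam" using plam by simp
    from log_expansion_centered[OF this lam0 lam_lim] show ?thesis using that by blast
  qed
  obtain z \<zeta> where zeta: "isCont \<zeta> 0" "\<zeta> 0 = 0" and Z_eq: "\<And>t. Z t = (\<Sum>k\<le>r. z k * complex_of_real t ^ k) + complex_of_real t ^ r * \<zeta> t"
  proof -
    have "peano r Z" by (rule peano_le[OF _ pZ]) simp
    then obtain z \<zeta> where "isCont \<zeta> 0" "\<zeta> 0 = 0" "\<And>t. Z t = (\<Sum>k\<le>r. t ^ k *\<^sub>R z k) + t ^ r *\<^sub>R \<zeta> t"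
      unfolding peano_iff_remainder by blast
    then show ?thesis using that[of \<zeta> z] by (simp add: scaleR_conv_of_real mult.commute)
  qed
  have z0: "z 0 = 1"
  proof -
    have "(\<Sum>k\<le>r. z k * complex_of_real 0 ^ k) = z 0" by (subst sum.atMost_shift) simp
    then show ?thesis using Z_eq[of 0] Z0 zeta(2) by simp
  qed
  obtain a :: "nat \<Rightarrow> complex poly" and Kl ml where Kl: "Kl \<ge> 0" and loc: "\<And>\<epsilon>. \<epsilon> > 0 \<Longrightarrow> \<exists>\<delta>>0. \<exists>N1. \<forall>N\<ge>N1. \<forall>t. \<bar>t\<bar> \<le> \<delta> \<longrightarrow>
    cmod (lam t ^ N * Z t * iexp (- (real N * A * t)) - edgeworth_ft \<sigma>2 a r N t)
      \<le> \<epsilon> * (1 / sqrt (real N)) ^ r * \<bar>sqrt (real N) * t\<bar> * Kl * (1 + \<bar>sqrt (real N) * t\<bar>) ^ ml * exp (- \<sigma>2 * (sqrt (real N) * t)\<^sup>2 / 4)"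
    using edgeworth_local[OF sigma_pos r_pos d1 lam_eq eta Z_eq zeta z0] by blast
  have dist: "two_distributions (M1 N) (M2 N)" if "N \<ge> 1" for N
    by (intro two_distributions.intro rd1 rd2[OF that])
  have quot_eq: "cmod (two_distributions.char_quot (M1 N) (M2 N) t - edgeworth_corr \<sigma>2 a r N t) = cmod (char (M1 N) t - edgeworth_ft \<sigma>2 a r N t) / \<bar>t\<bar>"
    if N: "N \<ge> 1" and t: "t \<noteq> 0" for N t
  proof -
    interpret T: two_distributions "M1 N" "M2 N" by (rule dist[OF N])
    have "- (\<i> * complex_of_real t) * (T.char_quot t - edgeworth_corr \<sigma>2 a r N t) = char (M1 N) t - edgeworth_ft \<sigma>2 a r N t"
      using t by (simp only: right_diff_distrib edgeworth_corr_ft[OF N]) (simp add: T.char_quot_def T.char_diff_def char2[OF N])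
    then have "cmod (- (\<i> * complex_of_real t)) * cmod (T.char_quot t - edgeworth_corr \<sigma>2 a r N t) = cmod (char (M1 N) t - edgeworth_ft \<sigma>2 a r N t)"
      by (simp only: norm_mult[symmetric])
    then show ?thesis using t by (simp add: norm_mult field_simps)
  qed
  have quot_AE: "AE t in lborel. cmod (two_distributions.char_quot (M1 N) (M2 N) t - edgeworth_corr \<sigma>2 a r N t) * freq_weight q t = cmod (char (M1 N) t - edgeworth_ft \<sigma>2 a r N t) / \<bar>t\<bar> * freq_weight q t"
    if N: "N \<ge> 1" for N
  proof -
    have "AE t in lborel. t \<noteq> (0::real)" by (rule AE_lborel_singleton)
    then show ?thesis by eventually_elim (simp add: quot_eq[OF N])
  qed
  \<comment> \<open>The radius and the constant may depend on \<open>N\<close>: they serve only the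
    integrability of the quotient for each fixed \<open>N\<close>. The expansion of order 1 of
    \<open>op_pow (L t) N\<close> provides the linear vanishing without any moment
    assumption.\<close>
  have char_diff_near: "\<exists>d>0. \<exists>C. \<forall>t. \<bar>t\<bar> \<le> d \<longrightarrow> cmod (char (M1 N) t - char (M2 N) t) \<le> C * \<bar>t\<bar>" if N: "N \<ge> 1" for N
  proof -
    have "peano (Suc 0) L" by (rule peano_le[OF _ smooth]) simp
    then have "peano (Suc 0) (\<lambda>t. op_pow (L t) N)" by (rule peano_op_pow)
    then have "peano (Suc 0) (\<phi> N)"
      unfolding \<phi>_def by (rule peano_linear[rotated]) (intro bounded_linear_compose[OF blinfun.bounded_linear_right] blinfun.bounded_linear_left)
    then obtain g where g: "\<And>t. \<phi> N t = \<phi> N 0 + t *\<^sub>R g t" "isCont g 0" by auto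
    obtain d2 where d2: "d2 > 0" "\<And>t. \<bar>t\<bar> < d2 \<Longrightarrow> norm (g t) \<le> norm (g 0) + 1"
      using isCont_bounded_near_0[OF g(2)] by blast
    define d3 where "d3 = min (d2 / 2) 1"
    have d3: "d3 > 0" "d3 < d2" "d3 \<le> 1" using d2 by (auto simp: d3_def)
    define C where "C = (norm (g 0) + 1) + real N * \<bar>A\<bar> + \<sigma>2 * real N"
    have "cmod (char (M1 N) t - char (M2 N) t) \<le> C * \<bar>t\<bar>" if t: "\<bar>t\<bar> \<le> d3" for t
    proof -
      have gt: "norm (g t) \<le> norm (g 0) + 1" by (rule d2(2)) (use t d3 in linarith)
      have "\<phi> N t - 1 = t *\<^sub>R g t" using g(1)[of t] phi0[OF N] by (metis add_diff_cancel_left')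
      then have p: "cmod (\<phi> N t - 1) \<le> (norm (g 0) + 1) * \<bar>t\<bar>" using gt by (simp add: mult.commute mult_left_mono)
      have i: "cmod (iexp (- (real N * A * t)) - 1) \<le> real N * \<bar>A\<bar> * \<bar>t\<bar>"
        using norm_iexp_minus_1_le[of "- (real N * A * t)"] by (simp add: abs_mult)
      define y where "y = \<sigma>2 * (sqrt (real N) * t)\<^sup>2 / 2"
      have y: "y \<ge> 0" unfolding y_def using sigma_pos by simp
      have "y \<le> \<sigma>2 * real N * \<bar>t\<bar>"
      proof -
        have "\<bar>t\<bar> * \<bar>t\<bar> \<le> \<bar>t\<bar> * 1" using t d3 by (intro mult_left_mono) auto
        then have "t\<^sup>2 \<le> \<bar>t\<bar>" by (simp add: power2_eq_square)
        then have "\<sigma>2 * real N * t\<^sup>2 \<le> \<sigma>2 * real N * \<bar>t\<bar>" using sigma_pos by (intro mult_left_mono) auto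
        moreover have "y = \<sigma>2 * real N * t\<^sup>2 / 2" by (simp add: y_def power_mult_distrib)
        moreover have "0 \<le> \<sigma>2 * real N * t\<^sup>2" using sigma_pos by simp
        ultimately show ?thesis by linarith
      qed
      moreover have "cmod (1 - char (M2 N) t) = \<bar>1 - exp (- y)\<bar>"
      proof -
        have "1 - char (M2 N) t = complex_of_real (1 - exp (- y))" unfolding char2[OF N] y_def by simp
        then show ?thesis by (simp only: norm_of_real)
      qed
      moreover have "\<bar>1 - exp (- y)\<bar> \<le> y" using y exp_ge_add_one_self[of "- y"] by simp
      ultimately have e: "cmod (1 - char (M2 N) t) \<le> \<sigma>2 * real N * \<bar>t\<bar>" by linarith
      have "char (M1 N) t - char (M2 N) t = iexp (- (real N * A * t)) * (\<phi> N t - 1) + (iexp (- (real N * A * t)) - 1) + (1 - char (M2 N) t)"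
        unfolding char1[OF N] by (simp add: algebra_simps)
      also have "cmod \<dots> \<le> cmod (iexp (- (real N * A * t)) * (\<phi> N t - 1)) + cmod (iexp (- (real N * A * t)) - 1) + cmod (1 - char (M2 N) t)"
        by (meson add_right_mono norm_triangle_ineq order_trans)
      also have "\<dots> \<le> (norm (g 0) + 1) * \<bar>t\<bar> + real N * \<bar>A\<bar> * \<bar>t\<bar> + \<sigma>2 * real N * \<bar>t\<bar>"
        by (intro add_mono i e) (use p in \<open>simp add: norm_mult\<close>)
      also have "\<dots> = C * \<bar>t\<bar>" by (simp add: C_def algebra_simps)
      finally show ?thesis .
    qed
    then show ?thesis using d3(1) by blast
  qed
  have int_quot: "integrable lborel (\<lambda>t. cmod (two_distributions.char_quot (M1 N) (M2 N) t - edgeworth_corr \<sigma>2 a r N t) * freq_weight q t)" if N: "N \<ge> 1" for N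
  proof -
    interpret T: two_distributions "M1 N" "M2 N" by (rule dist[OF N])
    obtain d' C' where d': "d' > 0" "\<And>t. \<bar>t\<bar> \<le> d' \<Longrightarrow> cmod (T.char_diff t) \<le> C' * \<bar>t\<bar>"
      using char_diff_near[OF N] unfolding T.char_diff_def by blast
    have corr: "integrable lborel (edgeworth_corr \<sigma>2 a r N)" by (rule edgeworth_corr_integrable[OF sigma_pos N])
    then have [measurable]: "edgeworth_corr \<sigma>2 a r N \<in> borel_measurable borel" by auto
    show ?thesis
    proof (rule Bochner_Integration.integrable_bound)
      show "integrable lborel (\<lambda>t. cmod (T.char_quot t) * freq_weight q t + cmod (edgeworth_corr \<sigma>2 a r N t))"
        by (intro Bochner_Integration.integrable_add T.char_quot_integrable[OF q1 d'] integrable_norm corr)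
      show "AE t in lborel. norm (cmod (T.char_quot t - edgeworth_corr \<sigma>2 a r N t) * freq_weight q t) \<le> norm (cmod (T.char_quot t) * freq_weight q t + cmod (edgeworth_corr \<sigma>2 a r N t))"
      proof (rule AE_I2)
        fix t
        have fw: "0 \<le> freq_weight q t" "freq_weight q t \<le> 1" by (rule freq_weight_nonneg, rule freq_weight_le_1)
        have "cmod (T.char_quot t - edgeworth_corr \<sigma>2 a r N t) * freq_weight q t \<le> (cmod (T.char_quot t) + cmod (edgeworth_corr \<sigma>2 a r N t)) * freq_weight q t"
          by (intro mult_right_mono norm_triangle_ineq4 fw)
        also have "\<dots> \<le> cmod (T.char_quot t) * freq_weight q t + cmod (edgeworth_corr \<sigma>2 a r N t)"
          unfolding distrib_right by (intro add_left_mono mult_left_le fw) auto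
        finally show "norm (cmod (T.char_quot t - edgeworth_corr \<sigma>2 a r N t) * freq_weight q t) \<le> norm (cmod (T.char_quot t) * freq_weight q t + cmod (edgeworth_corr \<sigma>2 a r N t))"
          using fw by simp
      qed
    qed measurable
  qed
  define I where "I N = (LINT t|lborel. cmod (char (M1 N) t - edgeworth_ft \<sigma>2 a r N t) / \<bar>t\<bar> * freq_weight q t)" for N
  have ft_meas [measurable]: "edgeworth_ft \<sigma>2 a r N \<in> borel_measurable borel" for N
    unfolding edgeworth_ft_def Let_def by (intro borel_measurable_continuous_onI continuous_intros) auto
  have int_I: "integrable lborel (\<lambda>t. cmod (char (M1 N) t - edgeworth_ft \<sigma>2 a r N t) / \<bar>t\<bar> * freq_weight q t)" if N: "N \<ge> 1" for N
  proof -
    interpret T: two_distributions "M1 N" "M2 N" by (rule dist[OF N])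
    have "(\<lambda>t. cmod (char (M1 N) t - edgeworth_ft \<sigma>2 a r N t) / \<bar>t\<bar> * freq_weight q t) \<in> borel_measurable lborel" by measurable
    then show ?thesis using integrable_cong_AE_imp[OF int_quot[OF N] _ quot_AE[OF N]] by blast
  qed
  have I_quot: "(LINT t|lborel. cmod (two_distributions.char_quot (M1 N) (M2 N) t - edgeworth_corr \<sigma>2 a r N t) * freq_weight q t) = I N" if N: "N \<ge> 1" for N
    unfolding I_def using int_quot[OF N] int_I[OF N] quot_AE[OF N] by (intro integral_cong_AE) auto
  have norm_phi: "cmod (\<phi> N t) \<le> norm l * norm v * norm (op_pow (L t) N)" for N t
  proof -
    have "cmod (\<phi> N t) \<le> norm l * (norm (op_pow (L t) N) * norm v)"
      unfolding \<phi>_def by (intro order_trans[OF norm_blinfun] mult_left_mono norm_blinfun) auto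
    then show ?thesis by (simp add: mult_ac)
  qed
  have near: "\<exists>\<delta>>0. \<exists>N1. \<forall>N\<ge>N1. \<forall>t. \<bar>t\<bar> \<le> \<delta> \<longrightarrow> cmod (char (M1 N) t - edgeworth_ft \<sigma>2 a r N t) \<le>
        \<epsilon> * (1 / sqrt (real N)) ^ r * \<bar>sqrt (real N) * t\<bar> * Kl * (1 + \<bar>sqrt (real N) * t\<bar>) ^ ml * exp (- \<sigma>2 * (sqrt (real N) * t)\<^sup>2 / 4)
        + C * \<bar>t\<bar> * real N * \<theta> ^ N" if eps: "\<epsilon> > 0" for \<epsilon>
  proof -
    obtain \<delta>' N1 where \<delta>': "\<delta>' > 0" and loc': "\<And>N t. N \<ge> N1 \<Longrightarrow> \<bar>t\<bar> \<le> \<delta>' \<Longrightarrow>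
      cmod (lam t ^ N * Z t * iexp (- (real N * A * t)) - edgeworth_ft \<sigma>2 a r N t)
      \<le> \<epsilon> * (1 / sqrt (real N)) ^ r * \<bar>sqrt (real N) * t\<bar> * Kl * (1 + \<bar>sqrt (real N) * t\<bar>) ^ ml * exp (- \<sigma>2 * (sqrt (real N) * t)\<^sup>2 / 4)"
      using loc[OF eps] by blast
    have "cmod (char (M1 N) t - edgeworth_ft \<sigma>2 a r N t) \<le>
        \<epsilon> * (1 / sqrt (real N)) ^ r * \<bar>sqrt (real N) * t\<bar> * Kl * (1 + \<bar>sqrt (real N) * t\<bar>) ^ ml * exp (- \<sigma>2 * (sqrt (real N) * t)\<^sup>2 / 4)
        + C * \<bar>t\<bar> * real N * \<theta> ^ N" if N: "N \<ge> max N1 1" and t: "\<bar>t\<bar> \<le> min \<delta>' (d / 2)" for N t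
    proof -
      have N1: "N \<ge> 1" "N \<ge> N1" using N by auto
      have td: "\<bar>t\<bar> < d" "\<bar>t\<bar> \<le> \<delta>'" using t d by auto
      let ?e = "iexp (- (real N * A * t))"
      have "char (M1 N) t - edgeworth_ft \<sigma>2 a r N t = (lam t ^ N * Z t * ?e - edgeworth_ft \<sigma>2 a r N t) + ?e * (\<phi> N t - lam t ^ N * Z t)"
        unfolding char1[OF N1(1)] by (simp add: algebra_simps)
      then have "cmod (char (M1 N) t - edgeworth_ft \<sigma>2 a r N t) \<le> cmod (lam t ^ N * Z t * ?e - edgeworth_ft \<sigma>2 a r N t) + cmod (?e * (\<phi> N t - lam t ^ N * Z t))"
        by (metis norm_triangle_ineq)
      also have "cmod (?e * (\<phi> N t - lam t ^ N * Z t)) = cmod (\<phi> N t - lam t ^ N * Z t)" by (simp add: norm_mult)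
      finally show ?thesis using loc'[OF N1(2) td(2)] rem[OF td(1) N1(1)] by linarith
    qed
    then show ?thesis
      using \<delta>' d by (intro exI[of _ "min \<delta>' (d / 2)"] conjI exI[of _ "max N1 1"]) auto
  qed
  have middle: "\<exists>C\<ge>0. \<exists>\<theta>. 0 < \<theta> \<and> \<theta> < 1 \<and> (\<forall>N\<ge>1. \<forall>t. \<delta>' \<le> \<bar>t\<bar> \<longrightarrow> \<bar>t\<bar> \<le> B \<longrightarrow> cmod (char (M1 N) t) \<le> C * \<theta> ^ N)"
    if \<delta>': "\<delta>' > 0" for \<delta>' B :: real
  proof -
    have comp: "compact ({-B..-\<delta>'} \<union> {\<delta>'..B})" by (intro compact_Un) auto
    have "\<exists>C\<ge>0. \<exists>\<theta>. 0 < \<theta> \<and> \<theta> < 1 \<and> (\<forall>t\<in>{-B..-\<delta>'} \<union> {\<delta>'..B}. \<forall>n. norm (op_pow (L t) n) \<le> C * \<theta> ^ n)"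
    proof (rule op_pow_compact_decay[OF A1_cont comp])
      fix t assume "t \<in> {-B..-\<delta>'} \<union> {\<delta>'..B}"
      then have "t \<noteq> 0" using \<delta>' by auto
      then show "(\<lambda>n. norm (op_pow (L t) n)) \<longlonglongrightarrow> 0" by (intro op_pow_tendsto_0_if_spectrum Lclin A3)
    qed
    then obtain C' \<theta>' where C': "C' \<ge> 0" "0 < \<theta>'" "\<theta>' < 1" and dec: "\<And>t n. t \<in> {-B..-\<delta>'} \<union> {\<delta>'..B} \<Longrightarrow> norm (op_pow (L t) n) \<le> C' * \<theta>' ^ n" by blast
    have "cmod (char (M1 N) t) \<le> (norm l * norm v * C') * \<theta>' ^ N" if "N \<ge> 1" "\<delta>' \<le> \<bar>t\<bar>" "\<bar>t\<bar> \<le> B" for N t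
    proof -
      have "t \<in> {-B..-\<delta>'} \<union> {\<delta>'..B}" using that by (auto simp: abs_if split: if_splits)
      from dec[OF this, of N] have "norm l * norm v * norm (op_pow (L t) N) \<le> norm l * norm v * (C' * \<theta>' ^ N)"
        by (intro mult_left_mono) auto
      then show ?thesis using norm_phi[of N t] unfolding norm_char1[OF that(1)] by (simp add: mult.assoc)
    qed
    note mid = this
    have "0 \<le> norm l * norm v * C'" by (intro mult_nonneg_nonneg norm_ge_zero C'(1))
    with C'(2,3) mid show ?thesis by blast
  qed
  have high: "\<exists>c>0. \<exists>C\<ge>0. \<exists>N1. \<forall>N\<ge>N1. \<forall>t. K \<le> \<bar>t\<bar> \<longrightarrow> \<bar>t\<bar> \<le> c * real N powr r1 \<longrightarrow> cmod (char (M1 N) t) \<le> C * real N powr (- (real r / 2 + r1 + 1))"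
  proof -
    have "\<exists>c>0. \<exists>C\<ge>0. \<exists>N1. \<forall>N\<ge>N1. \<forall>t. K \<le> \<bar>t\<bar> \<longrightarrow> \<bar>t\<bar> \<le> c * real N powr r1 \<longrightarrow>
        norm (op_pow (L t) N) \<le> C * real N powr (- (real r / 2 + r1 + 1))"
      by (rule op_pow_polynomial_decay[OF A4_pos(2,3)]) (rule A4)
    then obtain c' C' N1 where c': "c' > 0" "C' \<ge> 0" and hi: "\<And>N t. N \<ge> N1 \<Longrightarrow> K \<le> \<bar>t\<bar> \<Longrightarrow> \<bar>t\<bar> \<le> c' * real N powr r1 \<Longrightarrow>
        norm (op_pow (L t) N) \<le> C' * real N powr (- (real r / 2 + r1 + 1))"
      by blast
    have "cmod (char (M1 N) t) \<le> (norm l * norm v * C') * real N powr (- (real r / 2 + r1 + 1))"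
      if "N \<ge> max N1 1" "K \<le> \<bar>t\<bar>" "\<bar>t\<bar> \<le> c' * real N powr r1" for N t
    proof -
      have N: "N \<ge> N1" "N \<ge> 1" using that by auto
      have "norm l * norm v * norm (op_pow (L t) N) \<le> norm l * norm v * (C' * real N powr (- (real r / 2 + r1 + 1)))"
        by (intro mult_left_mono hi N that) auto
      then show ?thesis using norm_phi[of N t] unfolding norm_char1[OF N(2)] by (simp add: mult.assoc)
    qed
    note high = this
    have "0 \<le> norm l * norm v * C'" by (intro mult_nonneg_nonneg norm_ge_zero c'(2))
    with c'(1) high show ?thesis by blast
  qed
  have I_lim: "(\<lambda>N. sqrt (real N) ^ r * I N) \<longlonglongrightarrow> 0"
    unfolding I_def
  proof (rule error_integral_tendsto_0[where \<phi> = "\<lambda>N. char (M1 N)", OF sigma_pos A4_pos(2) q1 q_big A4_pos(1) _ C th Kl near middle high int_I])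
    show "cmod (char (M1 N) t) \<le> 1" for N t by (rule real_distribution.cmod_char_le_1[OF rd1])
  qed
  have "\<forall>p. \<exists>P :: complex poly. \<forall>x. (LINT t|lborel. iexp (- (t * x)) * edgeworth_kernel \<sigma>2 a p t) / (2 * pi) = poly P (complex_of_real x) * complex_of_real (nfrak \<sigma>2 x)"
    unfolding edgeworth_kernel_def using gauss_poly_transform[OF sigma_pos] by blast
  from choice[OF this] obtain P :: "nat \<Rightarrow> complex poly" where
    P: "\<And>p x. (LINT t|lborel. iexp (- (t * x)) * edgeworth_kernel \<sigma>2 a p t) / (2 * pi) = poly (P p) (complex_of_real x) * complex_of_real (nfrak \<sigma>2 x)" by blast
  have "\<forall>p. \<exists>Q :: real poly. \<forall>x. poly Q x = Re (poly (P p) (complex_of_real x))" using poly_real_part by blast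
  from choice[OF this] obtain Q :: "nat \<Rightarrow> real poly" where Q: "\<And>p x. poly (Q p) x = Re (poly (P p) (complex_of_real x))" by blast
  define W where "W p x = poly (P p) (complex_of_real x) * complex_of_real (nfrak \<sigma>2 x)" for p x
  have W_meas [measurable]: "W p \<in> borel_measurable borel" for p
  proof -
    have [measurable]: "(\<lambda>x. poly (P p) (complex_of_real x)) \<in> borel_measurable borel"
      by (intro borel_measurable_continuous_onI continuous_intros)
    show ?thesis unfolding W_def by measurable
  qed
  \<comment> \<open>Boundedness is read off from the integral representation of \<open>W\<close> as
    the inverse transform of an integrable kernel; it makes the products with \<open>f\<close>
    integrable.\<close>
  have W_bound: "cmod (W p x) \<le> (LINT t|lborel. cmod (edgeworth_kernel \<sigma>2 a p t)) / (2 * pi)" for p x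
  proof -
    have n: "cmod (complex_of_real (2 * pi)) = 2 * pi" by simp
    have "cmod (LINT t|lborel. iexp (- (t * x)) * edgeworth_kernel \<sigma>2 a p t) \<le> (LINT t|lborel. cmod (iexp (- (t * x)) * edgeworth_kernel \<sigma>2 a p t))"
      by (rule integral_norm_bound)
    also have "\<dots> = (LINT t|lborel. cmod (edgeworth_kernel \<sigma>2 a p t))" by (simp add: norm_mult)
    finally show ?thesis unfolding W_def P[symmetric] norm_divide n by (intro divide_right_mono) auto
  qed
  \<comment> \<open>Built from the error integral alone, hence independent of \<open>z\<close> and
    \<open>f\<close>; \<open>2 * pi\<close> is the normalisation of Fourier inversion.\<close>
  define \<epsilon> where "\<epsilon> N = sqrt (real N) ^ r * I N / (2 * pi)" for N
  have "\<epsilon> \<longlonglongrightarrow> 0" unfolding \<epsilon>_def by (intro tendsto_divide_zero I_lim)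
  moreover have "\<bar>(LINT y|lborel.
           (prob_space.prob M {\<omega>\<in>space M.
               ((\<Sum>n\<in>{1..N}. X n \<omega>) - real N * A) / sqrt (real N) \<le> z + y / sqrt (real N)}
            - Nfrak \<sigma>2 (z + y / sqrt (real N))) * f y)
        - (\<Sum>p\<in>{1..r}. 1 / sqrt (real N) ^ p *
             (LINT y|lborel. poly (Q p) (z + y / sqrt (real N)) * nfrak \<sigma>2 (z + y / sqrt (real N)) * f y))\<bar>
       \<le> C_norm q 0 f * \<epsilon> N / sqrt (real N) ^ r"
    if N: "N \<ge> 1" and f: "f \<in> F_space q 0" for N z f
  proof -
    interpret T: two_distributions "M1 N" "M2 N" by (rule dist[OF N])
    define s where "s = sqrt (real N)"
    have s: "s > 0" using N by (simp add: s_def)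
    have arg: "(s * z + y) / s = z + y / s" for y using s by (simp add: add_divide_distrib)
    have f_int: "integrable lborel f" using f unfolding F_space_def by force
    then have [measurable]: "f \<in> borel_measurable borel" by auto
    have D_eq: "prob {\<omega>\<in>space M. ((\<Sum>n\<in>{1..N}. X n \<omega>) - real N * A) / s \<le> z + y / s} - Nfrak \<sigma>2 (z + y / s) = T.cdf_diff (s * z + y)" for y
    proof -
      have "cdf (M1 N) (s * z + y) = prob ((\<lambda>\<omega>. S N \<omega> - real N * A) -` {..s * z + y} \<inter> space M)"
        unfolding cdf_def M1_def by (rule measure_distr) auto
      also have "(\<lambda>\<omega>. S N \<omega> - real N * A) -` {..s * z + y} \<inter> space M = {\<omega>\<in>space M. ((\<Sum>n\<in>{1..N}. X n \<omega>) - real N * A) / s \<le> z + y / s}"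
        unfolding S_def[symmetric] arg[symmetric] using s by (auto simp: divide_le_cancel)
      finally have 1: "cdf (M1 N) (s * z + y) = prob {\<omega>\<in>space M. ((\<Sum>n\<in>{1..N}. X n \<omega>) - real N * A) / s \<le> z + y / s}" .
      have 2: "cdf (M2 N) (s * z + y) = Nfrak \<sigma>2 (z + y / s)"
        unfolding M2_def s_def[symmetric] cdf_scaled_normal[OF sigma_pos s] arg ..
      show ?thesis unfolding T.cdf_diff_def 1 2 ..
    qed
    define U where "U x = (\<Sum>p=1..r. complex_of_real (1 / s) ^ p * W p (x / s))" for x
    have U: "U x = (LINT t|lborel. iexp (- (t * x)) * edgeworth_corr \<sigma>2 a r N t) / (2 * pi)" for x
      unfolding U_def W_def s_def by (rule edgeworth_corr_transform[OF sigma_pos N P, symmetric])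
    have int_W: "integrable lborel (\<lambda>y. W p (z + y / s) * complex_of_real (f y))" for p
    proof (rule Bochner_Integration.integrable_bound)
      show "integrable lborel (\<lambda>y. (LINT t|lborel. cmod (edgeworth_kernel \<sigma>2 a p t)) / (2 * pi) * f y)" using f_int by simp
      show "AE y in lborel. norm (W p (z + y / s) * complex_of_real (f y)) \<le> norm ((LINT t|lborel. cmod (edgeworth_kernel \<sigma>2 a p t)) / (2 * pi) * f y)"
        by (rule AE_I2, simp only: norm_mult norm_of_real real_norm_def abs_mult)
           (intro mult_right_mono order_trans[OF W_bound abs_ge_self] abs_ge_zero)
    qed measurable
    have "(LINT y|lborel. U (s * z + y) * complex_of_real (f y)) = (LINT y|lborel. (\<Sum>p=1..r. complex_of_real (1 / s) ^ p * (W p (z + y / s) * complex_of_real (f y))))"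
      unfolding U_def arg sum_distrib_right by (simp only: mult.assoc)
    also have "\<dots> = (\<Sum>p=1..r. LINT y|lborel. complex_of_real (1 / s) ^ p * (W p (z + y / s) * complex_of_real (f y)))"
      by (rule Bochner_Integration.integral_sum) (intro integrable_mult_right int_W)
    also have "\<dots> = (\<Sum>p=1..r. complex_of_real (1 / s ^ p) * (LINT y|lborel. W p (z + y / s) * complex_of_real (f y)))"
      unfolding integral_mult_right_zero by (simp add: power_divide)
    finally have UI: "(LINT y|lborel. U (s * z + y) * complex_of_real (f y)) = (\<Sum>p=1..r. complex_of_real (1 / s ^ p) * (LINT y|lborel. W p (z + y / s) * complex_of_real (f y)))" .
    have Re_W: "Re (LINT y|lborel. W p (z + y / s) * complex_of_real (f y)) = (LINT y|lborel. poly (Q p) (z + y / s) * nfrak \<sigma>2 (z + y / s) * f y)" for p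
    proof -
      have "Re (LINT y|lborel. W p (z + y / s) * complex_of_real (f y)) = (LINT y|lborel. Re (W p (z + y / s) * complex_of_real (f y)))"
        by (rule integral_Re[OF int_W, symmetric])
      also have "\<dots> = (LINT y|lborel. poly (Q p) (z + y / s) * nfrak \<sigma>2 (z + y / s) * f y)"
        by (intro Bochner_Integration.integral_cong refl) (simp only: W_def Q Re_complex_of_real times_complex.sel Im_complex_of_real mult_zero_right diff_zero)
      finally show ?thesis .
    qed
    have Re_UI: "Re (LINT y|lborel. U (s * z + y) * complex_of_real (f y)) = (\<Sum>p\<in>{1..r}. 1 / s ^ p * (LINT y|lborel. poly (Q p) (z + y / s) * nfrak \<sigma>2 (z + y / s) * f y))"
      unfolding UI Re_sum by (intro sum.cong refl) (simp only: Re_W times_complex.sel Re_complex_of_real Im_complex_of_real mult_zero_left diff_zero)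
    let ?D = "LINT y|lborel. T.cdf_diff (s * z + y) * f y"
    let ?J = "LINT y|lborel. U (s * z + y) * complex_of_real (f y)"
    have "\<bar>?D - Re ?J\<bar> = \<bar>Re (complex_of_real ?D - ?J)\<bar>" by simp
    also have "\<dots> \<le> cmod (complex_of_real ?D - ?J)" by (rule abs_Re_le_cmod)
    also have "\<dots> \<le> C_norm q 0 f * I N / (2 * pi)"
      using T.averaged_difference_bound[OF f edgeworth_corr_integrable[OF sigma_pos N] U int_quot[OF N], of "s * z"]
      unfolding I_quot[OF N] .
    also have "\<dots> = C_norm q 0 f * \<epsilon> N / s ^ r" using s by (simp add: \<epsilon>_def s_def)
    finally show ?thesis unfolding s_def[symmetric] D_eq Re_UI .
  qed
  ultimately show ?thesis by (intro exI[of _ Q] exI[of _ \<epsilon>]) blast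
qed

end
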